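(* Let $\tau\in(0,1)$, $\Lambda>0$, and let $\mu\in A_2(\mathbb{R})$ be such that, for some constant $C_0>0$ independent of $\tau$, $$\int_0^{\tau y}\mu(s)\,ds\le C_0\,\tau\,\mu(y\tau),\quad\text{for a.e. }y\in(0,1).$$ Let $\tilde{\mathbb{A}}_0(y)$ be a symmetric measurable $(n+1)\times(n+1)$ matrix of the form $$\tilde{\mathbb{A}}_0(y)=\mu(y)\begin{bmatrix}\tilde{\mathbb{B}}_0&0\\0&1\end{bmatrix},$$ where $\begin{bmatrix}\tilde{\mathbb{B}}_0&0\\0&1\end{bmatrix}$ is an elliptic constant $(n+1)\times(n+1)$ matrix, and assume $$\Lambda^{-1}\mu(y)|\xi|^2\le\langle\tilde{\mathbb{A}}_0(y)\xi,\xi\rangle\le\Lambda\mu(y)|\xi|^2,\quad\forall\,\xi\in\mathbb{R}^{n+1},\ \text{for a.e. }y\in(0,\tau).$$ Then for every weak solution $v\in W^{1,2}(Q_\tau^+,\mu)$ of $$\begin{cases}\operatorname{div}[\tilde{\mathbb{A}}_0(y)\nabla v(X)]=0, & X=(x,y)\in Q_\tau^+,\\ v=0, & \text{on }T_\tau\times(0,\tau),\\ \lim_{y\to0^+}\langle\tilde{\mathbb{A}}_0(y)\nabla v(x,y),e_{n+1}\rangle=0, & x\in B_\tau^+,\end{cases}$$ and every $\theta\in(0,1)$, there is $C=C(n,\Lambda,C_0,[\mu]_{A_2},\theta)$ such that $$\|\nabla v\|_{L^\infty(Q^+_{\theta\tau})}\le C\left[\frac1{\hat\mu(Q_\tau)}\int_{Q_\tau^+}|\nabla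 v|^2\mu(y)\,dX\right]^{1/2}.$$
   Context: $X=(x,y)\in\mathbb{R}^n\times\mathbb{R}$, $x=(x',x_n)$, $\nabla=(\nabla_x,\partial_y)$, $e_{n+1}=(0,\dots,0,1)$; $B_r\subset\mathbb{R}^n$ is the ball of radius $r$ centered at $0$, $B_r^+=\{x\in B_r:x_n>0\}$, $T_r=\{x\in B_r:x_n=0\}$, $Q_r=B_r\times(0,r)$, $Q_r^+=B_r^+\times(0,r)$. $\hat\mu(E)=\int_E\mu(y)\,dX$. $\mu\in A_2(\mathbb{R})$ means $\mu\ge0$ is locally integrable and $[\mu]_{A_2}=\sup_I\left(\frac1{|I|}\int_I\mu\right)\left(\frac1{|I|}\int_I\mu^{-1}\right)<\infty$ over bounded intervals. $W^{1,2}(E,\mu)$: functions which together with their weak gradients are square integrable on $E$ with respect to $\mu(y)\,dx\,dy$. Weak solution: $v$ lies in the closure in $W^{1,2}(Q_\tau^+,\mu)$ of $\{\phi\in C^\infty(\overline{Q_\tau^+}):\phi=0\text{ on }T_\tau\times(0,\tau)\}$, and $\int_{Q_\tau^+}\langle\tilde{\mathbb{A}}_0(y)\nabla v,\nabla\psi\rangle dX=0$ for all $\psi$ in the closure in $W^{1,2}(Q_\tau^+,\mu)$ of $\{\phi\in C^\infty(\overline{Q_\tau^+}):\phi=0\text{ on }(\partial B_\tau^+\times(0,\tau))\cup(B_\tau^+\times\{\tau\})\}$. The constant $C$ depends only on the listed quantities. *)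

theory Defs
  imports "HOL-Analysis.Analysis" "HOL-Probability.Essential_Supremum"
begin

text \<open>
  Points of \<open>\<real>\<^sup>n \<times> \<real>\<close> have type \<^typ>\<open>(real^'n) \<times> real\<close>, whose norm and inner product are the
  Euclidean ones of \<open>\<real>\<^sup>n\<^sup>+\<^sup>1\<close>.  Since the finite index type \<open>'n\<close> carries no order, an index \<open>l :: 'n\<close>
  marks the distinguished ("last") coordinate \<open>x\<^sub>n\<close> of \<open>x\<close>.
\<close>

definition half_ball :: "'n::finite \<Rightarrow> real \<Rightarrow> (real^'n) set" where
  "half_ball l r = {x \<in> ball 0 r. x $ l > 0}"

definition flat_part :: "'n::finite \<Rightarrow> real \<Rightarrow> (real^'n) set" where
  "flat_part l r = {x \<in> ball 0 r. x $ l = 0}"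

definition cyl :: "real \<Rightarrow> ((real^'n::finite) \<times> real) set" where
  "cyl r = ball 0 r \<times> {0<..<r}"

definition half_cyl :: "'n::finite \<Rightarrow> real \<Rightarrow> ((real^'n) \<times> real) set" where
  "half_cyl l r = half_ball l r \<times> {0<..<r}"

definition mu_hat :: "(real \<Rightarrow> real) \<Rightarrow> ((real^'n::finite) \<times> real) set \<Rightarrow> real" where
  "mu_hat \<mu> E = (LINT X:E|lebesgue. \<mu> (snd X))"


subsection \<open>Muckenhoupt weights\<close>

definition A2_const :: "(real \<Rightarrow> real) \<Rightarrow> ennreal" where
  "A2_const \<mu> = (SUP (a, b) \<in> {(a, b). a < b}.
      ((\<integral>\<^sup>+ y \<in> {a..b}. ennreal (\<mu> y) \<partial>lebesgue) / ennreal (b - a)) *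
      ((\<integral>\<^sup>+ y \<in> {a..b}. inverse (ennreal (\<mu> y)) \<partial>lebesgue) / ennreal (b - a)))"

text \<open>
  In \<^typ>\<open>ennreal\<close>, \<open>inverse 0 = \<infinity>\<close> and \<open>0 * \<infinity> = 0\<close>, so a weight vanishing a.e. would have
  \<^const>\<open>A2_const\<close> equal to \<open>0\<close>; it is excluded explicitly.  A weight vanishing on a set of positive
  measure but not a.e. has infinite \<^const>\<open>A2_const\<close>.
\<close>

definition A2_weight :: "(real \<Rightarrow> real) \<Rightarrow> bool" where
  "A2_weight \<mu> \<longleftrightarrow> (\<forall>y. 0 \<le> \<mu> y) \<and> (\<forall>a b. set_integrable lebesgue {a..b} \<mu>) \<and>
     \<not> (AE y in lebesgue. \<mu> y = 0) \<and> A2_const \<mu> < \<infinity>"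


subsection \<open>Smooth functions\<close>

fun Ck :: "nat \<Rightarrow> ('a::euclidean_space \<Rightarrow> real) \<Rightarrow> bool" where
  "Ck 0 f \<longleftrightarrow> continuous_on UNIV f"
| "Ck (Suc k) f \<longleftrightarrow> (\<forall>x. f differentiable (at x)) \<and>
      (\<forall>i\<in>Basis. Ck k (\<lambda>x. frechet_derivative f (at x) i))"

definition smooth :: "('a::euclidean_space \<Rightarrow> real) \<Rightarrow> bool" where
  "smooth f \<longleftrightarrow> (\<forall>k. Ck k f)"

definition grad :: "('a::euclidean_space \<Rightarrow> real) \<Rightarrow> 'a \<Rightarrow> 'a" where
  "grad f x = (\<Sum>i\<in>Basis. frechet_derivative f (at x) i *\<^sub>R i)"

definition test_functions :: "'a::euclidean_space set \<Rightarrow> ('a \<Rightarrow> real) set" where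
  "test_functions \<Omega> = {\<phi>. smooth \<phi> \<and> compact (closure {x. \<phi> x \<noteq> 0}) \<and> closure {x. \<phi> x \<noteq> 0} \<subseteq> \<Omega>}"


subsection \<open>Weighted Sobolev spaces\<close>

definition locally_integrable :: "'a::euclidean_space set \<Rightarrow> ('a \<Rightarrow> 'b::euclidean_space) \<Rightarrow> bool" where
  "locally_integrable \<Omega> f \<longleftrightarrow> (\<forall>K. compact K \<and> K \<subseteq> \<Omega> \<longrightarrow> set_integrable lebesgue K f)"

definition weak_gradient :: "'a::euclidean_space set \<Rightarrow> ('a \<Rightarrow> real) \<Rightarrow> ('a \<Rightarrow> 'a) \<Rightarrow> bool" where
  "weak_gradient \<Omega> v G \<longleftrightarrow> locally_integrable \<Omega> v \<and> locally_integrable \<Omega> G \<and>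
     (\<forall>\<phi>\<in>test_functions \<Omega>. \<forall>i\<in>Basis.
        (LINT X:\<Omega>|lebesgue. v X * (grad \<phi> X \<bullet> i)) = - (LINT X:\<Omega>|lebesgue. (G X \<bullet> i) * \<phi> X))"

text \<open>
  \<open>W12 \<Omega> \<mu> v G\<close>: the function \<open>v\<close> belongs to \<open>W\<^sup>1\<^sup>,\<^sup>2(\<Omega>, \<mu>)\<close> and \<open>G\<close> (unique up to null sets) is its weak
  gradient.
\<close>

definition W12 :: "((real^'n::finite) \<times> real) set \<Rightarrow> (real \<Rightarrow> real) \<Rightarrow>
    ((real^'n) \<times> real \<Rightarrow> real) \<Rightarrow> ((real^'n) \<times> real \<Rightarrow> (real^'n) \<times> real) \<Rightarrow> bool" where
  "W12 \<Omega> \<mu> v G \<longleftrightarrow> weak_gradient \<Omega> v G \<and>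
     set_integrable lebesgue \<Omega> (\<lambda>X. (v X)\<^sup>2 * \<mu> (snd X)) \<and>
     set_integrable lebesgue \<Omega> (\<lambda>X. (norm (G X))\<^sup>2 * \<mu> (snd X))"

text \<open>
  \<open>W12_vanishing \<Omega> \<mu> S v G\<close>: \<open>v\<close>, with weak gradient \<open>G\<close>, lies in the \<open>W\<^sup>1\<^sup>,\<^sup>2(\<Omega>, \<mu>)\<close>-closure of the
  functions that are smooth up to the boundary of \<open>\<Omega>\<close> and vanish on \<open>S\<close>.  Smoothness up to the boundary
  is expressed as being the restriction of a smooth function on the whole space; \<open>\<Omega>\<close> will be a bounded
  convex open set, so this agrees with continuous extendability of all derivatives to the closure.
\<close>

definition W12_vanishing :: "((real^'n::finite) \<times> real) set \<Rightarrow> (real \<Rightarrow> real) \<Rightarrow>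
    ((real^'n) \<times> real) set \<Rightarrow>
    ((real^'n) \<times> real \<Rightarrow> real) \<Rightarrow> ((real^'n) \<times> real \<Rightarrow> (real^'n) \<times> real) \<Rightarrow> bool" where
  "W12_vanishing \<Omega> \<mu> S v G \<longleftrightarrow> W12 \<Omega> \<mu> v G \<and>
     (\<forall>\<epsilon>>0. \<exists>\<phi>. smooth \<phi> \<and> (\<forall>X\<in>S. \<phi> X = 0) \<and>
        (\<integral>\<^sup>+ X \<in> \<Omega>. ennreal (((v X - \<phi> X)\<^sup>2 + (norm (G X - grad \<phi> X))\<^sup>2) * \<mu> (snd X)) \<partial>lebesgue)
          < ennreal \<epsilon>)"


subsection \<open>The mixed boundary value problem\<close>

text \<open>The matrix with diagonal blocks \<open>B\<close> and \<open>1\<close>, acting on \<open>\<real>\<^sup>n \<times> \<real>\<close>.\<close>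

definition block_mat :: "real^'n^'n \<Rightarrow> (real^'n::finite) \<times> real \<Rightarrow> (real^'n) \<times> real" where
  "block_mat B \<xi> = (B *v fst \<xi>, snd \<xi>)"

text \<open>
  The test functions \<open>\<psi>\<close> are not required to vanish on the bottom face \<open>y = 0\<close>; this is how the
  homogeneous conormal condition there enters the weak formulation.
\<close>

definition weak_solution :: "'n::finite \<Rightarrow> real \<Rightarrow> (real \<Rightarrow> real) \<Rightarrow>
    (real \<Rightarrow> (real^'n) \<times> real \<Rightarrow> (real^'n) \<times> real) \<Rightarrow>
    ((real^'n) \<times> real \<Rightarrow> real) \<Rightarrow> ((real^'n) \<times> real \<Rightarrow> (real^'n) \<times> real) \<Rightarrow> bool" where
  "weak_solution l \<tau> \<mu> A v G \<longleftrightarrow>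
     W12_vanishing (half_cyl l \<tau>) \<mu> (flat_part l \<tau> \<times> {0<..<\<tau>}) v G \<and>
     (\<forall>\<psi> H. W12_vanishing (half_cyl l \<tau>) \<mu>
               (frontier (half_ball l \<tau>) \<times> {0<..<\<tau>} \<union> half_ball l \<tau> \<times> {\<tau>}) \<psi> H \<longrightarrow>
        (LINT X:half_cyl l \<tau>|lebesgue. A (snd X) (G X) \<bullet> H X) = 0)"

definition Linf_norm :: "'a::euclidean_space set \<Rightarrow> ('a \<Rightarrow> 'b::euclidean_space) \<Rightarrow> ereal" where
  "Linf_norm E f = esssup (lebesgue_on E) (\<lambda>X. ereal (norm (f X)))"

end

theory Submission
  imports Defs "HOL-Computational_Algebra.Polynomial"
begin

text \<open>
  The matrix depends on \<open>y\<close> only through the scalar weight and its horizontal block \<open>B\<close> is constant.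
  Therefore the equation is invariant under translations in \<open>x\<close> and under the reflection \<open>Rf\<close> along the
  conormal \<open>B e\<close>, which fixes the flat part of the lateral boundary. The solution vanishes there, so it is
  extended by odd reflection and mollified in \<open>x\<close> alone (\<open>pair\<close>). A translated kernel minus its
  reflection vanishes on the flat part, so it is a legitimate horizontal factor of a test function, and the
  mollified solution satisfies the equation on horizontal balls that may cross the flat part. The boundary
  condition thus disappears, and the estimate becomes an interior one in \<open>x\<close>.

  For fixed \<open>x\<close> the mollified equation is an ordinary differential equation in \<open>y\<close>; the conormal condition
  says that the flux starts from \<open>0\<close>, which gives \<open>pair_conormal\<close>:
  \<open>m y * h\<^sub>k = - (\<integral> over (0, y) of m * L v\<^sub>k)\<close>. Multiplication by cutoffs and the solution gives a
  Caccioppoli inequality (\<open>caccioppoli\<close>) with constants that depend neither on the kernel nor on its scale.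
  Horizontal derivatives of a mollified solution are again mollified solutions, so the inequality can be
  iterated (\<open>iterated_caccioppoli\<close>), starting from the energy of the gradient, which mollification increases
  only by a factor that depends on \<open>\<Lambda>\<close> (\<open>base_energy\<close>).

  Pointwise bounds for horizontal derivatives follow from an elementary Sobolev inequality: one slice in each
  horizontal coordinate, and one in \<open>y\<close> (\<open>section_sup_bound\<close>). The passage from weighted \<open>L\<^sup>2\<close> to \<open>L\<^sup>1\<close>
  costs \<open>\<integral> (1 / m)\<close>, and the Muckenhoupt condition trades this integral for the mass of the cylinder. The
  vertical derivative cannot be treated in this way, as the weight depends on \<open>y\<close>; instead the identity
  for the flux bounds it by second horizontal derivatives, and the growth condition on the weight is
  exactly what cancels \<open>m y\<close> (\<open>conormal_sup_bound\<close>).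

  Finally the scale of mollification tends to \<open>0\<close> (\<open>mollified_bound_limit\<close>, \<open>gradient_sup_bound\<close>). The
  remaining lemmas translate the definition of a weak solution into this setting
  (\<open>weak_solution_mixed_solution\<close>) and collect the constants.
\<close>

section \<open>Partial derivatives of smooth functions\<close>

definition pd :: "'a::euclidean_space => ('a => real) => 'a => real" where
  "pd i f x = frechet_derivative f (at x) i"

lemma pd_eqI: "(f has_derivative f') (at x) ==> pd i f x = f' i"
  unfolding pd_def using frechet_derivative_at by metis

lemma has_derivative_pd: "f differentiable (at x) ==> (f has_derivative (\<lambda>i. pd i f x)) (at x)"
  unfolding pd_def using frechet_derivative_works by blast

text \<open>The successor equation of the recursion for \<^const>\<open>Ck\<close>, phrased with \<^const>\<open>pd\<close>; it replaces the equation that unfolds to derivatives.\<close>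

lemma Ck_Suc_iff: "Ck (Suc k) f \<longleftrightarrow> (\<forall>x. f differentiable (at x)) \<and> (\<forall>i\<in>Basis. Ck k (pd i f))"
  by (simp add: pd_def[abs_def])

declare Ck.simps(2) [simp del]

lemma Ck_SucD: "Ck (Suc k) f ==> Ck k f"
proof (induction k arbitrary: f)
  case 0
  then show ?case
    by (auto simp: Ck_Suc_iff continuous_on_eq_continuous_within differentiable_imp_continuous_within)
next
  case (Suc k)
  then show ?case by (metis Ck_Suc_iff)
qed

lemma Ck_const: "Ck k (\<lambda>x. c)"
proof (induction k arbitrary: c)
  case (Suc k)
  have "pd i (\<lambda>x. c) = (\<lambda>x. 0)" for i :: 'a
    by (rule ext, rule pd_eqI) (rule has_derivative_const)
  then show ?case using Suc by (simp add: Ck_Suc_iff)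
qed simp

lemma Ck_add: "Ck k f ==> Ck k g ==> Ck k (\<lambda>x. f x + g x)"
proof (induction k arbitrary: f g)
  case (Suc k)
  have d: "f differentiable (at x)" "g differentiable (at x)" for x
    using Suc.prems by (auto simp: Ck_Suc_iff)
  have "pd i (\<lambda>x. f x + g x) = (\<lambda>x. pd i f x + pd i g x)" for i
    by (rule ext, rule pd_eqI) (intro has_derivative_add has_derivative_pd d)
  then show ?case using Suc d by (auto simp: Ck_Suc_iff)
qed (auto intro: continuous_intros)

lemma Ck_mult: "Ck k f ==> Ck k g ==> Ck k (\<lambda>x. f x * g x)"
proof (induction k arbitrary: f g)
  case (Suc k)
  have d: "f differentiable (at x)" "g differentiable (at x)" for x
    using Suc.prems by (auto simp: Ck_Suc_iff)
  have e: "pd i (\<lambda>x. f x * g x) = (\<lambda>x. f x * pd i g x + pd i f x * g x)" for i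
    by (rule ext, rule pd_eqI) (intro has_derivative_mult has_derivative_pd d)
  have "Ck k f" "Ck k g" using Suc.prems Ck_SucD by auto
  then have "Ck k (pd i (\<lambda>x. f x * g x))" if "i \<in> Basis" for i
    unfolding e using Suc.prems that by (intro Ck_add Suc.IH) (auto simp: Ck_Suc_iff)
  then show ?case using d by (auto simp: Ck_Suc_iff)
qed (auto intro: continuous_intros)

lemma Ck_sum: "(\<And>i. i \<in> I ==> Ck k (f i)) ==> Ck k (\<lambda>x. \<Sum>i\<in>I. f i x)"
  by (induction I rule: infinite_finite_induct) (auto intro: Ck_const Ck_add)

lemma pd_affine:
  assumes "f differentiable (at (L x + c))" "linear L"
  shows "pd i (\<lambda>x. f (L x + c)) x = (\<Sum>j\<in>Basis. (L i \<bullet> j) * pd j f (L x + c))"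
    and "(\<lambda>x. f (L x + c)) differentiable (at x)"
proof -
  have L: "(L has_derivative L) (at x)"
    using assms(2) by (simp add: linear_imp_has_derivative)
  have *: "((\<lambda>x. f (L x + c)) has_derivative (\<lambda>i. pd (L i) f (L x + c))) (at x)"
    using L by (intro has_derivative_compose[of "\<lambda>x. L x + c" L x UNIV f "\<lambda>i. pd i f (L x + c)"]
        has_derivative_pd assms) (auto intro!: derivative_eq_intros)
  show "(\<lambda>x. f (L x + c)) differentiable (at x)"
    using * by (auto simp: differentiable_def)
  have lin: "linear (\<lambda>i. pd i f (L x + c))"
    using has_derivative_pd[OF assms(1)] by (auto dest: has_derivative_linear)
  have "pd i (\<lambda>x. f (L x + c)) x = pd (L i) f (L x + c)"
    by (rule pd_eqI[OF *])
  also have "\<dots> = pd (\<Sum>j\<in>Basis. (L i \<bullet> j) *\<^sub>R j) f (L x + c)"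
    by (simp add: euclidean_representation)
  also have "\<dots> = (\<Sum>j\<in>Basis. (L i \<bullet> j) * pd j f (L x + c))"
    unfolding linear_sum[OF lin] linear_cmul[OF lin] by simp
  finally show "pd i (\<lambda>x. f (L x + c)) x = (\<Sum>j\<in>Basis. (L i \<bullet> j) * pd j f (L x + c))" .
qed

lemma Ck_affine:
  assumes "Ck k f" "linear L"
  shows "Ck k (\<lambda>x. f (L x + c))"
  using assms(1)
proof (induction k arbitrary: f)
  case 0
  then show ?case
    using assms(2)
    by (simp add: linear_conv_bounded_linear)
       (rule continuous_on_compose2[of UNIV f], auto intro: continuous_on_add linear_continuous_on)
next
  case (Suc k)
  have d: "f differentiable (at x)" for x using Suc.prems by (auto simp: Ck_Suc_iff)
  have "pd i (\<lambda>x. f (L x + c)) = (\<lambda>x. \<Sum>j\<in>Basis. (L i \<bullet> j) * pd j f (L x + c))" for i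
    by (rule ext, rule pd_affine(1)[OF d assms(2)])
  moreover have "Ck k (pd j f)" if "j \<in> Basis" for j
    using Suc.prems that by (auto simp: Ck_Suc_iff)
  ultimately show ?case
    using pd_affine(2)[OF d assms(2)]
    by (auto simp: Ck_Suc_iff intro!: Ck_sum Ck_mult Ck_const Suc.IH)
qed

lemma smooth_const: "smooth (\<lambda>x. c)"
  and smooth_add: "smooth f ==> smooth g ==> smooth (\<lambda>x. f x + g x)"
  and smooth_mult: "smooth f ==> smooth g ==> smooth (\<lambda>x. f x * g x)"
  and smooth_sum: "(\<And>i. i \<in> I ==> smooth (F i)) ==> smooth (\<lambda>x. \<Sum>i\<in>I. F i x)"
  and smooth_affine: "smooth u ==> linear L ==> smooth (\<lambda>x. u (L x + b))"
  unfolding smooth_def by (auto intro: Ck_const Ck_add Ck_mult Ck_sum Ck_affine)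

lemma smooth_diff: "smooth f ==> smooth g ==> smooth (\<lambda>x. f x - g x)"
  using smooth_add[of f "\<lambda>x. (- 1) * g x"] smooth_mult[OF smooth_const[of "-1"], of g] by simp

lemma smooth_linear: "linear L ==> smooth (L :: 'a::euclidean_space => real)"
proof -
  have "Ck k (\<lambda>x. x :: real)" for k
  proof (cases k)
    case (Suc k')
    have "pd i (\<lambda>x. x :: real) = (\<lambda>x. i)" for i
      by (rule ext, rule pd_eqI) (rule has_derivative_ident)
    then show ?thesis by (auto simp: Suc Ck_Suc_iff Ck_const)
  qed auto
  then have "smooth (\<lambda>x. x :: real)" by (simp add: smooth_def)
  from smooth_affine[OF this, of L 0] show "linear L ==> smooth L" by simp
qed

lemma smooth_pd: "smooth f ==> i \<in> Basis ==> smooth (pd i f)"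
  unfolding smooth_def by (metis Ck_Suc_iff)

lemma smooth_differentiable: "smooth f ==> f differentiable (at x)"
  unfolding smooth_def by (metis Ck_Suc_iff)

lemma smooth_continuous: "smooth f ==> continuous_on S f"
  unfolding smooth_def by (metis Ck.simps(1) continuous_on_subset subset_UNIV)

lemma smooth_borel: "smooth f ==> f \<in> borel_measurable borel"
  by (intro borel_measurable_continuous_onI smooth_continuous)

lemma pd_mult: "smooth f ==> smooth g ==> pd i (\<lambda>x. f x * g x) x = f x * pd i g x + pd i f x * g x"
  by (rule pd_eqI) (intro has_derivative_mult has_derivative_pd smooth_differentiable)

lemma pd_diff: "smooth f ==> smooth g ==> pd i (\<lambda>x. f x - g x) x = pd i f x - pd i g x"
  by (rule pd_eqI) (intro has_derivative_diff has_derivative_pd smooth_differentiable)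

lemma smooth_has_real_derivative_line:
  assumes "smooth f"
  shows "((\<lambda>t. f (x + t *\<^sub>R i)) has_real_derivative pd i f (x + t *\<^sub>R i)) (at t)"
proof -
  have d: "(f has_derivative (\<lambda>h. pd h f (x + t *\<^sub>R i))) (at (x + t *\<^sub>R i))"
    by (intro has_derivative_pd smooth_differentiable assms)
  have l: "((\<lambda>t. x + t *\<^sub>R i) has_derivative (\<lambda>s. s *\<^sub>R i)) (at t)"
    by (auto intro!: derivative_eq_intros)
  have "((\<lambda>t. f (x + t *\<^sub>R i)) has_derivative (\<lambda>s. pd (s *\<^sub>R i) f (x + t *\<^sub>R i))) (at t)"
    by (rule has_derivative_compose[OF l d])
  moreover have "pd (s *\<^sub>R i) f (x + t *\<^sub>R i) = pd i f (x + t *\<^sub>R i) * s" for s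
    using linear_cmul[OF has_derivative_linear[OF d], of s i] by simp
  ultimately show ?thesis
    by (simp add: has_field_derivative_def)
qed

lemma pd_sum_Basis:
  assumes "smooth f"
  shows "pd h f x = (\<Sum>i\<in>Basis. (h \<bullet> i) * pd i f x)"
  using pd_affine(1)[of f "\<lambda>x. x" x 0 h] smooth_differentiable[OF assms] by (auto simp: linear_iff)

lemma smooth_Lipschitz_on_cball:
  assumes "smooth f"
  obtains C where "C \<ge> 0" "\<And>x y. x \<in> cball 0 r ==> y \<in> cball 0 r ==> \<bar>f x - f y\<bar> \<le> C * norm (x - y)"
proof -
  have "compact ((\<lambda>x. \<Sum>i\<in>Basis. \<bar>pd i f x\<bar>) ` cball 0 r)"
    using assms by (intro compact_continuous_image continuous_intros smooth_continuous smooth_pd) auto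
  then have "bounded ((\<lambda>x. \<Sum>i\<in>Basis. \<bar>pd i f x\<bar>) ` cball 0 r)"
    by (rule compact_imp_bounded)
  then obtain C where "\<forall>y\<in>(\<lambda>x. \<Sum>i\<in>Basis. \<bar>pd i f x\<bar>) ` cball 0 r. \<bar>y\<bar> \<le> C"
    unfolding bounded_real by (elim exE)
  then have C: "\<And>x. x \<in> cball 0 r ==> (\<Sum>i\<in>Basis. \<bar>pd i f x\<bar>) \<le> C"
    by force
  have "\<bar>f y - f x\<bar> \<le> max 0 C * norm (y - x)" if "x \<in> cball 0 r" "y \<in> cball 0 r" for x y
  proof -
    have "norm (f y - f x) \<le> max 0 C * norm (y - x)"
    proof (rule differentiable_bound[of "cball 0 r" f "\<lambda>x h. pd h f x"])
      fix x :: 'a assume x: "x \<in> cball 0 r"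
      show "(f has_derivative (\<lambda>h. pd h f x)) (at x within cball 0 r)"
        by (rule has_derivative_at_withinI) (intro has_derivative_pd smooth_differentiable assms)
      show "onorm (\<lambda>h. pd h f x) \<le> max 0 C"
      proof (rule onorm_le)
        fix h
        have "\<bar>pd h f x\<bar> \<le> (\<Sum>i\<in>Basis. \<bar>h \<bullet> i\<bar> * \<bar>pd i f x\<bar>)"
          unfolding pd_sum_Basis[OF assms, of h] by (rule order_trans[OF sum_abs]) (simp add: abs_mult)
        also have "\<dots> \<le> (\<Sum>i\<in>Basis. norm h * \<bar>pd i f x\<bar>)"
          by (intro sum_mono mult_right_mono) (auto simp: Basis_le_norm)
        also have "\<dots> = norm h * (\<Sum>i\<in>Basis. \<bar>pd i f x\<bar>)" by (simp add: sum_distrib_left)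
        also have "\<dots> \<le> norm h * max 0 C"
          using C[OF x] by (intro mult_left_mono) auto
        finally show "norm (pd h f x) \<le> max 0 C * norm h" by (simp add: mult.commute)
      qed
    qed (use that in auto)
    then show ?thesis by simp
  qed
  then show ?thesis
    by (intro that[of "max 0 C"]) (auto simp: abs_minus_commute norm_minus_commute)
qed

lemma smooth_bounded_on_cball:
  assumes "smooth f"
  obtains C where "C \<ge> 0" "\<And>x. x \<in> cball 0 r ==> \<bar>f x\<bar> \<le> C"
proof -
  have "compact ((\<lambda>x. \<bar>f x\<bar>) ` cball 0 r)"
    using assms by (intro compact_continuous_image continuous_intros smooth_continuous) auto
  then have "bounded ((\<lambda>x. \<bar>f x\<bar>) ` cball 0 r)" by (rule compact_imp_bounded)
  then obtain C where "\<forall>y\<in>(\<lambda>x. \<bar>f x\<bar>) ` cball 0 r. \<bar>y\<bar> \<le> C"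
    unfolding bounded_real by (elim exE)
  then have C: "\<And>x. x \<in> cball 0 r ==> \<bar>f x\<bar> \<le> C" by force
  then have "\<And>x. x \<in> cball 0 r ==> \<bar>f x\<bar> \<le> max C 0" by (simp add: le_max_iff_disj)
  then show ?thesis by (intro that[of "max C 0"]) auto
qed

lemma real_polynomial_function_smooth:
  "real_polynomial_function p ==> smooth (p :: 'a::euclidean_space => real)"
  by (induction p rule: real_polynomial_function.induct)
     (auto intro: smooth_linear smooth_const smooth_add smooth_mult bounded_linear.linear)

section \<open>A smooth bump, integration by translation and one-dimensional slices\<close>

text \<open>The functions \<open>p(1/t) exp (-1/t)\<close>, extended by \<open>0\<close> to \<open>t \<le> 0\<close>. They form a class closed under differentiation, which is why a polynomial is carried along.\<close>

definition exp_flat :: "real poly => real => real" where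
  "exp_flat p t = (if t > 0 then poly p (1 / t) * exp (- (1 / t)) else 0)"

lemma exp_flat_has_derivative:
  "(exp_flat p has_real_derivative exp_flat ([:0, 0, 1:] * (p - pderiv p)) t) (at t)"
proof (cases t "0 :: real" rule: linorder_cases)
  case less
  have "((\<lambda>t. 0) has_real_derivative 0) (at t)" by simp
  moreover have "\<forall>\<^sub>F s in nhds t. exp_flat p s = 0"
    using eventually_nhds_in_open[of "{..<0}" t] less
    by (auto elim!: eventually_mono simp: exp_flat_def)
  ultimately have "(exp_flat p has_real_derivative 0) (at t)"
    by (subst DERIV_cong_ev[OF refl _ refl]) auto
  then show ?thesis using less by (simp add: exp_flat_def)
next
  case greater
  have "((\<lambda>t. poly p (1 / t) * exp (- (1 / t))) has_real_derivative
      poly p (1 / t) * (exp (- (1 / t)) * (1 / t\<^sup>2)) + (poly (pderiv p) (1 / t) * (- (1 / t\<^sup>2))) * exp (- (1 / t))) (at t)"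
    using greater
    by (auto intro!: derivative_eq_intros DERIV_chain2[OF poly_DERIV] simp: power2_eq_square field_simps)
  moreover have "\<forall>\<^sub>F s in nhds t. exp_flat p s = poly p (1 / s) * exp (- (1 / s))"
    using eventually_nhds_in_open[of "{0<..}" t] greater
    by (auto elim!: eventually_mono simp: exp_flat_def)
  ultimately have "(exp_flat p has_real_derivative
      poly p (1 / t) * (exp (- (1 / t)) * (1 / t\<^sup>2)) + (poly (pderiv p) (1 / t) * (- (1 / t\<^sup>2))) * exp (- (1 / t))) (at t)"
    by (subst DERIV_cong_ev[OF refl _ refl])
  moreover have "poly p (1 / t) * (exp (- (1 / t)) * (1 / t\<^sup>2)) + (poly (pderiv p) (1 / t) * (- (1 / t\<^sup>2))) * exp (- (1 / t))
      = exp_flat ([:0, 0, 1:] * (p - pderiv p)) t"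
    using greater by (simp add: exp_flat_def power2_eq_square field_simps)
  ultimately show ?thesis by simp
next
  case equal
  have lim: "((\<lambda>s. poly q s * exp (- s)) \<longlongrightarrow> 0) at_top" for q :: "real poly"
  proof -
    have "((\<lambda>s. \<Sum>i\<le>degree q. coeff q i * (s ^ i / exp s)) \<longlongrightarrow> (\<Sum>i\<le>degree q. coeff q i * 0)) at_top"
      by (intro tendsto_sum tendsto_mult tendsto_const tendsto_power_div_exp_0)
    then show ?thesis
      by (simp add: poly_altdef sum_distrib_right exp_minus divide_inverse mult.assoc)
  qed
  have "((\<lambda>s. poly ([:0, 1:] * p) (inverse s) * exp (- inverse s)) \<longlongrightarrow> 0) (at_right 0)"
    by (rule filterlim_compose[OF lim filterlim_inverse_at_top_right])
  then have "((\<lambda>s. (exp_flat p s - exp_flat p 0) / (s - 0)) \<longlongrightarrow> 0) (at_right 0)"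
    by (rule Lim_transform_eventually)
       (auto simp: exp_flat_def eventually_at_right_less field_simps intro!: eventually_at_rightI[of 0 1])
  moreover have "((\<lambda>s. (exp_flat p s - exp_flat p 0) / (s - 0)) \<longlongrightarrow> 0) (at_left 0)"
    by (rule Lim_transform_eventually[of "\<lambda>_. 0"])
       (auto simp: exp_flat_def intro!: eventually_at_leftI[of "-1"])
  ultimately have "((\<lambda>s. (exp_flat p s - exp_flat p 0) / (s - 0)) \<longlongrightarrow> 0) (at 0)"
    by (simp add: filterlim_split_at)
  then show ?thesis using equal by (simp add: has_field_derivative_iff exp_flat_def)
qed

text \<open>The derivative of such a function is again one, by \<open>exp_flat_has_derivative\<close>, so induction on the order of differentiability applies.\<close>

lemma smooth_exp_flat:
  assumes Q: "smooth Q"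
  shows "smooth (\<lambda>x. exp_flat p (Q x))"
proof -
  have "Ck k (\<lambda>x. exp_flat p (Q x))" for k
  proof (induction k arbitrary: p)
    case 0
    have "continuous_on UNIV (exp_flat p)"
      by (meson DERIV_isCont continuous_at_imp_continuous_on exp_flat_has_derivative)
    from continuous_on_compose2[OF this smooth_continuous[OF Q]] show ?case by simp
  next
    case (Suc k)
    define q where "q = [:0, 0, 1:] * (p - pderiv p)"
    have d: "((\<lambda>x. exp_flat p (Q x)) has_derivative (\<lambda>h. exp_flat q (Q x) * pd h Q x)) (at x)" for x
      unfolding q_def
      by (rule has_derivative_compose[OF has_derivative_pd[OF smooth_differentiable[OF Q]]
          exp_flat_has_derivative[unfolded has_field_derivative_def]])
    have "pd i (\<lambda>x. exp_flat p (Q x)) = (\<lambda>x. exp_flat q (Q x) * pd i Q x)" for i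
      by (rule ext, rule pd_eqI[OF d])
    moreover have "Ck k (pd i Q)" if "i \<in> Basis" for i
      using smooth_pd[OF Q that] by (simp add: smooth_def)
    ultimately show ?case using d Suc.IH
      by (auto simp: Ck_Suc_iff differentiable_def intro!: Ck_mult)
  qed
  then show ?thesis by (simp add: smooth_def)
qed

lemma nn_integral_lborel_translate:
  fixes f :: "'a::euclidean_space => ennreal"
  assumes [measurable]: "f \<in> borel_measurable borel"
  shows "(\<integral>\<^sup>+ x. f (x + c) \<partial>lborel) = (\<integral>\<^sup>+ x. f x \<partial>lborel)"
  using nn_integral_distr[of "(+) c" lborel borel f] by (simp add: lborel_distr_plus add.commute)

lemma integral_lborel_translate:
  fixes f :: "'a::euclidean_space => real"
  assumes [measurable]: "f \<in> borel_measurable borel"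
  shows "(LBINT x. f (x + c)) = (LBINT x. f x)"
    and "integrable lborel (\<lambda>x. f (x + c)) \<longleftrightarrow> integrable lborel f"
  using integral_distr[of "(+) c" lborel borel f] integrable_distr_eq[of "(+) c" lborel borel f]
  by (simp_all add: lborel_distr_plus add.commute)

lemma nn_integral_lborel_reflect:
  fixes f :: "'a::euclidean_space => ennreal"
  assumes [measurable]: "f \<in> borel_measurable borel"
  shows "(\<integral>\<^sup>+ z. f (x - z) \<partial>lborel) = (\<integral>\<^sup>+ z. f z \<partial>lborel)"
proof -
  have "distr lborel borel (\<lambda>z. x - z) = lborel"
    using lborel_affine[of "-1" x] by (simp add: density_1)
  then show ?thesis
    using nn_integral_distr[of "\<lambda>z. x - z" lborel borel f] by simp
qed

text \<open>By translation invariance the difference quotients of \<open>h\<close> integrate to \<open>0\<close>. They are uniformly bounded and supported in a fixed ball, so dominated convergence passes this to the derivative. Differentiability is asked for almost everywhere, in order to cover functions with a corner, such as those cut off at the flat part.\<close>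

lemma integral_directional_derivative_zero:
  fixes h h' :: "'a::euclidean_space => real"
  assumes int: "integrable lborel h" and [measurable]: "h' \<in> borel_measurable borel"
    and lip: "\<And>x t. 0 < t ==> t \<le> 1 ==> \<bar>h (x + t *\<^sub>R e) - h x\<bar> \<le> C * t"
    and supp: "\<And>x. norm x > r ==> h x = 0"
    and deriv: "AE x in lborel. ((\<lambda>t. h (x + t *\<^sub>R e)) has_real_derivative h' x) (at 0)"
  shows "integral\<^sup>L lborel h' = 0"
proof -
  have [measurable]: "h \<in> borel_measurable borel" using int by auto
  define t where "t n = 1 / real (Suc n)" for n
  have t: "0 < t n" "t n \<le> 1" for n by (auto simp: t_def)
  have t0: "t \<longlonglongrightarrow> 0" unfolding t_def by (rule LIMSEQ_Suc[OF lim_1_over_n])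
  define s where "s n x = (h (x + t n *\<^sub>R e) - h x) / t n" for n x
  have "C \<ge> 0" using order_trans[OF abs_ge_zero lip[of 1]] by simp
  have "(\<lambda>n. integral\<^sup>L lborel (s n)) \<longlonglongrightarrow> integral\<^sup>L lborel h'"
  proof (rule integral_dominated_convergence)
    show "h' \<in> borel_measurable lborel" by simp
    show "s n \<in> borel_measurable lborel" for n unfolding s_def[abs_def] by measurable
    show "integrable lborel (\<lambda>x::'a. C * indicator (cball 0 (r + norm e)) x :: real)"
      by (intro integrable_mult_right integrable_real_indicator)
         (use emeasure_lborel_cball_finite[of "0::'a" "r + norm e"] in auto)
    show "AE x in lborel. (\<lambda>n. s n x) \<longlonglongrightarrow> h' x"
      using deriv
    proof eventually_elim
      case (elim x)
      have "filterlim t (at 0) sequentially"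
        using t t0 by (auto simp: filterlim_at less_imp_neq[symmetric] intro!: always_eventually)
      then show ?case
        using filterlim_compose[of _ _ "at 0" t] elim
        by (simp add: has_field_derivative_iff s_def)
    qed
    show "AE x in lborel. norm (s n x) \<le> C * indicator (cball 0 (r + norm e)) x" for n
    proof (intro AE_I2)
      fix x
      have 1: "\<bar>s n x\<bar> \<le> C" using lip[OF t[of n], of x] t[of n] by (simp add: s_def field_simps)
      moreover have "s n x = 0" if "norm x > r + norm e"
      proof -
        have "norm x \<le> norm (x + t n *\<^sub>R e) + norm (t n *\<^sub>R e)"
          using norm_triangle_ineq4[of "x + t n *\<^sub>R e" "t n *\<^sub>R e"] by simp
        moreover have "norm (t n *\<^sub>R e) \<le> norm e" using t[of n] by (simp add: mult_left_le_one_le)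
        ultimately have "norm (x + t n *\<^sub>R e) > r" "norm x > r" using that norm_ge_zero[of e] by linarith+
        then show ?thesis by (simp add: s_def supp)
      qed
      ultimately show "norm (s n x) \<le> C * indicator (cball 0 (r + norm e)) x"
        using \<open>C \<ge> 0\<close> by (auto simp: indicator_def not_le)
    qed
  qed
  moreover have "integral\<^sup>L lborel (s n) = 0" for n
  proof -
    have "integral\<^sup>L lborel (s n) = ((\<integral>x. h (x + t n *\<^sub>R e) \<partial>lborel) - integral\<^sup>L lborel h) / t n"
      unfolding s_def[abs_def] using int by (simp add: integral_lborel_translate)
    then show ?thesis by (simp add: integral_lborel_translate)
  qed
  ultimately show ?thesis by (simp add: LIMSEQ_const_iff)
qed

lemma has_real_derivative_under_integral:
  fixes f f' :: "'z => real => real"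
  assumes int: "\<And>t. integrable M (\<lambda>z. f z t)" and [measurable]: "(\<lambda>z. f' z t0) \<in> borel_measurable M"
    and d: "\<And>z t. (f z has_real_derivative f' z t) (at t)"
    and b: "\<And>z t. \<bar>f' z t\<bar> \<le> w z" and w: "integrable M w"
  shows "((\<lambda>t. \<integral>z. f z t \<partial>M) has_real_derivative (\<integral>z. f' z t0 \<partial>M)) (at t0)"
  unfolding has_field_derivative_iff tendsto_at_iff_sequentially comp_def
proof (intro allI impI)
  fix X :: "nat => real" assume X: "\<forall>i. X i \<in> UNIV - {t0}" and lim: "X \<longlonglongrightarrow> t0"
  have [measurable]: "(\<lambda>z. f z t) \<in> borel_measurable M" for t using int[of t] by auto
  have "(\<lambda>n. \<integral>z. (f z (X n) - f z t0) / (X n - t0) \<partial>M) \<longlonglongrightarrow> (\<integral>z. f' z t0 \<partial>M)"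
  proof (rule integral_dominated_convergence[OF _ _ w])
    show "AE z in M. (\<lambda>n. (f z (X n) - f z t0) / (X n - t0)) \<longlonglongrightarrow> f' z t0"
      using d[of _ t0] X lim
      unfolding has_field_derivative_iff tendsto_at_iff_sequentially comp_def by blast
    show "AE z in M. norm ((f z (X n) - f z t0) / (X n - t0)) \<le> w z" for n
    proof (intro AE_I2)
      fix z
      have "norm (f z (X n) - f z t0) \<le> w z * norm (X n - t0)"
        using d b by (intro field_differentiable_bound[of UNIV "f z" "f' z"]) auto
      then show "norm ((f z (X n) - f z t0) / (X n - t0)) \<le> w z"
        using X by (simp add: abs_divide divide_le_eq)
    qed
  qed auto
  then show "(\<lambda>n. ((\<integral>z. f z (X n) \<partial>M) - (\<integral>z. f z t0 \<partial>M)) / (X n - t0)) \<longlonglongrightarrow> (\<integral>z. f' z t0 \<partial>M)"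
    by (simp add: int Bochner_Integration.integral_diff)
qed

lemma integral_lborel_reflect:
  fixes f :: "'a::euclidean_space => real"
  assumes [measurable]: "f \<in> borel_measurable borel"
  shows "(LBINT z. f (x - z)) = (LBINT z. f z)"
proof -
  have "distr lborel borel (\<lambda>z. x - z) = lborel"
    using lborel_affine[of "-1" x] by (simp add: density_1)
  then show ?thesis
    using integral_distr[of "\<lambda>z. x - z" lborel borel f] by simp
qed

text \<open>The value at a point is at most the mean over an interval of length \<open>r\<close> plus the integral of the derivative over that interval.\<close>

lemma slice_estimate:
  fixes g g' :: "real => real"
  assumes g: "\<And>t. (g has_real_derivative g' t) (at t)" and c: "continuous_on UNIV g'" and r: "r > 0"
  shows "ennreal \<bar>g 0\<bar> \<le> ennreal (1 / r) * (\<integral>\<^sup>+ t\<in>{0..r}. ennreal (\<bar>g t\<bar> + r * \<bar>g' t\<bar>) \<partial>lborel)"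
proof -
  have cg: "continuous_on UNIV g" using g by (meson DERIV_isCont continuous_at_imp_continuous_on)
  have [measurable]: "g \<in> borel_measurable borel" "g' \<in> borel_measurable borel"
    using c cg by (auto intro: borel_measurable_continuous_onI)
  have i: "set_integrable lborel {0..s} (\<lambda>t. \<bar>g' t\<bar>)" "set_integrable lborel {0..s} g'" "set_integrable lborel {0..s} (\<lambda>t. \<bar>g t\<bar>)" for s
    by (intro borel_integrable_atLeastAtMost' continuous_intros continuous_on_subset[OF c]
        continuous_on_subset[OF cg]; simp)+
  define J where "J = (LBINT t:{0..r}. \<bar>g' t\<bar>)"
  have 1: "\<bar>g 0\<bar> \<le> \<bar>g t\<bar> + J" if "t \<in> {0..r}" for t
  proof -
    have "(LBINT t:{0..t}. g' t) = g t - g 0"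
      unfolding set_lebesgue_integral_def using that
      by (intro integral_FTC_atLeastAtMost)
         (auto intro: has_field_derivative_at_within g continuous_on_subset[OF c]
           simp: has_real_derivative_iff_has_vector_derivative[symmetric])
    moreover have "\<bar>LBINT t:{0..t}. g' t\<bar> \<le> (LBINT t:{0..t}. \<bar>g' t\<bar>)"
      using set_integral_norm_bound[OF i(2)[of t]] by simp
    moreover have "(LBINT t:{0..t}. \<bar>g' t\<bar>) \<le> J"
      unfolding J_def set_lebesgue_integral_def using that i[unfolded set_integrable_def]
      by (intro integral_mono) (auto simp: indicator_def)
    ultimately show ?thesis by linarith
  qed
  have "(LBINT t:{0..r}. \<bar>g 0\<bar>) \<le> (LBINT t:{0..r}. \<bar>g t\<bar> + J)"
    using 1 by (intro set_integral_mono set_integral_add(1) i) (auto intro!: borel_integrable_atLeastAtMost')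
  also have "\<dots> = (LBINT t:{0..r}. \<bar>g t\<bar>) + r * J"
    using r by (subst set_integral_add)
      (auto intro!: i borel_integrable_atLeastAtMost' simp: set_lebesgue_integral_def)
  also have "\<dots> = (LBINT t:{0..r}. \<bar>g t\<bar> + r * \<bar>g' t\<bar>)"
    unfolding J_def by (subst set_integral_add) (auto intro!: i)
  finally have 2: "r * \<bar>g 0\<bar> \<le> (LBINT t:{0..r}. \<bar>g t\<bar> + r * \<bar>g' t\<bar>)"
    using r by (simp add: set_lebesgue_integral_def[of _ _ "\<lambda>_. \<bar>g 0\<bar>"])
  have "ennreal (LBINT t:{0..r}. \<bar>g t\<bar> + r * \<bar>g' t\<bar>) = (\<integral>\<^sup>+ t. ennreal (indicator {0..r} t * (\<bar>g t\<bar> + r * \<bar>g' t\<bar>)) \<partial>lborel)"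
    unfolding set_lebesgue_integral_def
    using r set_integral_add(1)[OF i(3) set_integrable_mult_right[OF i(1), of r r]]
    by (subst nn_integral_eq_integral) (auto simp: set_integrable_def)
  also have "\<dots> = (\<integral>\<^sup>+ t\<in>{0..r}. ennreal (\<bar>g t\<bar> + r * \<bar>g' t\<bar>) \<partial>lborel)"
    by (intro nn_integral_cong) (auto simp: indicator_def)
  finally have 3: "ennreal (LBINT t:{0..r}. \<bar>g t\<bar> + r * \<bar>g' t\<bar>) = \<dots>" .
  have "ennreal \<bar>g 0\<bar> \<le> ennreal (1 / r * (LBINT t:{0..r}. \<bar>g t\<bar> + r * \<bar>g' t\<bar>))"
    using 2 r by (intro ennreal_leI) (simp add: field_simps)
  also have "\<dots> = ennreal (1 / r) * (\<integral>\<^sup>+ t\<in>{0..r}. ennreal (\<bar>g t\<bar> + r * \<bar>g' t\<bar>) \<partial>lborel)"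
    using r unfolding 3[symmetric] by (subst ennreal_mult[symmetric]) (auto simp: set_lebesgue_integral_def)
  finally show ?thesis .
qed

text \<open>One slice in each coordinate. In the application \<open>\<Psi> m\<close> is the sum of the moduli of the derivatives of order at most \<open>m\<close>, so a step raises the order by one; the result is a Sobolev inequality in \<open>L\<^sup>1\<close> form on a cube of side \<open>r\<close>.\<close>

lemma iterated_slice_estimate:
  fixes \<Psi> :: "nat => 'a::euclidean_space => ennreal"
  assumes meas[measurable]: "\<And>m. \<Psi> m \<in> borel_measurable borel"
    and step: "\<And>m x b. b \<in> Basis ==> \<Psi> m x \<le> c * (\<integral>\<^sup>+ t\<in>{0..r}. \<Psi> (Suc m) (x + t *\<^sub>R b) \<partial>lborel)"
  shows "\<Psi> 0 x \<le> c ^ DIM('a) * (\<integral>\<^sup>+ z\<in>{z. \<forall>b\<in>Basis. z \<bullet> b \<in> {0..r}}. \<Psi> DIM('a) (x + z) \<partial>lborel)"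
proof -
  interpret P: product_sigma_finite "\<lambda>_::'a. lborel :: real measure" ..
  have *: "\<Psi> 0 x \<le> c ^ card S * (\<integral>\<^sup>+ f. (\<Prod>b\<in>S. indicator {0..r} (f b)) * \<Psi> (card S) (x + (\<Sum>b\<in>S. f b *\<^sub>R b)) \<partial>PiM S (\<lambda>_. lborel))"
    if "finite S" "S \<subseteq> Basis" for S
    using that
  proof (induction S rule: finite_induct)
    case empty
    show ?case by (subst P.nn_integral_empty) auto
  next
    case (insert b S)
    have bS: "(f(b := t)) b = t" "(\<Sum>d\<in>S. (f(b := t)) d *\<^sub>R d) = (\<Sum>d\<in>S. f d *\<^sub>R d)"
      "(\<Prod>d\<in>S. indicator {0..r} ((f(b := t)) d)) = (\<Prod>d\<in>S. indicator {0..r} (f d) :: ennreal)" for f t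
      using insert.hyps by (auto intro!: sum.cong prod.cong)
    have "\<Psi> 0 x \<le> c ^ card S * (\<integral>\<^sup>+ f. (\<Prod>b\<in>S. indicator {0..r} (f b)) * \<Psi> (card S) (x + (\<Sum>b\<in>S. f b *\<^sub>R b)) \<partial>PiM S (\<lambda>_. lborel))"
      using insert by simp
    also have "\<dots> \<le> c ^ card S * (\<integral>\<^sup>+ f. (\<Prod>b\<in>S. indicator {0..r} (f b)) *
        (c * (\<integral>\<^sup>+ t\<in>{0..r}. \<Psi> (Suc (card S)) ((x + (\<Sum>b\<in>S. f b *\<^sub>R b)) + t *\<^sub>R b) \<partial>lborel)) \<partial>PiM S (\<lambda>_. lborel))"
      using insert.prems by (intro mult_left_mono nn_integral_mono step) auto
    also have "\<dots> = c ^ card (insert b S) * (\<integral>\<^sup>+ f. \<integral>\<^sup>+ t. (\<Prod>d\<in>insert b S. indicator {0..r} ((f(b := t)) d)) *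
        \<Psi> (card (insert b S)) (x + (\<Sum>d\<in>insert b S. (f(b := t)) d *\<^sub>R d)) \<partial>lborel \<partial>PiM S (\<lambda>_. lborel))"
    proof -
      have "(\<integral>\<^sup>+ t. (\<Prod>d\<in>insert b S. indicator {0..r} ((f(b := t)) d)) *
        \<Psi> (card (insert b S)) (x + (\<Sum>d\<in>insert b S. (f(b := t)) d *\<^sub>R d)) \<partial>lborel)
        = (\<Prod>b\<in>S. indicator {0..r} (f b)) *
          (\<integral>\<^sup>+ t\<in>{0..r}. \<Psi> (Suc (card S)) ((x + (\<Sum>b\<in>S. f b *\<^sub>R b)) + t *\<^sub>R b) \<partial>lborel)" for f
        using insert.hyps
        by (subst nn_integral_cmult[symmetric]) (auto simp: bS ac_simps simp del: fun_upd_apply intro!: nn_integral_cong)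
      moreover have "(\<lambda>f. \<integral>\<^sup>+ t\<in>{0..r}. \<Psi> (Suc (card S)) ((x + (\<Sum>b\<in>S. f b *\<^sub>R b)) + t *\<^sub>R b) \<partial>lborel)
          \<in> borel_measurable (PiM S (\<lambda>_. lborel))"
        by measurable
      ultimately show ?thesis
        using insert.hyps
        by (simp add: nn_integral_cmult[symmetric] mult.left_commute[of _ c] mult.assoc)
    qed
    also have "\<dots> = c ^ card (insert b S) * (\<integral>\<^sup>+ f. (\<Prod>d\<in>insert b S. indicator {0..r} (f d)) *
        \<Psi> (card (insert b S)) (x + (\<Sum>d\<in>insert b S. f d *\<^sub>R d)) \<partial>PiM (insert b S) (\<lambda>_. lborel))"
      using insert.hyps by (subst P.product_nn_integral_insert) auto
    finally show ?case .
  qed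
  have [measurable]: "{z::'a. \<forall>b\<in>Basis. z \<bullet> b \<in> {0..r}} \<in> sets borel"
    by measurable
  have "(\<integral>\<^sup>+ z\<in>{z. \<forall>b\<in>Basis. z \<bullet> b \<in> {0..r}}. \<Psi> DIM('a) (x + z) \<partial>lborel) =
     (\<integral>\<^sup>+ f. (\<Prod>b\<in>Basis. indicator {0..r} (f b)) * \<Psi> DIM('a) (x + (\<Sum>b\<in>Basis. f b *\<^sub>R b)) \<partial>PiM Basis (\<lambda>_. lborel))"
    by (subst (1) lborel_eq, subst nn_integral_distr)
       (auto intro!: nn_integral_cong prod_zero simp: indicator_def split: if_splits)
  then show ?thesis using *[of Basis] by simp
qed

section \<open>Integration over products\<close>

lemma borel_pair_measurable [measurable]:
  "fst \<in> borel_measurable (borel :: ('a::second_countable_topology \<times> 'b::second_countable_topology) measure)"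
  "snd \<in> borel_measurable (borel :: ('a::second_countable_topology \<times> 'b::second_countable_topology) measure)"
  unfolding borel_prod[symmetric] by measurable

lemma nn_integral_lborel_pair:
  fixes f :: "'a::euclidean_space \<times> 'b::euclidean_space => ennreal"
  assumes [measurable]: "f \<in> borel_measurable borel"
  shows "(\<integral>\<^sup>+ X. f X \<partial>lborel) = (\<integral>\<^sup>+ z. \<integral>\<^sup>+ y. f (z, y) \<partial>lborel \<partial>lborel)"
    and "(\<integral>\<^sup>+ X. f X \<partial>lborel) = (\<integral>\<^sup>+ y. \<integral>\<^sup>+ z. f (z, y) \<partial>lborel \<partial>lborel)"
proof -
  have [measurable]: "f \<in> borel_measurable (lborel \<Otimes>\<^sub>M lborel)"
    by (simp add: lborel_prod)
  show "(\<integral>\<^sup>+ X. f X \<partial>lborel) = (\<integral>\<^sup>+ z. \<integral>\<^sup>+ y. f (z, y) \<partial>lborel \<partial>lborel)"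
    by (subst lborel.nn_integral_fst) (simp_all add: lborel_prod)
  show "(\<integral>\<^sup>+ X. f X \<partial>lborel) = (\<integral>\<^sup>+ y. \<integral>\<^sup>+ z. f (z, y) \<partial>lborel \<partial>lborel)"
    by (subst lborel_pair.nn_integral_snd) (simp_all add: lborel_prod)
qed

lemma integral_lborel_pair:
  fixes f :: "'a::euclidean_space \<times> 'b::euclidean_space => real"
  assumes "integrable lborel f"
  shows "(LBINT X. f X) = (\<integral> z. \<integral> y. f (z, y) \<partial>lborel \<partial>lborel)"
    and "(LBINT X. f X) = (\<integral> y. \<integral> z. f (z, y) \<partial>lborel \<partial>lborel)"
    and "AE z in lborel. integrable lborel (\<lambda>y. f (z, y))"
    and "AE y in lborel. integrable lborel (\<lambda>z. f (z, y))"
    and "integrable lborel (\<lambda>z. \<integral> y. f (z, y) \<partial>lborel)"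
    and "integrable lborel (\<lambda>y. \<integral> z. f (z, y) \<partial>lborel)"
proof -
  have i: "integrable (lborel \<Otimes>\<^sub>M lborel) f" using assms by (simp add: lborel_prod)
  have i': "integrable (lborel \<Otimes>\<^sub>M lborel) (\<lambda>(z, y). f (z, y))" using i by simp
  show "(LBINT X. f X) = (\<integral> z. \<integral> y. f (z, y) \<partial>lborel \<partial>lborel)"
    by (subst lborel_pair.integral_fst'[OF i]) (simp add: lborel_prod)
  show "(LBINT X. f X) = (\<integral> y. \<integral> z. f (z, y) \<partial>lborel \<partial>lborel)"
    by (subst lborel_pair.integral_snd[OF i']) (simp add: lborel_prod)
  show "AE z in lborel. integrable lborel (\<lambda>y. f (z, y))" by (rule lborel_pair.AE_integrable_fst'[OF i])
  show "AE y in lborel. integrable lborel (\<lambda>z. f (z, y))" by (rule lborel_pair.AE_integrable_snd[OF i'])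
  show "integrable lborel (\<lambda>z. \<integral> y. f (z, y) \<partial>lborel)" by (rule lborel_pair.integrable_fst'[OF i])
  show "integrable lborel (\<lambda>y. \<integral> z. f (z, y) \<partial>lborel)" by (rule lborel_pair.integrable_snd[OF i'])
qed

lemma AE_lborel_pair:
  fixes P :: "'a::euclidean_space \<times> 'b::euclidean_space => bool"
  assumes [measurable]: "Measurable.pred borel P"
  shows "(AE X in lborel. P X) \<longleftrightarrow> (AE z in lborel. AE y in lborel. P (z, y))"
    and "(AE X in lborel. P X) \<longleftrightarrow> (AE y in lborel. AE z in lborel. P (z, y))"
proof -
  have [measurable]: "Measurable.pred (lborel \<Otimes>\<^sub>M lborel) P" by (simp add: lborel_prod)
  have "{x \<in> space (lborel \<Otimes>\<^sub>M lborel). P (fst x, snd x)} \<in> sets (lborel \<Otimes>\<^sub>M lborel)" by measurable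
  from lborel_pair.AE_pair_iff[of "\<lambda>z y. P (z, y)", OF this] lborel_pair.AE_commute[of "\<lambda>z y. P (z, y)", OF this]
  show "(AE X in lborel. P X) \<longleftrightarrow> (AE z in lborel. AE y in lborel. P (z, y))"
    and "(AE X in lborel. P X) \<longleftrightarrow> (AE y in lborel. AE z in lborel. P (z, y))"
    unfolding lborel_prod by simp_all
qed

lemma integrable_lborel_pairI:
  fixes f :: "'a::euclidean_space \<times> 'b::euclidean_space => real"
  assumes [measurable]: "f \<in> borel_measurable borel"
    and 1: "\<And>y. integrable lborel (\<lambda>z. f (z, y))"
    and 2: "integrable lborel (\<lambda>y. \<integral> z. \<bar>f (z, y)\<bar> \<partial>lborel)"
  shows "integrable lborel f"
proof (rule integrableI_bounded)
  have "(\<integral>\<^sup>+ X. ennreal (norm (f X)) \<partial>lborel) = (\<integral>\<^sup>+ y. \<integral>\<^sup>+ z. ennreal (norm (f (z, y))) \<partial>lborel \<partial>lborel)"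
    by (rule nn_integral_lborel_pair) measurable
  also have "\<dots> = (\<integral>\<^sup>+ y. ennreal (LBINT z. \<bar>f (z, y)\<bar>) \<partial>lborel)"
    using 1 by (intro nn_integral_cong) (simp add: nn_integral_eq_integral)
  also have "\<dots> = ennreal (\<integral> y. (LBINT z. \<bar>f (z, y)\<bar>) \<partial>lborel)"
    using 2 by (intro nn_integral_eq_integral) auto
  finally show "(\<integral>\<^sup>+ X. ennreal (norm (f X)) \<partial>lborel) < \<infinity>" by simp
qed simp

lemma weighted_Cauchy_Schwarz:
  fixes u w :: "'a => real"
  assumes [measurable]: "u \<in> borel_measurable M" "w \<in> borel_measurable M"
    and "\<And>x. 0 \<le> w x"
  shows "(\<integral>\<^sup>+ x. ennreal (\<bar>u x\<bar> * w x) \<partial>M)\<^sup>2 \<le> (\<integral>\<^sup>+ x. ennreal ((u x)\<^sup>2 * w x) \<partial>M) * (\<integral>\<^sup>+ x. ennreal (w x) \<partial>M)"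
proof -
  have "(\<integral>\<^sup>+ x. ennreal (\<bar>u x\<bar> * sqrt (w x)) * ennreal (sqrt (w x)) \<partial>M)\<^sup>2
      \<le> (\<integral>\<^sup>+ x. (ennreal (\<bar>u x\<bar> * sqrt (w x)))\<^sup>2 \<partial>M) * (\<integral>\<^sup>+ x. (ennreal (sqrt (w x)))\<^sup>2 \<partial>M)"
    by (rule Cauchy_Schwarz_nn_integral) measurable
  also have "(\<lambda>x. ennreal (\<bar>u x\<bar> * sqrt (w x)) * ennreal (sqrt (w x))) = (\<lambda>x. ennreal (\<bar>u x\<bar> * w x))"
    using assms(3) by (auto simp: fun_eq_iff ennreal_mult'[symmetric] mult.assoc)
  also have "(\<lambda>x. (ennreal (\<bar>u x\<bar> * sqrt (w x)))\<^sup>2) = (\<lambda>x. ennreal ((u x)\<^sup>2 * w x))"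
    using assms(3) by (auto simp: fun_eq_iff ennreal_power power_mult_distrib)
  also have "(\<lambda>x. (ennreal (sqrt (w x)))\<^sup>2) = (\<lambda>x. ennreal (w x))"
    using assms(3) by (auto simp: fun_eq_iff ennreal_power)
  finally show ?thesis .
qed

lemma Cauchy_Schwarz_integral:
  fixes u w :: "'a => real"
  assumes [measurable]: "u \<in> borel_measurable M" "w \<in> borel_measurable M"
    and w: "\<And>x. 0 \<le> w x" "integrable M w" and u: "integrable M (\<lambda>x. (u x)\<^sup>2 * w x)"
  shows "integrable M (\<lambda>x. u x * w x)"
    and "(\<integral> x. \<bar>u x\<bar> * w x \<partial>M)\<^sup>2 \<le> (\<integral> x. (u x)\<^sup>2 * w x \<partial>M) * (\<integral> x. w x \<partial>M)"
proof -
  have CS: "(\<integral>\<^sup>+ x. ennreal (\<bar>u x\<bar> * w x) \<partial>M)\<^sup>2 \<le> ennreal (\<integral> x. (u x)\<^sup>2 * w x \<partial>M) * ennreal (\<integral> x. w x \<partial>M)"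
    using weighted_Cauchy_Schwarz[of u M w] w u by (simp add: nn_integral_eq_integral)
  then have "(\<integral>\<^sup>+ x. ennreal (\<bar>u x\<bar> * w x) \<partial>M)\<^sup>2 < \<infinity>"
    by (rule le_less_trans) (simp add: ennreal_mult_less_top)
  then have "(\<integral>\<^sup>+ x. ennreal (\<bar>u x\<bar> * w x) \<partial>M) < \<infinity>"
    by (simp add: power_less_top_ennreal)
  then show i: "integrable M (\<lambda>x. u x * w x)"
    using w by (intro integrableI_bounded) (auto simp: abs_mult)
  have i': "integrable M (\<lambda>x. \<bar>u x\<bar> * w x)"
    using integrable_abs[OF i] w by (simp add: abs_mult)
  have nn: "0 \<le> (\<integral> x. (u x)\<^sup>2 * w x \<partial>M)" "0 \<le> (\<integral> x. w x \<partial>M)" "0 \<le> (\<integral> x. \<bar>u x\<bar> * w x \<partial>M)"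
    using w by simp_all
  have "ennreal ((\<integral> x. \<bar>u x\<bar> * w x \<partial>M)\<^sup>2) \<le> ennreal ((\<integral> x. (u x)\<^sup>2 * w x \<partial>M) * (\<integral> x. w x \<partial>M))"
    using CS nn_integral_eq_integral[OF i'] w nn by (simp add: ennreal_power[symmetric] ennreal_mult')
  then show "(\<integral> x. \<bar>u x\<bar> * w x \<partial>M)\<^sup>2 \<le> (\<integral> x. (u x)\<^sup>2 * w x \<partial>M) * (\<integral> x. w x \<partial>M)"
    using nn by (subst (asm) ennreal_le_iff) auto
qed

text \<open>Integration by parts for two primitives, from Fubini's theorem on the half plane \<open>s \<le> y\<close>. In this form it applies to merely integrable derivatives.\<close>

lemma Fubini_primitives:
  fixes a b :: "real => real"
  assumes a: "integrable lborel a" and b: "integrable lborel b"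
  shows "(\<integral> y. (LBINT s. indicator {..y} s * a s) * b y \<partial>lborel)
       = (\<integral> s. a s * (LBINT y. indicator {s..} y * b y) \<partial>lborel)"
    and "integrable lborel (\<lambda>y. (LBINT s. indicator {..y} s * a s) * b y)"
    and "integrable lborel (\<lambda>s. a s * (LBINT y. indicator {s..} y * b y))"
proof -
  have [measurable]: "a \<in> borel_measurable borel" "b \<in> borel_measurable borel" using a b by auto
  define F :: "real \<times> real => real" where "F X = (if fst X \<le> snd X then a (fst X) * b (snd X) else 0)" for X
  have [measurable]: "F \<in> borel_measurable borel" unfolding F_def[abs_def] by measurable
  have i: "integrable lborel (\<lambda>s. indicator {..y} s * a s)" for y
    using integrable_mult_indicator[OF _ a, of "{..y}"] by simp
  have F1: "F (s, y) = (indicator {..y} s * a s) * b y" for s y by (simp add: F_def)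
  have F2: "F (s, y) = a s * (indicator {s..} y * b y)" for s y by (simp add: F_def)
  have "integrable lborel F"
  proof (rule integrable_lborel_pairI)
    show "integrable lborel (\<lambda>s. F (s, y))" for y
      unfolding F1 by (rule integrable_mult_left) (rule i)
    show "integrable lborel (\<lambda>y. \<integral> s. \<bar>F (s, y)\<bar> \<partial>lborel)"
    proof (rule Bochner_Integration.integrable_bound)
      show "integrable lborel (\<lambda>y. (LBINT s. \<bar>a s\<bar>) * b y)" by (intro integrable_mult_right b)
      show "AE y in lborel. norm (LBINT s. \<bar>F (s, y)\<bar>) \<le> norm ((LBINT s. \<bar>a s\<bar>) * b y)"
      proof (intro AE_I2)
        fix y
        have "(LBINT s. \<bar>F (s, y)\<bar>) \<le> (LBINT s. \<bar>a s\<bar> * \<bar>b y\<bar>)"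
          unfolding F1 using i a
          by (intro integral_mono integrable_abs integrable_mult_left) (auto simp: abs_mult indicator_def)
        then show "norm (LBINT s. \<bar>F (s, y)\<bar>) \<le> norm ((LBINT s. \<bar>a s\<bar>) * b y)"
          using a by (simp add: abs_mult)
      qed
      have "(\<lambda>y. \<integral> s. \<bar>F (s, y)\<bar> \<partial>lborel) \<in> borel_measurable borel"
        unfolding F_def by measurable
      then show "(\<lambda>y. \<integral> s. \<bar>F (s, y)\<bar> \<partial>lborel) \<in> borel_measurable lborel" by simp
    qed
  qed simp
  note * = integral_lborel_pair[OF this]
  show "(\<integral> y. (LBINT s. indicator {..y} s * a s) * b y \<partial>lborel)
       = (\<integral> s. a s * (LBINT y. indicator {s..} y * b y) \<partial>lborel)"
    using *(1,2) by (simp add: F1[symmetric] F2[symmetric] flip: integral_mult_left_zero integral_mult_right_zero)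
  show "integrable lborel (\<lambda>y. (LBINT s. indicator {..y} s * a s) * b y)"
    using *(6) by (simp add: F1)
  show "integrable lborel (\<lambda>s. a s * (LBINT y. indicator {s..} y * b y))"
    using *(5) by (simp add: F2)
qed

text \<open>The fundamental lemma of the calculus of variations; the bound by one on the test functions is a normalization that makes dominated convergence applicable.\<close>

lemma AE_zero_if_orthogonal_to_continuous:
  fixes H :: "'a::euclidean_space => real"
  assumes H: "integrable lborel H"
    and orth: "\<And>c. continuous_on UNIV c ==> (\<And>x. \<bar>c x\<bar> \<le> 1) ==> (LBINT x. H x * c x) = 0"
  shows "AE x in lborel. H x = 0"
proof -
  have [measurable]: "H \<in> borel_measurable borel" using H by auto
  define s where "s x = sgn (H x)" for x
  have [measurable]: "s \<in> borel_measurable borel"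
    unfolding s_def[abs_def] sgn_real_def by measurable
  have "s measurable_on UNIV"
    by (rule lebesgue_measurable_imp_measurable_on_real) (auto intro: measurable_completion)
  then obtain N g where N: "negligible N" and g: "\<And>n. continuous_on UNIV (g n)"
    and lim: "\<And>x. x \<notin> N ==> (\<lambda>n. g n x) \<longlonglongrightarrow> s x"
    unfolding measurable_on_def by auto
  define c where "c n x = max (-1) (min 1 (g n x))" for n x
  have c: "continuous_on UNIV (c n)" for n
    unfolding c_def[abs_def] by (intro continuous_intros g)
  have [measurable]: "c n \<in> borel_measurable borel" for n
    by (intro borel_measurable_continuous_onI c)
  have b: "\<bar>c n x\<bar> \<le> 1" for n x by (auto simp: c_def)
  have clim: "(\<lambda>n. c n x) \<longlonglongrightarrow> s x" if "x \<notin> N" for x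
  proof -
    have "(\<lambda>n. c n x) \<longlonglongrightarrow> max (-1) (min 1 (s x))"
      unfolding c_def by (intro tendsto_intros lim that)
    moreover have "max (-1) (min 1 (s x)) = s x" by (auto simp: s_def sgn_if)
    ultimately show ?thesis by simp
  qed
  have "AE x in lebesgue. x \<notin> N" using N by (auto simp: negligible_iff_null_sets intro: AE_not_in)
  then have AEN: "AE x in lborel. x \<notin> N" by (simp add: AE_completion_iff)
  have "(\<lambda>n. \<integral> x. H x * c n x \<partial>lborel) \<longlonglongrightarrow> (LBINT x. H x * s x)"
  proof (rule integral_dominated_convergence)
    show "integrable lborel (\<lambda>x. \<bar>H x\<bar>)" using H by simp
    show "AE x in lborel. (\<lambda>n. H x * c n x) \<longlonglongrightarrow> H x * s x"
      using AEN by eventually_elim (intro tendsto_intros clim)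
    show "AE x in lborel. norm (H x * c n x) \<le> \<bar>H x\<bar>" for n
      using b by (auto simp: abs_mult intro!: mult_right_le_one_le)
  qed auto
  then have "(LBINT x. H x * s x) = 0"
    using orth[OF c b] by (simp add: LIMSEQ_const_iff)
  moreover have "H x * s x = \<bar>H x\<bar>" for x by (simp add: s_def abs_sgn)
  ultimately have "(LBINT x. \<bar>H x\<bar>) = 0" by simp
  then have "AE x in lborel. \<bar>H x\<bar> = 0"
    using H by (subst (asm) integral_nonneg_eq_0_iff_AE) auto
  then show ?thesis by simp
qed

section \<open>The weight, the half cylinder and the solution\<close>

text \<open>The weight as a Borel function on the line that is \<open>0\<close> off \<open>(0, \<tau>)\<close>, with a unit basis vector \<open>e\<close> normal to the flat part. Of the Muckenhoupt condition only the integrability of the weight and of its reciprocal enters the local theory; the product of the two integrals enters the final constant.\<close>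

locale half_cylinder_weight =
  fixes e :: "'a::euclidean_space" and \<tau> :: real and m :: "real => real"
  assumes e_Basis: "e \<in> Basis" and tau_pos: "0 < \<tau>"
    and m_borel [measurable]: "m \<in> borel_measurable borel"
    and m_nonneg: "\<And>y. 0 \<le> m y"
    and m_zero: "\<And>y. y \<notin> {0<..<\<tau>} ==> m y = 0"
    and m_pos: "AE y in lborel. y \<in> {0<..<\<tau>} --> 0 < m y"
    and m_int: "integrable lborel m"
    and minv_int: "integrable lborel (\<lambda>y. inverse (m y))"
begin

definition D :: "'a set" where "D = {z. norm z < \<tau> \<and> 0 < z \<bullet> e}"

definition Om :: "('a \<times> real) set" where "Om = D \<times> {0<..<\<tau>}"

lemma D_sets [measurable]: "D \<in> sets borel"
  unfolding D_def by measurable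

lemma Om_sets [measurable]: "Om \<in> sets borel"
  unfolding Om_def borel_prod[symmetric] by measurable

lemma D_finite: "emeasure lborel D < \<infinity>"
  by (rule le_less_trans[OF emeasure_mono emeasure_lborel_cball_finite[of 0 \<tau>]]) (auto simp: D_def)

lemma D_bounded: "z \<in> D ==> z \<in> cball 0 \<tau>" by (simp add: D_def)

text \<open>Weighted square integrability on the half cylinder, for functions extended by \<open>0\<close>. Every horizontal section is required to be integrable, which can be arranged by changing the function on a null set and removes exceptional sets in \<open>y\<close> later.\<close>

definition wL2 :: "('a \<times> real => real) => bool" where
  "wL2 F \<longleftrightarrow> F \<in> borel_measurable borel \<and> (\<forall>X. X \<notin> Om --> F X = 0) \<and>
     integrable lborel (\<lambda>X. (F X)\<^sup>2 * m (snd X)) \<and> (\<forall>y. integrable lborel (\<lambda>z. F (z, y)))"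

lemma wL2D:
  assumes "wL2 F"
  shows wL2_borel: "F \<in> borel_measurable borel" and wL2_off: "X \<notin> Om ==> F X = 0"
    and wL2_square: "integrable lborel (\<lambda>X. (F X)\<^sup>2 * m (snd X))"
    and wL2_section: "integrable lborel (\<lambda>z. F (z, y))"
  using assms unfolding wL2_def by blast+

definition energy :: "('a \<times> real => real) => real" where
  "energy F = (LBINT X. (F X)\<^sup>2 * m (snd X))"

definition mass :: "('a \<times> real => real) => real => real" where
  "mass F y = (LBINT z. \<bar>F (z, y)\<bar>)"

lemma mass_nonneg: "0 \<le> mass F y" by (simp add: mass_def)

lemma mass_borel: "wL2 F ==> mass F \<in> borel_measurable borel"
proof -
  assume "wL2 F"
  then have [measurable]: "F \<in> borel_measurable borel" by (rule wL2_borel)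
  show ?thesis unfolding mass_def[abs_def] by measurable
qed

lemma mass_zero: "wL2 F ==> y \<notin> {0<..<\<tau>} ==> mass F y = 0"
  by (simp add: mass_def wL2_off Om_def)

text \<open>Cauchy--Schwarz on each section, whose domain \<open>D\<close> has finite measure.\<close>

lemma mass_square_integrable:
  assumes F: "wL2 F"
  shows "integrable lborel (\<lambda>y. (mass F y)\<^sup>2 * m y)"
proof (rule Bochner_Integration.integrable_bound)
  note [measurable] = wL2_borel[OF F] mass_borel[OF F]
  have *: "integrable lborel (\<lambda>y. \<integral> z. (F (z, y))\<^sup>2 * m y \<partial>lborel)"
    "AE y in lborel. integrable lborel (\<lambda>z. (F (z, y))\<^sup>2 * m y)"
    using integral_lborel_pair(4,6)[OF wL2_square[OF F]] by simp_all
  show "integrable lborel (\<lambda>y. measure lborel D * (LBINT z. (F (z, y))\<^sup>2 * m y))"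
    using * by simp
  show "AE y in lborel. norm ((mass F y)\<^sup>2 * m y) \<le> norm (measure lborel D * (LBINT z. (F (z, y))\<^sup>2 * m y))"
    using *(2)
  proof eventually_elim
    case (elim y)
    show ?case
    proof (cases "m y = 0")
      case False
      then have y: "y \<in> {0<..<\<tau>}" using m_zero by blast
      have i: "integrable lborel (\<lambda>z. (F (z, y))\<^sup>2)" using elim False by simp
      have e: "(F (z, y))\<^sup>2 = (F (z, y))\<^sup>2 * indicator D z" "\<bar>F (z, y)\<bar> = \<bar>F (z, y)\<bar> * indicator D z" for z
        using wL2_off[OF F, of "(z, y)"] by (auto simp: Om_def indicator_def)
      have "(LBINT z. \<bar>F (z, y)\<bar> * indicator D z)\<^sup>2 \<le> (LBINT z. (F (z, y))\<^sup>2 * indicator D z) * (LBINT z. indicator D z)"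
        using i D_finite by (intro Cauchy_Schwarz_integral(2)) (auto simp: e(1)[symmetric])
      then have "(mass F y)\<^sup>2 \<le> measure lborel D * (LBINT z. (F (z, y))\<^sup>2)"
        unfolding e(1)[symmetric] e(2)[symmetric] by (simp add: mass_def mult.commute)
      then have "(mass F y)\<^sup>2 * m y \<le> measure lborel D * (LBINT z. (F (z, y))\<^sup>2) * m y"
        by (intro mult_right_mono m_nonneg)
      then show ?thesis using m_nonneg[of y] by (simp add: abs_mult mult.assoc)
    qed simp
  qed
qed (use mass_borel[OF F] in measurable)

lemma AE_m_inverse: "AE y in lborel. y \<in> {0<..<\<tau>} --> m y * inverse (m y) = 1"
  using m_pos by eventually_elim auto

lemma mass_integrable:
  assumes F: "wL2 F"
  shows "integrable lborel (mass F)" and "integrable lborel (\<lambda>y. mass F y * m y)"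
proof -
  note [measurable] = mass_borel[OF F]
  have "integrable lborel (\<lambda>y. (mass F y * m y) * inverse (m y))"
  proof (rule Cauchy_Schwarz_integral(1))
    have "(mass F y * m y)\<^sup>2 * inverse (m y) = (mass F y)\<^sup>2 * m y" for y
      by (cases "m y = 0") (auto simp: power2_eq_square)
    then show "integrable lborel (\<lambda>y. (mass F y * m y)\<^sup>2 * inverse (m y))"
      using mass_square_integrable[OF F] by simp
  qed (use m_nonneg minv_int in auto)
  moreover have "AE y in lborel. (mass F y * m y) * inverse (m y) = mass F y"
    using AE_m_inverse
  proof eventually_elim
    case (elim y)
    then show ?case by (cases "y \<in> {0<..<\<tau>}") (auto simp: mass_zero[OF F])
  qed
  ultimately show "integrable lborel (mass F)"
    using integrable_cong_AE_imp[of lborel "\<lambda>y. (mass F y * m y) * inverse (m y)" "mass F"] by simp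
  show "integrable lborel (\<lambda>y. mass F y * m y)"
    by (rule Cauchy_Schwarz_integral(1)) (use mass_square_integrable[OF F] m_nonneg m_int in auto)
qed

lemma wL2_integrable:
  assumes F: "wL2 F"
  shows "integrable lborel F"
  using wL2_borel[OF F] wL2_section[OF F] mass_integrable(1)[OF F, unfolded mass_def[abs_def]]
  by (rule integrable_lborel_pairI)

lemma wL2_m_integrable:
  assumes F: "wL2 F"
  shows "integrable lborel (\<lambda>X. F X * m (snd X))"
proof (rule integrable_lborel_pairI)
  note [measurable] = wL2_borel[OF F]
  show "(\<lambda>X. F X * m (snd X)) \<in> borel_measurable borel" by measurable
  show "integrable lborel (\<lambda>z. F (z, y) * m (snd (z, y)))" for y
    using wL2_section[OF F] by simp
  have "(LBINT z. \<bar>F (z, y) * m (snd (z, y))\<bar>) = mass F y * m y" for y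
    using m_nonneg[of y] by (simp add: abs_mult mass_def)
  then show "integrable lborel (\<lambda>y. \<integral> z. \<bar>F (z, y) * m (snd (z, y))\<bar> \<partial>lborel)"
    using mass_integrable(2)[OF F] by simp
qed

text \<open>Cauchy--Schwarz against \<open>1 / m\<close>: this is how integrability of the reciprocal weight makes weighted \<open>L\<^sup>2\<close> limits meaningful without the weight.\<close>

lemma L1_convergence_if_weighted_L2:
  fixes U :: "nat => 'a \<times> real => real"
  assumes [measurable]: "\<And>j. U j \<in> borel_measurable borel"
    and lim: "(\<lambda>j. \<integral>\<^sup>+ X\<in>Om. ennreal ((U j X)\<^sup>2 * m (snd X)) \<partial>lborel) \<longlonglongrightarrow> 0"
  shows "(\<lambda>j. \<integral>\<^sup>+ X\<in>Om. ennreal \<bar>U j X\<bar> \<partial>lborel) \<longlonglongrightarrow> 0"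
proof -
  define Q where "Q = (\<integral>\<^sup>+ X. ennreal (inverse (m (snd X)) * indicator Om X) \<partial>(lborel :: ('a \<times> real) measure))"
  have "Q = (\<integral>\<^sup>+ y. \<integral>\<^sup>+ z. ennreal (inverse (m y) * indicator Om (z :: 'a, y)) \<partial>lborel \<partial>lborel)"
    unfolding Q_def by (subst nn_integral_lborel_pair(2)) auto
  also have "\<dots> \<le> (\<integral>\<^sup>+ y. \<integral>\<^sup>+ z. ennreal (inverse (m y)) * indicator D z \<partial>lborel \<partial>lborel)"
    using m_nonneg by (intro nn_integral_mono) (auto simp: Om_def indicator_def)
  also have "\<dots> = (\<integral>\<^sup>+ y. ennreal (inverse (m y)) * emeasure lborel D \<partial>lborel)"
    by (simp add: nn_integral_cmult)
  also have "\<dots> = ennreal (LBINT y. inverse (m y)) * emeasure lborel D"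
    using minv_int m_nonneg by (simp add: nn_integral_multc nn_integral_eq_integral)
  also have "\<dots> < \<infinity>"
    using D_finite by (simp add: ennreal_mult_less_top)
  finally have Q: "Q < \<infinity>" .
  define a where "a j = (\<integral>\<^sup>+ X\<in>Om. ennreal \<bar>U j X\<bar> \<partial>lborel)" for j
  define b where "b j = (\<integral>\<^sup>+ X\<in>Om. ennreal ((U j X)\<^sup>2 * m (snd X)) \<partial>lborel)" for j
  have m_AE: "AE X in lborel. X \<in> Om --> m (snd X) * inverse (m (snd X)) = 1"
  proof (subst AE_lborel_pair(2))
    show "AE y in lborel. AE z in lborel. (z, y) \<in> Om --> m (snd (z, y)) * inverse (m (snd (z, y))) = 1"
      using AE_m_inverse by eventually_elim (auto simp: Om_def)
  qed measurable
  have ab: "(a j)\<^sup>2 \<le> b j * Q" for j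
  proof -
    have "a j = (\<integral>\<^sup>+ X. ennreal (\<bar>U j X * m (snd X)\<bar> * (inverse (m (snd X)) * indicator Om X)) \<partial>lborel)"
      unfolding a_def
    proof (rule nn_integral_cong_AE, use m_AE in eventually_elim)
      case (elim X)
      then show ?case using m_nonneg[of "snd X"] by (auto simp: indicator_def abs_mult mult.assoc)
    qed
    also have "\<dots>\<^sup>2 \<le> (\<integral>\<^sup>+ X. ennreal ((U j X * m (snd X))\<^sup>2 * (inverse (m (snd X)) * indicator Om X)) \<partial>lborel) * Q"
      unfolding Q_def using m_nonneg by (intro weighted_Cauchy_Schwarz) auto
    also have "(\<integral>\<^sup>+ X. ennreal ((U j X * m (snd X))\<^sup>2 * (inverse (m (snd X)) * indicator Om X)) \<partial>lborel) = b j"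
      unfolding b_def
    proof (intro nn_integral_cong)
      fix X show "ennreal ((U j X * m (snd X))\<^sup>2 * (inverse (m (snd X)) * indicator Om X)) = ennreal ((U j X)\<^sup>2 * m (snd X)) * indicator Om X"
        by (cases "m (snd X) = 0") (auto simp: indicator_def power2_eq_square field_simps)
    qed
    finally show ?thesis .
  qed
  have bQ: "(\<lambda>j. b j * Q) \<longlonglongrightarrow> 0"
  proof -
    have "b \<longlonglongrightarrow> 0" using lim by (simp add: b_def[abs_def])
    from tendsto_mult_ennreal[OF this tendsto_const[of Q]] Q show ?thesis by simp
  qed
  show ?thesis unfolding a_def[symmetric]
  proof (rule order_tendstoI)
    fix \<epsilon> :: ennreal assume "0 < \<epsilon>"
    then have "\<forall>\<^sub>F j in sequentially. b j * Q < \<epsilon>\<^sup>2"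
      by (intro order_tendstoD(2)[OF bQ]) (simp add: power2_eq_square ennreal_zero_less_mult_iff)
    then show "\<forall>\<^sub>F j in sequentially. a j < \<epsilon>"
    proof eventually_elim
      case (elim j)
      show ?case
      proof (rule ccontr)
        assume "\<not> a j < \<epsilon>"
        then have "\<epsilon>\<^sup>2 \<le> (a j)\<^sup>2" by (intro power_mono) auto
        with ab[of j] elim show False by (meson leD order.strict_trans1 order_trans)
      qed
    qed
  qed simp
qed

end

text \<open>A weak solution in a form adapted to the proof: \<open>g\<close> and \<open>h\<close> are the horizontal and vertical parts of the weak gradient of \<open>v\<close>, and \<open>\<phi> j\<close> are the smooth approximants that vanish on the flat part. The equation is required only for products \<open>\<eta>(x) \<zeta>(y)\<close> with \<open>\<zeta>\<close> a polynomial. No condition is put on \<open>\<zeta> 0\<close>, which encodes the conormal condition on the bottom face.\<close>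

locale mixed_solution = half_cylinder_weight e \<tau> m
  for e :: "'a::euclidean_space" and \<tau> m +
  fixes v h :: "'a \<times> real => real" and g :: "'a \<times> real => 'a"
    and \<phi> :: "nat => 'a \<times> real => real" and B :: "'a => 'a" and \<Lambda> :: real
  assumes B_lin: "linear B" and B_sym: "\<And>a b. B a \<bullet> b = a \<bullet> B b"
    and Lam: "1 \<le> \<Lambda>"
    and B_lower: "\<And>\<xi>. inverse \<Lambda> * (norm \<xi>)\<^sup>2 \<le> B \<xi> \<bullet> \<xi>"
    and B_upper: "\<And>\<xi>. B \<xi> \<bullet> \<xi> \<le> \<Lambda> * (norm \<xi>)\<^sup>2"
    and v_L2: "wL2 v" and h_L2: "wL2 h" and g_L2: "\<And>i. i \<in> Basis ==> wL2 (\<lambda>X. g X \<bullet> i)"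
    and phi_smooth: "\<And>j. smooth (\<phi> j)"
    and phi_flat: "\<And>j z y. norm z < \<tau> ==> z \<bullet> e = 0 ==> y \<in> {0<..<\<tau>} ==> \<phi> j (z, y) = 0"
    and conv_v: "(\<lambda>j. \<integral>\<^sup>+ X\<in>Om. ennreal ((v X - \<phi> j X)\<^sup>2 * m (snd X)) \<partial>lborel) \<longlonglongrightarrow> 0"
    and conv_g: "\<And>i. i \<in> Basis ==>
      (\<lambda>j. \<integral>\<^sup>+ X\<in>Om. ennreal ((g X \<bullet> i - pd (i, 0) (\<phi> j) X)\<^sup>2 * m (snd X)) \<partial>lborel) \<longlonglongrightarrow> 0"
    and conv_h: "(\<lambda>j. \<integral>\<^sup>+ X\<in>Om. ennreal ((h X - pd (0, 1) (\<phi> j) X)\<^sup>2 * m (snd X)) \<partial>lborel) \<longlonglongrightarrow> 0"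
    and weak: "\<And>\<eta> \<zeta> \<zeta>'. smooth \<eta> ==> (\<And>z. z \<bullet> e = 0 ==> \<eta> z = 0) ==>
      (\<And>z. z \<bullet> e \<ge> 0 ==> norm z \<ge> \<tau> ==> \<eta> z = 0) ==> real_polynomial_function \<zeta> ==>
      (\<And>t. (\<zeta> has_real_derivative \<zeta>' t) (at t)) ==> \<zeta> \<tau> = 0 ==>
      (\<integral> X. m (snd X) * ((\<Sum>i\<in>Basis. (B (g X) \<bullet> i) * pd i \<eta> (fst X)) * \<zeta> (snd X)
          + h X * \<eta> (fst X) * \<zeta>' (snd X)) \<partial>lborel) = 0"
begin

lemmas [measurable] = wL2_borel[OF v_L2] wL2_borel[OF h_L2]

lemma phi_borel [measurable]:
  "\<phi> j \<in> borel_measurable borel" "pd (0, 1) (\<phi> j) \<in> borel_measurable borel"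
  "i \<in> Basis ==> pd (i, 0) (\<phi> j) \<in> borel_measurable borel"
  using phi_smooth[of j] by (auto intro!: smooth_borel smooth_pd simp: Basis_prod_def)

lemma L1_v: "(\<lambda>j. \<integral>\<^sup>+ X\<in>Om. ennreal \<bar>v X - \<phi> j X\<bar> \<partial>lborel) \<longlonglongrightarrow> 0"
  by (rule L1_convergence_if_weighted_L2[OF _ conv_v]) measurable

lemma L1_h: "(\<lambda>j. \<integral>\<^sup>+ X\<in>Om. ennreal \<bar>h X - pd (0, 1) (\<phi> j) X\<bar> \<partial>lborel) \<longlonglongrightarrow> 0"
  by (rule L1_convergence_if_weighted_L2[OF _ conv_h]) measurable

lemma L1_g:
  assumes i: "i \<in> Basis"
  shows "(\<lambda>j. \<integral>\<^sup>+ X\<in>Om. ennreal \<bar>g X \<bullet> i - pd (i, 0) (\<phi> j) X\<bar> \<partial>lborel) \<longlonglongrightarrow> 0"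
proof -
  note [measurable] = wL2_borel[OF g_L2[OF i]] phi_borel(3)[OF i]
  show ?thesis by (rule L1_convergence_if_weighted_L2[OF _ conv_g[OF i]]) measurable
qed


text \<open>A cutoff in the vertical variable from above only: it need not vanish at \<open>y = 0\<close>, because the conormal condition removes the boundary term there.\<close>

definition ycut :: "real => real => real" where "ycut S y = (max 0 (S - y))\<^sup>2"
definition ycut' :: "real => real => real" where "ycut' S y = - 2 * max 0 (S - y)"

lemma ycut_derivative: "(ycut S has_real_derivative ycut' S y) (at y)"
proof (cases y S rule: linorder_cases)
  case less
  have "((\<lambda>y. (S - y)\<^sup>2) has_real_derivative ycut' S y) (at y)"
    using less by (auto intro!: derivative_eq_intros simp: ycut'_def)
  moreover have "\<forall>\<^sub>F s in nhds y. ycut S s = (S - s)\<^sup>2"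
    using eventually_nhds_in_open[of "{..<S}" y] less by (auto elim!: eventually_mono simp: ycut_def)
  ultimately show ?thesis by (subst DERIV_cong_ev[OF refl _ refl])
next
  case greater
  have "((\<lambda>y. 0) has_real_derivative ycut' S y) (at y)" using greater by (simp add: ycut'_def)
  moreover have "\<forall>\<^sub>F s in nhds y. ycut S s = 0"
    using eventually_nhds_in_open[of "{S<..}" y] greater by (auto elim!: eventually_mono simp: ycut_def)
  ultimately show ?thesis by (subst DERIV_cong_ev[OF refl _ refl])
next
  case equal
  have "((\<lambda>s. (ycut S s - ycut S y) / (s - y)) \<longlongrightarrow> 0) (at y)"
  proof (rule Lim_null_comparison)
    show "\<forall>\<^sub>F s in at y. norm ((ycut S s - ycut S y) / (s - y)) \<le> \<bar>s - y\<bar>"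
      using equal by (intro always_eventually) (auto simp: ycut_def max_def power2_eq_square abs_mult)
    show "((\<lambda>s. \<bar>s - y\<bar>) \<longlongrightarrow> 0) (at y)" by (auto intro!: tendsto_eq_intros)
  qed
  then show ?thesis using equal by (simp add: has_field_derivative_iff ycut'_def)
qed

lemma ycut_continuous: "continuous_on A (ycut S)" "continuous_on A (ycut' S)"
  unfolding ycut_def[abs_def] ycut'_def[abs_def] by (intro continuous_intros)+

lemma ycut_borel [measurable]: "ycut S \<in> borel_measurable borel" "ycut' S \<in> borel_measurable borel"
  by (intro borel_measurable_continuous_onI ycut_continuous)+

lemma ycut_bounds:
  assumes "0 \<le> y" "S \<le> \<tau>"
  shows "\<bar>ycut S y\<bar> \<le> \<tau>\<^sup>2" "\<bar>ycut' S y\<bar> \<le> 2 * \<tau>"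
proof -
  have "max 0 (S - y) \<le> \<tau>" using assms tau_pos by auto
  then show "\<bar>ycut S y\<bar> \<le> \<tau>\<^sup>2" "\<bar>ycut' S y\<bar> \<le> 2 * \<tau>"
    using power_mono[of "max 0 (S - y)" \<tau> 2] by (auto simp: ycut_def ycut'_def)
qed

end

section \<open>Absolute continuity of sections\<close>

lemma zero_if_le_null_sequences:
  fixes x :: ennreal
  assumes a: "a \<longlonglongrightarrow> 0" and b: "b \<longlonglongrightarrow> 0" and "c1 < \<infinity>" "c2 < \<infinity>"
    and le: "\<And>j::nat. x \<le> c1 * a j + c2 * b j"
  shows "x = 0"
proof -
  have "(\<lambda>j. c1 * a j + c2 * b j) \<longlonglongrightarrow> c1 * 0 + c2 * 0"
    using assms by (intro tendsto_add tendsto_mult_ennreal tendsto_const) auto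
  then have "x \<le> c1 * 0 + c2 * 0" by (rule LIMSEQ_le_const) (use le in auto)
  then show ?thesis by simp
qed

lemma pd_zero_on_open:
  assumes "open U" "x \<in> U" "\<And>y. y \<in> U ==> f y = 0"
  shows "pd i f x = 0"
proof -
  have "((\<lambda>_. 0) has_derivative (\<lambda>_. 0)) (at x)" by simp
  then have "(f has_derivative (\<lambda>_. 0)) (at x)"
    by (rule has_derivative_transform_within_open) (use assms in auto)
  from pd_eqI[OF this] show ?thesis by simp
qed

context half_cylinder_weight
begin

text \<open>The section of \<open>F\<close> at height \<open>y\<close>, tested against a function of the horizontal variable.\<close>

definition sect :: "('a \<times> real => real) => ('a => real) => real => real" where
  "sect F \<eta> y = (LBINT z. F (z, y) * \<eta> z)"

lemma sect_borel [measurable]: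
  assumes "wL2 F" and [measurable]: "\<eta> \<in> borel_measurable borel"
  shows "sect F \<eta> \<in> borel_measurable borel"
proof -
  note [measurable] = wL2_borel[OF assms(1)]
  show ?thesis unfolding sect_def[abs_def] by measurable
qed

lemma sect_integrand:
  assumes F: "wL2 F" and [measurable]: "\<eta> \<in> borel_measurable borel"
    and c: "\<And>z. z \<in> D ==> \<bar>\<eta> z\<bar> \<le> c"
  shows "integrable lborel (\<lambda>z. F (z, y) * \<eta> z)" and "\<bar>sect F \<eta> y\<bar> \<le> c * mass F y"
    and "integrable lborel (\<lambda>X. F X * \<eta> (fst X))"
proof -
  note [measurable] = wL2_borel[OF F]
  have b: "\<bar>F X * \<eta> (fst X)\<bar> \<le> c * \<bar>F X\<bar>" for X
    using c[of "fst X"] wL2_off[OF F, of X] mult_right_mono[of "\<bar>\<eta> (fst X)\<bar>" c "\<bar>F X\<bar>"]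
    by (cases "X \<in> Om") (auto simp: Om_def abs_mult mult.commute)
  have nb: "\<bar>F X * \<eta> (fst X)\<bar> \<le> \<bar>c * F X\<bar>" for X
    using b[of X] mult_right_mono[OF abs_ge_self[of c], of "\<bar>F X\<bar>"] by (auto simp: abs_mult)
  show i: "integrable lborel (\<lambda>z. F (z, y) * \<eta> z)"
    by (rule Bochner_Integration.integrable_bound[OF integrable_mult_right[OF wL2_section[OF F], of c]])
       (use nb[of "(_, y)"] in auto)
  show "integrable lborel (\<lambda>X. F X * \<eta> (fst X))"
    by (rule Bochner_Integration.integrable_bound[OF integrable_mult_right[OF wL2_integrable[OF F], of c]])
       (use nb in auto)
  have "\<bar>sect F \<eta> y\<bar> \<le> (LBINT z. \<bar>F (z, y) * \<eta> z\<bar>)"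
    unfolding sect_def by (rule integral_abs_bound)
  also have "\<dots> \<le> (LBINT z. c * \<bar>F (z, y)\<bar>)"
    using b[of "(_, y)"] i wL2_section[OF F] by (intro integral_mono) auto
  finally show "\<bar>sect F \<eta> y\<bar> \<le> c * mass F y" by (simp add: mass_def)
qed

lemma sect_zero: "wL2 F ==> y \<notin> {0<..<\<tau>} ==> sect F \<eta> y = 0"
  by (simp add: sect_def wL2_off Om_def)

lemma sect_integrable:
  assumes F: "wL2 F" and [measurable]: "\<eta> \<in> borel_measurable borel"
    and c: "\<And>z. z \<in> D ==> \<bar>\<eta> z\<bar> \<le> c"
  shows "integrable lborel (sect F \<eta>)" and "integrable lborel (\<lambda>y. sect F \<eta> y * m y)"
    and "integrable lborel (\<lambda>y. (sect F \<eta> y)\<^sup>2 * m y)"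
proof -
  note [measurable] = sect_borel[OF F] mass_borel[OF F]
  have b: "\<bar>sect F \<eta> y\<bar> \<le> \<bar>c\<bar> * mass F y" for y
    using sect_integrand(2)[OF assms, of y] mult_right_mono[OF abs_ge_self[of c] mass_nonneg[of F y]] by simp
  show "integrable lborel (sect F \<eta>)"
    by (rule Bochner_Integration.integrable_bound[OF integrable_mult_right[OF mass_integrable(1)[OF F], of "\<bar>c\<bar>"]])
       (use b mass_nonneg in \<open>auto simp: abs_mult\<close>)
  show "integrable lborel (\<lambda>y. sect F \<eta> y * m y)"
    by (rule Bochner_Integration.integrable_bound[OF integrable_mult_right[OF mass_integrable(2)[OF F], of "\<bar>c\<bar>"]])
       (use mult_right_mono[OF b m_nonneg] mass_nonneg m_nonneg in \<open>auto simp: abs_mult mult.assoc\<close>)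
  show "integrable lborel (\<lambda>y. (sect F \<eta> y)\<^sup>2 * m y)"
  proof (rule Bochner_Integration.integrable_bound[OF integrable_mult_right[OF mass_square_integrable[OF F], of "c\<^sup>2"]])
    have "(sect F \<eta> y)\<^sup>2 * m y \<le> c\<^sup>2 * ((mass F y)\<^sup>2 * m y)" for y
    proof -
      have "(sect F \<eta> y)\<^sup>2 \<le> (\<bar>c\<bar> * mass F y)\<^sup>2"
        using b[of y] by (metis abs_ge_zero power2_abs power_mono)
      then show ?thesis using mult_right_mono[OF _ m_nonneg] by (simp add: power_mult_distrib mult.assoc[symmetric])
    qed
    then show "AE y in lborel. norm ((sect F \<eta> y)\<^sup>2 * m y) \<le> norm (c\<^sup>2 * ((mass F y)\<^sup>2 * m y))"
      using m_nonneg by (auto simp: abs_mult)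
  qed simp
qed

end

context mixed_solution
begin

text \<open>The identity is the fundamental theorem of calculus for the smooth approximants; \<open>L\<^sup>1\<close> convergence of the functions and of their vertical derivatives passes it to the limit.\<close>

lemma v_absolutely_continuous:
  assumes S: "S \<le> \<tau>"
  shows "AE y in lborel. AE z in lborel. (z, y) \<in> Om -->
    ycut S y * v (z, y) = - (LBINT s. indicator {y..} s * (ycut' S s * v (z, s) + ycut S s * h (z, s)))"
proof -
  define P where "P X = ycut S (snd X) * v X + (\<integral> s. indicator {snd X..} s *
      (ycut' S s * v (fst X, s) + ycut S s * h (fst X, s)) \<partial>lborel)" for X
  have ind: "(\<lambda>p::('a \<times> real) \<times> real. indicator {snd (fst p)..} (snd p) :: real) = (\<lambda>p. if snd (fst p) \<le> snd p then 1 else 0)"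
    by (auto simp: fun_eq_iff indicator_def)
  have [measurable]: "P \<in> borel_measurable borel"
  proof -
    have "(\<lambda>X::'a \<times> real. \<integral> s. (if snd X \<le> s then 1 else 0) * (ycut' S s * v (fst X, s) + ycut S s * h (fst X, s)) \<partial>lborel) \<in> borel_measurable borel"
      by measurable
    moreover have "(\<lambda>X::'a \<times> real. \<integral> s. (if snd X \<le> s then 1 else 0) * (ycut' S s * v (fst X, s) + ycut S s * h (fst X, s)) \<partial>lborel)
      = (\<lambda>X. \<integral> s. indicator {snd X..} s * (ycut' S s * v (fst X, s) + ycut S s * h (fst X, s)) \<partial>lborel)"
      by (intro ext Bochner_Integration.integral_cong) (auto simp: indicator_def)
    ultimately show ?thesis unfolding P_def[abs_def] by simp
  qed
  define u where "u j X = \<bar>v X - \<phi> j X\<bar>" for j X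
  define w where "w j X = \<bar>h X - pd (0, 1) (\<phi> j) X\<bar>" for j X
  have [measurable]: "u j \<in> borel_measurable borel" "w j \<in> borel_measurable borel" for j
    unfolding u_def[abs_def] w_def[abs_def] by measurable
  define T where "T j X = 2 * \<tau> * u j X + \<tau>\<^sup>2 * w j X" for j X
  have [measurable]: "T j \<in> borel_measurable borel" for j unfolding T_def[abs_def] by measurable
  have key: "ennreal \<bar>P (z, y)\<bar> \<le> ennreal (\<tau>\<^sup>2 * u j (z, y)) + (\<integral>\<^sup>+ s\<in>{0<..<\<tau>}. ennreal (T j (z, s)) \<partial>lborel)"
    if int: "integrable lborel (\<lambda>s. v (z, s))" "integrable lborel (\<lambda>s. h (z, s))" and z: "z \<in> D" and y: "0 < y" "y < \<tau>" for z y j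
  proof -
    let ?\<phi> = "\<lambda>s. \<phi> j (z, s)" and ?\<phi>' = "\<lambda>s. pd (0, 1) (\<phi> j) (z, s)"
    have d: "(?\<phi> has_real_derivative ?\<phi>' s) (at s)" for s
      using smooth_has_real_derivative_line[OF phi_smooth, of j "(z, 0)" "(0, 1)" s] by simp
    have c\<phi>: "continuous_on A ?\<phi>" "continuous_on A ?\<phi>'" for A
      using smooth_continuous[OF phi_smooth, of UNIV j] smooth_continuous[OF smooth_pd[OF phi_smooth], of "(0,1)" UNIV j]
      by (auto intro!: continuous_on_compose2[of UNIV _ A "\<lambda>s. (z, s)"] continuous_intros simp: Basis_prod_def)
    let ?G = "\<lambda>s. ycut' S s * ?\<phi> s + ycut S s * ?\<phi>' s"
    have cG: "continuous_on A ?G" for A by (intro continuous_intros ycut_continuous c\<phi>)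
    have "(LBINT s. indicator {y..\<tau>} s *\<^sub>R ?G s) = ycut S \<tau> * ?\<phi> \<tau> - ycut S y * ?\<phi> y"
    proof (rule integral_FTC_atLeastAtMost)
      show "((\<lambda>s. ycut S s * ?\<phi> s) has_vector_derivative ?G s) (at s within {y..\<tau>})" for s
        unfolding has_real_derivative_iff_has_vector_derivative[symmetric]
        by (rule has_field_derivative_at_within) (auto intro!: derivative_eq_intros ycut_derivative d)
    qed (use y cG in auto)
    moreover have "ycut S \<tau> = 0" using S by (simp add: ycut_def)
    ultimately have FTC: "ycut S y * ?\<phi> y = - (LBINT s. indicator {y..\<tau>} s * ?G s)" by simp
    have iG: "integrable lborel (\<lambda>s. indicator {y..\<tau>} s * ?G s)"
      using borel_integrable_atLeastAtMost'[OF cG, of y \<tau>] by (simp add: set_integrable_def)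
    let ?H = "\<lambda>s. ycut' S s * v (z, s) + ycut S s * h (z, s)"
    have H0: "?H s = 0" if "s \<notin> {0<..<\<tau>}" for s
      using that by (simp add: wL2_off[OF v_L2] wL2_off[OF h_L2] Om_def)
    have b0: "\<bar>ycut S s\<bar> \<le> \<tau>\<^sup>2" "\<bar>ycut' S s\<bar> \<le> 2 * \<tau>" if "0 < s" for s
      using ycut_bounds[of s S] that S by auto
    have v0: "v (z, s) = 0" "h (z, s) = 0" if "s \<notin> {0<..<\<tau>}" for s
      using that by (simp_all add: wL2_off[OF v_L2] wL2_off[OF h_L2] Om_def)
    have iH: "integrable lborel ?H"
    proof (rule Bochner_Integration.integrable_bound)
      show "integrable lborel (\<lambda>s. 2 * \<tau> * \<bar>v (z, s)\<bar> + \<tau>\<^sup>2 * \<bar>h (z, s)\<bar>)" using int by simp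
      have "\<bar>?H s\<bar> \<le> 2 * \<tau> * \<bar>v (z, s)\<bar> + \<tau>\<^sup>2 * \<bar>h (z, s)\<bar>" for s
      proof (cases "s \<in> {0<..<\<tau>}")
        case True
        then have "\<bar>ycut' S s\<bar> * \<bar>v (z, s)\<bar> \<le> 2 * \<tau> * \<bar>v (z, s)\<bar>" "\<bar>ycut S s\<bar> * \<bar>h (z, s)\<bar> \<le> \<tau>\<^sup>2 * \<bar>h (z, s)\<bar>"
          by (auto intro!: mult_right_mono b0)
        then show ?thesis using abs_triangle_ineq[of "ycut' S s * v (z, s)" "ycut S s * h (z, s)"] by (simp add: abs_mult)
      qed (simp add: v0)
      then show "AE s in lborel. norm (?H s) \<le> norm (2 * \<tau> * \<bar>v (z, s)\<bar> + \<tau>\<^sup>2 * \<bar>h (z, s)\<bar>)"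
        using tau_pos by auto
    qed measurable
    have iH': "integrable lborel (\<lambda>s. indicator {y..\<tau>} s * ?H s)"
      using integrable_mult_indicator[OF _ iH, of "{y..\<tau>}"] by simp
    have "(LBINT s. indicator {y..} s * ?H s) = (LBINT s. indicator {y..\<tau>} s * ?H s)"
      using H0 by (intro Bochner_Integration.integral_cong) (auto simp: indicator_def)
    then have "P (z, y) = ycut S y * (v (z, y) - ?\<phi> y) + (LBINT s. indicator {y..\<tau>} s * (?H s - ?G s))"
      using FTC Bochner_Integration.integral_diff[OF iH' iG] by (simp add: P_def algebra_simps)
    then have "\<bar>P (z, y)\<bar> \<le> \<bar>ycut S y * (v (z, y) - ?\<phi> y)\<bar> + \<bar>\<integral> s. indicator {y..\<tau>} s * (?H s - ?G s) \<partial>lborel\<bar>"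
      by linarith
    also have "\<dots> \<le> \<tau>\<^sup>2 * u j (z, y) + \<bar>\<integral> s. indicator {y..\<tau>} s * (?H s - ?G s) \<partial>lborel\<bar>"
      using b0(1)[OF y(1)] by (simp add: abs_mult u_def mult_right_mono)
    finally have "ennreal \<bar>P (z, y)\<bar> \<le> ennreal (\<tau>\<^sup>2 * u j (z, y) + \<bar>\<integral> s. indicator {y..\<tau>} s * (?H s - ?G s) \<partial>lborel\<bar>)"
      by (rule ennreal_leI)
    also have "\<dots> = ennreal (\<tau>\<^sup>2 * u j (z, y)) + ennreal \<bar>\<integral> s. indicator {y..\<tau>} s * (?H s - ?G s) \<partial>lborel\<bar>"
      by (rule ennreal_plus) (auto simp: u_def)
    also have "ennreal \<bar>\<integral> s. indicator {y..\<tau>} s * (?H s - ?G s) \<partial>lborel\<bar>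
        \<le> (\<integral>\<^sup>+ s. ennreal \<bar>indicator {y..\<tau>} s * (?H s - ?G s)\<bar> \<partial>lborel)"
      using integral_norm_bound_ennreal[of lborel "\<lambda>s. indicator {y..\<tau>} s * (?H s - ?G s)"] iH' iG
      by (simp add: right_diff_distrib)
    also have "\<dots> \<le> (\<integral>\<^sup>+ s\<in>{0<..<\<tau>}. ennreal (T j (z, s)) \<partial>lborel)"
    proof (rule nn_integral_mono_AE)
      have "AE s in lborel. s \<noteq> \<tau>" by (rule AE_lborel_singleton)
      then show "AE s in lborel. ennreal \<bar>indicator {y..\<tau>} s * (?H s - ?G s)\<bar> \<le> ennreal (T j (z, s)) * indicator {0<..<\<tau>} s"
      proof eventually_elim
        case (elim s)
        show ?case
        proof (cases "s \<in> {y..<\<tau>}")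
          case True
          then have s: "0 < s" "s < \<tau>" using y by auto
          have "\<bar>?H s - ?G s\<bar> = \<bar>ycut' S s * (v (z, s) - ?\<phi> s) + ycut S s * (h (z, s) - ?\<phi>' s)\<bar>"
            by (simp add: algebra_simps)
          also have "\<dots> \<le> \<bar>ycut' S s\<bar> * u j (z, s) + \<bar>ycut S s\<bar> * w j (z, s)"
            unfolding u_def w_def abs_mult[symmetric] by (rule abs_triangle_ineq)
          also have "\<dots> \<le> T j (z, s)"
            unfolding T_def using b0[OF s(1)] by (intro add_mono mult_right_mono) (auto simp: u_def w_def)
          finally show ?thesis using True s by (auto simp: indicator_def intro: ennreal_leI)
        next
          case False
          then show ?thesis using elim by (auto simp: indicator_def)
        qed
      qed
    qed
    finally show ?thesis by (simp only: add_left_mono)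
  qed
  have AEz: "AE z in lborel. integrable lborel (\<lambda>s. v (z, s)) \<and> integrable lborel (\<lambda>s. h (z, s))"
    using integral_lborel_pair(3)[OF wL2_integrable[OF v_L2]] integral_lborel_pair(3)[OF wL2_integrable[OF h_L2]]
    by eventually_elim auto
  define a where "a j = (\<integral>\<^sup>+ X\<in>Om. ennreal (u j X) \<partial>lborel)" for j
  define b where "b j = (\<integral>\<^sup>+ X\<in>Om. ennreal (w j X) \<partial>lborel)" for j
  have T_Om: "(\<integral>\<^sup>+ X\<in>Om. ennreal (T j X) \<partial>lborel) = ennreal (2 * \<tau>) * a j + ennreal (\<tau>\<^sup>2) * b j" for j
    using tau_pos
    by (simp add: a_def b_def T_def ennreal_mult' u_def w_def distrib_right mult.assoc nn_integral_add nn_integral_cmult)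
  have "(\<integral>\<^sup>+ X\<in>Om. ennreal \<bar>P X\<bar> \<partial>lborel) \<le> ennreal (3 * \<tau>\<^sup>2) * a j + ennreal (\<tau> ^ 3) * b j" for j
  proof -
    have ind: "indicator Om (z, s) = (indicator D z * indicator {0<..<\<tau>} s :: ennreal)" for z s
      by (auto simp: Om_def indicator_def)
    have "(\<integral>\<^sup>+ X\<in>Om. ennreal \<bar>P X\<bar> \<partial>lborel) = (\<integral>\<^sup>+ z. \<integral>\<^sup>+ y. ennreal \<bar>P (z, y)\<bar> * indicator Om (z, y) \<partial>lborel \<partial>lborel)"
      by (rule nn_integral_lborel_pair) measurable
    also have "\<dots> \<le> (\<integral>\<^sup>+ z. \<integral>\<^sup>+ y. (ennreal (\<tau>\<^sup>2 * u j (z, y)) * indicator Om (z, y)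
        + (\<integral>\<^sup>+ s. ennreal (T j (z, s)) * indicator Om (z, s) \<partial>lborel) * indicator {0<..<\<tau>} y) \<partial>lborel \<partial>lborel)"
    proof (rule nn_integral_mono_AE, use AEz in eventually_elim, rule nn_integral_mono)
      fix z y assume *: "integrable lborel (\<lambda>s. v (z, s)) \<and> integrable lborel (\<lambda>s. h (z, s))"
      show "ennreal \<bar>P (z, y)\<bar> * indicator Om (z, y) \<le> ennreal (\<tau>\<^sup>2 * u j (z, y)) * indicator Om (z, y)
        + (\<integral>\<^sup>+ s. ennreal (T j (z, s)) * indicator Om (z, s) \<partial>lborel) * indicator {0<..<\<tau>} y"
        using key[of z y j] * by (cases "z \<in> D \<and> 0 < y \<and> y < \<tau>") (auto simp: ind)
    qed
    also have "\<dots> = (\<integral>\<^sup>+ z. ((\<integral>\<^sup>+ y. ennreal (\<tau>\<^sup>2 * u j (z, y)) * indicator Om (z, y) \<partial>lborel)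
        + (\<integral>\<^sup>+ s. ennreal (T j (z, s)) * indicator Om (z, s) \<partial>lborel) * ennreal \<tau>) \<partial>lborel)"
      using tau_pos by (subst nn_integral_add) (auto simp: nn_integral_cmult)
    also have "\<dots> = (\<integral>\<^sup>+ X\<in>Om. ennreal (\<tau>\<^sup>2 * u j X) \<partial>lborel) + (\<integral>\<^sup>+ X\<in>Om. ennreal (T j X) \<partial>lborel) * ennreal \<tau>"
      by (simp add: nn_integral_add nn_integral_multc nn_integral_lborel_pair(1))
    also have "(\<integral>\<^sup>+ X\<in>Om. ennreal (\<tau>\<^sup>2 * u j X) \<partial>lborel) = ennreal (\<tau>\<^sup>2) * a j"
      by (simp add: a_def ennreal_mult' u_def mult.assoc nn_integral_cmult)
    also have "ennreal (\<tau>\<^sup>2) * a j + (\<integral>\<^sup>+ X\<in>Om. ennreal (T j X) \<partial>lborel) * ennreal \<tau> =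
        (ennreal (\<tau>\<^sup>2) + ennreal (2 * \<tau>) * ennreal \<tau>) * a j + (ennreal (\<tau>\<^sup>2) * ennreal \<tau>) * b j"
      unfolding T_Om by (simp add: algebra_simps)
    also have "ennreal (\<tau>\<^sup>2) + ennreal (2 * \<tau>) * ennreal \<tau> = ennreal (3 * \<tau>\<^sup>2)"
      using tau_pos by (simp add: ennreal_mult[symmetric] ennreal_plus[symmetric] power2_eq_square del: ennreal_plus)
    also have "ennreal (\<tau>\<^sup>2) * ennreal \<tau> = ennreal (\<tau> ^ 3)"
      using tau_pos by (simp add: ennreal_mult[symmetric] power2_eq_square power3_eq_cube)
    finally show ?thesis .
  qed
  then have "(\<integral>\<^sup>+ X\<in>Om. ennreal \<bar>P X\<bar> \<partial>lborel) = 0"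
    using L1_v L1_h unfolding a_def b_def u_def w_def
    by (intro zero_if_le_null_sequences[of "\<lambda>j. \<integral>\<^sup>+ X\<in>Om. ennreal \<bar>v X - \<phi> j X\<bar> \<partial>lborel"
        "\<lambda>j. \<integral>\<^sup>+ X\<in>Om. ennreal \<bar>h X - pd (0, 1) (\<phi> j) X\<bar> \<partial>lborel"
        "ennreal (3 * \<tau>\<^sup>2)" "ennreal (\<tau> ^ 3)"]) auto
  then have "AE X in lborel. X \<in> Om --> P X = 0"
    by (subst (asm) nn_integral_0_iff_AE) (auto elim!: eventually_mono simp: indicator_def)
  then have "AE y in lborel. AE z in lborel. (z, y) \<in> Om --> P (z, y) = 0"
    by (subst (asm) AE_lborel_pair(2)) auto
  then show ?thesis
    by eventually_elim (auto elim!: eventually_mono simp: P_def)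
qed

lemma sect_absolutely_continuous:
  assumes S: "S \<le> \<tau>" and [measurable]: "\<eta> \<in> borel_measurable borel"
    and c: "\<And>z. z \<in> D ==> \<bar>\<eta> z\<bar> \<le> c"
  shows "AE y in lborel. y \<in> {0<..<\<tau>} -->
    ycut S y * sect v \<eta> y = - (LBINT s. indicator {y..} s * (ycut' S s * sect v \<eta> s + ycut S s * sect h \<eta> s))"
  using v_absolutely_continuous[OF S]
proof eventually_elim
  case (elim y)
  show ?case
  proof
    assume y: "y \<in> {0<..<\<tau>}"
    define K where "K X = indicator {y..} (snd X) * (ycut' S (snd X) * (v X * \<eta> (fst X)) + ycut S (snd X) * (h X * \<eta> (fst X)))" for X
    have [measurable]: "K \<in> borel_measurable borel" unfolding K_def[abs_def] by measurable
    have iK: "integrable lborel K"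
    proof (rule Bochner_Integration.integrable_bound)
      show "integrable lborel (\<lambda>X. 2 * \<tau> * \<bar>v X * \<eta> (fst X)\<bar> + \<tau>\<^sup>2 * \<bar>h X * \<eta> (fst X)\<bar>)"
        using sect_integrand(3)[of v \<eta> c, OF v_L2 _ c] sect_integrand(3)[of h \<eta> c, OF h_L2 _ c] by simp
      have "\<bar>K X\<bar> \<le> 2 * \<tau> * \<bar>v X * \<eta> (fst X)\<bar> + \<tau>\<^sup>2 * \<bar>h X * \<eta> (fst X)\<bar>" for X
      proof (cases "snd X \<ge> y")
        case True
        then have b: "\<bar>ycut S (snd X)\<bar> \<le> \<tau>\<^sup>2" "\<bar>ycut' S (snd X)\<bar> \<le> 2 * \<tau>"
          using ycut_bounds[of "snd X" S] S y by auto
        have "\<bar>K X\<bar> \<le> \<bar>ycut' S (snd X)\<bar> * \<bar>v X * \<eta> (fst X)\<bar> + \<bar>ycut S (snd X)\<bar> * \<bar>h X * \<eta> (fst X)\<bar>"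
          using abs_triangle_ineq[of "ycut' S (snd X) * (v X * \<eta> (fst X))" "ycut S (snd X) * (h X * \<eta> (fst X))"] True
          by (simp add: K_def abs_mult)
        also have "\<dots> \<le> 2 * \<tau> * \<bar>v X * \<eta> (fst X)\<bar> + \<tau>\<^sup>2 * \<bar>h X * \<eta> (fst X)\<bar>"
          using b by (intro add_mono mult_right_mono) auto
        finally show ?thesis .
      qed (use tau_pos in \<open>simp add: K_def\<close>)
      then show "AE X in lborel. norm (K X) \<le> norm (2 * \<tau> * \<bar>v X * \<eta> (fst X)\<bar> + \<tau>\<^sup>2 * \<bar>h X * \<eta> (fst X)\<bar>)"
        using tau_pos by auto
    qed measurable
    have "ycut S y * sect v \<eta> y = (LBINT z. ycut S y * v (z, y) * \<eta> z)"
      by (simp add: sect_def mult.assoc)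
    also have "\<dots> = (\<integral> z. - (LBINT s. K (z, s)) \<partial>lborel)"
    proof (rule integral_cong_AE)
      show "AE z in lborel. ycut S y * v (z, y) * \<eta> z = - (LBINT s. K (z, s))"
        using elim
      proof eventually_elim
        case (elim z)
        have K: "K (z, s) = indicator {y..} s * (ycut' S s * v (z, s) + ycut S s * h (z, s)) * \<eta> z" for s
          by (simp add: K_def algebra_simps)
        show ?case
        proof (cases "z \<in> D")
          case True
          then show ?thesis using elim y by (simp add: K Om_def)
        next
          case False
          then have "v (z, s) = 0" "h (z, s) = 0" for s
            by (simp_all add: wL2_off[OF v_L2] wL2_off[OF h_L2] Om_def)
          then show ?thesis by (simp add: K)
        qed
      qed
    qed measurable
    also have "\<dots> = - (\<integral> s. \<integral> z. K (z, s) \<partial>lborel \<partial>lborel)"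
      using integral_lborel_pair(1,2)[OF iK] by simp
    also have "(\<integral> s. \<integral> z. K (z, s) \<partial>lborel \<partial>lborel) = (LBINT s. indicator {y..} s * (ycut' S s * sect v \<eta> s + ycut S s * sect h \<eta> s))"
      using sect_integrand(1)[of v \<eta> c, OF v_L2 _ c] sect_integrand(1)[of h \<eta> c, OF h_L2 _ c]
      by (intro Bochner_Integration.integral_cong) (simp_all add: K_def sect_def)
    finally show "ycut S y * sect v \<eta> y = - (LBINT s. indicator {y..} s * (ycut' S s * sect v \<eta> s + ycut S s * sect h \<eta> s))" .
  qed
qed

end

section \<open>Integration by parts in the half space\<close>

text \<open>Convolution kernels at scale \<open>\<delta>\<close>. Only smoothness and support are recorded, so that derivatives of kernels are kernels of the same scale.\<close>

definition ker :: "real => ('a::euclidean_space => real) => bool" where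
  "ker \<delta> \<kappa> \<longleftrightarrow> smooth \<kappa> \<and> (\<forall>z. \<delta> < norm z --> \<kappa> z = 0)"

lemma ker_smooth: "ker \<delta> \<kappa> ==> smooth \<kappa>" by (simp add: ker_def)

lemma ker_borel: "ker \<delta> \<kappa> ==> \<kappa> \<in> borel_measurable borel" by (simp add: ker_def smooth_borel)

lemma ker_pd:
  assumes "ker \<delta> \<kappa>" "i \<in> Basis"
  shows "ker \<delta> (pd i \<kappa>)"
proof -
  have "open {z::'a. \<delta> < norm z}" by (intro open_Collect_less continuous_intros)
  then show ?thesis
    using assms pd_zero_on_open[of "{z. \<delta> < norm z}" _ \<kappa> i] by (auto simp: ker_def smooth_pd)
qed

lemma ker_sum: "(\<And>i. i \<in> I ==> ker \<delta> (f i)) ==> ker \<delta> (\<lambda>x. \<Sum>i\<in>I. f i x)"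
  by (auto simp: ker_def intro!: smooth_sum sum.neutral)

lemma ker_cmult: "ker \<delta> f ==> ker \<delta> (\<lambda>x. c * f x)"
  by (auto simp: ker_def intro!: smooth_mult smooth_const)

lemma ker_bounded:
  assumes "ker \<delta> \<kappa>"
  obtains c where "0 \<le> c" "\<And>z. \<bar>\<kappa> z\<bar> \<le> c"
proof -
  obtain c where c: "0 \<le> c" "\<And>z. z \<in> cball 0 \<delta> ==> \<bar>\<kappa> z\<bar> \<le> c"
    using smooth_bounded_on_cball[OF ker_smooth[OF assms]] by metis
  have "\<bar>\<kappa> z\<bar> \<le> c" for z
    using c assms by (cases "z \<in> cball 0 \<delta>") (auto simp: ker_def)
  with c(1) show ?thesis by (rule that)
qed

lemma pd_slice:
  fixes f :: "'a::euclidean_space \<times> 'b::euclidean_space => real"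
  assumes "smooth f"
  shows "smooth (\<lambda>z. f (z, y))" and "pd i (\<lambda>z. f (z, y)) z = pd (i, 0) f (z, y)"
proof -
  show "smooth (\<lambda>z. f (z, y))"
    using smooth_affine[OF assms, of "\<lambda>z. (z, 0)" "(0, y)"] by (simp add: linear_iff)
  have d: "((\<lambda>z. (z, y)) has_derivative (\<lambda>h. (h, 0))) (at z)"
    by (auto intro!: derivative_eq_intros)
  show "pd i (\<lambda>z. f (z, y)) z = pd (i, 0) f (z, y)"
    by (rule pd_eqI[OF has_derivative_compose[OF d has_derivative_pd[OF smooth_differentiable[OF assms]]]])
qed

lemma real_polynomial_antiderivative:
  assumes "real_polynomial_function (p :: real => real)"
  obtains \<zeta> where "real_polynomial_function \<zeta>" "\<And>t. (\<zeta> has_real_derivative p t) (at t)" "\<zeta> a = 0"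
proof -
  obtain c n where p: "p = (\<lambda>x. \<Sum>i\<le>n::nat. c i * x ^ i)"
    using assms unfolding real_polynomial_function_iff_sum by blast
  define \<zeta>0 where "\<zeta>0 x = (\<Sum>i\<le>n. (c i / real (Suc i)) * x ^ Suc i)" for x
  have poly: "real_polynomial_function \<zeta>0"
    unfolding \<zeta>0_def[abs_def]
    by (intro real_polynomial_function_sum real_polynomial_function.intros(2,4) real_polynomial_function_power)
       (auto intro: real_polynomial_function.intros(1) bounded_linear_ident)
  have d: "(\<zeta>0 has_real_derivative p t) (at t)" for t
    unfolding \<zeta>0_def[abs_def] p
    by (rule DERIV_sum, rule DERIV_cong[OF DERIV_cmult[OF DERIV_pow]]) (simp del: of_nat_Suc)
  show ?thesis
  proof (rule that[of "\<lambda>x. \<zeta>0 x - \<zeta>0 a"])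
    show "real_polynomial_function (\<lambda>x. \<zeta>0 x - \<zeta>0 a)"
      using poly by (intro real_polynomial_function_diff real_polynomial_function.intros(2))
  qed (auto intro!: derivative_eq_intros d)
qed

context mixed_solution
begin

text \<open>One of the two factors vanishes on the flat part, so extending the product by \<open>0\<close> across it gives a Lipschitz function, to which the vanishing of integrated derivatives applies.\<close>

lemma half_space_integration_by_parts:
  assumes \<kappa>: "smooth \<kappa>" and \<tau>': "\<tau>' < \<tau>" and zero: "\<And>z. 0 \<le> z \<bullet> e ==> \<tau>' \<le> norm z ==> \<kappa> z = 0"
    and i: "i \<in> Basis" and y: "y \<in> {0<..<\<tau>}"
  shows "(LBINT z. indicator D z * (\<phi> j (z, y) * pd i \<kappa> z + pd (i, 0) (\<phi> j) (z, y) * \<kappa> z)) = 0"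
proof -
  define \<omega> where "\<omega> z = \<phi> j (z, y) * \<kappa> z" for z
  have sm: "smooth \<omega>" unfolding \<omega>_def[abs_def] by (intro smooth_mult pd_slice phi_smooth \<kappa>)
  have pd\<omega>: "pd i \<omega> z = \<phi> j (z, y) * pd i \<kappa> z + pd (i, 0) (\<phi> j) (z, y) * \<kappa> z" for z
    unfolding \<omega>_def[abs_def] by (simp add: pd_mult pd_slice phi_smooth \<kappa>)
  have out: "\<omega> z = 0" if "0 \<le> z \<bullet> e" "\<tau>' \<le> norm z" for z
    using zero[OF that] by (simp add: \<omega>_def)
  have flat: "\<omega> z = 0" if "z \<bullet> e = 0" for z
    using phi_flat[of z y j] that y zero[of z] \<tau>' by (cases "norm z < \<tau>") (auto simp: \<omega>_def)
  define H where "H z = (if 0 < z \<bullet> e then \<omega> z else 0)" for z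
  define H' where "H' z = (if 0 < z \<bullet> e then pd i \<omega> z else 0)" for z
  note [measurable] = smooth_borel[OF sm] smooth_borel[OF smooth_pd[OF sm i]]
  have [measurable]: "H \<in> borel_measurable borel" "H' \<in> borel_measurable borel"
    unfolding H_def[abs_def] H'_def[abs_def] by measurable
  have supp: "H z = 0" if "\<tau>' < norm z" for z
    using out[of z] that by (auto simp: H_def)
  obtain C where C: "C \<ge> 0" "\<And>x y. x \<in> cball 0 (\<tau> + 1) ==> y \<in> cball 0 (\<tau> + 1) ==> \<bar>\<omega> x - \<omega> y\<bar> \<le> C * norm (x - y)"
    using smooth_Lipschitz_on_cball[OF sm] by metis
  obtain M where M: "M \<ge> 0" "\<And>x. x \<in> cball 0 \<tau> ==> \<bar>\<omega> x\<bar> \<le> M"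
    using smooth_bounded_on_cball[OF sm] by metis
  have "integral\<^sup>L lborel H' = 0"
  proof (rule integral_directional_derivative_zero[of H H' i C \<tau>'])
    show "integrable lborel H"
    proof (rule Bochner_Integration.integrable_bound)
      show "integrable lborel (\<lambda>z::'a. M * indicator (cball 0 \<tau>) z)"
        using emeasure_lborel_cball_finite[of "0::'a" \<tau>] by simp
      have "\<bar>H z\<bar> \<le> M * indicator (cball 0 \<tau>) z" for z
        using M(2)[of z] M(1) supp[of z] \<tau>' by (cases "z \<in> cball 0 \<tau>") (auto simp: H_def indicator_def)
      then show "AE z in lborel. norm (H z) \<le> norm (M * indicator (cball 0 \<tau>) z)"
        by (auto intro!: AE_I2 order_trans[OF _ abs_ge_self])
    qed simp
    show "\<bar>H (x + t *\<^sub>R i) - H x\<bar> \<le> C * t" if t: "0 < t" "t \<le> 1" for x t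
    proof (cases "H x = 0 \<and> H (x + t *\<^sub>R i) = 0")
      case True
      then show ?thesis using C t by simp
    next
      case False
      then have "norm x \<le> \<tau> \<or> norm (x + t *\<^sub>R i) \<le> \<tau>"
        using supp[of x] supp[of "x + t *\<^sub>R i"] \<tau>' by fastforce
      have near: "norm (x + s *\<^sub>R i) \<le> \<tau> + 1" if s: "0 \<le> s" "s \<le> t" for s
      proof -
        have n1: "norm (x + s *\<^sub>R i) \<le> norm x + s"
          using norm_triangle_ineq[of x "s *\<^sub>R i"] s i by simp
        have eq: "x + s *\<^sub>R i = (x + t *\<^sub>R i) + (s - t) *\<^sub>R i" by (simp add: algebra_simps)
        have n2: "norm (x + s *\<^sub>R i) \<le> norm (x + t *\<^sub>R i) + (t - s)"
          unfolding eq using norm_triangle_ineq[of "x + t *\<^sub>R i" "(s - t) *\<^sub>R i"] s i by simp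
        show ?thesis using \<open>norm x \<le> \<tau> \<or> norm (x + t *\<^sub>R i) \<le> \<tau>\<close> n1 n2 s t by linarith
      qed
      have Lip: "\<bar>\<omega> (x + t *\<^sub>R i) - \<omega> (x + s *\<^sub>R i)\<bar> \<le> C * (t - s)" if s: "0 \<le> s" "s \<le> t" for s
        using C(2)[of "x + t *\<^sub>R i" "x + s *\<^sub>R i"] near[OF s] near[of t] t s i
        by (simp add: scaleR_left_diff_distrib[symmetric])
      show ?thesis
      proof (cases "i = e")
        case False
        then have "i \<bullet> e = 0" using i e_Basis by (simp add: inner_Basis)
        then have same: "(x + t *\<^sub>R i) \<bullet> e = x \<bullet> e" by (simp add: inner_add_left)
        show ?thesis using Lip[of 0] t C same by (auto simp: H_def)
      next
        case True
        then have ee: "(x + s *\<^sub>R i) \<bullet> e = x \<bullet> e + s" for s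
          using e_Basis by (simp add: inner_add_left)
        show ?thesis
        proof (cases "0 < x \<bullet> e")
          case True
          then show ?thesis using Lip[of 0] t ee[of t] by (auto simp: H_def)
        next
          case False
          show ?thesis
          proof (cases "0 < x \<bullet> e + t")
            case True
            have "\<omega> (x + (- (x \<bullet> e)) *\<^sub>R i) = 0" using ee[of "- (x \<bullet> e)"] by (intro flat) simp
            then have "\<bar>\<omega> (x + t *\<^sub>R i)\<bar> \<le> C * (t - (- (x \<bullet> e)))"
              using Lip[of "- (x \<bullet> e)"] False True by simp
            also have "\<dots> \<le> C * t" using False C by (intro mult_left_mono) auto
            finally show ?thesis using ee[of t] True False by (simp add: H_def)
          qed (use ee[of t] False C t in \<open>simp add: H_def\<close>)
        qed
      qed
    qed
    show "\<tau>' < norm z ==> H z = 0" for z by (rule supp)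
    have "AE z in lborel. z \<bullet> e \<noteq> 0"
    proof -
      have "negligible {z. e \<bullet> z = 0}" by (rule negligible_hyperplane) (use e_Basis in auto)
      then have "AE z in lebesgue. z \<notin> {z. e \<bullet> z = 0}"
        by (intro AE_not_in) (simp add: negligible_iff_null_sets)
      then show ?thesis by (simp add: AE_completion_iff inner_commute)
    qed
    then show "AE z in lborel. ((\<lambda>t. H (z + t *\<^sub>R i)) has_real_derivative H' z) (at 0)"
    proof eventually_elim
      case (elim z)
      have cont: "continuous_on UNIV (\<lambda>t. (z + t *\<^sub>R i) \<bullet> e)" by (intro continuous_intros)
      show ?case
      proof (cases "0 < z \<bullet> e")
        case True
        have "open {t. 0 < (z + t *\<^sub>R i) \<bullet> e}" by (intro open_Collect_less continuous_intros)
        then have "\<forall>\<^sub>F t in nhds 0. t \<in> {t. 0 < (z + t *\<^sub>R i) \<bullet> e}"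
          by (rule eventually_nhds_in_open) (use True in simp)
        then have "\<forall>\<^sub>F t in nhds 0. H (z + t *\<^sub>R i) = \<omega> (z + t *\<^sub>R i)"
          by eventually_elim (simp add: H_def)
        then show ?thesis
          using smooth_has_real_derivative_line[OF sm, of z i 0] True
          by (subst DERIV_cong_ev[OF refl _ refl]) (auto simp: H'_def)
      next
        case False
        have "open {t. (z + t *\<^sub>R i) \<bullet> e < 0}" by (intro open_Collect_less continuous_intros)
        then have "\<forall>\<^sub>F t in nhds 0. t \<in> {t. (z + t *\<^sub>R i) \<bullet> e < 0}"
          by (rule eventually_nhds_in_open) (use False elim in simp)
        then have "\<forall>\<^sub>F t in nhds 0. H (z + t *\<^sub>R i) = 0"
          by eventually_elim (simp add: H_def)
        then show ?thesis
          using False by (subst DERIV_cong_ev[OF refl _ refl]) (auto simp: H'_def)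
      qed
    qed
  qed simp
  moreover have "H' = (\<lambda>z. indicator D z * (\<phi> j (z, y) * pd i \<kappa> z + pd (i, 0) (\<phi> j) (z, y) * \<kappa> z))"
  proof (rule ext, goal_cases)
    case (1 z)
    show ?case
  proof (cases "0 < z \<bullet> e \<and> \<not> norm z < \<tau>")
    case True
    have "open {z. 0 < z \<bullet> e \<and> \<tau>' < norm z}"
      by (intro open_Collect_conj open_Collect_less continuous_intros)
    then have "pd i \<omega> z = 0"
      by (rule pd_zero_on_open) (use True \<tau>' out in auto)
    then show ?thesis using True by (simp add: H'_def D_def)
  qed (auto simp: H'_def D_def pd\<omega> indicator_def)
  qed
  ultimately show ?thesis by simp
qed

text \<open>Integration by parts for the approximants, which vanish on the flat part, followed by passage to the limit; the limit holds for almost every height.\<close>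

lemma sect_integration_by_parts:
  assumes \<kappa>: "smooth \<kappa>" and \<tau>': "\<tau>' < \<tau>" and zero: "\<And>z. 0 \<le> z \<bullet> e ==> \<tau>' \<le> norm z ==> \<kappa> z = 0"
    and i: "i \<in> Basis"
  shows "AE y in lborel. y \<in> {0<..<\<tau>} --> sect v (pd i \<kappa>) y = - sect (\<lambda>X. g X \<bullet> i) \<kappa> y"
proof -
  note g = g_L2[OF i]
  have \<kappa>': "smooth (pd i \<kappa>)" by (rule smooth_pd[OF \<kappa> i])
  note [measurable] = smooth_borel[OF \<kappa>] smooth_borel[OF \<kappa>'] wL2_borel[OF g] sect_borel[OF v_L2] sect_borel[OF g] phi_borel(3)[OF i]
  obtain c1 c2 where c12: "0 \<le> c1" "\<And>z. z \<in> cball 0 \<tau> ==> \<bar>\<kappa> z\<bar> \<le> c1" "0 \<le> c2" "\<And>z. z \<in> cball 0 \<tau> ==> \<bar>pd i \<kappa> z\<bar> \<le> c2"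
    using smooth_bounded_on_cball[OF \<kappa>] smooth_bounded_on_cball[OF \<kappa>'] by metis
  have b1: "\<bar>\<kappa> z\<bar> \<le> c1" and b2: "\<bar>pd i \<kappa> z\<bar> \<le> c2" if "z \<in> D" for z
    using c12 that D_bounded by auto
  define T where "T y = sect v (pd i \<kappa>) y + sect (\<lambda>X. g X \<bullet> i) \<kappa> y" for y
  have [measurable]: "T \<in> borel_measurable borel" unfolding T_def[abs_def] by measurable
  define u where "u j X = \<bar>v X - \<phi> j X\<bar>" for j X
  define w where "w j X = \<bar>g X \<bullet> i - pd (i, 0) (\<phi> j) X\<bar>" for j X
  have [measurable]: "u j \<in> borel_measurable borel" "w j \<in> borel_measurable borel" for j
    unfolding u_def[abs_def] w_def[abs_def] by measurable
  have uw0: "0 \<le> u j X" "0 \<le> w j X" for j X by (simp_all add: u_def w_def)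
  have key: "ennreal \<bar>T y\<bar> \<le> (\<integral>\<^sup>+ z. ennreal (c2 * u j (z, y) + c1 * w j (z, y)) * indicator D z \<partial>lborel)"
    if y: "y \<in> {0<..<\<tau>}" for y j
  proof -
    let ?f = "\<lambda>z. v (z, y) * pd i \<kappa> z + (g (z, y) \<bullet> i) * \<kappa> z"
    let ?p = "\<lambda>z. indicator D z * (\<phi> j (z, y) * pd i \<kappa> z + pd (i, 0) (\<phi> j) (z, y) * \<kappa> z)"
    have if1: "integrable lborel ?f"
      using sect_integrand(1)[of v "pd i \<kappa>" c2, OF v_L2 _ b2] sect_integrand(1)[of "\<lambda>X. g X \<bullet> i" \<kappa> c1, OF g _ b1] by simp
    have ip: "integrable lborel ?p"
    proof -
      have sp: "smooth (\<lambda>z. \<phi> j (z, y) * pd i \<kappa> z + pd (i, 0) (\<phi> j) (z, y) * \<kappa> z)"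
        using i by (intro smooth_add smooth_mult pd_slice(1) phi_smooth \<kappa> \<kappa>' smooth_pd) (auto simp: Basis_prod_def)
      obtain M where M: "M \<ge> 0" "\<And>z. z \<in> cball 0 \<tau> ==> \<bar>\<phi> j (z, y) * pd i \<kappa> z + pd (i, 0) (\<phi> j) (z, y) * \<kappa> z\<bar> \<le> M"
        using smooth_bounded_on_cball[OF sp] by metis
      have "integrable lborel (\<lambda>z. M * indicator D z)" using D_finite by simp
      then show ?thesis
      proof (rule Bochner_Integration.integrable_bound)
        show "AE z in lborel. norm (?p z) \<le> norm (M * indicator D z)"
          using M D_bounded by (auto simp: indicator_def)
      qed simp
    qed
    have "T y = (LBINT z. ?f z)"
      using sect_integrand(1)[of v "pd i \<kappa>" c2, OF v_L2 _ b2] sect_integrand(1)[of "\<lambda>X. g X \<bullet> i" \<kappa> c1, OF g _ b1]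
      by (simp add: T_def sect_def)
    also have "\<dots> = (LBINT z. ?f z - ?p z)"
      using half_space_integration_by_parts[OF assms y] if1 ip by simp
    finally have "ennreal \<bar>T y\<bar> \<le> (\<integral>\<^sup>+ z. ennreal \<bar>?f z - ?p z\<bar> \<partial>lborel)"
      using integral_norm_bound_ennreal[of lborel "\<lambda>z. ?f z - ?p z"] if1 ip by simp
    also have "\<dots> \<le> (\<integral>\<^sup>+ z. ennreal (c2 * u j (z, y) + c1 * w j (z, y)) * indicator D z \<partial>lborel)"
    proof (rule nn_integral_mono)
      fix z
      show "ennreal \<bar>?f z - ?p z\<bar> \<le> ennreal (c2 * u j (z, y) + c1 * w j (z, y)) * indicator D z"
      proof (cases "z \<in> D")
        case True
        have "?f z - ?p z = (v (z, y) - \<phi> j (z, y)) * pd i \<kappa> z + (g (z, y) \<bullet> i - pd (i, 0) (\<phi> j) (z, y)) * \<kappa> z"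
          using True by (simp add: algebra_simps)
        then have "\<bar>?f z - ?p z\<bar> \<le> u j (z, y) * \<bar>pd i \<kappa> z\<bar> + w j (z, y) * \<bar>\<kappa> z\<bar>"
          unfolding u_def w_def abs_mult[symmetric] using abs_triangle_ineq by simp
        also have "\<dots> \<le> c2 * u j (z, y) + c1 * w j (z, y)"
          using b1[OF True] b2[OF True] uw0[of j "(z, y)"]
          by (simp add: add_mono mult_left_mono mult.commute[of c2] mult.commute[of c1])
        finally show ?thesis using True by (simp add: ennreal_leI del: ennreal_plus)
      next
        case False
        then show ?thesis using wL2_off[OF v_L2, of "(z, y)"] wL2_off[OF g, of "(z, y)"] by (simp add: Om_def)
      qed
    qed
    finally show ?thesis .
  qed
  define a where "a j = (\<integral>\<^sup>+ X\<in>Om. ennreal (u j X) \<partial>lborel)" for j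
  define b where "b j = (\<integral>\<^sup>+ X\<in>Om. ennreal (w j X) \<partial>lborel)" for j
  have "(\<integral>\<^sup>+ y\<in>{0<..<\<tau>}. ennreal \<bar>T y\<bar> \<partial>lborel) \<le> ennreal c2 * a j + ennreal c1 * b j" for j
  proof -
    have "(\<integral>\<^sup>+ y\<in>{0<..<\<tau>}. ennreal \<bar>T y\<bar> \<partial>lborel) \<le>
      (\<integral>\<^sup>+ y. \<integral>\<^sup>+ z. ennreal (c2 * u j (z, y) + c1 * w j (z, y)) * indicator Om (z, y) \<partial>lborel \<partial>lborel)"
    proof (rule nn_integral_mono)
      fix y
      show "ennreal \<bar>T y\<bar> * indicator {0<..<\<tau>} y \<le> (\<integral>\<^sup>+ z. ennreal (c2 * u j (z, y) + c1 * w j (z, y)) * indicator Om (z, y) \<partial>lborel)"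
      proof (cases "y \<in> {0<..<\<tau>}")
        case True
        then have "indicator Om (z, y) = (indicator D z :: ennreal)" for z by (simp add: Om_def indicator_def)
        then show ?thesis using key[OF True] True by simp
      qed simp
    qed
    also have "\<dots> = (\<integral>\<^sup>+ X\<in>Om. ennreal (c2 * u j X + c1 * w j X) \<partial>lborel)"
      by (rule nn_integral_lborel_pair(2)[symmetric]) measurable
    also have "\<dots> = ennreal c2 * a j + ennreal c1 * b j"
      using c12 uw0 by (simp add: a_def b_def ennreal_mult' distrib_right mult.assoc nn_integral_add nn_integral_cmult)
    finally show ?thesis .
  qed
  then have "(\<integral>\<^sup>+ y\<in>{0<..<\<tau>}. ennreal \<bar>T y\<bar> \<partial>lborel) = 0"
    using L1_v L1_g[OF i] unfolding a_def b_def u_def w_def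
    by (intro zero_if_le_null_sequences[of "\<lambda>j. \<integral>\<^sup>+ X\<in>Om. ennreal \<bar>v X - \<phi> j X\<bar> \<partial>lborel"
        "\<lambda>j. \<integral>\<^sup>+ X\<in>Om. ennreal \<bar>g X \<bullet> i - pd (i, 0) (\<phi> j) X\<bar> \<partial>lborel" "ennreal c2" "ennreal c1"]) auto
  then have "AE y in lborel. y \<in> {0<..<\<tau>} --> T y = 0"
    by (subst (asm) nn_integral_0_iff_AE) (auto elim!: eventually_mono simp: indicator_def)
  then show ?thesis by eventually_elim (auto simp: T_def)
qed

end

section \<open>The reflected test functions\<close>

lemma pd_lincomb:
  assumes "\<And>a. a \<in> A ==> smooth (F a)"
  shows "pd i (\<lambda>x. \<Sum>a\<in>A. c a * F a x) x = (\<Sum>a\<in>A. c a * pd i (F a) x)"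
  by (rule pd_eqI, intro has_derivative_sum has_derivative_mult_right has_derivative_pd smooth_differentiable assms)

lemma sum_swap4:
  "(\<Sum>i\<in>I. \<Sum>j\<in>J. \<Sum>a\<in>P. \<Sum>b\<in>Q. T i j a b) = (\<Sum>b\<in>Q. \<Sum>a\<in>P. \<Sum>i\<in>I. \<Sum>j\<in>J. T i j a b)"
proof -
  have "(\<Sum>i\<in>I. \<Sum>j\<in>J. \<Sum>a\<in>P. \<Sum>b\<in>Q. T i j a b) = (\<Sum>i\<in>I. \<Sum>j\<in>J. \<Sum>b\<in>Q. \<Sum>a\<in>P. T i j a b)"
    by (intro sum.cong refl sum.swap)
  also have "\<dots> = (\<Sum>i\<in>I. \<Sum>b\<in>Q. \<Sum>j\<in>J. \<Sum>a\<in>P. T i j a b)"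
    by (intro sum.cong refl sum.swap)
  also have "\<dots> = (\<Sum>b\<in>Q. \<Sum>i\<in>I. \<Sum>j\<in>J. \<Sum>a\<in>P. T i j a b)"
    by (rule sum.swap)
  also have "\<dots> = (\<Sum>b\<in>Q. \<Sum>i\<in>I. \<Sum>a\<in>P. \<Sum>j\<in>J. T i j a b)"
    by (intro sum.cong refl sum.swap)
  also have "\<dots> = (\<Sum>b\<in>Q. \<Sum>a\<in>P. \<Sum>i\<in>I. \<Sum>j\<in>J. T i j a b)"
    by (intro sum.cong refl sum.swap)
  finally show ?thesis .
qed

lemma (in half_cylinder_weight) tensor_integral:
  assumes F: "wL2 F" and [measurable]: "\<eta> \<in> borel_measurable borel" "\<zeta> \<in> borel_measurable borel"
    and c: "\<And>z. z \<in> D ==> \<bar>\<eta> z\<bar> \<le> c" and c': "\<And>y. y \<in> {0<..<\<tau>} ==> \<bar>\<zeta> y\<bar> \<le> c'"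
  shows "integrable lborel (\<lambda>X. m (snd X) * (F X * \<eta> (fst X) * \<zeta> (snd X)))"
    and "(LBINT X. m (snd X) * (F X * \<eta> (fst X) * \<zeta> (snd X))) = (LBINT y. m y * (sect F \<eta> y * \<zeta> y))"
    and "integrable lborel (\<lambda>y. m y * (sect F \<eta> y * \<zeta> y))"
proof -
  note [measurable] = wL2_borel[OF F]
  show i: "integrable lborel (\<lambda>X. m (snd X) * (F X * \<eta> (fst X) * \<zeta> (snd X)))"
  proof (rule Bochner_Integration.integrable_bound)
    show "integrable lborel (\<lambda>X. (\<bar>c\<bar> * \<bar>c'\<bar>) * \<bar>F X * m (snd X)\<bar>)"
      using wL2_m_integrable[OF F] by (intro integrable_mult_right integrable_abs)
    have "\<bar>m (snd X) * (F X * \<eta> (fst X) * \<zeta> (snd X))\<bar> \<le> (\<bar>c\<bar> * \<bar>c'\<bar>) * \<bar>F X * m (snd X)\<bar>" for X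
    proof (cases "X \<in> Om")
      case True
      then have "\<bar>\<eta> (fst X)\<bar> \<le> \<bar>c\<bar>" "\<bar>\<zeta> (snd X)\<bar> \<le> \<bar>c'\<bar>"
        using c[of "fst X"] c'[of "snd X"] by (auto simp: Om_def)
      then have "\<bar>\<eta> (fst X)\<bar> * \<bar>\<zeta> (snd X)\<bar> * \<bar>F X * m (snd X)\<bar> \<le> (\<bar>c\<bar> * \<bar>c'\<bar>) * \<bar>F X * m (snd X)\<bar>"
        by (intro mult_right_mono mult_mono) auto
      then show ?thesis by (simp add: abs_mult ac_simps)
    qed (simp add: wL2_off[OF F])
    then show "AE X in lborel. norm (m (snd X) * (F X * \<eta> (fst X) * \<zeta> (snd X))) \<le> norm ((\<bar>c\<bar> * \<bar>c'\<bar>) * \<bar>F X * m (snd X)\<bar>)"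
      by (auto simp: abs_mult)
  qed measurable
  have e: "(LBINT z. m (snd (z, y)) * (F (z, y) * \<eta> (fst (z, y)) * \<zeta> (snd (z, y)))) = m y * (sect F \<eta> y * \<zeta> y)" for y
    by (simp add: sect_def)
  show "(LBINT X. m (snd X) * (F X * \<eta> (fst X) * \<zeta> (snd X))) = (LBINT y. m y * (sect F \<eta> y * \<zeta> y))"
    unfolding integral_lborel_pair(2)[OF i] e by simp
  show "integrable lborel (\<lambda>y. m y * (sect F \<eta> y * \<zeta> y))"
    using integral_lborel_pair(6)[OF i] unfolding e .
qed

context mixed_solution
begin

text \<open>The reflection along the conormal direction \<open>B e\<close> rather than along \<open>e\<close>: it fixes the flat part and exchanges the two half spaces, and it preserves the quadratic form dual to \<open>B\<close>. Hence composition with it commutes with the constant coefficient operator \<open>div (B \<nabla>)\<close>. Below, \<open>Rt\<close> is its transpose.\<close>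

definition Rf :: "'a => 'a" where "Rf z = z - (2 * (z \<bullet> e) / (B e \<bullet> e)) *\<^sub>R B e"
definition Rt :: "'a => 'a" where "Rt a = a - (2 * (B e \<bullet> a) / (B e \<bullet> e)) *\<^sub>R e"

lemma Be_lower: "inverse \<Lambda> \<le> B e \<bullet> e"
  using B_lower[of e] e_Basis by simp

lemma Be_pos: "0 < B e \<bullet> e"
  using Be_lower Lam by (auto intro: less_le_trans[of 0 "inverse \<Lambda>"])

lemma Rf_linear: "linear Rf"
  unfolding Rf_def by (rule linearI) (auto simp: algebra_simps add_divide_distrib)

lemma Rf_e: "Rf z \<bullet> e = - (z \<bullet> e)"
  using Be_pos by (simp add: Rf_def inner_diff_left)

lemma Rf_Rf: "Rf (Rf z) = z"
  unfolding Rf_def[of "Rf z"] Rf_e by (simp add: Rf_def)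

lemma Rf_flat: "z \<bullet> e = 0 ==> Rf z = z" by (simp add: Rf_def)

lemma Rf_Rt: "Rf z \<bullet> a = z \<bullet> Rt a"
  by (simp add: Rf_def Rt_def inner_diff_left inner_diff_right)

text \<open>The invariance that makes the reflection commute with the operator.\<close>

lemma B_Rt: "B (Rt a) \<bullet> Rt b = B a \<bullet> b"
proof -
  have B: "B (x - c *\<^sub>R y) = B x - c *\<^sub>R B y" for x y c
    using linear_diff[OF B_lin] linear_cmul[OF B_lin] by simp
  show ?thesis
    using Be_pos
    by (simp add: Rt_def B inner_diff_left inner_diff_right B_sym[of a e] inner_commute[of a "B e"] field_simps)
qed

text \<open>The operator \<open>div (B \<nabla>)\<close> in the horizontal variable.\<close>

definition Lop :: "('a => real) => 'a => real" where
  "Lop \<kappa> x = (\<Sum>i\<in>Basis. \<Sum>j\<in>Basis. (B i \<bullet> j) * pd i (pd j \<kappa>) x)"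

lemma Lop_affine:
  assumes \<kappa>: "smooth \<kappa>" and L: "linear L" "\<And>x y. L x \<bullet> y = x \<bullet> Lt y" "\<And>a b. B (Lt a) \<bullet> Lt b = B a \<bullet> b"
  shows "Lop (\<lambda>z. \<kappa> (L z + c)) z = Lop \<kappa> (L z + c)"
proof -
  have 1: "pd j (\<lambda>z. \<kappa> (L z + c)) = (\<lambda>z. \<Sum>a\<in>Basis. (L j \<bullet> a) * pd a \<kappa> (L z + c))" for j
    by (rule ext, rule pd_affine(1)[OF smooth_differentiable[OF \<kappa>] L(1)])
  have 2: "pd i (\<lambda>z. \<Sum>a\<in>Basis. (L j \<bullet> a) * pd a \<kappa> (L z + c)) z
     = (\<Sum>a\<in>Basis. (L j \<bullet> a) * (\<Sum>b\<in>Basis. (L i \<bullet> b) * pd b (pd a \<kappa>) (L z + c)))" for i j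
    by (subst pd_lincomb)
       (auto intro!: smooth_affine[OF _ L(1)] smooth_pd \<kappa> sum.cong
          simp: pd_affine(1)[OF smooth_differentiable[OF smooth_pd[OF \<kappa>]] L(1)])
  have 3: "(\<Sum>i\<in>Basis. \<Sum>j\<in>Basis. (B i \<bullet> j) * (L j \<bullet> a) * (L i \<bullet> b)) = B b \<bullet> a" for a b
  proof -
    have Lc: "L j \<bullet> d = Lt d \<bullet> j" for j d by (metis L(2) inner_commute)
    have "(\<Sum>i\<in>Basis. \<Sum>j\<in>Basis. (B i \<bullet> j) * (L j \<bullet> a) * (L i \<bullet> b))
        = (\<Sum>i\<in>Basis. (\<Sum>j\<in>Basis. (B i \<bullet> j) * (Lt a \<bullet> j)) * (Lt b \<bullet> i))"
      by (simp only: Lc sum_distrib_right)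
    also have "\<dots> = (\<Sum>i\<in>Basis. (B (Lt a) \<bullet> i) * (Lt b \<bullet> i))"
    proof -
      have "(\<Sum>j\<in>Basis. (B i \<bullet> j) * (Lt a \<bullet> j)) = B (Lt a) \<bullet> i" for i
        unfolding euclidean_inner[symmetric] by (metis B_sym inner_commute)
      then show ?thesis by (simp only:)
    qed
    also have "\<dots> = B a \<bullet> b"
      by (simp only: euclidean_inner[symmetric] L(3))
    also have "B a \<bullet> b = B b \<bullet> a" by (metis B_sym inner_commute)
    finally show ?thesis .
  qed
  have "Lop (\<lambda>z. \<kappa> (L z + c)) z = (\<Sum>i\<in>Basis. \<Sum>j\<in>Basis. \<Sum>a\<in>Basis. \<Sum>b\<in>Basis.
      ((B i \<bullet> j) * (L j \<bullet> a) * (L i \<bullet> b)) * pd b (pd a \<kappa>) (L z + c))"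
    unfolding Lop_def 1 2 by (simp add: sum_distrib_left mult.assoc)
  also have "\<dots> = (\<Sum>b\<in>Basis. \<Sum>a\<in>Basis. (\<Sum>i\<in>Basis. \<Sum>j\<in>Basis. (B i \<bullet> j) * (L j \<bullet> a) * (L i \<bullet> b)) * pd b (pd a \<kappa>) (L z + c))"
    by (subst sum_swap4) (simp add: sum_distrib_right)
  finally show ?thesis unfolding 3 Lop_def .
qed

lemma Lop_diff: "smooth f ==> smooth k ==> Lop (\<lambda>z. f z - k z) z = Lop f z - Lop k z"
proof -
  assume s: "smooth f" "smooth k"
  have 1: "pd j (\<lambda>z. f z - k z) = (\<lambda>z. pd j f z - pd j k z)" for j
    by (rule ext, rule pd_diff[OF s])
  have 2: "pd i (\<lambda>z. pd j f z - pd j k z) z = pd i (pd j f) z - pd i (pd j k) z" if "j \<in> Basis" for i j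
    using s that by (intro pd_diff smooth_pd)
  show ?thesis
    unfolding Lop_def 1 by (simp add: 2 algebra_simps sum_subtractf)
qed

lemma ker_Lop: "ker \<delta> \<kappa> ==> ker \<delta> (Lop \<kappa>)"
  unfolding Lop_def[abs_def] by (intro ker_sum ker_cmult ker_pd)

text \<open>A kernel centred at \<open>x\<close> minus its reflection. The difference vanishes on the flat part, so it is an admissible test function for every \<open>x\<close>, even for \<open>x\<close> on or beyond the flat part.\<close>

definition tst :: "('a => real) => 'a => 'a => real" where
  "tst \<kappa> x z = \<kappa> (x - z) - \<kappa> (x - Rf z)"

lemma uminus_linear: "linear (\<lambda>z::'a. - z)" "linear (\<lambda>z. - Rf z)"
  using Rf_linear linear_compose_neg[of Rf] by (auto simp: linear_iff)

lemma tst_eq: "tst \<kappa> x = (\<lambda>z. \<kappa> (- z + x) - \<kappa> (- Rf z + x))"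
  by (simp add: tst_def fun_eq_iff)

lemma shift_smooth: "smooth \<kappa> ==> smooth (\<lambda>z. \<kappa> (x - z))" "smooth \<kappa> ==> smooth (\<lambda>z. \<kappa> (x - Rf z))"
  using smooth_affine[OF _ uminus_linear(1), of \<kappa> x] smooth_affine[OF _ uminus_linear(2), of \<kappa> x] by simp_all

lemma tst_smooth: "smooth \<kappa> ==> smooth (tst \<kappa> x)"
  unfolding tst_eq by (intro smooth_diff smooth_affine uminus_linear)

lemma tst_flat: "z \<bullet> e = 0 ==> tst \<kappa> x z = 0"
  by (simp add: tst_def Rf_flat)

text \<open>Both translation and reflection commute with the operator.\<close>

lemma Lop_tst:
  assumes \<kappa>: "smooth \<kappa>"
  shows "Lop (tst \<kappa> x) = tst (Lop \<kappa>) x"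
proof
  fix z
  have "B (- a) = - B a" for a using linear_neg[OF B_lin] .
  then show "Lop (tst \<kappa> x) z = tst (Lop \<kappa>) x z"
    unfolding tst_eq
    using Lop_affine[OF \<kappa> uminus_linear(1), of "\<lambda>z. - z" x z]
      Lop_affine[OF \<kappa> uminus_linear(2), of "\<lambda>z. - Rt z" x z]
    by (subst Lop_diff) (auto intro!: shift_smooth \<kappa> simp: Rf_Rt B_Rt tst_def)
qed

lemma pd_tst:
  assumes \<kappa>: "smooth \<kappa>" and i: "i \<in> Basis"
  shows "pd i (tst \<kappa> x) z = - pd i \<kappa> (x - z) + (\<Sum>a\<in>Basis. (Rf i \<bullet> a) * pd a \<kappa> (x - Rf z))"
proof -
  have d: "pd i (\<lambda>z. \<kappa> (- z + x)) z = - pd i \<kappa> (x - z)"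
    using i by (subst pd_affine(1)[OF smooth_differentiable[OF \<kappa>] uminus_linear(1)])
      (simp add: inner_Basis if_distrib if_distribR sum_negf cong: if_cong)
  have d': "pd i (\<lambda>z. \<kappa> (- Rf z + x)) z = - (\<Sum>a\<in>Basis. (Rf i \<bullet> a) * pd a \<kappa> (x - Rf z))"
    by (subst pd_affine(1)[OF smooth_differentiable[OF \<kappa>] uminus_linear(2)]) (simp add: sum_negf)
  show ?thesis
    unfolding tst_eq
    using d d' by (subst pd_diff) (auto intro!: shift_smooth \<kappa>)
qed

lemma tst_bounded:
  assumes "ker \<delta> \<kappa>"
  obtains c where "0 \<le> c" "\<And>x z. \<bar>tst \<kappa> x z\<bar> \<le> c"
proof -
  obtain c where c: "0 \<le> c" "\<And>z. \<bar>\<kappa> z\<bar> \<le> c" using ker_bounded[OF assms] by metis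
  have "\<bar>tst \<kappa> x z\<bar> \<le> 2 * c" for x z
    using c(2)[of "x - z"] c(2)[of "x - Rf z"] unfolding tst_def by linarith
  then show ?thesis using c(1) by (intro that[of "2 * c"]) auto
qed

lemma tst_borel [measurable]: "ker \<delta> \<kappa> ==> tst \<kappa> x \<in> borel_measurable borel"
  by (intro smooth_borel tst_smooth ker_smooth)

text \<open>For a kernel that is invariant under the reflection this is the function \<open>F\<close>, extended by odd reflection and mollified in the horizontal variable only.\<close>

definition pair :: "('a \<times> real => real) => ('a => real) => 'a => real => real" where
  "pair F \<kappa> x y = sect F (tst \<kappa> x) y"

text \<open>The test function centred at \<open>x\<close> vanishes near the round part of the lateral boundary. A uniform gap \<open>\<tau>' < \<tau>\<close> is required so that nothing is lost at the boundary of the ball.\<close>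

definition adm :: "'a => real => bool" where
  "adm x \<delta> \<longleftrightarrow> (\<exists>\<tau>'<\<tau>. \<forall>z. 0 \<le> z \<bullet> e --> \<tau>' \<le> norm z --> \<delta> < norm (x - z) \<and> \<delta> < norm (x - Rf z))"

lemma tst_out:
  assumes "ker \<delta> \<kappa>" "\<delta> < norm (x - z)" "\<delta> < norm (x - Rf z)"
  shows "tst \<kappa> x z = 0" and "i \<in> Basis ==> pd i (tst \<kappa> x) z = 0"
proof -
  show "tst \<kappa> x z = 0" using assms by (simp add: tst_def ker_def)
  assume i: "i \<in> Basis"
  have "pd a \<kappa> (x - z) = 0" "pd a \<kappa> (x - Rf z) = 0" if "a \<in> Basis" for a
    using ker_pd[OF assms(1) that] assms by (auto simp: ker_def)
  then show "pd i (tst \<kappa> x) z = 0"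
    using i by (simp add: pd_tst[OF ker_smooth[OF assms(1)]])
qed

lemma polynomial_bounded:
  assumes "real_polynomial_function (p :: real => real)"
  obtains c where "\<And>y. y \<in> {0<..<\<tau>} ==> \<bar>p y\<bar> \<le> c"
proof -
  obtain C where "0 \<le> C" "\<And>x. x \<in> cball 0 \<tau> ==> \<bar>p x\<bar> \<le> C"
    using smooth_bounded_on_cball[OF real_polynomial_function_smooth[OF assms]] by metis
  then show ?thesis by (intro that[of C]) auto
qed

text \<open>Test the equation with \<open>tst \<kappa> x\<close> times a polynomial, then move both horizontal derivatives to the kernel. For fixed \<open>x\<close> an ordinary differential equation in \<open>y\<close> remains.\<close>

lemma pair_weak_equation:
  assumes \<kappa>: "ker \<delta> \<kappa>" and x: "adm x \<delta>" and p: "real_polynomial_function \<zeta>" "real_polynomial_function \<zeta>'"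
    and d: "\<And>t. (\<zeta> has_real_derivative \<zeta>' t) (at t)" and 0: "\<zeta> \<tau> = 0"
  shows "(LBINT y. m y * (pair h \<kappa> x y * \<zeta>' y)) = (LBINT y. m y * (pair v (Lop \<kappa>) x y * \<zeta> y))"
proof -
  define \<eta> where "\<eta> = tst \<kappa> x"
  have sm: "smooth \<eta>" unfolding \<eta>_def by (intro tst_smooth ker_smooth[OF \<kappa>])
  define \<eta>k where "\<eta>k k z = (\<Sum>i\<in>Basis. (B k \<bullet> i) * pd i \<eta> z)" for k z
  have smk: "smooth (\<eta>k k)" for k
    unfolding \<eta>k_def[abs_def] by (intro smooth_sum smooth_mult smooth_const smooth_pd sm)
  obtain \<tau>' where \<tau>': "\<tau>' < \<tau>" and out: "\<And>z. 0 \<le> z \<bullet> e ==> \<tau>' \<le> norm z ==> \<delta> < norm (x - z) \<and> \<delta> < norm (x - Rf z)"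
    using x by (auto simp: adm_def)
  have z0: "\<eta> z = 0" "\<eta>k k z = 0" if "0 \<le> z \<bullet> e" "\<tau>' \<le> norm z" for z k
    using tst_out[OF \<kappa>, of x z] out[OF that] by (auto simp: \<eta>_def \<eta>k_def)
  note [measurable] = smooth_borel[OF sm] smooth_borel[OF smk]
  have [measurable]: "\<zeta> \<in> borel_measurable borel" "\<zeta>' \<in> borel_measurable borel"
    using p by (auto intro: smooth_borel real_polynomial_function_smooth)
  obtain c1 c2 where c12: "\<And>y. y \<in> {0<..<\<tau>} ==> \<bar>\<zeta> y\<bar> \<le> c1" "\<And>y. y \<in> {0<..<\<tau>} ==> \<bar>\<zeta>' y\<bar> \<le> c2"
    using polynomial_bounded p by metis
  have "\<forall>k. \<exists>c. \<forall>z\<in>cball 0 \<tau>. \<bar>\<eta>k k z\<bar> \<le> c" using smooth_bounded_on_cball[OF smk] by metis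
  then obtain ck where ck: "\<And>k z. z \<in> cball 0 \<tau> ==> \<bar>\<eta>k k z\<bar> \<le> ck k" by metis
  obtain c0 where c0: "\<And>z. z \<in> cball 0 \<tau> ==> \<bar>\<eta> z\<bar> \<le> c0" using smooth_bounded_on_cball[OF sm] by metis
  have tg: "integrable lborel (\<lambda>X. m (snd X) * ((g X \<bullet> k) * \<eta>k k (fst X) * \<zeta> (snd X)))"
    "(LBINT X. m (snd X) * ((g X \<bullet> k) * \<eta>k k (fst X) * \<zeta> (snd X))) = (LBINT y. m y * (sect (\<lambda>X. g X \<bullet> k) (\<eta>k k) y * \<zeta> y))"
    "integrable lborel (\<lambda>y. m y * (sect (\<lambda>X. g X \<bullet> k) (\<eta>k k) y * \<zeta> y))" if "k \<in> Basis" for k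
    using tensor_integral[of "\<lambda>X. g X \<bullet> k" "\<eta>k k" \<zeta> "ck k" c1] g_L2[OF that] ck[OF D_bounded] c12(1) by simp_all
  have th: "integrable lborel (\<lambda>X. m (snd X) * (h X * \<eta> (fst X) * \<zeta>' (snd X)))"
    "(LBINT X. m (snd X) * (h X * \<eta> (fst X) * \<zeta>' (snd X))) = (LBINT y. m y * (sect h \<eta> y * \<zeta>' y))"
    using tensor_integral[of h \<eta> \<zeta>' c0 c2] h_L2 c0[OF D_bounded] c12(2) by simp_all
  have E: "(\<Sum>i\<in>Basis. (B (g X) \<bullet> i) * pd i \<eta> (fst X)) = (\<Sum>k\<in>Basis. (g X \<bullet> k) * \<eta>k k (fst X))" for X
  proof -
    have "(\<Sum>i\<in>Basis. (B (g X) \<bullet> i) * pd i \<eta> (fst X)) = (\<Sum>i\<in>Basis. \<Sum>k\<in>Basis. (g X \<bullet> k) * (B i \<bullet> k) * pd i \<eta> (fst X))"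
      by (simp add: B_sym euclidean_inner[of "g X" "B _"] sum_distrib_right)
    also have "\<dots> = (\<Sum>k\<in>Basis. \<Sum>i\<in>Basis. (g X \<bullet> k) * (B i \<bullet> k) * pd i \<eta> (fst X))"
      by (rule sum.swap)
    also have "\<dots> = (\<Sum>k\<in>Basis. (g X \<bullet> k) * \<eta>k k (fst X))"
    proof -
      have sw: "B i \<bullet> k = B k \<bullet> i" for i k by (metis B_sym inner_commute)
      show ?thesis unfolding \<eta>k_def sum_distrib_left by (intro sum.cong refl) (metis sw mult.assoc)
    qed
    finally show ?thesis .
  qed
  have "0 = (\<integral> X. m (snd X) * ((\<Sum>i\<in>Basis. (B (g X) \<bullet> i) * pd i \<eta> (fst X)) * \<zeta> (snd X)
          + h X * \<eta> (fst X) * \<zeta>' (snd X)) \<partial>lborel)"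
    by (rule weak[symmetric, OF sm _ _ p(1) d 0]) (use z0 \<tau>' in \<open>auto simp: \<eta>_def tst_flat\<close>)
  also have "\<dots> = (\<integral> X. (\<Sum>k\<in>Basis. m (snd X) * ((g X \<bullet> k) * \<eta>k k (fst X) * \<zeta> (snd X)))
          + m (snd X) * (h X * \<eta> (fst X) * \<zeta>' (snd X)) \<partial>lborel)"
    unfolding E by (intro Bochner_Integration.integral_cong) (simp_all add: algebra_simps sum_distrib_left)
  also have "\<dots> = (\<Sum>k\<in>Basis. \<integral> X. m (snd X) * ((g X \<bullet> k) * \<eta>k k (fst X) * \<zeta> (snd X)) \<partial>lborel)
          + (LBINT X. m (snd X) * (h X * \<eta> (fst X) * \<zeta>' (snd X)))"
  proof (subst Bochner_Integration.integral_add)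
    show "(LBINT X. (\<Sum>k\<in>Basis. m (snd X) * ((g X \<bullet> k) * \<eta>k k (fst X) * \<zeta> (snd X))))
          + (LBINT X. m (snd X) * (h X * \<eta> (fst X) * \<zeta>' (snd X)))
        = (\<Sum>k\<in>Basis. \<integral> X. m (snd X) * ((g X \<bullet> k) * \<eta>k k (fst X) * \<zeta> (snd X)) \<partial>lborel)
          + (LBINT X. m (snd X) * (h X * \<eta> (fst X) * \<zeta>' (snd X)))"
      by (subst Bochner_Integration.integral_sum) (auto intro!: tg(1))
  qed (auto intro!: tg(1) th(1) Bochner_Integration.integrable_sum)
  also have "\<dots> = (\<Sum>k\<in>Basis. \<integral> y. m y * (sect (\<lambda>X. g X \<bullet> k) (\<eta>k k) y * \<zeta> y) \<partial>lborel)
          + (LBINT y. m y * (sect h \<eta> y * \<zeta>' y))"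
    using tg(2) th(2) by simp
  also have "(\<Sum>k\<in>Basis. \<integral> y. m y * (sect (\<lambda>X. g X \<bullet> k) (\<eta>k k) y * \<zeta> y) \<partial>lborel)
      = (LBINT y. (\<Sum>k\<in>Basis. m y * (sect (\<lambda>X. g X \<bullet> k) (\<eta>k k) y * \<zeta> y)))"
    by (rule Bochner_Integration.integral_sum[symmetric]) (rule tg(3))
  also have "\<dots> = (LBINT y. - (m y * (pair v (Lop \<kappa>) x y * \<zeta> y)))"
  proof (rule integral_cong_AE)
    have *: "AE y in lborel. \<forall>k\<in>Basis. y \<in> {0<..<\<tau>} --> sect v (pd k (\<eta>k k)) y = - sect (\<lambda>X. g X \<bullet> k) (\<eta>k k) y"
      by (rule AE_finite_allI[OF finite_Basis], rule sect_integration_by_parts[OF smk \<tau>' z0(2)])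
    show "AE y in lborel. (\<Sum>k\<in>Basis. m y * (sect (\<lambda>X. g X \<bullet> k) (\<eta>k k) y * \<zeta> y)) = - (m y * (pair v (Lop \<kappa>) x y * \<zeta> y))"
      using *
    proof eventually_elim
      case (elim y)
      show ?case
      proof (cases "y \<in> {0<..<\<tau>}")
        case True
        have smpd: "smooth (pd k (\<eta>k k))" if "k \<in> Basis" for k using smooth_pd[OF smk that] .
        have int: "integrable lborel (\<lambda>z. v (z, y) * pd k (\<eta>k k) z)" if k: "k \<in> Basis" for k
        proof -
          obtain c where c: "\<And>z. z \<in> cball 0 \<tau> ==> \<bar>pd k (\<eta>k k) z\<bar> \<le> c"
            using smooth_bounded_on_cball[OF smpd[OF k]] by metis
          show ?thesis by (rule sect_integrand(1)[OF v_L2 smooth_borel[OF smpd[OF k]] c[OF D_bounded]])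
        qed
        have "(\<Sum>k\<in>Basis. pd k (\<eta>k k) z) = tst (Lop \<kappa>) x z" for z
          unfolding Lop_tst[OF ker_smooth[OF \<kappa>], symmetric] \<eta>_def[symmetric] Lop_def \<eta>k_def[abs_def]
          by (intro sum.cong refl pd_lincomb smooth_pd sm)
        then have "pair v (Lop \<kappa>) x y = (LBINT z. (\<Sum>k\<in>Basis. v (z, y) * pd k (\<eta>k k) z))"
          unfolding pair_def sect_def by (simp add: sum_distrib_left[symmetric])
        also have "\<dots> = (\<Sum>k\<in>Basis. sect v (pd k (\<eta>k k)) y)"
          unfolding sect_def using int by (simp add: Bochner_Integration.integral_sum)
        also have "\<dots> = - (\<Sum>k\<in>Basis. sect (\<lambda>X. g X \<bullet> k) (\<eta>k k) y)"
          using elim True by (simp add: sum_negf)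
        finally show ?thesis by (simp add: sum_distrib_left sum_distrib_right)
      qed (simp add: m_zero)
    qed
    show "(\<lambda>y. \<Sum>k\<in>Basis. m y * (sect (\<lambda>X. g X \<bullet> k) (\<eta>k k) y * \<zeta> y)) \<in> borel_measurable lborel"
      using sect_borel[OF g_L2] by measurable
    show "(\<lambda>y. - (m y * (pair v (Lop \<kappa>) x y * \<zeta> y))) \<in> borel_measurable lborel"
      unfolding pair_def using tst_borel[OF ker_Lop[OF \<kappa>]] sect_borel[OF v_L2] by measurable
  qed
  finally show ?thesis by (simp add: pair_def \<eta>_def)
qed

end

section \<open>The ordinary differential equation in y\<close>

context half_cylinder_weight
begin

lemma mass_product_integrable:
  assumes F: "wL2 F" and G: "wL2 G"
  shows "integrable lborel (\<lambda>y. mass F y * mass G y * m y)"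
proof -
  note [measurable] = mass_borel[OF F] mass_borel[OF G]
  show ?thesis
proof (rule Bochner_Integration.integrable_bound)
  show "integrable lborel (\<lambda>y. (mass F y)\<^sup>2 * m y + (mass G y)\<^sup>2 * m y)"
    using mass_square_integrable F G by simp
  have "mass F y * mass G y \<le> (mass F y)\<^sup>2 + (mass G y)\<^sup>2" for y
    using sum_squares_bound[of "mass F y" "mass G y"] mass_nonneg[of F y] mass_nonneg[of G y]
      mult_nonneg_nonneg[of "mass F y" "mass G y"] by linarith
  from mult_right_mono[OF this m_nonneg]
  show "AE y in lborel. norm (mass F y * mass G y * m y) \<le> norm ((mass F y)\<^sup>2 * m y + (mass G y)\<^sup>2 * m y)"
    using mass_nonneg m_nonneg by (auto simp: algebra_simps)
qed measurable
qed

end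

context mixed_solution
begin

lemma pair_borel: "wL2 F ==> ker \<delta> \<kappa> ==> pair F \<kappa> x \<in> borel_measurable borel"
  unfolding pair_def[abs_def] by (intro sect_borel tst_borel)

lemma pair_integrable:
  assumes "wL2 F" "ker \<delta> \<kappa>"
  shows "integrable lborel (pair F \<kappa> x)" "integrable lborel (\<lambda>y. pair F \<kappa> x y * m y)"
    "integrable lborel (\<lambda>y. (pair F \<kappa> x y)\<^sup>2 * m y)"
proof -
  obtain c where "0 \<le> c" and c: "\<And>x z. \<bar>tst \<kappa> x z\<bar> \<le> c" using tst_bounded[OF assms(2)] by metis
  from sect_integrable[OF assms(1) tst_borel[OF assms(2)] c]
  show "integrable lborel (pair F \<kappa> x)" "integrable lborel (\<lambda>y. pair F \<kappa> x y * m y)"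
    "integrable lborel (\<lambda>y. (pair F \<kappa> x y)\<^sup>2 * m y)"
    unfolding pair_def[abs_def] by simp_all
qed

lemma pair_bound:
  assumes "ker \<delta> \<kappa>"
  obtains c where "0 \<le> c" "\<And>F x y. wL2 F ==> \<bar>pair F \<kappa> x y\<bar> \<le> c * mass F y"
proof -
  obtain c where "0 \<le> c" and c: "\<And>x z. \<bar>tst \<kappa> x z\<bar> \<le> c" using tst_bounded[OF assms] by metis
  show ?thesis
    by (rule that[of c]) (use \<open>0 \<le> c\<close> sect_integrand(2)[OF _ tst_borel[OF assms] c] in \<open>auto simp: pair_def\<close>)
qed

lemma pair_zero: "wL2 F ==> y \<notin> {0<..<\<tau>} ==> pair F \<kappa> x y = 0"
  by (simp add: pair_def sect_zero)

text \<open>The integrated form of the equation in \<open>y\<close>: the flux through height \<open>y\<close> is the integral of the horizontal operator below \<open>y\<close>. There is no constant of integration, because the test polynomials are free at \<open>y = 0\<close>. This identity is what later bounds the vertical derivative pointwise.\<close>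

lemma pair_conormal:
  assumes \<kappa>: "ker \<delta> \<kappa>" and x: "adm x \<delta>"
  shows "AE y in lborel. y \<in> {0<..<\<tau>} -->
    m y * pair h \<kappa> x y = - (LBINT s. indicator {..y} s * (pair v (Lop \<kappa>) x s * m s))"
proof -
  define Y where "Y = pair h \<kappa> x"
  define N where "N = pair v (Lop \<kappa>) x"
  note iY = pair_integrable[OF h_L2 \<kappa>, of x, folded Y_def]
  note iN = pair_integrable[OF v_L2 ker_Lop[OF \<kappa>], of x, folded N_def]
  define a where "a s = N s * m s" for s
  have ia: "integrable lborel a" unfolding a_def[abs_def] by (rule iN(2))
  have [measurable]: "Y \<in> borel_measurable borel" "N \<in> borel_measurable borel" "a \<in> borel_measurable borel"
    using iY(1) iN(1) ia by auto
  define P where "P y = (LBINT s. indicator {..y} s * a s)" for y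
  have P_if: "P = (\<lambda>y. \<integral> s. (if s \<le> y then a s else 0) \<partial>lborel)"
    unfolding P_def by (intro ext Bochner_Integration.integral_cong) (auto simp: indicator_def)
  have [measurable]: "P \<in> borel_measurable borel" unfolding P_if by measurable
  define H where "H y = indicator {0<..<\<tau>} y * (m y * Y y + P y)" for y
  have iP: "integrable lborel (\<lambda>y. P y * (indicator {0<..<\<tau>} y * c y))" if "integrable lborel (\<lambda>y. indicator {0<..<\<tau>} y * c y)" for c
    unfolding P_def by (rule Fubini_primitives(2)[OF ia that])
  have i1: "integrable lborel (\<lambda>y. indicator {0<..<\<tau>} y * (1::real))"
  proof -
    have "integrable lborel (indicator {0<..<\<tau>} :: real => real)"
      by (rule integrable_real_indicator) (use tau_pos in auto)
    then show ?thesis by (simp only: mult_1_right)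
  qed
  have imY: "integrable lborel (\<lambda>y. m y * Y y)"
  proof -
    have "(\<lambda>y. m y * Y y) = (\<lambda>y. Y y * m y)" by (intro ext mult.commute)
    then show ?thesis using iY(2) by (simp only:)
  qed
  have H_eq: "H y = m y * Y y + P y * (indicator {0<..<\<tau>} y * 1)" for y
    by (simp add: H_def m_zero indicator_def)
  have iH: "integrable lborel H"
    unfolding H_eq[abs_def] by (intro Bochner_Integration.integrable_add imY iP i1)
  have ort_poly: "(LBINT y. H y * p y) = 0" if p: "real_polynomial_function p" for p
  proof -
    obtain \<zeta> where \<zeta>: "real_polynomial_function \<zeta>" "\<And>t. (\<zeta> has_real_derivative p t) (at t)" "\<zeta> \<tau> = 0"
      using real_polynomial_antiderivative[OF p] by metis
    have cp: "continuous_on A p" for A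
      using real_polynomial_function_smooth[OF p] by (rule smooth_continuous)
    define b where "b y = indicator {0<..<\<tau>} y * p y" for y
    have ib: "integrable lborel b"
    proof -
      have "integrable lborel (\<lambda>y. indicator {0<..<\<tau>} y *\<^sub>R (indicator {0..\<tau>} y *\<^sub>R p y))"
        by (rule integrable_mult_indicator)
           (use borel_integrable_atLeastAtMost'[OF cp, of 0 \<tau>] in \<open>simp_all add: set_integrable_def\<close>)
      also have "(\<lambda>y. indicator {0<..<\<tau>} y *\<^sub>R (indicator {0..\<tau>} y *\<^sub>R p y)) = b"
        by (auto simp: b_def fun_eq_iff indicator_def)
      finally show ?thesis .
    qed
    have tail: "(LBINT y. indicator {s..} y * b y) = - \<zeta> s" if s: "s \<in> {0<..<\<tau>}" for s
    proof -
      have "(LBINT y. indicator {s..} y * b y) = (LBINT y. indicator {s..\<tau>} y *\<^sub>R p y)"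
      proof (rule integral_cong_AE)
        have "AE y in lborel. y \<noteq> \<tau>" by (rule AE_lborel_singleton)
        then show "AE y in lborel. indicator {s..} y * b y = indicator {s..\<tau>} y *\<^sub>R p y"
          by eventually_elim (use s in \<open>auto simp: b_def indicator_def\<close>)
        have [measurable]: "p \<in> borel_measurable borel" using cp by (rule borel_measurable_continuous_onI)
        show "(\<lambda>y. indicator {s..} y * b y) \<in> borel_measurable lborel" using ib by measurable
        show "(\<lambda>y. indicator {s..\<tau>} y *\<^sub>R p y) \<in> borel_measurable lborel" by measurable
      qed
      also have "\<dots> = \<zeta> \<tau> - \<zeta> s"
        using s by (intro integral_FTC_atLeastAtMost cp)
          (auto intro!: has_field_derivative_at_within \<zeta> simp: has_real_derivative_iff_has_vector_derivative[symmetric])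
      finally show ?thesis using \<zeta>(3) by simp
    qed
    have imYp: "integrable lborel (\<lambda>y. m y * (Y y * p y))"
    proof -
      obtain c where c: "\<And>y. y \<in> {0<..<\<tau>} ==> \<bar>p y\<bar> \<le> c" using polynomial_bounded[OF p] by metis
      obtain c0 where "0 \<le> c0" and c0: "\<And>x z. \<bar>tst \<kappa> x z\<bar> \<le> c0" using tst_bounded[OF \<kappa>] by metis
      have [measurable]: "p \<in> borel_measurable borel" using cp by (rule borel_measurable_continuous_onI)
      show ?thesis unfolding Y_def pair_def
        by (rule tensor_integral(3)[OF h_L2 tst_borel[OF \<kappa>] _ c0 c]) simp_all
    qed
    have "(LBINT y. H y * p y) = (LBINT y. m y * (Y y * p y) + P y * b y)"
      by (intro Bochner_Integration.integral_cong) (auto simp: H_eq b_def algebra_simps)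
    also have "\<dots> = (LBINT y. m y * (Y y * p y)) + (LBINT y. P y * b y)"
      using iP[of p] ib by (intro Bochner_Integration.integral_add imYp) (simp add: b_def[abs_def])
    also have "(LBINT y. P y * b y) = (\<integral> s. a s * (LBINT y. indicator {s..} y * b y) \<partial>lborel)"
      unfolding P_def by (rule Fubini_primitives(1)[OF ia ib])
    also have "\<dots> = (LBINT s. - (m s * (N s * \<zeta> s)))"
    proof (intro Bochner_Integration.integral_cong refl)
      fix s show "a s * (LBINT y. indicator {s..} y * b y) = - (m s * (N s * \<zeta> s))"
        using tail[of s] m_zero[of s] by (cases "s \<in> {0<..<\<tau>}") (auto simp: a_def)
    qed
    also have "\<dots> = - (LBINT y. m y * (Y y * p y))"
      using pair_weak_equation[OF \<kappa> x \<zeta>(1) p \<zeta>(2,3)] by (simp add: N_def Y_def)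
    finally show ?thesis by simp
  qed
  have "AE y in lborel. H y = 0"
  proof (rule AE_zero_if_orthogonal_to_continuous[OF iH])
    fix c :: "real => real" assume c: "continuous_on UNIV c" and c1: "\<And>x. \<bar>c x\<bar> \<le> 1"
    have [measurable]: "c \<in> borel_measurable borel" using c by (rule borel_measurable_continuous_onI)
    have [measurable]: "H \<in> borel_measurable borel" using iH by auto
    have iHc: "integrable lborel (\<lambda>y. H y * c y)"
      by (rule Bochner_Integration.integrable_bound[OF iH]) (auto simp: abs_mult intro!: mult_right_le_one_le c1)
    define J where "J = (LBINT y. \<bar>H y\<bar>)"
    have J0: "J \<ge> 0" by (simp add: J_def)
    have small: "\<bar>\<integral> y. H y * c y \<partial>lborel\<bar> \<le> \<epsilon> * J" if \<epsilon>: "\<epsilon> > 0" for \<epsilon>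
    proof -
      obtain p where p: "real_polynomial_function p" "\<And>y. y \<in> {0..\<tau>} ==> \<bar>c y - p y\<bar> < \<epsilon>"
        using Stone_Weierstrass_real_polynomial_function[of "{0..\<tau>}" c \<epsilon>] c \<epsilon>
        by (metis compact_Icc continuous_on_subset subset_UNIV)
      have [measurable]: "p \<in> borel_measurable borel"
        by (intro smooth_borel real_polynomial_function_smooth p)
      have pt: "\<bar>H y * (c y - p y)\<bar> \<le> \<epsilon> * \<bar>H y\<bar>" for y
      proof (cases "y \<in> {0<..<\<tau>}")
        case True
        then have "\<bar>c y - p y\<bar> \<le> \<epsilon>" using p(2)[of y] by auto
        then have "\<bar>c y - p y\<bar> * \<bar>H y\<bar> \<le> \<epsilon> * \<bar>H y\<bar>" by (intro mult_right_mono) auto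
        then show ?thesis by (simp add: abs_mult mult.commute)
      qed (simp add: H_def)
      have id: "integrable lborel (\<lambda>y. H y * (c y - p y))"
        by (rule Bochner_Integration.integrable_bound[OF integrable_mult_right[OF integrable_abs[OF iH], of \<epsilon>]])
           (use pt \<epsilon> in auto)
      have ip: "integrable lborel (\<lambda>y. H y * p y)"
        using Bochner_Integration.integrable_diff[OF iHc id] by (simp add: algebra_simps)
      have "(LBINT y. H y * c y) = (LBINT y. H y * (c y - p y)) + (LBINT y. H y * p y)"
        using Bochner_Integration.integral_add[OF id ip] by (simp add: algebra_simps)
      then have "\<bar>\<integral> y. H y * c y \<partial>lborel\<bar> = \<bar>\<integral> y. H y * (c y - p y) \<partial>lborel\<bar>" using ort_poly[OF p(1)] by simp
      also have "\<dots> \<le> (LBINT y. \<bar>H y * (c y - p y)\<bar>)" by (rule integral_abs_bound)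
      also have "\<dots> \<le> (LBINT y. \<epsilon> * \<bar>H y\<bar>)"
        using pt by (intro integral_mono integrable_abs[OF id] integrable_mult_right integrable_abs[OF iH]) auto
      finally show ?thesis by (simp add: J_def)
    qed
    show "(LBINT y. H y * c y) = 0"
    proof (rule ccontr)
      define I where "I = \<bar>\<integral> y. H y * c y \<partial>lborel\<bar>"
      assume "(LBINT y. H y * c y) \<noteq> 0"
      then have "I > 0" by (simp add: I_def)
      then have "I \<le> I / (2 * (J + 1)) * J" using small[of "I / (2 * (J + 1))"] J0 by (simp add: I_def)
      then have "I * (2 * (J + 1)) \<le> I * J" using J0 by (simp add: field_simps)
      then show False using \<open>I > 0\<close> J0 by (simp add: mult_le_cancel_left)
    qed
  qed
  then show ?thesis
    by eventually_elim (auto simp: H_def P_def a_def Y_def N_def)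
qed

lemma ycut_m_bounds:
  assumes "S \<le> \<tau>"
  shows "\<bar>ycut S y * m y\<bar> \<le> \<tau>\<^sup>2 * m y" "\<bar>ycut' S y * m y\<bar> \<le> 2 * \<tau> * m y"
proof -
  have "\<bar>ycut S y\<bar> * m y \<le> \<tau>\<^sup>2 * m y \<and> \<bar>ycut' S y\<bar> * m y \<le> 2 * \<tau> * m y"
  proof (cases "y \<in> {0<..<\<tau>}")
    case True
    then show ?thesis
      using ycut_bounds[of y S] assms m_nonneg[of y] by (intro conjI mult_right_mono) auto
  qed (simp add: m_zero)
  then show "\<bar>ycut S y * m y\<bar> \<le> \<tau>\<^sup>2 * m y" "\<bar>ycut' S y * m y\<bar> \<le> 2 * \<tau> * m y"
    using m_nonneg[of y] by (simp_all add: abs_mult)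
qed

text \<open>Multiply the equation in \<open>y\<close> by \<open>ycut S y\<close> times \<open>pair v \<kappa> x y\<close> and integrate by parts; the primitives are handled by \<open>Fubini_primitives\<close>.\<close>

lemma section_energy_identity:
  assumes \<kappa>: "ker \<delta> \<kappa>" and x: "adm x \<delta>" and S: "S \<le> \<tau>"
  shows "(\<integral> y. ycut S y * (pair h \<kappa> x y)\<^sup>2 * m y + ycut' S y * (pair v \<kappa> x y * pair h \<kappa> x y) * m y
      - ycut S y * (pair v (Lop \<kappa>) x y * pair v \<kappa> x y) * m y \<partial>lborel) = 0"
proof -
  define W where "W = pair v \<kappa> x"
  define Y where "Y = pair h \<kappa> x"
  define N where "N = pair v (Lop \<kappa>) x"
  note iW = pair_integrable[OF v_L2 \<kappa>, of x, folded W_def]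
  note iY = pair_integrable[OF h_L2 \<kappa>, of x, folded Y_def]
  note iN = pair_integrable[OF v_L2 ker_Lop[OF \<kappa>], of x, folded N_def]
  have [measurable]: "W \<in> borel_measurable borel" "Y \<in> borel_measurable borel" "N \<in> borel_measurable borel"
    using iW(1) iY(1) iN(1) by auto
  have i2: "integrable lborel (\<lambda>y. q y * (U y * V y) * m y)"
    if "integrable lborel (\<lambda>y. (U y)\<^sup>2 * m y)" "integrable lborel (\<lambda>y. (V y)\<^sup>2 * m y)"
      "\<And>y. \<bar>q y * m y\<bar> \<le> c * m y" "0 \<le> c" and [measurable]: "U \<in> borel_measurable borel" "V \<in> borel_measurable borel" "q \<in> borel_measurable borel"
    for U V q :: "real => real" and c
  proof (rule Bochner_Integration.integrable_bound)
    show "integrable lborel (\<lambda>y. c * ((U y)\<^sup>2 * m y + (V y)\<^sup>2 * m y))" using that by simp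
    have "\<bar>q y * (U y * V y) * m y\<bar> \<le> c * ((U y)\<^sup>2 * m y + (V y)\<^sup>2 * m y)" for y
    proof -
      have "\<bar>U y * V y\<bar> \<le> (U y)\<^sup>2 + (V y)\<^sup>2"
        using sum_squares_bound[of "\<bar>U y\<bar>" "\<bar>V y\<bar>"] mult_nonneg_nonneg[of "\<bar>U y\<bar>" "\<bar>V y\<bar>"]
        by (simp add: abs_mult del: mult_nonneg_nonneg)
      then have "\<bar>q y * m y\<bar> * \<bar>U y * V y\<bar> \<le> (c * m y) * ((U y)\<^sup>2 + (V y)\<^sup>2)"
        using that(3,4) m_nonneg[of y] by (intro mult_mono) auto
      then show ?thesis by (simp add: abs_mult algebra_simps)
    qed
    then show "AE y in lborel. norm (q y * (U y * V y) * m y) \<le> norm (c * ((U y)\<^sup>2 * m y + (V y)\<^sup>2 * m y))"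
      by (auto intro!: AE_I2 order_trans[OF _ abs_ge_self])
  qed measurable
  have j1: "integrable lborel (\<lambda>y. ycut S y * (Y y * Y y) * m y)"
    using tau_pos by (intro i2[OF iY(3) iY(3) ycut_m_bounds(1)[OF S]]) auto
  have j2: "integrable lborel (\<lambda>y. ycut' S y * (W y * Y y) * m y)"
    using tau_pos by (intro i2[OF iW(3) iY(3) ycut_m_bounds(2)[OF S]]) auto
  have j3: "integrable lborel (\<lambda>y. ycut S y * (N y * W y) * m y)"
    using tau_pos by (intro i2[OF iN(3) iW(3) ycut_m_bounds(1)[OF S]]) auto
  define a where "a s = N s * m s" for s
  have ia: "integrable lborel a" unfolding a_def[abs_def] by (rule iN(2))
  define \<Phi> where "\<Phi> s = ycut' S s * W s + ycut S s * Y s" for s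
  have W0: "W y = 0" "Y y = 0" if "y \<notin> {0<..<\<tau>}" for y
    using that pair_zero[OF v_L2] pair_zero[OF h_L2] by (auto simp: W_def Y_def)
  have i\<Phi>: "integrable lborel \<Phi>"
  proof (rule Bochner_Integration.integrable_bound)
    show "integrable lborel (\<lambda>y. 2 * \<tau> * \<bar>W y\<bar> + \<tau>\<^sup>2 * \<bar>Y y\<bar>)" using iW(1) iY(1) by simp
    have "\<bar>\<Phi> y\<bar> \<le> 2 * \<tau> * \<bar>W y\<bar> + \<tau>\<^sup>2 * \<bar>Y y\<bar>" for y
    proof (cases "y \<in> {0<..<\<tau>}")
      case True
      then have "\<bar>ycut' S y\<bar> * \<bar>W y\<bar> \<le> 2 * \<tau> * \<bar>W y\<bar>" "\<bar>ycut S y\<bar> * \<bar>Y y\<bar> \<le> \<tau>\<^sup>2 * \<bar>Y y\<bar>"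
        using ycut_bounds[of y S] S by (auto intro!: mult_right_mono)
      then show ?thesis
        using abs_triangle_ineq[of "ycut' S y * W y" "ycut S y * Y y"] by (simp add: \<Phi>_def abs_mult)
    qed (simp add: \<Phi>_def W0)
    then show "AE y in lborel. norm (\<Phi> y) \<le> norm (2 * \<tau> * \<bar>W y\<bar> + \<tau>\<^sup>2 * \<bar>Y y\<bar>)"
      by (auto intro!: AE_I2 order_trans[OF _ abs_ge_self])
    show "\<Phi> \<in> borel_measurable lborel" unfolding \<Phi>_def[abs_def] by measurable
  qed
  obtain c0 where c0: "\<And>x z. \<bar>tst \<kappa> x z\<bar> \<le> c0" using tst_bounded[OF \<kappa>] by metis
  have "(LBINT y. ycut S y * (Y y)\<^sup>2 * m y + ycut' S y * (W y * Y y) * m y)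
      = (\<integral> y. - ((LBINT s. indicator {..y} s * a s) * \<Phi> y) \<partial>lborel)"
  proof (rule integral_cong_AE)
    show "AE y in lborel. ycut S y * (Y y)\<^sup>2 * m y + ycut' S y * (W y * Y y) * m y = - ((LBINT s. indicator {..y} s * a s) * \<Phi> y)"
      using pair_conormal[OF \<kappa> x]
    proof eventually_elim
      case (elim y)
      show ?case
      proof (cases "y \<in> {0<..<\<tau>}")
        case True
        then have "m y * Y y = - (LBINT s. indicator {..y} s * a s)" using elim by (simp add: Y_def a_def N_def)
        then have "- ((LBINT s. indicator {..y} s * a s) * \<Phi> y) = m y * Y y * \<Phi> y" by simp
        then show ?thesis by (simp add: \<Phi>_def algebra_simps power2_eq_square)
      qed (simp add: W0 \<Phi>_def)
    qed
    show "(\<lambda>y. - ((LBINT s. indicator {..y} s * a s) * \<Phi> y)) \<in> borel_measurable lborel"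
      using Fubini_primitives(2)[OF ia i\<Phi>] by measurable
  qed measurable
  also have "\<dots> = - (\<integral> s. a s * (LBINT y. indicator {s..} y * \<Phi> y) \<partial>lborel)"
    using Fubini_primitives(1)[OF ia i\<Phi>] by simp
  also have "(\<integral> s. a s * (LBINT y. indicator {s..} y * \<Phi> y) \<partial>lborel) = (LBINT s. - (ycut S s * (N s * W s) * m s))"
  proof (rule integral_cong_AE)
    show "AE s in lborel. a s * (LBINT y. indicator {s..} y * \<Phi> y) = - (ycut S s * (N s * W s) * m s)"
      using sect_absolutely_continuous[OF S tst_borel[OF \<kappa>] c0, of x]
    proof eventually_elim
      case (elim s)
      show ?case
      proof (cases "s \<in> {0<..<\<tau>}")
        case True
        then have "ycut S s * W s = - (LBINT y. indicator {s..} y * \<Phi> y)"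
          using elim by (simp add: W_def Y_def pair_def \<Phi>_def)
        then have "(LBINT y. indicator {s..} y * \<Phi> y) = - (ycut S s * W s)" by simp
        then show ?thesis by (simp add: a_def)
      qed (simp add: a_def m_zero)
    qed
    show "(\<lambda>s. a s * (LBINT y. indicator {s..} y * \<Phi> y)) \<in> borel_measurable lborel"
      using Fubini_primitives(3)[OF ia i\<Phi>] by measurable
  qed measurable
  finally have "(LBINT y. ycut S y * (Y y)\<^sup>2 * m y + ycut' S y * (W y * Y y) * m y)
      = (LBINT s. ycut S s * (N s * W s) * m s)" by simp
  then show ?thesis
    using j1 j2 j3 unfolding W_def[symmetric] Y_def[symmetric] N_def[symmetric]
    by (simp add: power2_eq_square)
qed

text \<open>Differentiation in \<open>x\<close> falls on the kernel, for the kernel and for its reflection alike.\<close>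

lemma pair_derivative:
  assumes F: "wL2 F" and \<kappa>: "ker \<delta> \<kappa>" and i: "i \<in> Basis"
  shows "((\<lambda>t. pair F \<kappa> (x + t *\<^sub>R i) y) has_real_derivative pair F (pd i \<kappa>) (x + t0 *\<^sub>R i) y) (at t0)"
proof -
  obtain c where c: "\<And>x z. \<bar>tst \<kappa> x z\<bar> \<le> c" using tst_bounded[OF \<kappa>] by metis
  obtain c' where c': "\<And>x z. \<bar>tst (pd i \<kappa>) x z\<bar> \<le> c'" using tst_bounded[OF ker_pd[OF \<kappa> i]] by metis
  have d: "((\<lambda>t. tst \<kappa> (x + t *\<^sub>R i) z) has_real_derivative tst (pd i \<kappa>) (x + t *\<^sub>R i) z) (at t)" for z t
    unfolding tst_def
    using DERIV_diff[OF smooth_has_real_derivative_line[OF ker_smooth[OF \<kappa>], of "x - z" i t]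
      smooth_has_real_derivative_line[OF ker_smooth[OF \<kappa>], of "x - Rf z" i t]]
    by (simp add: algebra_simps)
  show ?thesis
    unfolding pair_def sect_def
  proof (rule has_real_derivative_under_integral[where w = "\<lambda>z. \<bar>F (z, y)\<bar> * c'"])
    show "integrable lborel (\<lambda>z. F (z, y) * tst \<kappa> (x + t *\<^sub>R i) z)" for t
      by (rule sect_integrand(1)[OF F tst_borel[OF \<kappa>] c])
    show "(\<lambda>z. F (z, y) * tst (pd i \<kappa>) (x + t0 *\<^sub>R i) z) \<in> borel_measurable lborel"
      using sect_integrand(1)[OF F tst_borel[OF ker_pd[OF \<kappa> i]] c'] by auto
    show "((\<lambda>t. F (z, y) * tst \<kappa> (x + t *\<^sub>R i) z) has_real_derivative F (z, y) * tst (pd i \<kappa>) (x + t *\<^sub>R i) z) (at t)" for z t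
      by (intro DERIV_cmult d)
    show "\<bar>F (z, y) * tst (pd i \<kappa>) (x + t *\<^sub>R i) z\<bar> \<le> \<bar>F (z, y)\<bar> * c'" for z t
      by (simp add: abs_mult mult_left_mono c')
    show "integrable lborel (\<lambda>z. \<bar>F (z, y)\<bar> * c')"
      by (intro integrable_mult_left integrable_abs wL2_section[OF F])
  qed
qed

lemma Rf_borel [measurable]: "Rf \<in> borel_measurable borel"
  by (intro borel_measurable_continuous_onI linear_continuous_on) (use Rf_linear in \<open>simp add: linear_conv_bounded_linear\<close>)

lemma pair_joint_borel:
  assumes F: "wL2 F" and \<kappa>: "ker \<delta> \<kappa>"
  shows "(\<lambda>X. pair F \<kappa> (fst X) (snd X)) \<in> borel_measurable borel"
proof -
  note [measurable] = wL2_borel[OF F] ker_borel[OF \<kappa>]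
  show ?thesis unfolding pair_def sect_def tst_def by measurable
qed

lemma pair_product_integrable:
  assumes F: "wL2 F" "ker \<delta> \<kappa>" and G: "wL2 G" "ker \<delta>' \<kappa>'"
    and [measurable]: "\<rho> \<in> borel_measurable borel"
    and \<rho>: "\<And>X. snd X \<in> {0<..<\<tau>} ==> \<bar>\<rho> X\<bar> \<le> c" "\<And>X. R < norm (fst X - x0) ==> \<rho> X = 0"
  shows "integrable lborel (\<lambda>X. \<rho> X * (pair F \<kappa> (fst X) (snd X) * pair G \<kappa>' (fst X) (snd X)) * m (snd X))"
proof -
  obtain a where a: "0 \<le> a" "\<And>x y. \<bar>pair F \<kappa> x y\<bar> \<le> a * mass F y"
    using pair_bound[OF F(2)] F(1) by metis
  obtain b where b: "0 \<le> b" "\<And>x y. \<bar>pair G \<kappa>' x y\<bar> \<le> b * mass G y"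
    using pair_bound[OF G(2)] G(1) by metis
  note [measurable] = pair_joint_borel[OF F] pair_joint_borel[OF G] mass_borel[OF F(1)] mass_borel[OF G(1)]
  have [measurable]: "cball x0 R \<in> sets borel" by simp
  let ?B = "\<lambda>X::'a \<times> real. indicator (cball x0 R) (fst X) * (\<bar>c\<bar> * a * b * (mass F (snd X) * mass G (snd X) * m (snd X)))"
  have "integrable lborel ?B"
  proof (rule integrable_lborel_pairI)
    show "integrable lborel (\<lambda>z. ?B (z, y))" for y
      using emeasure_lborel_cball_finite[of x0 R] by simp
    have e: "(LBINT z. \<bar>?B (z, y)\<bar>) = measure lborel (cball x0 R) * (\<bar>c\<bar> * a * b * (mass F y * mass G y * m y))" for y
      using a b mass_nonneg[of F y] mass_nonneg[of G y] m_nonneg[of y] by (simp add: abs_mult)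
    show "integrable lborel (\<lambda>y. \<integral> z. \<bar>?B (z, y)\<bar> \<partial>lborel)"
      unfolding e by (intro integrable_mult_right mass_product_integrable F G)
  qed measurable
  then show ?thesis
  proof (rule Bochner_Integration.integrable_bound)
    have "\<bar>\<rho> X * (pair F \<kappa> (fst X) (snd X) * pair G \<kappa>' (fst X) (snd X)) * m (snd X)\<bar> \<le> ?B X" for X
    proof (cases "R < norm (fst X - x0) \<or> snd X \<notin> {0<..<\<tau>}")
      case True
      then show ?thesis using \<rho>(2)[of X] a b mass_nonneg m_nonneg m_zero[of "snd X"] by (auto simp: indicator_def)
    next
      case False
      then have i: "fst X \<in> cball x0 R" "\<bar>\<rho> X\<bar> \<le> \<bar>c\<bar>" using \<rho>(1)[of X] by (auto simp: dist_norm norm_minus_commute)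
      have "\<bar>\<rho> X\<bar> * (\<bar>pair F \<kappa> (fst X) (snd X)\<bar> * \<bar>pair G \<kappa>' (fst X) (snd X)\<bar>) * m (snd X)
          \<le> \<bar>c\<bar> * ((a * mass F (snd X)) * (b * mass G (snd X))) * m (snd X)"
      proof -
        have "\<bar>pair F \<kappa> (fst X) (snd X)\<bar> * \<bar>pair G \<kappa>' (fst X) (snd X)\<bar> \<le> (a * mass F (snd X)) * (b * mass G (snd X))"
          by (rule mult_mono[OF a(2) b(2)]) (use a b mass_nonneg in auto)
        then have "\<bar>\<rho> X\<bar> * (\<bar>pair F \<kappa> (fst X) (snd X)\<bar> * \<bar>pair G \<kappa>' (fst X) (snd X)\<bar>) \<le> \<bar>c\<bar> * ((a * mass F (snd X)) * (b * mass G (snd X)))"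
          by (intro mult_mono[OF i(2)]) auto
        then show ?thesis by (rule mult_right_mono[OF _ m_nonneg])
      qed
      then show ?thesis using i m_nonneg[of "snd X"] by (simp add: abs_mult ac_simps)
    qed
    then show "AE X in lborel. norm (\<rho> X * (pair F \<kappa> (fst X) (snd X) * pair G \<kappa>' (fst X) (snd X)) * m (snd X)) \<le> norm (?B X)"
      by (auto intro!: AE_I2 order_trans[OF _ abs_ge_self])
  qed measurable
qed

end

section \<open>Cutoffs and the elliptic part\<close>

context mixed_solution
begin

text \<open>A cutoff that is quadratic near the boundary of the ball, so that it is continuously differentiable although it is only piecewise polynomial.\<close>

definition xcut :: "'a => real => 'a => real" where
  "xcut x0 R x = ycut (R\<^sup>2) ((norm (x - x0))\<^sup>2)"

definition xcut' :: "'a => real => 'a => 'a => real" where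
  "xcut' x0 R i x = ycut' (R\<^sup>2) ((norm (x - x0))\<^sup>2) * (2 * ((x - x0) \<bullet> i))"

lemma xcut_derivative:
  "((\<lambda>t. xcut x0 R (x + t *\<^sub>R i)) has_real_derivative xcut' x0 R i (x + t *\<^sub>R i)) (at t)"
proof -
  have "((\<lambda>t. (norm (x + t *\<^sub>R i - x0))\<^sup>2) has_real_derivative 2 * ((x + t *\<^sub>R i - x0) \<bullet> i)) (at t)"
    unfolding power2_norm_eq_inner has_field_derivative_def
    by (auto intro!: derivative_eq_intros simp: fun_eq_iff algebra_simps inner_commute)
  from DERIV_chain2[OF ycut_derivative this, of "R\<^sup>2"] show ?thesis
    unfolding xcut_def xcut'_def .
qed

lemma xcut_borel [measurable]: "xcut x0 R \<in> borel_measurable borel" "xcut' x0 R i \<in> borel_measurable borel"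
  unfolding xcut_def[abs_def] xcut'_def[abs_def] by measurable

lemma xcut_eq: "xcut x0 R x = (max 0 (R\<^sup>2 - (norm (x - x0))\<^sup>2))\<^sup>2"
  "xcut' x0 R i x = max 0 (R\<^sup>2 - (norm (x - x0))\<^sup>2) * ((- 4 *\<^sub>R (x - x0)) \<bullet> i)"
  by (simp_all add: xcut_def xcut'_def ycut_def ycut'_def)

lemma xcut_outside:
  assumes "0 < R" "R \<le> norm (x - x0)"
  shows "xcut x0 R x = 0" "xcut' x0 R i x = 0"
  using power_mono[of R "norm (x - x0)" 2] assms by (simp_all add: xcut_eq)

lemma xcut_bounds:
  assumes "0 < R" "i \<in> Basis"
  shows "0 \<le> xcut x0 R x" "\<bar>xcut x0 R x\<bar> \<le> R ^ 4" "\<bar>xcut' x0 R i x\<bar> \<le> 4 * R ^ 3"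
proof -
  have s: "0 \<le> max 0 (R\<^sup>2 - (norm (x - x0))\<^sup>2)" "max 0 (R\<^sup>2 - (norm (x - x0))\<^sup>2) \<le> R\<^sup>2" by auto
  show "0 \<le> xcut x0 R x" by (simp add: xcut_eq)
  show "\<bar>xcut x0 R x\<bar> \<le> R ^ 4"
    using power_mono[OF s(2) s(1), of 2] by (simp add: xcut_eq power_mult[symmetric])
  show "\<bar>xcut' x0 R i x\<bar> \<le> 4 * R ^ 3"
  proof (cases "norm (x - x0) < R")
    case True
    have "\<bar>(x - x0) \<bullet> i\<bar> \<le> R" using Basis_le_norm[OF assms(2), of "x - x0"] True by linarith
    then have "max 0 (R\<^sup>2 - (norm (x - x0))\<^sup>2) * \<bar>(x - x0) \<bullet> i\<bar> \<le> R\<^sup>2 * R"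
      using s by (intro mult_mono) auto
    then show ?thesis by (simp add: xcut_eq abs_mult power3_eq_cube power2_eq_square)
  qed (use xcut_outside(2)[OF assms(1), of x x0 i] assms(1) in auto)
qed

lemma integrable_bounded_support:
  fixes f :: "'a => real"
  assumes [measurable]: "f \<in> borel_measurable borel" and M: "\<And>x. \<bar>f x\<bar> \<le> M" and 0: "\<And>x. R < norm (x - x0) ==> f x = 0"
  shows "integrable lborel f"
proof (rule Bochner_Integration.integrable_bound)
  show "integrable lborel (\<lambda>x. M * indicator (cball x0 R) x)"
    using emeasure_lborel_cball_finite[of x0 R] by simp
  have "\<bar>f x\<bar> \<le> M * indicator (cball x0 R) x" for x
    using M[of x] 0[of x] by (auto simp: indicator_def dist_norm norm_minus_commute not_le)
  then show "AE x in lborel. norm (f x) \<le> norm (M * indicator (cball x0 R) x)"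
    by (auto intro!: AE_I2 order_trans[OF _ abs_ge_self])
qed simp

lemma pair_section_borel: "wL2 F ==> ker \<delta> \<kappa> ==> (\<lambda>x. pair F \<kappa> x y) \<in> borel_measurable borel"
  using measurable_compose[OF _ pair_joint_borel, of "\<lambda>x. (x, y)" borel F \<delta> \<kappa>] by simp

lemma pair_bound_section:
  assumes "wL2 F" "ker \<delta> \<kappa>"
  obtains M where "0 \<le> M" "\<And>x. \<bar>pair F \<kappa> x y\<bar> \<le> M"
proof -
  obtain c where "0 \<le> c" "\<And>x y. \<bar>pair F \<kappa> x y\<bar> \<le> c * mass F y" using pair_bound[OF assms(2)] assms(1) by metis
  then show ?thesis using mass_nonneg[of F y] by (intro that[of "c * mass F y"]) auto
qed

lemma cutoff_integration_by_parts:
  assumes F: "wL2 F" and \<kappa>: "ker \<delta> \<kappa>" and ij: "i \<in> Basis" "j \<in> Basis" and R: "0 < R"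
  shows "(\<integral> x. xcut x0 R x * (pair F (pd i (pd j \<kappa>)) x y * pair F \<kappa> x y)
      + xcut x0 R x * (pair F (pd i \<kappa>) x y * pair F (pd j \<kappa>) x y)
      + xcut' x0 R i x * (pair F \<kappa> x y * pair F (pd j \<kappa>) x y) \<partial>lborel) = 0"
proof -
  note ki = ker_pd[OF \<kappa> ij(1)] and kj = ker_pd[OF \<kappa> ij(2)]
  note kij = ker_pd[OF kj ij(1)]
  note [measurable] = pair_section_borel[OF F \<kappa>] pair_section_borel[OF F ki] pair_section_borel[OF F kj] pair_section_borel[OF F kij]
  obtain a where a: "0 \<le> a" "\<And>x. \<bar>pair F \<kappa> x y\<bar> \<le> a" using pair_bound_section[OF F \<kappa>] by metis
  obtain b where b: "0 \<le> b" "\<And>x. \<bar>pair F (pd i \<kappa>) x y\<bar> \<le> b" using pair_bound_section[OF F ki] by metis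
  obtain c where c: "0 \<le> c" "\<And>x. \<bar>pair F (pd j \<kappa>) x y\<bar> \<le> c" using pair_bound_section[OF F kj] by metis
  obtain d where d: "0 \<le> d" "\<And>x. \<bar>pair F (pd i (pd j \<kappa>)) x y\<bar> \<le> d" using pair_bound_section[OF F kij] by metis
  note xb = xcut_bounds(2,3)[OF R ij(1), of x0]
  define h1 where "h1 x = xcut x0 R x * (pair F \<kappa> x y * pair F (pd j \<kappa>) x y)" for x
  define h2 where "h2 x = xcut x0 R x * (pair F (pd i (pd j \<kappa>)) x y * pair F \<kappa> x y)
      + xcut x0 R x * (pair F (pd i \<kappa>) x y * pair F (pd j \<kappa>) x y)
      + xcut' x0 R i x * (pair F \<kappa> x y * pair F (pd j \<kappa>) x y)" for x
  have p3: "\<bar>p * (q * r)\<bar> \<le> P * (Q * S)" if "\<bar>p\<bar> \<le> P" "\<bar>q\<bar> \<le> Q" "\<bar>r\<bar> \<le> S" for p q r P Q S :: real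
  proof -
    have "\<bar>q\<bar> * \<bar>r\<bar> \<le> Q * S" by (rule mult_mono) (use that in auto)
    then have "\<bar>p\<bar> * (\<bar>q\<bar> * \<bar>r\<bar>) \<le> P * (Q * S)" by (intro mult_mono) (use that in auto)
    then show ?thesis by (simp add: abs_mult)
  qed
  define C where "C = R ^ 4 * (d * a) + R ^ 4 * (b * c) + 4 * R ^ 3 * (a * c)"
  have h2b: "\<bar>h2 x\<bar> \<le> C" for x
    using p3[OF xb(1)[of x] d(2)[of x] a(2)[of x]] p3[OF xb(1)[of x] b(2)[of x] c(2)[of x]] p3[OF xb(2)[of x] a(2)[of x] c(2)[of x]]
    unfolding h2_def C_def by linarith
  have D: "((\<lambda>t. h1 (x + t *\<^sub>R i)) has_real_derivative h2 (x + t *\<^sub>R i)) (at t)" for x t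
    unfolding h1_def h2_def
    by (rule DERIV_cong, rule DERIV_mult[OF xcut_derivative DERIV_mult[OF pair_derivative[OF F \<kappa> ij(1)] pair_derivative[OF F kj ij(1)]]])
       (simp add: algebra_simps)
  have "integral\<^sup>L lborel h2 = 0"
  proof (rule integral_directional_derivative_zero[of h1 h2 i C "norm x0 + R"])
    have z: "h1 x = 0" if "R < norm (x - x0)" for x
      using xcut_outside(1)[OF R, of x x0] that by (simp add: h1_def)
    have [measurable]: "h1 \<in> borel_measurable borel" unfolding h1_def[abs_def] by measurable
    show "integrable lborel h1"
      by (rule integrable_bounded_support[of _ "R ^ 4 * (a * c)" R x0])
         (use p3[OF xb(1) a(2) c(2)] z in \<open>auto simp: h1_def\<close>)
    show "h2 \<in> borel_measurable borel" unfolding h2_def[abs_def] by measurable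
    show "h1 x = 0" if "norm x0 + R < norm x" for x
      using z[of x] that norm_triangle_sub[of x x0] by simp
    show "AE x in lborel. ((\<lambda>t. h1 (x + t *\<^sub>R i)) has_real_derivative h2 x) (at 0)"
      using D[of _ 0] by simp
    show "\<bar>h1 (x + t *\<^sub>R i) - h1 x\<bar> \<le> C * t" if "0 < t" "t \<le> 1" for x t
    proof -
      have "norm (h1 (x + t *\<^sub>R i) - h1 (x + 0 *\<^sub>R i)) \<le> C * norm (t - 0)"
        by (rule field_differentiable_bound[of UNIV "\<lambda>t. h1 (x + t *\<^sub>R i)" "\<lambda>t. h2 (x + t *\<^sub>R i)"])
           (use D h2b in auto)
      then show ?thesis using that by simp
    qed
  qed
  then show ?thesis by (simp add: h2_def[abs_def])
qed

lemma pair_Lop: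
  assumes F: "wL2 F" and \<kappa>: "ker \<delta> \<kappa>"
  shows "pair F (Lop \<kappa>) x y = (\<Sum>i\<in>Basis. \<Sum>j\<in>Basis. (B i \<bullet> j) * pair F (pd i (pd j \<kappa>)) x y)"
proof -
  have k: "ker \<delta> (pd i (pd j \<kappa>))" if "i \<in> Basis" "j \<in> Basis" for i j
    using ker_pd[OF ker_pd[OF \<kappa>]] that by simp
  have i: "integrable lborel (\<lambda>z. F (z, y) * tst (pd i (pd j \<kappa>)) x z)" if ij: "i \<in> Basis" "j \<in> Basis" for i j
  proof -
    obtain c where c: "\<And>x z. \<bar>tst (pd i (pd j \<kappa>)) x z\<bar> \<le> c" using tst_bounded[OF k[OF ij]] by metis
    show ?thesis by (rule sect_integrand(1)[OF F tst_borel[OF k[OF ij]] c])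
  qed
  have "tst (Lop \<kappa>) x z = (\<Sum>i\<in>Basis. \<Sum>j\<in>Basis. (B i \<bullet> j) * tst (pd i (pd j \<kappa>)) x z)" for z
    unfolding tst_def Lop_def by (simp only: right_diff_distrib sum_subtractf)
  then have "F (z, y) * tst (Lop \<kappa>) x z = (\<Sum>i\<in>Basis. \<Sum>j\<in>Basis. (B i \<bullet> j) * (F (z, y) * tst (pd i (pd j \<kappa>)) x z))" for z
    by (simp only: sum_distrib_left mult.left_commute)
  then show ?thesis
    unfolding pair_def sect_def using i
    by (simp add: Bochner_Integration.integral_sum Bochner_Integration.integrable_sum)
qed

text \<open>Polarization of the upper bound with a free parameter, by the symmetry and positivity of \<open>B\<close>.\<close>

lemma B_polarized:
  assumes "0 < t"
  shows "\<bar>B a \<bullet> b\<bar> \<le> (\<Lambda> / 2) * (t * (norm a)\<^sup>2 + (norm b)\<^sup>2 / t)"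
proof -
  have 1: "\<bar>B p \<bullet> q\<bar> \<le> (\<Lambda> / 2) * ((norm p)\<^sup>2 + (norm q)\<^sup>2)" for p q
  proof -
    have pp: "0 \<le> B p \<bullet> p" for p
      using B_lower[of p] Lam by (meson inverse_nonnegative_iff_nonnegative mult_nonneg_nonneg order_trans zero_le_one zero_le_power2)
    have s: "B (p + q) \<bullet> (p + q) = B p \<bullet> p + 2 * (B p \<bullet> q) + B q \<bullet> q"
      using B_sym[of q p] by (simp add: linear_add[OF B_lin] algebra_simps inner_commute)
    have d: "B (p - q) \<bullet> (p - q) = B p \<bullet> p - 2 * (B p \<bullet> q) + B q \<bullet> q"
      using B_sym[of q p] by (simp add: linear_diff[OF B_lin] algebra_simps inner_commute)
    have n: "(norm (p + q))\<^sup>2 + (norm (p - q))\<^sup>2 = 2 * ((norm p)\<^sup>2 + (norm q)\<^sup>2)"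
      by (simp add: power2_norm_eq_inner algebra_simps)
    have "\<Lambda> * (norm (p + q))\<^sup>2 \<le> \<Lambda> * (2 * ((norm p)\<^sup>2 + (norm q)\<^sup>2))" "\<Lambda> * (norm (p - q))\<^sup>2 \<le> \<Lambda> * (2 * ((norm p)\<^sup>2 + (norm q)\<^sup>2))"
      using Lam unfolding n[symmetric] by (auto intro!: mult_left_mono)
    moreover have "4 * (B p \<bullet> q) = B (p + q) \<bullet> (p + q) - B (p - q) \<bullet> (p - q)" using s d by simp
    ultimately have "4 * (B p \<bullet> q) \<le> \<Lambda> * (2 * ((norm p)\<^sup>2 + (norm q)\<^sup>2))" "- (4 * (B p \<bullet> q)) \<le> \<Lambda> * (2 * ((norm p)\<^sup>2 + (norm q)\<^sup>2))"
      using B_upper[of "p + q"] B_upper[of "p - q"] pp[of "p + q"] pp[of "p - q"] by linarith+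
    then show ?thesis by (auto simp: abs_le_iff algebra_simps)
  qed
  have "B (sqrt t *\<^sub>R a) \<bullet> ((1 / sqrt t) *\<^sub>R b) = B a \<bullet> b"
    using assms by (simp add: linear_cmul[OF B_lin])
  moreover have "(norm (sqrt t *\<^sub>R a))\<^sup>2 = t * (norm a)\<^sup>2" "(norm ((1 / sqrt t) *\<^sub>R b))\<^sup>2 = (norm b)\<^sup>2 / t"
    using assms by (simp_all add: power_mult_distrib power_divide)
  ultimately show ?thesis using 1[of "sqrt t *\<^sub>R a" "(1 / sqrt t) *\<^sub>R b"] by simp
qed

lemma quadratic_form:
  "(\<Sum>i\<in>Basis. \<Sum>j\<in>Basis. (B i \<bullet> j) * ((p \<bullet> i) * (q \<bullet> j))) = B p \<bullet> q"
proof -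
  have "B p \<bullet> q = (\<Sum>i\<in>Basis. (p \<bullet> i) * (B i \<bullet> q))"
    using euclidean_inner[of p "B q"] B_sym[of p q] B_sym by (simp add: inner_commute)
  also have "\<dots> = (\<Sum>i\<in>Basis. (p \<bullet> i) * (\<Sum>j\<in>Basis. (B i \<bullet> j) * (q \<bullet> j)))"
    by (intro sum.cong refl arg_cong2[where f = "(*)"] euclidean_inner)
  finally show ?thesis by (simp add: sum_distrib_left ac_simps)
qed

text \<open>The two cross terms produced by the cutoffs are absorbed into the gradient terms by Young's inequality, at the cost of the square of the cutoff gradients.\<close>

lemma pointwise_absorption:
  fixes w :: "'a => real"
  assumes R: "0 < R"
  shows "- (\<Sum>i\<in>Basis. \<Sum>j\<in>Basis. (B i \<bullet> j) * (xcut x0 R x * (w i * w j) + xcut' x0 R i x * (W * w j)))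
    \<le> - (inverse \<Lambda> / 2) * (xcut x0 R x * (\<Sum>i\<in>Basis. (w i)\<^sup>2)) + 8 * \<Lambda> ^ 3 * R\<^sup>2 * (indicator (ball x0 R) x * W\<^sup>2)"
proof -
  define s where "s = max 0 (R\<^sup>2 - (norm (x - x0))\<^sup>2)"
  define q where "q = (\<Sum>i\<in>Basis. w i *\<^sub>R i)"
  define u where "u = - 4 *\<^sub>R (x - x0)"
  define a where "a = W *\<^sub>R u"
  have xc: "xcut x0 R x = s\<^sup>2" "xcut' x0 R i x = s * (u \<bullet> i)" for i
    by (simp_all only: xcut_eq s_def u_def)
  have s0: "0 \<le> s" by (simp add: s_def)
  have qi: "q \<bullet> i = w i" if "i \<in> Basis" for i
    using that by (simp add: q_def inner_sum_left inner_Basis if_distrib cong: if_cong)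
  have nq: "(norm q)\<^sup>2 = (\<Sum>i\<in>Basis. (w i)\<^sup>2)"
    unfolding power2_norm_eq_inner euclidean_inner[of q q] by (simp add: qi power2_eq_square)
  have "(\<Sum>i\<in>Basis. \<Sum>j\<in>Basis. (B i \<bullet> j) * (xcut x0 R x * (w i * w j) + xcut' x0 R i x * (W * w j)))
     = (\<Sum>i\<in>Basis. \<Sum>j\<in>Basis. s\<^sup>2 * ((B i \<bullet> j) * ((q \<bullet> i) * (q \<bullet> j))) + (B i \<bullet> j) * ((a \<bullet> i) * ((s *\<^sub>R q) \<bullet> j)))"
    by (intro sum.cong refl) (simp add: xc qi a_def algebra_simps)
  also have "\<dots> = s\<^sup>2 * (B q \<bullet> q) + B a \<bullet> (s *\<^sub>R q)"
    by (simp only: sum.distrib sum_distrib_left[symmetric] quadratic_form)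
  finally have eq: "(\<Sum>i\<in>Basis. \<Sum>j\<in>Basis. (B i \<bullet> j) * (xcut x0 R x * (w i * w j) + xcut' x0 R i x * (W * w j)))
     = s\<^sup>2 * (B q \<bullet> q) + B a \<bullet> (s *\<^sub>R q)" .
  have L: "inverse \<Lambda> * (s\<^sup>2 * (norm q)\<^sup>2) \<le> s\<^sup>2 * (B q \<bullet> q)"
    using mult_left_mono[OF B_lower[of q], of "s\<^sup>2"] by (simp add: ac_simps)
  have "\<bar>B a \<bullet> (s *\<^sub>R q)\<bar> \<le> 8 * \<Lambda> ^ 3 * R\<^sup>2 * (indicator (ball x0 R) x * W\<^sup>2) + (inverse \<Lambda> / 2) * (s\<^sup>2 * (norm q)\<^sup>2)"
  proof (cases "x \<in> ball x0 R")
    case True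
    have na: "(norm a)\<^sup>2 \<le> 16 * (R\<^sup>2 * W\<^sup>2)"
    proof -
      have "(norm (x - x0))\<^sup>2 \<le> R\<^sup>2" using True by (intro power_mono) (auto simp: dist_norm norm_minus_commute)
      then have "W\<^sup>2 * (norm (x - x0))\<^sup>2 \<le> W\<^sup>2 * R\<^sup>2" by (intro mult_left_mono) auto
      then show ?thesis by (simp add: a_def u_def power_mult_distrib ac_simps)
    qed
    have "\<bar>B a \<bullet> (s *\<^sub>R q)\<bar> \<le> (\<Lambda> / 2) * (\<Lambda>\<^sup>2 * (norm a)\<^sup>2 + (norm (s *\<^sub>R q))\<^sup>2 / \<Lambda>\<^sup>2)"
      using Lam by (intro B_polarized) auto
    also have "\<dots> \<le> (\<Lambda> / 2) * (\<Lambda>\<^sup>2 * (16 * (R\<^sup>2 * W\<^sup>2)) + (norm (s *\<^sub>R q))\<^sup>2 / \<Lambda>\<^sup>2)"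
      using Lam na by (intro mult_left_mono add_right_mono) auto
    also have "\<dots> = 8 * \<Lambda> ^ 3 * R\<^sup>2 * W\<^sup>2 + (inverse \<Lambda> / 2) * (s\<^sup>2 * (norm q)\<^sup>2)"
      using Lam by (simp add: field_simps power2_eq_square power3_eq_cube power_mult_distrib)
    finally show ?thesis using True by simp
  next
    case False
    then have "s = 0" using power_mono[of R "norm (x - x0)" 2] R by (simp add: s_def dist_norm norm_minus_commute not_less)
    then show ?thesis using Lam by simp
  qed
  then show ?thesis unfolding eq using L
    unfolding nq[symmetric] xc by linarith
qed

end

section \<open>The Caccioppoli inequality\<close>

context mixed_solution
begin

text \<open>The weighted energy of a mollified function over a ball in \<open>x\<close> times an interval \<open>(0, S)\<close> reaching down to the bottom face.\<close>

definition cyl_energy :: "('a \<times> real => real) => ('a => real) => 'a => real => real => real" where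
  "cyl_energy F \<kappa> x0 R S = (\<integral> X. (indicator (ball x0 R) (fst X) * indicator {0<..<S} (snd X)) *
      (pair F \<kappa> (fst X) (snd X) * pair F \<kappa> (fst X) (snd X)) * m (snd X) \<partial>lborel)"

lemma cyl_energy_integrable:
  assumes "wL2 F" "ker \<delta> \<kappa>"
  shows "integrable lborel (\<lambda>X. (indicator (ball x0 R) (fst X) * indicator {0<..<S} (snd X)) *
      (pair F \<kappa> (fst X) (snd X) * pair F \<kappa> (fst X) (snd X)) * m (snd X))"
proof -
  have [measurable]: "ball x0 R \<in> sets borel" by simp
  show ?thesis
    by (rule pair_product_integrable[OF assms assms, of _ 1 R x0])
       (auto simp: indicator_def dist_norm norm_minus_commute)
qed

lemma cyl_energy_nonneg: "0 \<le> cyl_energy F \<kappa> x0 R S"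
  unfolding cyl_energy_def by (intro integral_nonneg_AE AE_I2 mult_nonneg_nonneg[OF mult_nonneg_nonneg[OF _ zero_le_square]] m_nonneg) auto

lemma ycut_le: "0 < y ==> 0 \<le> S ==> ycut S y \<le> S\<^sup>2 * indicator {..<S} y"
  by (auto simp: ycut_def indicator_def max_def intro!: power_mono)

text \<open>Integrate the section energy identity against the horizontal cutoff. The ball may cross the flat part: the mollified function is smooth across it, so no boundary term arises, and none arises at the bottom face by the conormal identity. The constants do not depend on the kernel.\<close>

lemma caccioppoli:
  assumes \<kappa>: "ker \<delta> \<kappa>" and x: "\<And>x. norm (x - x0) < R ==> adm x \<delta>"
    and d: "0 < d" "d < R" "d < S" "S \<le> \<tau>"
  shows "cyl_energy h \<kappa> x0 (R - d) (S - d) + inverse \<Lambda> * (\<Sum>i\<in>Basis. cyl_energy v (pd i \<kappa>) x0 (R - d) (S - d))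
    \<le> (4 * R\<^sup>2 + 16 * \<Lambda> ^ 3 * S\<^sup>2) / d ^ 4 * cyl_energy v \<kappa> x0 R S"
proof -
  have R: "0 < R" and S: "0 < S" using d by auto
  define W where "W X = pair v \<kappa> (fst X) (snd X)" for X
  define Y where "Y X = pair h \<kappa> (fst X) (snd X)" for X
  define N where "N X = pair v (Lop \<kappa>) (fst X) (snd X)" for X
  define w where "w i X = pair v (pd i \<kappa>) (fst X) (snd X)" for i X
  define w2 where "w2 i j X = pair v (pd i (pd j \<kappa>)) (fst X) (snd X)" for i j X
  note k = \<kappa> ker_Lop[OF \<kappa>] ker_pd[OF \<kappa>] ker_pd[OF ker_pd[OF \<kappa>]]
  have ycb: "\<bar>ycut S y\<bar> \<le> \<tau>\<^sup>2" "\<bar>ycut' S y\<bar> \<le> 2 * \<tau>" if "y \<in> {0<..<\<tau>}" for y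
    using ycut_bounds[of y S] d that by auto
  define \<rho>1 where "\<rho>1 X = xcut x0 R (fst X) * ycut S (snd X)" for X :: "'a \<times> real"
  define \<rho>2 where "\<rho>2 X = xcut x0 R (fst X) * ycut' S (snd X)" for X :: "'a \<times> real"
  define \<rho>3 where "\<rho>3 i X = xcut' x0 R i (fst X) * ycut S (snd X)" for i and X :: "'a \<times> real"
  have [measurable]: "\<rho>1 \<in> borel_measurable borel" "\<rho>2 \<in> borel_measurable borel" "\<rho>3 i \<in> borel_measurable borel" for i
    unfolding \<rho>1_def[abs_def] \<rho>2_def[abs_def] \<rho>3_def[abs_def] by measurable
  obtain b where b: "b \<in> (Basis :: 'a set)" using nonempty_Basis by blast
  have r1: "\<bar>\<rho>1 X\<bar> \<le> R ^ 4 * \<tau>\<^sup>2" and r2: "\<bar>\<rho>2 X\<bar> \<le> R ^ 4 * (2 * \<tau>)" if "snd X \<in> {0<..<\<tau>}" for X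
    unfolding \<rho>1_def \<rho>2_def abs_mult using xcut_bounds(2)[OF R b] ycb[OF that]
    by (auto intro!: mult_mono)
  have r3: "\<bar>\<rho>3 i X\<bar> \<le> 4 * R ^ 3 * \<tau>\<^sup>2" if "snd X \<in> {0<..<\<tau>}" "i \<in> Basis" for X i
    unfolding \<rho>3_def abs_mult using xcut_bounds(3)[OF R that(2), of x0 "fst X"] ycb[OF that(1)] R
    by (intro mult_mono) auto
  have z1: "\<rho>1 X = 0" "\<rho>2 X = 0" "\<rho>3 i X = 0" if "R < norm (fst X - x0)" for X i
    using xcut_outside[OF R, of "fst X" x0] that by (auto simp: \<rho>1_def \<rho>2_def \<rho>3_def)
  note int1 = pair_product_integrable[OF _ _ _ _ _ r1 z1(1), of _ _ _ _ _ _ "\<lambda>x. x", simplified]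
  have iYY: "integrable lborel (\<lambda>X. \<rho>1 X * (Y X * Y X) * m (snd X))"
    unfolding Y_def by (rule pair_product_integrable[OF h_L2 \<kappa> h_L2 \<kappa> _ r1 z1(1)]) auto
  have iWY: "integrable lborel (\<lambda>X. \<rho>2 X * (W X * Y X) * m (snd X))"
    unfolding Y_def W_def by (rule pair_product_integrable[OF v_L2 \<kappa> h_L2 \<kappa> _ r2 z1(2)]) auto
  have iNW: "integrable lborel (\<lambda>X. \<rho>1 X * (N X * W X) * m (snd X))"
    unfolding N_def W_def by (rule pair_product_integrable[OF v_L2 k(2) v_L2 \<kappa> _ r1 z1(1)]) auto
  have iww: "integrable lborel (\<lambda>X. \<rho>1 X * (w i X * w j X) * m (snd X))" if "i \<in> Basis" "j \<in> Basis" for i j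
    unfolding w_def by (rule pair_product_integrable[OF v_L2 k(3)[OF that(1)] v_L2 k(3)[OF that(2)] _ r1 z1(1)]) auto
  have iw2: "integrable lborel (\<lambda>X. \<rho>1 X * (w2 i j X * W X) * m (snd X))" if "i \<in> Basis" "j \<in> Basis" for i j
    unfolding w2_def W_def by (rule pair_product_integrable[OF v_L2 k(4)[OF that(2) that(1)] v_L2 \<kappa> _ r1 z1(1)]) auto
  have iWw: "integrable lborel (\<lambda>X. \<rho>3 i X * (W X * w j X) * m (snd X))" if "i \<in> Basis" "j \<in> Basis" for i j
    unfolding W_def w_def by (rule pair_product_integrable[OF v_L2 \<kappa> v_L2 k(3)[OF that(2)] _ r3 z1(3)]) (use that in auto)
  define E where "E = cyl_energy v \<kappa> x0 R S"
  define I where "I X = (indicator (ball x0 R) (fst X) * indicator {0<..<S} (snd X)) * (W X * W X) * m (snd X)" for X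
  have iI: "integrable lborel I" unfolding I_def[abs_def] W_def by (rule cyl_energy_integrable[OF v_L2 \<kappa>])
  have EI: "integral\<^sup>L lborel I = E" by (simp add: E_def I_def[abs_def] W_def cyl_energy_def)
  define A1 where "A1 = (LBINT X. \<rho>1 X * (Y X * Y X) * m (snd X))"
  define A2 where "A2 = (LBINT X. \<rho>2 X * (W X * Y X) * m (snd X))"
  define A3 where "A3 = (LBINT X. \<rho>1 X * (N X * W X) * m (snd X))"
  define A4 where "A4 = (\<Sum>i\<in>Basis. \<integral> X. \<rho>1 X * (w i X * w i X) * m (snd X) \<partial>lborel)"
  have id1: "A1 + A2 - A3 = 0"
  proof -
    let ?K = "\<lambda>X. \<rho>1 X * (Y X * Y X) * m (snd X) + \<rho>2 X * (W X * Y X) * m (snd X) - \<rho>1 X * (N X * W X) * m (snd X)"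
    have iK: "integrable lborel ?K" using iYY iWY iNW by simp
    have "A1 + A2 - A3 = (LBINT X. ?K X)" unfolding A1_def A2_def A3_def using iYY iWY iNW by simp
    also have "\<dots> = (\<integral> x. \<integral> y. ?K (x, y) \<partial>lborel \<partial>lborel)" by (rule integral_lborel_pair(1)[OF iK])
    finally have fub: "A1 + A2 - A3 = (\<integral> x. \<integral> y. ?K (x, y) \<partial>lborel \<partial>lborel)" .
    have "(LBINT y. ?K (x, y)) = 0" for x
    proof (cases "norm (x - x0) < R")
      case True
      have "(LBINT y. ?K (x, y)) = (\<integral> y. xcut x0 R x * (ycut S y * (pair h \<kappa> x y)\<^sup>2 * m y
          + ycut' S y * (pair v \<kappa> x y * pair h \<kappa> x y) * m y
          - ycut S y * (pair v (Lop \<kappa>) x y * pair v \<kappa> x y) * m y) \<partial>lborel)"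
        by (intro Bochner_Integration.integral_cong refl)
           (simp only: \<rho>1_def \<rho>2_def W_def Y_def N_def fst_conv snd_conv power2_eq_square distrib_left right_diff_distrib mult.assoc)
      then show ?thesis
        by (simp only: integral_mult_right_zero section_energy_identity[OF \<kappa> x[OF True] d(4)] mult_zero_right)
    next
      case False
      then show ?thesis using xcut_outside(1)[OF R, of x x0] by (simp add: \<rho>1_def \<rho>2_def)
    qed
    then show ?thesis unfolding fub by (simp only: integral_zero)
  qed
  have id2: "(LBINT X. \<rho>1 X * (w2 i j X * W X) * m (snd X)) =
      - (LBINT X. \<rho>1 X * (w i X * w j X) * m (snd X) + \<rho>3 i X * (W X * w j X) * m (snd X))"
    if ij: "i \<in> Basis" "j \<in> Basis" for i j
  proof -
    let ?K = "\<lambda>X. \<rho>1 X * (w2 i j X * W X) * m (snd X) + (\<rho>1 X * (w i X * w j X) * m (snd X) + \<rho>3 i X * (W X * w j X) * m (snd X))"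
    have iK: "integrable lborel ?K" using iww[OF ij] iw2[OF ij] iWw[OF ij] by simp
    have fub: "(LBINT X. ?K X) = (\<integral> y. \<integral> x. ?K (x, y) \<partial>lborel \<partial>lborel)" by (rule integral_lborel_pair(2)[OF iK])
    have "(LBINT x. ?K (x, y)) = 0" for y
    proof -
      have "(LBINT x. ?K (x, y)) = (\<integral> x. (ycut S y * m y) * (xcut x0 R x * (pair v (pd i (pd j \<kappa>)) x y * pair v \<kappa> x y)
        + xcut x0 R x * (pair v (pd i \<kappa>) x y * pair v (pd j \<kappa>) x y)
        + xcut' x0 R i x * (pair v \<kappa> x y * pair v (pd j \<kappa>) x y)) \<partial>lborel)"
        by (intro Bochner_Integration.integral_cong refl)
           (simp add: \<rho>1_def \<rho>3_def W_def w_def w2_def algebra_simps)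
      then show ?thesis
        by (simp only: integral_mult_right_zero cutoff_integration_by_parts[OF v_L2 \<kappa> ij R] mult_zero_right)
    qed
    then have "(LBINT X. ?K X) = 0" unfolding fub by (simp only: integral_zero)
    then show ?thesis using iww[OF ij] iw2[OF ij] iWw[OF ij] by simp
  qed
  have A3_le: "A3 \<le> - (inverse \<Lambda> / 2) * A4 + 8 * \<Lambda> ^ 3 * R\<^sup>2 * (S\<^sup>2 * E)"
  proof -
    have NW: "\<rho>1 X * (N X * W X) * m (snd X) = (\<Sum>i\<in>Basis. \<Sum>j\<in>Basis. (B i \<bullet> j) * (\<rho>1 X * (w2 i j X * W X) * m (snd X)))" for X
      unfolding N_def pair_Lop[OF v_L2 \<kappa>] w2_def[symmetric]
      by (simp add: sum_distrib_left sum_distrib_right mult.assoc mult.left_commute)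
    let ?Q = "\<lambda>i j X. \<rho>1 X * (w i X * w j X) * m (snd X) + \<rho>3 i X * (W X * w j X) * m (snd X)"
    have iQ: "integrable lborel (?Q i j)" if "i \<in> Basis" "j \<in> Basis" for i j
      using iww[OF that] iWw[OF that] by simp
    have "A3 = (\<Sum>i\<in>Basis. \<Sum>j\<in>Basis. (B i \<bullet> j) * (LBINT X. \<rho>1 X * (w2 i j X * W X) * m (snd X)))"
      unfolding A3_def NW using iw2
      by (simp add: Bochner_Integration.integral_sum Bochner_Integration.integrable_sum)
    also have "\<dots> = (\<Sum>i\<in>Basis. \<Sum>j\<in>Basis. - ((B i \<bullet> j) * (LBINT X. ?Q i j X)))"
      by (intro sum.cong refl) (simp only: id2 mult_minus_right)
    also have "\<dots> = (LBINT X. - (\<Sum>i\<in>Basis. \<Sum>j\<in>Basis. (B i \<bullet> j) * ?Q i j X))"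
    proof -
      have i1: "integrable lborel (\<lambda>X. (B i \<bullet> j) * ?Q i j X)" if "i \<in> Basis" "j \<in> Basis" for i j
        using iQ[OF that] by (rule integrable_mult_right)
      have 1: "(LBINT X. (\<Sum>j\<in>Basis. (B i \<bullet> j) * ?Q i j X)) = (\<Sum>j\<in>Basis. (B i \<bullet> j) * (LBINT X. ?Q i j X))"
        if "i \<in> Basis" for i
        by (subst Bochner_Integration.integral_sum[OF i1[OF that]]) (simp_all only: integral_mult_right_zero)
      have i2: "integrable lborel (\<lambda>X. \<Sum>j\<in>Basis. (B i \<bullet> j) * ?Q i j X)" if "i \<in> Basis" for i
        by (rule Bochner_Integration.integrable_sum[OF i1[OF that]])
      have "(LBINT X. (\<Sum>i\<in>Basis. \<Sum>j\<in>Basis. (B i \<bullet> j) * ?Q i j X)) = (\<Sum>i\<in>Basis. \<Sum>j\<in>Basis. (B i \<bullet> j) * (LBINT X. ?Q i j X))"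
        by (subst Bochner_Integration.integral_sum[OF i2]) (auto intro!: sum.cong 1)
      then show ?thesis by (simp only: integral_minus sum_negf)
    qed
    also have "\<dots> \<le> (LBINT X. - (inverse \<Lambda> / 2) * (\<Sum>i\<in>Basis. \<rho>1 X * (w i X * w i X) * m (snd X)) + 8 * \<Lambda> ^ 3 * R\<^sup>2 * (S\<^sup>2 * I X))"
    proof (rule integral_mono)
      show "integrable lborel (\<lambda>X. - (\<Sum>i\<in>Basis. \<Sum>j\<in>Basis. (B i \<bullet> j) * ?Q i j X))"
        using iQ by (intro Bochner_Integration.integrable_minus Bochner_Integration.integrable_sum integrable_mult_right) auto
      show "integrable lborel (\<lambda>X. - (inverse \<Lambda> / 2) * (\<Sum>i\<in>Basis. \<rho>1 X * (w i X * w i X) * m (snd X)) + 8 * \<Lambda> ^ 3 * R\<^sup>2 * (S\<^sup>2 * I X))"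
        using iww iI by (intro Bochner_Integration.integrable_add Bochner_Integration.integrable_sum integrable_mult_right) auto
      fix X :: "'a \<times> real"
      have c0: "0 \<le> ycut S (snd X) * m (snd X)" using m_nonneg by (simp add: ycut_def)
      have "- (\<Sum>i\<in>Basis. \<Sum>j\<in>Basis. (B i \<bullet> j) * ?Q i j X) = (ycut S (snd X) * m (snd X)) *
         (- (\<Sum>i\<in>Basis. \<Sum>j\<in>Basis. (B i \<bullet> j) * (xcut x0 R (fst X) * (w i X * w j X) + xcut' x0 R i (fst X) * (W X * w j X))))"
        unfolding mult_minus_right sum_distrib_left
        by (intro arg_cong[where f = uminus] sum.cong refl) (simp add: \<rho>1_def \<rho>3_def algebra_simps)
      also have "\<dots> \<le> (ycut S (snd X) * m (snd X)) * (- (inverse \<Lambda> / 2) * (xcut x0 R (fst X) * (\<Sum>i\<in>Basis. (w i X)\<^sup>2))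
          + 8 * \<Lambda> ^ 3 * R\<^sup>2 * (indicator (ball x0 R) (fst X) * (W X)\<^sup>2))"
        by (rule mult_left_mono[OF pointwise_absorption[OF R] c0])
      also have "\<dots> = - (inverse \<Lambda> / 2) * (\<Sum>i\<in>Basis. \<rho>1 X * (w i X * w i X) * m (snd X))
          + 8 * \<Lambda> ^ 3 * R\<^sup>2 * ((ycut S (snd X) * m (snd X)) * (indicator (ball x0 R) (fst X) * (W X)\<^sup>2))"
        by (simp add: \<rho>1_def sum_distrib_left power2_eq_square algebra_simps)
      also have "\<dots> \<le> - (inverse \<Lambda> / 2) * (\<Sum>i\<in>Basis. \<rho>1 X * (w i X * w i X) * m (snd X)) + 8 * \<Lambda> ^ 3 * R\<^sup>2 * (S\<^sup>2 * I X)"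
      proof (intro add_left_mono mult_left_mono)
        show "(ycut S (snd X) * m (snd X)) * (indicator (ball x0 R) (fst X) * (W X)\<^sup>2) \<le> S\<^sup>2 * I X"
        proof (cases "snd X \<in> {0<..<\<tau>}")
          case True
          then have "ycut S (snd X) \<le> S\<^sup>2 * indicator {0<..<S} (snd X)"
            using ycut_le[of "snd X" S] S by (auto simp: indicator_def)
          moreover have "0 \<le> m (snd X) * (indicator (ball x0 R) (fst X) * (W X)\<^sup>2)"
            by (intro mult_nonneg_nonneg m_nonneg) auto
          ultimately have "ycut S (snd X) * (m (snd X) * (indicator (ball x0 R) (fst X) * (W X)\<^sup>2))
            \<le> S\<^sup>2 * indicator {0<..<S} (snd X) * (m (snd X) * (indicator (ball x0 R) (fst X) * (W X)\<^sup>2))"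
            by (rule mult_right_mono)
          then show ?thesis by (simp only: I_def power2_eq_square ac_simps)
        qed (simp add: m_zero I_def)
      qed (use Lam in auto)
      finally show "- (\<Sum>i\<in>Basis. \<Sum>j\<in>Basis. (B i \<bullet> j) * ?Q i j X)
        \<le> - (inverse \<Lambda> / 2) * (\<Sum>i\<in>Basis. \<rho>1 X * (w i X * w i X) * m (snd X)) + 8 * \<Lambda> ^ 3 * R\<^sup>2 * (S\<^sup>2 * I X)" .
    qed
    also have "\<dots> = - (inverse \<Lambda> / 2) * A4 + 8 * \<Lambda> ^ 3 * R\<^sup>2 * (S\<^sup>2 * E)"
    proof -
      have "integrable lborel (\<lambda>X. \<Sum>i\<in>Basis. \<rho>1 X * (w i X * w i X) * m (snd X))"
        by (rule Bochner_Integration.integrable_sum) (rule iww)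
      moreover have "(LBINT X. (\<Sum>i\<in>Basis. \<rho>1 X * (w i X * w i X) * m (snd X))) = A4"
        unfolding A4_def by (rule Bochner_Integration.integral_sum) (rule iww)
      ultimately show ?thesis
        using iI EI by (subst Bochner_Integration.integral_add) (auto intro!: integrable_mult_right simp del: mult_minus_left)
    qed
    finally show ?thesis .
  qed
  have A2_ge: "- (A1 / 2 + 2 * R ^ 4 * E) \<le> A2"
  proof -
    have "- (A1 / 2 + 2 * R ^ 4 * E) = (LBINT X. - (1 / 2 * (\<rho>1 X * (Y X * Y X) * m (snd X)) + 2 * R ^ 4 * I X))"
      using iYY iI EI by (simp add: A1_def)
    also have "\<dots> \<le> A2"
      unfolding A2_def
    proof (rule integral_mono[OF _ iWY])
      show "integrable lborel (\<lambda>X. - (1 / 2 * (\<rho>1 X * (Y X * Y X) * m (snd X)) + 2 * R ^ 4 * I X))"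
        using iYY iI by (intro Bochner_Integration.integrable_minus Bochner_Integration.integrable_add integrable_mult_right)
      fix X :: "'a \<times> real"
      show "- (1 / 2 * (\<rho>1 X * (Y X * Y X) * m (snd X)) + 2 * R ^ 4 * I X) \<le> \<rho>2 X * (W X * Y X) * m (snd X)"
      proof (cases "snd X \<in> {0<..<S} \<and> norm (fst X - x0) < R")
        case True
        define s where "s = S - snd X"
        define p where "p = xcut x0 R (fst X)"
        have p: "0 \<le> p" "p \<le> R ^ 4" using xcut_bounds(1,2)[OF R b, of x0 "fst X"] by (auto simp: p_def)
        have e: "\<rho>1 X = p * s\<^sup>2" "\<rho>2 X = p * (- 2 * s)" "I X = (W X * W X) * m (snd X)"
          using True by (auto simp: \<rho>1_def \<rho>2_def p_def s_def ycut_def ycut'_def I_def dist_norm norm_minus_commute)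
        have "0 \<le> p * m (snd X) * (s * Y X - 2 * W X)\<^sup>2" using p m_nonneg by simp
        moreover have "p * (W X * W X * m (snd X)) \<le> R ^ 4 * (W X * W X * m (snd X))"
          using p m_nonneg by (intro mult_right_mono) auto
        ultimately show ?thesis unfolding e by (simp add: power2_eq_square algebra_simps)
      next
        case False
        then consider "snd X \<notin> {0<..<S}" "snd X \<in> {0<..<\<tau>}" | "snd X \<notin> {0<..<\<tau>}" | "R \<le> norm (fst X - x0)" by force
        then show ?thesis
        proof cases
          case 1
          then show ?thesis by (auto simp: \<rho>1_def \<rho>2_def I_def ycut_def ycut'_def)
        next
          case 2
          then show ?thesis by (simp add: m_zero I_def)
        next
          case 3
          then show ?thesis using xcut_outside[OF R 3]
            by (simp add: \<rho>1_def \<rho>2_def I_def dist_norm norm_minus_commute)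
        qed
      qed
    qed
    finally show ?thesis .
  qed
  have low: "R\<^sup>2 * d ^ 4 * cyl_energy F \<kappa>' x0 (R - d) (S - d)
      \<le> (LBINT X. \<rho>1 X * (pair F \<kappa>' (fst X) (snd X) * pair F \<kappa>' (fst X) (snd X)) * m (snd X))"
    if F: "wL2 F" and k': "ker \<delta> \<kappa>'" for F \<kappa>'
    unfolding cyl_energy_def integral_mult_right_zero[symmetric]
  proof (rule integral_mono)
    show "integrable lborel (\<lambda>X. \<rho>1 X * (pair F \<kappa>' (fst X) (snd X) * pair F \<kappa>' (fst X) (snd X)) * m (snd X))"
      by (rule pair_product_integrable[OF F k' F k' _ r1 z1(1)]) auto
    show "integrable lborel (\<lambda>X. R\<^sup>2 * d ^ 4 * (indicator (ball x0 (R - d)) (fst X) * indicator {0<..<S - d} (snd X) *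
        (pair F \<kappa>' (fst X) (snd X) * pair F \<kappa>' (fst X) (snd X)) * m (snd X)))"
      by (intro integrable_mult_right cyl_energy_integrable[OF F k'])
    fix X :: "'a \<times> real"
    have n: "0 \<le> (pair F \<kappa>' (fst X) (snd X) * pair F \<kappa>' (fst X) (snd X)) * m (snd X)"
      using m_nonneg by simp
    have "R\<^sup>2 * d ^ 4 * (indicator (ball x0 (R - d)) (fst X) * indicator {0<..<S - d} (snd X)) \<le> \<rho>1 X"
    proof (cases "fst X \<in> ball x0 (R - d) \<and> snd X \<in> {0<..<S - d}")
      case True
      then have nx: "norm (fst X - x0) \<le> R - d" by (auto simp: dist_norm norm_minus_commute)
      have "(norm (fst X - x0))\<^sup>2 \<le> (R - d)\<^sup>2" using nx by (intro power_mono) auto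
      moreover have "(R - d)\<^sup>2 + R * d \<le> R\<^sup>2" using d by (simp add: power2_eq_square algebra_simps)
      ultimately have 1: "R * d \<le> max 0 (R\<^sup>2 - (norm (fst X - x0))\<^sup>2)" by linarith
      have "(R * d)\<^sup>2 \<le> xcut x0 R (fst X)" unfolding xcut_eq using d by (intro power_mono[OF 1]) auto
      moreover have "d\<^sup>2 \<le> ycut S (snd X)" unfolding ycut_def using True d by (intro power_mono) auto
      ultimately have "(R * d)\<^sup>2 * d\<^sup>2 \<le> \<rho>1 X" unfolding \<rho>1_def by (intro mult_mono) (auto simp: xcut_eq)
      then show ?thesis using True by (simp add: power_mult_distrib mult.assoc power_add[symmetric])
    next
      case False
      then show ?thesis by (auto simp: \<rho>1_def xcut_eq ycut_def)
    qed
    from mult_right_mono[OF this n]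
    show "R\<^sup>2 * d ^ 4 * (indicator (ball x0 (R - d)) (fst X) * indicator {0<..<S - d} (snd X) *
        (pair F \<kappa>' (fst X) (snd X) * pair F \<kappa>' (fst X) (snd X)) * m (snd X))
      \<le> \<rho>1 X * (pair F \<kappa>' (fst X) (snd X) * pair F \<kappa>' (fst X) (snd X)) * m (snd X)"
      by (simp only: mult.assoc)
  qed
  define Z1 where "Z1 = cyl_energy h \<kappa> x0 (R - d) (S - d)"
  define Z4 where "Z4 = (\<Sum>i\<in>Basis. cyl_energy v (pd i \<kappa>) x0 (R - d) (S - d))"
  have L1: "R\<^sup>2 * d ^ 4 * Z1 \<le> A1" unfolding Z1_def A1_def Y_def by (rule low[OF h_L2 \<kappa>])
  have L4: "R\<^sup>2 * d ^ 4 * Z4 \<le> A4" unfolding Z4_def A4_def w_def sum_distrib_left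
    by (intro sum_mono low[OF v_L2 k(3)])
  have iL: "0 < inverse \<Lambda>" using Lam by simp
  have "A1 + inverse \<Lambda> * A4 \<le> (4 * R ^ 4 + 16 * \<Lambda> ^ 3 * R\<^sup>2 * S\<^sup>2) * E"
    using id1 A3_le A2_ge by (simp add: algebra_simps)
  moreover have "inverse \<Lambda> * (R\<^sup>2 * d ^ 4 * Z4) \<le> inverse \<Lambda> * A4" using L4 iL by simp
  ultimately have "R\<^sup>2 * (d ^ 4 * (Z1 + inverse \<Lambda> * Z4)) \<le> R\<^sup>2 * ((4 * R\<^sup>2 + 16 * \<Lambda> ^ 3 * S\<^sup>2) * E)"
    using L1 by (simp add: algebra_simps power4_eq_xxxx power2_eq_square)
  then have "d ^ 4 * (Z1 + inverse \<Lambda> * Z4) \<le> (4 * R\<^sup>2 + 16 * \<Lambda> ^ 3 * S\<^sup>2) * E"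
    using R by (simp add: mult_le_cancel_left)
  then show ?thesis using d unfolding Z1_def[symmetric] Z4_def[symmetric] E_def[symmetric]
    by (simp add: pos_le_divide_eq mult.commute)
qed

end

section \<open>Kernels invariant under the reflection\<close>

text \<open>A function of \<open>\<delta>\<^sup>2 - norm x\<^sup>2 - norm (T x)\<^sup>2\<close> is invariant under the involution \<open>T\<close>, so the bump needs no averaging. Invariance makes mollification commute with the odd reflection.\<close>

lemma invariant_kernel_exists:
  fixes T :: "'a::euclidean_space => 'a"
  assumes "\<delta> > 0" and T: "linear T" "\<And>x. T (T x) = x"
  obtains k :: "'a => real"
  where "smooth k" "\<And>x. k x \<ge> 0" "\<And>x. norm x > \<delta> ==> k x = 0" "\<And>x. k (T x) = k x"
    "integrable lborel k" "integral\<^sup>L lborel k = 1"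
proof -
  define Q :: "'a => real" where "Q x = \<delta>\<^sup>2 - ((\<Sum>b\<in>Basis. (x \<bullet> b) * (x \<bullet> b)) + (\<Sum>b\<in>Basis. (T x \<bullet> b) * (T x \<bullet> b)))" for x
  define k where "k x = exp_flat 1 (Q x)" for x
  have Q: "Q x = \<delta>\<^sup>2 - ((norm x)\<^sup>2 + (norm (T x))\<^sup>2)" for x
    unfolding Q_def using euclidean_inner[of x x] euclidean_inner[of "T x" "T x"] by (simp add: power2_norm_eq_inner)
  have lin: "linear (\<lambda>x. T x \<bullet> b)" for b
    using linear_compose[OF T(1) bounded_linear.linear[OF bounded_linear_inner_left[of b]]] by (simp add: comp_def)
  have smQ: "smooth Q"
    unfolding Q_def[abs_def]
    by (intro smooth_diff smooth_add smooth_const smooth_sum smooth_mult smooth_linear lin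
        bounded_linear.linear bounded_linear_inner_left)
  then have sm: "smooth k" unfolding k_def[abs_def] by (rule smooth_exp_flat)
  have nn: "k x \<ge> 0" for x by (simp add: k_def exp_flat_def)
  have z: "k x = 0" if "norm x > \<delta>" for x
  proof -
    have "\<delta>\<^sup>2 \<le> (norm x)\<^sup>2" using that assms by (intro power_mono) auto
    then have "Q x \<le> 0" using zero_le_power2[of "norm (T x)"] unfolding Q by linarith
    then show ?thesis by (simp add: k_def exp_flat_def)
  qed
  have inv: "k (T x) = k x" for x by (simp add: k_def Q T add.commute)
  have "open {x. 0 < Q x}" by (intro open_Collect_less continuous_on_const smooth_continuous smQ)
  moreover have "0 \<in> {x. 0 < Q x}" using assms by (simp add: Q linear_0[OF T(1)])
  ultimately obtain \<epsilon> where \<epsilon>: "\<epsilon> > 0" "ball 0 \<epsilon> \<subseteq> {x. 0 < Q x}" by (rule openE)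
  have pos: "k x > 0" if "x \<in> ball 0 \<epsilon>" for x
    using subsetD[OF \<epsilon>(2) that] by (simp add: k_def exp_flat_def)
  have "integrable lborel (\<lambda>x. indicator (cball 0 \<delta>) x *\<^sub>R k x)"
    by (rule borel_integrable_compact) (auto intro: smooth_continuous sm)
  also have "(\<lambda>x. indicator (cball 0 \<delta>) x *\<^sub>R k x) = k"
    by (auto simp: fun_eq_iff indicator_def z)
  finally have int: "integrable lborel k" .
  have "integral\<^sup>L lborel k \<noteq> 0"
  proof
    assume "integral\<^sup>L lborel k = 0"
    then have "AE x in lborel. k x = 0"
      using int nn by (subst (asm) integral_nonneg_eq_0_iff_AE) auto
    then have "AE x in lborel. x \<notin> ball (0::'a) \<epsilon>"
      by eventually_elim (use pos in force)
    then have "emeasure lborel (ball (0::'a) \<epsilon>) = 0"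
      by (subst (asm) AE_iff_measurable[OF _ refl]) (auto simp: ball_def)
    then show False
      using content_ball_pos[OF \<epsilon>(1), of "0::'a"] by (simp add: measure_def)
  qed
  moreover have "integral\<^sup>L lborel k \<ge> 0" using nn by simp
  ultimately have I: "integral\<^sup>L lborel k > 0" by simp
  show ?thesis
  proof (rule that[of "\<lambda>x. (1 / integral\<^sup>L lborel k) * k x"])
    show "smooth (\<lambda>x. (1 / integral\<^sup>L lborel k) * k x)"
      by (intro smooth_mult smooth_const sm)
  qed (use nn z int I inv in auto)
qed

context mixed_solution
begin

lemma norm_Be: "norm (B e) \<le> \<Lambda>"
proof (cases "B e = 0")
  case False
  then have n: "0 < norm (B e)" by simp
  have "(norm (B e))\<^sup>2 \<le> (\<Lambda> / 2) * (norm (B e) * (norm e)\<^sup>2 + (norm (B e))\<^sup>2 / norm (B e))"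
    using B_polarized[OF n, of e "B e"] by (simp add: power2_norm_eq_inner)
  also have "\<dots> = \<Lambda> * norm (B e)" using n e_Basis by (simp add: power2_eq_square field_simps)
  finally show ?thesis using n by (simp add: power2_eq_square)
qed (use Lam in auto)

text \<open>Points close to the flat part are moved little; the constant comes from the ellipticity of \<open>B\<close> in the direction \<open>e\<close>.\<close>

lemma Rf_distance: "norm (Rf z - z) \<le> 2 * \<Lambda>\<^sup>2 * \<bar>z \<bullet> e\<bar>"
proof -
  have "\<bar>z \<bullet> e\<bar> / (B e \<bullet> e) \<le> \<bar>z \<bullet> e\<bar> / inverse \<Lambda>"
    using Be_lower Lam Be_pos by (intro divide_left_mono mult_pos_pos) auto
  then have 1: "\<bar>z \<bullet> e\<bar> / (B e \<bullet> e) \<le> \<bar>z \<bullet> e\<bar> * \<Lambda>" using Lam by (simp add: divide_inverse)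
  have "norm (Rf z - z) = 2 * (\<bar>z \<bullet> e\<bar> / (B e \<bullet> e)) * norm (B e)"
    using Be_pos by (simp add: Rf_def abs_mult)
  also have "\<dots> \<le> 2 * (\<bar>z \<bullet> e\<bar> * \<Lambda>) * \<Lambda>"
    using 1 norm_Be Lam by (intro mult_mono mult_left_mono) auto
  finally show ?thesis by (simp add: power2_eq_square ac_simps)
qed

lemma Rf_Basis_norm: "i \<in> Basis ==> norm (Rf i) \<le> 1 + 2 * \<Lambda>\<^sup>2"
proof -
  assume i: "i \<in> Basis"
  have "norm (Rf i) \<le> norm i + norm (Rf i - i)" by (metis add.commute diff_add_cancel norm_triangle_ineq)
  also have "\<dots> \<le> 1 + 2 * \<Lambda>\<^sup>2 * \<bar>i \<bullet> e\<bar>" using Rf_distance[of i] i by simp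
  also have "\<dots> \<le> 1 + 2 * \<Lambda>\<^sup>2 * 1"
    using Basis_le_norm[OF e_Basis, of i] i by (intro add_left_mono mult_left_mono) auto
  finally show ?thesis by simp
qed

text \<open>The Dirichlet energy of the horizontal gradient, the quantity on the right of all estimates below.\<close>

definition g_energy :: real where
  "g_energy = (\<Sum>i\<in>Basis. energy (\<lambda>X. g X \<bullet> i))"

lemma g_energy_nonneg: "0 \<le> g_energy"
  unfolding g_energy_def energy_def using m_nonneg by (intro sum_nonneg integral_nonneg_AE AE_I2) auto

lemma g_dir_borel: "(\<lambda>X. g X \<bullet> a) \<in> borel_measurable borel"
proof -
  have "(\<lambda>X. \<Sum>i\<in>Basis. (g X \<bullet> i) * (a \<bullet> i)) \<in> borel_measurable borel"
    using wL2_borel[OF g_L2] by (intro borel_measurable_sum borel_measurable_times) auto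
  then show ?thesis by (simp only: euclidean_inner[symmetric])
qed

lemma g_dir_energy:
  "(\<integral>\<^sup>+ X. ennreal ((g X \<bullet> a)\<^sup>2 * m (snd X)) \<partial>lborel) \<le> ennreal ((norm a)\<^sup>2 * g_energy)"
proof -
  have i: "integrable lborel (\<lambda>X. (\<Sum>i\<in>Basis. (g X \<bullet> i)\<^sup>2 * m (snd X)))"
    by (rule Bochner_Integration.integrable_sum) (rule wL2_square[OF g_L2])
  have "(g X \<bullet> a)\<^sup>2 \<le> (norm a)\<^sup>2 * (\<Sum>i\<in>Basis. (g X \<bullet> i)\<^sup>2)" for X
  proof -
    have "(g X \<bullet> a)\<^sup>2 \<le> (norm (g X) * norm a)\<^sup>2"
      using Cauchy_Schwarz_ineq2[of "g X" a] by (metis abs_ge_zero power2_abs power_mono)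
    moreover have "(norm (g X))\<^sup>2 = (\<Sum>i\<in>Basis. (g X \<bullet> i)\<^sup>2)"
      unfolding power2_norm_eq_inner euclidean_inner[of "g X" "g X"] by (simp add: power2_eq_square)
    ultimately show ?thesis by (simp add: power_mult_distrib mult.commute)
  qed
  from mult_right_mono[OF this m_nonneg]
  have "(\<integral>\<^sup>+ X. ennreal ((g X \<bullet> a)\<^sup>2 * m (snd X)) \<partial>lborel)
    \<le> (\<integral>\<^sup>+ X. ennreal ((norm a)\<^sup>2 * (\<Sum>i\<in>Basis. (g X \<bullet> i)\<^sup>2 * m (snd X))) \<partial>lborel)"
    by (intro nn_integral_mono ennreal_leI) (simp add: sum_distrib_right mult.assoc)
  also have "\<dots> = ennreal (LBINT X. (norm a)\<^sup>2 * (\<Sum>i\<in>Basis. (g X \<bullet> i)\<^sup>2 * m (snd X)))"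
    using m_nonneg by (intro nn_integral_eq_integral integrable_mult_right i AE_I2 mult_nonneg_nonneg sum_nonneg) auto
  also have "(LBINT X. (norm a)\<^sup>2 * (\<Sum>i\<in>Basis. (g X \<bullet> i)\<^sup>2 * m (snd X))) = (norm a)\<^sup>2 * g_energy"
    unfolding g_energy_def energy_def
    by (subst integral_mult_right_zero, subst Bochner_Integration.integral_sum) (auto intro: wL2_square[OF g_L2])
  finally show ?thesis .
qed

text \<open>Derivatives of the mollified function are mollifications of the weak gradient, reflected with the transformation of its components.\<close>

lemma pair_gradient:
  assumes k: "ker \<delta> k" and x: "adm x \<delta>" and i: "i \<in> Basis"
  shows "AE y in lborel. y \<in> {0<..<\<tau>} -->
    pair v (pd i k) x y = (LBINT z. (g (z, y) \<bullet> i) * k (x - z) - (g (z, y) \<bullet> Rf i) * k (x - Rf z))"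
proof -
  define \<kappa>1 where "\<kappa>1 z = k (x - z)" for z
  define \<kappa>2 where "\<kappa>2 z = k (x - Rf z)" for z
  have sk: "smooth k" by (rule ker_smooth[OF k])
  have s: "smooth \<kappa>1" "smooth \<kappa>2" unfolding \<kappa>1_def[abs_def] \<kappa>2_def[abs_def] by (rule shift_smooth[OF sk])+
  obtain \<tau>' where \<tau>': "\<tau>' < \<tau>" and out: "\<And>z. 0 \<le> z \<bullet> e ==> \<tau>' \<le> norm z ==> \<delta> < norm (x - z) \<and> \<delta> < norm (x - Rf z)"
    using x by (auto simp: adm_def)
  have z: "\<kappa>1 z = 0" "\<kappa>2 z = 0" if "0 \<le> z \<bullet> e" "\<tau>' \<le> norm z" for z
    using out[OF that] k by (auto simp: \<kappa>1_def \<kappa>2_def ker_def)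
  have p1: "pd j \<kappa>1 z = - pd j k (x - z)" if "j \<in> Basis" for j z
    using that pd_affine(1)[OF smooth_differentiable[OF sk] uminus_linear(1), of j x z]
    by (simp add: \<kappa>1_def[abs_def] inner_Basis if_distrib if_distribR sum_negf cong: if_cong)
  have p2: "pd j \<kappa>2 z = - (\<Sum>a\<in>Basis. (Rf j \<bullet> a) * pd a k (x - Rf z))" for j z
    using pd_affine(1)[OF smooth_differentiable[OF sk] uminus_linear(2), of j x z]
    by (simp add: \<kappa>2_def[abs_def] sum_negf)
  have p3: "(\<Sum>j\<in>Basis. (Rf i \<bullet> j) * pd j \<kappa>2 z) = - pd i k (x - Rf z)" for z
  proof -
    have "(\<Sum>j\<in>Basis. (Rf i \<bullet> j) * (Rf j \<bullet> a)) = i \<bullet> a" for a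
    proof -
      have "(\<Sum>j\<in>Basis. (Rf i \<bullet> j) * (Rf j \<bullet> a)) = (\<Sum>j\<in>Basis. (Rf i \<bullet> j) * (Rt a \<bullet> j))"
        by (intro sum.cong refl) (metis Rf_Rt inner_commute)
      also have "\<dots> = Rf i \<bullet> Rt a" by (rule euclidean_inner[symmetric])
      also have "\<dots> = i \<bullet> a" using Rf_Rt[of "Rf i" a] by (simp add: Rf_Rf)
      finally show ?thesis .
    qed
    then have "(\<Sum>j\<in>Basis. (Rf i \<bullet> j) * pd j \<kappa>2 z) = - (\<Sum>a\<in>Basis. (i \<bullet> a) * pd a k (x - Rf z))"
      unfolding p2 mult_minus_right sum_negf sum_distrib_left mult.assoc[symmetric]
      by (subst sum.swap) (simp only: sum_distrib_right[symmetric])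
    then show ?thesis using i by (simp add: inner_Basis if_distrib if_distribR cong: if_cong)
  qed
  have bd: "\<exists>c. \<forall>z\<in>D. \<bar>f z\<bar> \<le> c" if "smooth f" for f
    using smooth_bounded_on_cball[OF that, of \<tau>] D_bounded by metis
  have int: "integrable lborel (\<lambda>z. F (z, y) * f z)" if F: "wL2 F" and f: "smooth f" for F f y
  proof -
    obtain c where "\<And>z. z \<in> D ==> \<bar>f z\<bar> \<le> c" using bd[OF f] by metis
    then show ?thesis by (rule sect_integrand(1)[OF F smooth_borel[OF f]])
  qed
  have E1: "AE y in lborel. y \<in> {0<..<\<tau>} --> sect v (pd i \<kappa>1) y = - sect (\<lambda>X. g X \<bullet> i) \<kappa>1 y"
    by (rule sect_integration_by_parts[OF s(1) \<tau>' z(1) i])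
  have "AE y in lborel. \<forall>j\<in>Basis. y \<in> {0<..<\<tau>} --> sect v (pd j \<kappa>2) y = - sect (\<lambda>X. g X \<bullet> j) \<kappa>2 y"
    by (rule AE_finite_allI[OF finite_Basis], rule sect_integration_by_parts[OF s(2) \<tau>' z(2)])
  then show ?thesis
    using E1
  proof eventually_elim
    case (elim y)
    show ?case
    proof
      assume y: "y \<in> {0<..<\<tau>}"
      have t: "tst (pd i k) x z = - pd i \<kappa>1 z + (\<Sum>j\<in>Basis. (Rf i \<bullet> j) * pd j \<kappa>2 z)" for z
        unfolding tst_def p3 using p1[OF i] by simp
      have "pair v (pd i k) x y = (LBINT z. - (v (z, y) * pd i \<kappa>1 z) + (\<Sum>j\<in>Basis. (Rf i \<bullet> j) * (v (z, y) * pd j \<kappa>2 z)))"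
        unfolding pair_def sect_def t
        by (intro Bochner_Integration.integral_cong refl) (simp only: distrib_left mult_minus_right sum_distrib_left mult.left_commute)
      also have "\<dots> = - sect v (pd i \<kappa>1) y + (\<Sum>j\<in>Basis. (Rf i \<bullet> j) * sect v (pd j \<kappa>2) y)"
      proof (subst Bochner_Integration.integral_add)
        have iv: "integrable lborel (\<lambda>z. (Rf i \<bullet> j) * (v (z, y) * pd j \<kappa>2 z))" if "j \<in> Basis" for j
          by (intro integrable_mult_right int v_L2 smooth_pd s that)
        show "integrable lborel (\<lambda>z. - (v (z, y) * pd i \<kappa>1 z))"
          by (intro Bochner_Integration.integrable_minus int v_L2 smooth_pd s i)
        show "integrable lborel (\<lambda>z. \<Sum>j\<in>Basis. (Rf i \<bullet> j) * (v (z, y) * pd j \<kappa>2 z))"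
          by (rule Bochner_Integration.integrable_sum) (rule iv)
        show "(LBINT z. - (v (z, y) * pd i \<kappa>1 z)) + (LBINT z. (\<Sum>j\<in>Basis. (Rf i \<bullet> j) * (v (z, y) * pd j \<kappa>2 z)))
          = - sect v (pd i \<kappa>1) y + (\<Sum>j\<in>Basis. (Rf i \<bullet> j) * sect v (pd j \<kappa>2) y)"
          by (subst Bochner_Integration.integral_sum[OF iv]) (simp_all add: sect_def)
      qed
      also have "\<dots> = sect (\<lambda>X. g X \<bullet> i) \<kappa>1 y - (\<Sum>j\<in>Basis. (Rf i \<bullet> j) * sect (\<lambda>X. g X \<bullet> j) \<kappa>2 y)"
        using elim y by (simp add: sum_negf)
      also have "(\<Sum>j\<in>Basis. (Rf i \<bullet> j) * sect (\<lambda>X. g X \<bullet> j) \<kappa>2 y) = (LBINT z. (\<Sum>j\<in>Basis. (Rf i \<bullet> j) * ((g (z, y) \<bullet> j) * \<kappa>2 z)))"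
      proof -
        have ig: "integrable lborel (\<lambda>z. (Rf i \<bullet> j) * ((g (z, y) \<bullet> j) * \<kappa>2 z))" if "j \<in> Basis" for j
          using int[OF g_L2[OF that] s(2)] by (rule integrable_mult_right)
        show ?thesis by (subst Bochner_Integration.integral_sum[OF ig]) (simp_all add: sect_def)
      qed
      also have "(\<lambda>z. \<Sum>j\<in>Basis. (Rf i \<bullet> j) * ((g (z, y) \<bullet> j) * \<kappa>2 z)) = (\<lambda>z. (g (z, y) \<bullet> Rf i) * \<kappa>2 z)"
        unfolding euclidean_inner[of "g (_, y)" "Rf i"] by (simp add: sum_distrib_left sum_distrib_right ac_simps)
      also have "sect (\<lambda>X. g X \<bullet> i) \<kappa>1 y - (LBINT z. (g (z, y) \<bullet> Rf i) * \<kappa>2 z)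
        = (LBINT z. (g (z, y) \<bullet> i) * \<kappa>1 z - (g (z, y) \<bullet> Rf i) * \<kappa>2 z)"
      proof -
        have "integrable lborel (\<lambda>z. (g (z, y) \<bullet> Rf i) * \<kappa>2 z)"
        proof -
          have "integrable lborel (\<lambda>z. \<Sum>j\<in>Basis. (Rf i \<bullet> j) * ((g (z, y) \<bullet> j) * \<kappa>2 z))"
            by (rule Bochner_Integration.integrable_sum, rule integrable_mult_right, rule int[OF g_L2 s(2)])
          then show ?thesis
            unfolding euclidean_inner[of "g (_, y)" "Rf i"] by (simp add: sum_distrib_left sum_distrib_right ac_simps)
        qed
        then show ?thesis using int[OF g_L2[OF i] s(1)] by (simp add: sect_def)
      qed
      finally show "pair v (pd i k) x y = (LBINT z. (g (z, y) \<bullet> i) * k (x - z) - (g (z, y) \<bullet> Rf i) * k (x - Rf z))"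
        by (simp add: \<kappa>1_def \<kappa>2_def)
    qed
  qed
qed

text \<open>Young's inequality for convolution with a kernel of integral one: up to a factor that comes from the reflection, mollification does not increase the energy of the gradient, whatever the scale. This is the start of the induction on derivatives.\<close>

lemma base_energy:
  assumes k: "ker \<delta> k" and k0: "\<And>z. 0 \<le> k z" and k1: "integrable lborel k" "integral\<^sup>L lborel k = 1"
    and inv: "\<And>z. k (Rf z) = k z" and i: "i \<in> Basis"
    and x: "\<And>x. norm (x - x0) < R ==> adm x \<delta>" and S: "S \<le> \<tau>"
  shows "cyl_energy v (pd i k) x0 R S \<le> 4 * (1 + 2 * \<Lambda>\<^sup>2)\<^sup>2 * g_energy"
proof -
  note [measurable] = ker_borel[OF k] g_dir_borel pair_joint_borel[OF v_L2 ker_pd[OF k i]]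
  have [measurable]: "ball x0 R \<in> sets borel" by simp
  have kn: "(\<integral>\<^sup>+ z. ennreal (k z) \<partial>lborel) = 1"
    using k0 k1 by (subst nn_integral_eq_integral) auto
  have kz1: "(\<integral>\<^sup>+ z. ennreal (k (x - z)) \<partial>lborel) = 1" for x
    using nn_integral_lborel_reflect[of "\<lambda>z. ennreal (k z)" x] kn by simp
  have kz2: "(\<integral>\<^sup>+ z. ennreal (k (x - Rf z)) \<partial>lborel) = 1" for x
  proof -
    have "k (x - Rf z) = k (Rf x - z)" for z
      using inv[of "Rf x - z"] by (simp add: linear_diff[OF Rf_linear] Rf_Rf)
    then show ?thesis using kz1[of "Rf x"] by simp
  qed
  have kx: "(\<integral>\<^sup>+ x. ennreal (k (x - w)) \<partial>lborel) = 1" for w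
    using nn_integral_lborel_translate[of "\<lambda>z. ennreal (k z)" "- w"] kn by simp
  let ?G1 = "\<lambda>z y. (g (z, y) \<bullet> i)\<^sup>2 * m y" and ?G2 = "\<lambda>z y. (g (z, y) \<bullet> Rf i)\<^sup>2 * m y"
  define \<Gamma> where "\<Gamma> x y = (\<integral>\<^sup>+ z. ennreal (?G1 z y * k (x - z)) \<partial>lborel) + (\<integral>\<^sup>+ z. ennreal (?G2 z y * k (x - Rf z)) \<partial>lborel)" for x y
  have key: "AE y in lborel. y \<in> {0<..<\<tau>} --> ennreal ((pair v (pd i k) x y)\<^sup>2 * m y) \<le> 2 * \<Gamma> x y"
    if x': "norm (x - x0) < R" for x
    using pair_gradient[OF k x[OF x'] i]
  proof eventually_elim
    case (elim y)
    show ?case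
    proof
      assume y: "y \<in> {0<..<\<tau>}"
      define a where "a = (\<integral>\<^sup>+ z. ennreal (\<bar>g (z, y) \<bullet> i\<bar> * k (x - z)) \<partial>lborel)"
      define b where "b = (\<integral>\<^sup>+ z. ennreal (\<bar>g (z, y) \<bullet> Rf i\<bar> * k (x - Rf z)) \<partial>lborel)"
      have a2: "a\<^sup>2 \<le> (\<integral>\<^sup>+ z. ennreal ((g (z, y) \<bullet> i)\<^sup>2 * k (x - z)) \<partial>lborel)"
        unfolding a_def using weighted_Cauchy_Schwarz[of "\<lambda>z. g (z, y) \<bullet> i" lborel "\<lambda>z. k (x - z)"] k0 kz1[of x] by simp
      have b2: "b\<^sup>2 \<le> (\<integral>\<^sup>+ z. ennreal ((g (z, y) \<bullet> Rf i)\<^sup>2 * k (x - Rf z)) \<partial>lborel)"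
        unfolding b_def using weighted_Cauchy_Schwarz[of "\<lambda>z. g (z, y) \<bullet> Rf i" lborel "\<lambda>z. k (x - Rf z)"] k0 kz2[of x] by simp
      have "ennreal \<bar>pair v (pd i k) x y\<bar> \<le> (\<integral>\<^sup>+ z. ennreal \<bar>(g (z, y) \<bullet> i) * k (x - z) - (g (z, y) \<bullet> Rf i) * k (x - Rf z)\<bar> \<partial>lborel)"
        using elim y integral_norm_bound_ennreal[of lborel "\<lambda>z. (g (z, y) \<bullet> i) * k (x - z) - (g (z, y) \<bullet> Rf i) * k (x - Rf z)"]
        by (cases "integrable lborel (\<lambda>z. (g (z, y) \<bullet> i) * k (x - z) - (g (z, y) \<bullet> Rf i) * k (x - Rf z))")
           (auto simp: not_integrable_integral_eq)
      also have "\<dots> \<le> (\<integral>\<^sup>+ z. ennreal (\<bar>g (z, y) \<bullet> i\<bar> * k (x - z)) + ennreal (\<bar>g (z, y) \<bullet> Rf i\<bar> * k (x - Rf z)) \<partial>lborel)"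
      proof (rule nn_integral_mono)
        fix z
        have "\<bar>(g (z, y) \<bullet> i) * k (x - z) - (g (z, y) \<bullet> Rf i) * k (x - Rf z)\<bar> \<le> \<bar>g (z, y) \<bullet> i\<bar> * k (x - z) + \<bar>g (z, y) \<bullet> Rf i\<bar> * k (x - Rf z)"
          using k0[of "x - z"] k0[of "x - Rf z"] abs_triangle_ineq4[of "(g (z, y) \<bullet> i) * k (x - z)" "(g (z, y) \<bullet> Rf i) * k (x - Rf z)"]
          by (simp add: abs_mult)
        from ennreal_leI[OF this]
        show "ennreal \<bar>(g (z, y) \<bullet> i) * k (x - z) - (g (z, y) \<bullet> Rf i) * k (x - Rf z)\<bar> \<le> ennreal (\<bar>g (z, y) \<bullet> i\<bar> * k (x - z)) + ennreal (\<bar>g (z, y) \<bullet> Rf i\<bar> * k (x - Rf z))"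
          using k0 by (subst ennreal_plus[symmetric]) auto
      qed
      also have "\<dots> = a + b" unfolding a_def b_def by (rule nn_integral_add) measurable
      finally have ab: "ennreal \<bar>pair v (pd i k) x y\<bar> \<le> a + b" .
      have "(a + b)\<^sup>2 \<le> 2 * (a\<^sup>2 + b\<^sup>2)"
      proof (cases "a < top \<and> b < top")
        case True
        then obtain p q where pq: "a = ennreal p" "b = ennreal q" "0 \<le> p" "0 \<le> q" by (metis ennreal_cases less_irrefl)
        have "(p + q)\<^sup>2 \<le> 2 * (p\<^sup>2 + q\<^sup>2)" using sum_squares_bound[of p q] by (simp add: power2_sum)
        then have "ennreal ((p + q)\<^sup>2) \<le> ennreal (2 * (p\<^sup>2 + q\<^sup>2))" by (rule ennreal_leI)
        then show ?thesis using pq by (simp add: ennreal_power[symmetric] ennreal_mult)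
      next
        case False
        then have "a = top \<or> b = top" by (simp add: less_top[symmetric])
        then show ?thesis by (auto simp: power2_eq_square ennreal_mult_top)
      qed
      moreover have "(ennreal \<bar>pair v (pd i k) x y\<bar>)\<^sup>2 \<le> (a + b)\<^sup>2" using ab by (intro power_mono) auto
      ultimately have "ennreal ((pair v (pd i k) x y)\<^sup>2) \<le> 2 * (a\<^sup>2 + b\<^sup>2)" by (simp add: ennreal_power)
      also have "\<dots> \<le> 2 * ((\<integral>\<^sup>+ z. ennreal ((g (z, y) \<bullet> i)\<^sup>2 * k (x - z)) \<partial>lborel) + (\<integral>\<^sup>+ z. ennreal ((g (z, y) \<bullet> Rf i)\<^sup>2 * k (x - Rf z)) \<partial>lborel))"
        using a2 b2 by (intro mult_left_mono add_mono) auto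
      finally have "ennreal ((pair v (pd i k) x y)\<^sup>2) * ennreal (m y) \<le> 2 * ((\<integral>\<^sup>+ z. ennreal ((g (z, y) \<bullet> i)\<^sup>2 * k (x - z)) \<partial>lborel) + (\<integral>\<^sup>+ z. ennreal ((g (z, y) \<bullet> Rf i)\<^sup>2 * k (x - Rf z)) \<partial>lborel)) * ennreal (m y)"
        by (rule mult_right_mono) simp
      also have "\<dots> = 2 * ((\<integral>\<^sup>+ z. ennreal ((g (z, y) \<bullet> i)\<^sup>2 * k (x - z)) * ennreal (m y) \<partial>lborel) + (\<integral>\<^sup>+ z. ennreal ((g (z, y) \<bullet> Rf i)\<^sup>2 * k (x - Rf z)) * ennreal (m y) \<partial>lborel))"
        by (simp add: distrib_right mult.assoc nn_integral_multc)
      also have "\<dots> = 2 * \<Gamma> x y"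
        unfolding \<Gamma>_def using m_nonneg k0 by (simp add: ennreal_mult[symmetric] ac_simps)
      finally show "ennreal ((pair v (pd i k) x y)\<^sup>2 * m y) \<le> 2 * \<Gamma> x y"
        using m_nonneg by (simp add: ennreal_mult)
    qed
  qed
  have total: "(\<integral>\<^sup>+ x. \<integral>\<^sup>+ y. \<Gamma> x y \<partial>lborel \<partial>lborel) \<le> ennreal ((norm i)\<^sup>2 * g_energy) + ennreal ((norm (Rf i))\<^sup>2 * g_energy)"
  proof -
    have swap: "(\<integral>\<^sup>+ x. \<integral>\<^sup>+ y. \<integral>\<^sup>+ z. ennreal ((g (z, y) \<bullet> a)\<^sup>2 * m y * k (x - T z)) \<partial>lborel \<partial>lborel \<partial>lborel) \<le> ennreal ((norm a)\<^sup>2 * g_energy)"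
      if [measurable]: "T \<in> borel_measurable borel" for a and T :: "'a => 'a"
    proof -
      have "(\<integral>\<^sup>+ x. \<integral>\<^sup>+ y. \<integral>\<^sup>+ z. ennreal ((g (z, y) \<bullet> a)\<^sup>2 * m y * k (x - T z)) \<partial>lborel \<partial>lborel \<partial>lborel)
         = (\<integral>\<^sup>+ x. \<integral>\<^sup>+ X. ennreal ((g X \<bullet> a)\<^sup>2 * m (snd X) * k (x - T (fst X))) \<partial>lborel \<partial>lborel)"
        by (intro nn_integral_cong, subst nn_integral_lborel_pair(2)) simp_all
      also have "\<dots> = (\<integral>\<^sup>+ X. \<integral>\<^sup>+ x. ennreal ((g X \<bullet> a)\<^sup>2 * m (snd X) * k (x - T (fst X))) \<partial>lborel \<partial>lborel)"
        by (rule lborel_pair.Fubini'[of "\<lambda>X x. ennreal ((g X \<bullet> a)\<^sup>2 * m (snd X) * k (x - T (fst X)))"]) measurable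
      also have "\<dots> = (\<integral>\<^sup>+ X. ennreal ((g X \<bullet> a)\<^sup>2 * m (snd X)) \<partial>lborel)"
        using k0 m_nonneg by (simp add: ennreal_mult nn_integral_cmult kx)
      finally show ?thesis using g_dir_energy[of a] by simp
    qed
    have "(\<integral>\<^sup>+ x. \<integral>\<^sup>+ y. \<Gamma> x y \<partial>lborel \<partial>lborel) = (\<integral>\<^sup>+ x. \<integral>\<^sup>+ y. \<integral>\<^sup>+ z. ennreal (?G1 z y * k (x - z)) \<partial>lborel \<partial>lborel \<partial>lborel)
        + (\<integral>\<^sup>+ x. \<integral>\<^sup>+ y. \<integral>\<^sup>+ z. ennreal (?G2 z y * k (x - Rf z)) \<partial>lborel \<partial>lborel \<partial>lborel)"
      unfolding \<Gamma>_def by (simp add: nn_integral_add)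
    also have "\<dots> \<le> ennreal ((norm i)\<^sup>2 * g_energy) + ennreal ((norm (Rf i))\<^sup>2 * g_energy)"
      using swap[of "\<lambda>z. z" i] swap[OF Rf_borel, of "Rf i"] by (intro add_mono) auto
    finally show ?thesis .
  qed
  have "ennreal (cyl_energy v (pd i k) x0 R S) = (\<integral>\<^sup>+ X. ennreal ((indicator (ball x0 R) (fst X) * indicator {0<..<S} (snd X)) *
      (pair v (pd i k) (fst X) (snd X) * pair v (pd i k) (fst X) (snd X)) * m (snd X)) \<partial>lborel)"
    unfolding cyl_energy_def using m_nonneg
    by (intro nn_integral_eq_integral[symmetric] cyl_energy_integrable[OF v_L2 ker_pd[OF k i]] AE_I2
        mult_nonneg_nonneg[OF mult_nonneg_nonneg[OF _ zero_le_square]]) auto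
  also have "\<dots> = (\<integral>\<^sup>+ x. \<integral>\<^sup>+ y. ennreal ((indicator (ball x0 R) x * indicator {0<..<S} y) *
      (pair v (pd i k) x y * pair v (pd i k) x y) * m y) \<partial>lborel \<partial>lborel)"
    by (subst nn_integral_lborel_pair(1)) simp_all
  also have "\<dots> \<le> (\<integral>\<^sup>+ x. \<integral>\<^sup>+ y. 2 * \<Gamma> x y \<partial>lborel \<partial>lborel)"
  proof (rule nn_integral_mono)
    fix x
    show "(\<integral>\<^sup>+ y. ennreal ((indicator (ball x0 R) x * indicator {0<..<S} y) *
      (pair v (pd i k) x y * pair v (pd i k) x y) * m y) \<partial>lborel) \<le> (\<integral>\<^sup>+ y. 2 * \<Gamma> x y \<partial>lborel)"
    proof (cases "norm (x - x0) < R")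
      case True
      show ?thesis
      proof (rule nn_integral_mono_AE, use key[OF True] in eventually_elim)
        case (elim y)
        show ?case
        proof (cases "y \<in> {0<..<S}")
          case True
          then show ?thesis using elim S \<open>norm (x - x0) < R\<close>
            by (simp add: power2_eq_square dist_norm norm_minus_commute)
        qed simp
      qed
    qed (simp add: dist_norm norm_minus_commute)
  qed
  also have "\<dots> = 2 * (\<integral>\<^sup>+ x. \<integral>\<^sup>+ y. \<Gamma> x y \<partial>lborel \<partial>lborel)"
  proof -
    have "\<Gamma> x \<in> borel_measurable lborel" "(\<lambda>x. \<integral>\<^sup>+ y. \<Gamma> x y \<partial>lborel) \<in> borel_measurable lborel" for x
      unfolding \<Gamma>_def[abs_def] by measurable
    then show ?thesis by (simp only: nn_integral_cmult)
  qed
  also have "\<dots> \<le> 2 * (ennreal ((norm i)\<^sup>2 * g_energy) + ennreal ((norm (Rf i))\<^sup>2 * g_energy))"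
    by (intro mult_left_mono total) simp
  also have "\<dots> = ennreal (2 * (((norm i)\<^sup>2 + (norm (Rf i))\<^sup>2) * g_energy))"
    using g_energy_nonneg by (simp add: ennreal_mult' distrib_right ennreal_plus)
  also have "\<dots> \<le> ennreal (4 * (1 + 2 * \<Lambda>\<^sup>2)\<^sup>2 * g_energy)"
  proof (rule ennreal_leI)
    have "(norm (Rf i))\<^sup>2 \<le> (1 + 2 * \<Lambda>\<^sup>2)\<^sup>2" by (intro power_mono Rf_Basis_norm i) auto
    moreover have "(norm i)\<^sup>2 \<le> (1 + 2 * \<Lambda>\<^sup>2)\<^sup>2" using i by (simp add: one_le_power)
    ultimately have "(norm i)\<^sup>2 + (norm (Rf i))\<^sup>2 \<le> 2 * (1 + 2 * \<Lambda>\<^sup>2)\<^sup>2" by linarith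
    from mult_right_mono[OF this g_energy_nonneg]
    show "2 * (((norm i)\<^sup>2 + (norm (Rf i))\<^sup>2) * g_energy) \<le> 4 * (1 + 2 * \<Lambda>\<^sup>2)\<^sup>2 * g_energy" by linarith
  qed
  finally show ?thesis
    using g_energy_nonneg by (subst (asm) ennreal_le_iff) auto
qed

end

section \<open>Iterated energy estimates\<close>

primrec kd :: "'a::euclidean_space list => ('a => real) => 'a => real" where
  "kd [] k = k"
| "kd (b # \<alpha>) k = pd b (kd \<alpha> k)"

lemma kd_append: "kd (\<alpha> @ \<beta>) k = kd \<alpha> (kd \<beta> k)"
  by (induction \<alpha>) auto

lemma ker_kd: "ker \<delta> k ==> set \<alpha> \<subseteq> Basis ==> ker \<delta> (kd \<alpha> k)"
  by (induction \<alpha>) (auto intro: ker_pd)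

text \<open>Words rather than multi-indices, since each letter is one application of the Caccioppoli inequality.\<close>

definition words :: "nat => 'a::euclidean_space list set" where
  "words p = {\<alpha>. set \<alpha> \<subseteq> Basis \<and> length \<alpha> \<le> p}"

lemma finite_words: "finite (words p)"
  unfolding words_def by (rule finite_lists_length_le[OF finite_Basis])

context mixed_solution
begin

lemma cyl_energy_mono:
  assumes "wL2 F" "ker \<delta> \<kappa>" "R' \<le> R" "S' \<le> S"
  shows "cyl_energy F \<kappa> x0 R' S' \<le> cyl_energy F \<kappa> x0 R S"
  unfolding cyl_energy_def
proof (intro integral_mono cyl_energy_integrable[OF assms(1,2)])
  fix X :: "'a \<times> real"
  have "0 \<le> (pair F \<kappa> (fst X) (snd X) * pair F \<kappa> (fst X) (snd X)) * m (snd X)"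
    using m_nonneg by simp
  moreover have "indicator (ball x0 R') (fst X) * indicator {0<..<S'} (snd X)
      \<le> (indicator (ball x0 R) (fst X) * indicator {0<..<S} (snd X) :: real)"
    using assms(3,4) by (auto simp: indicator_def)
  ultimately show "indicator (ball x0 R') (fst X) * indicator {0<..<S'} (snd X) *
      (pair F \<kappa> (fst X) (snd X) * pair F \<kappa> (fst X) (snd X)) * m (snd X)
    \<le> indicator (ball x0 R) (fst X) * indicator {0<..<S} (snd X) *
      (pair F \<kappa> (fst X) (snd X) * pair F \<kappa> (fst X) (snd X)) * m (snd X)"
    unfolding mult.assoc[of _ "pair F \<kappa> (fst X) (snd X) * pair F \<kappa> (fst X) (snd X)"]
    by (rule mult_right_mono[rotated])
qed

text \<open>The loss in the Caccioppoli inequality when both radii shrink by \<open>d\<close>.\<close>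

definition rate :: "real => real" where "rate d = 20 * \<Lambda> ^ 4 * \<tau>\<^sup>2 / d ^ 4"

lemma rate_nonneg: "0 \<le> rate d" using Lam by (simp add: rate_def)

lemma caccioppoli_rate:
  assumes \<kappa>: "ker \<delta> \<kappa>" and x: "\<And>x. norm (x - x0) < R ==> adm x \<delta>"
    and d: "0 < d" "d < R" "d < S" "S \<le> \<tau>" "R \<le> \<tau>"
  shows "cyl_energy h \<kappa> x0 (R - d) (S - d) \<le> rate d * cyl_energy v \<kappa> x0 R S"
    and "i \<in> Basis ==> cyl_energy v (pd i \<kappa>) x0 (R - d) (S - d) \<le> rate d * cyl_energy v \<kappa> x0 R S"
proof -
  define E where "E = cyl_energy v \<kappa> x0 R S"
  define H where "H = cyl_energy h \<kappa> x0 (R - d) (S - d)"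
  define V where "V i = cyl_energy v (pd i \<kappa>) x0 (R - d) (S - d)" for i
  have nn: "0 \<le> E" "0 \<le> H" "0 \<le> V i" for i unfolding E_def H_def V_def by (rule cyl_energy_nonneg)+
  have iL: "0 < inverse \<Lambda>" "inverse \<Lambda> \<le> 1" using Lam by (auto simp: inverse_le_1_iff)
  have C: "H + inverse \<Lambda> * (\<Sum>i\<in>Basis. V i) \<le> (4 * R\<^sup>2 + 16 * \<Lambda> ^ 3 * S\<^sup>2) / d ^ 4 * E"
    unfolding H_def V_def E_def by (rule caccioppoli[OF \<kappa> x d(1-4)])
  have "R\<^sup>2 \<le> \<tau>\<^sup>2" "S\<^sup>2 \<le> \<tau>\<^sup>2" using d by (auto intro!: power_mono)
  moreover have "1 \<le> \<Lambda> ^ 3" using Lam by simp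
  ultimately have "4 * R\<^sup>2 + 16 * \<Lambda> ^ 3 * S\<^sup>2 \<le> 4 * (\<Lambda> ^ 3 * \<tau>\<^sup>2) + 16 * \<Lambda> ^ 3 * \<tau>\<^sup>2"
    using Lam mult_mono[of 1 "\<Lambda> ^ 3" "R\<^sup>2" "\<tau>\<^sup>2"] by (intro add_mono mult_left_mono) auto
  also have "\<dots> = inverse \<Lambda> * (20 * \<Lambda> ^ 4 * \<tau>\<^sup>2)" using Lam by (simp add: power4_eq_xxxx power3_eq_cube)
  finally have "(4 * R\<^sup>2 + 16 * \<Lambda> ^ 3 * S\<^sup>2) / d ^ 4 \<le> inverse \<Lambda> * (20 * \<Lambda> ^ 4 * \<tau>\<^sup>2) / d ^ 4"
    using d by (intro divide_right_mono) auto
  from mult_right_mono[OF this nn(1)] C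
  have C': "H + inverse \<Lambda> * (\<Sum>i\<in>Basis. V i) \<le> inverse \<Lambda> * (rate d * E)" by (simp add: rate_def)
  have Vs: "0 \<le> (\<Sum>i\<in>Basis. V i)" using nn by (simp add: sum_nonneg)
  have rE: "0 \<le> rate d * E" using rate_nonneg nn by simp
  have "H \<le> inverse \<Lambda> * (rate d * E)" using C' mult_nonneg_nonneg[of "inverse \<Lambda>", OF _ Vs] iL by linarith
  also have "\<dots> \<le> rate d * E" using iL rE by (simp add: mult_left_le_one_le)
  finally show "cyl_energy h \<kappa> x0 (R - d) (S - d) \<le> rate d * cyl_energy v \<kappa> x0 R S" by (simp add: H_def E_def)
  assume i: "i \<in> Basis"
  have "V i \<le> (\<Sum>i\<in>Basis. V i)" using i nn by (intro member_le_sum) auto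
  also have "inverse \<Lambda> * (\<Sum>i\<in>Basis. V i) \<le> inverse \<Lambda> * (rate d * E)" using C' nn(2) by linarith
  then have "(\<Sum>i\<in>Basis. V i) \<le> rate d * E" using iL by (simp add: mult_le_cancel_left)
  finally show "cyl_energy v (pd i \<kappa>) x0 (R - d) (S - d) \<le> rate d * cyl_energy v \<kappa> x0 R S" by (simp add: V_def E_def)
qed

text \<open>Horizontal derivatives of a mollified solution are mollified solutions with another kernel, so the Caccioppoli inequality applies again; each derivative costs one factor \<open>rate d\<close> and shrinks the cylinder by \<open>d\<close>.\<close>

lemma iterated_caccioppoli:
  assumes k: "ker \<delta> k" "\<And>z. 0 \<le> k z" "integrable lborel k" "integral\<^sup>L lborel k = 1" "\<And>z. k (Rf z) = k z"
    and x: "\<And>x. norm (x - x0) < R ==> adm x \<delta>"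
    and RS: "R \<le> \<tau>" "S \<le> \<tau>" and d: "0 < d" "real N * d < R" "real N * d < S"
    and \<alpha>: "set \<alpha> \<subseteq> Basis" "length \<alpha> = Suc p" "Suc p \<le> N"
  shows "cyl_energy v (kd \<alpha> k) x0 (R - real N * d) (S - real N * d) \<le> rate d ^ p * (4 * (1 + 2 * \<Lambda>\<^sup>2)\<^sup>2 * g_energy)"
    and "cyl_energy h (kd \<alpha> k) x0 (R - real N * d) (S - real N * d) \<le> rate d ^ Suc p * (4 * (1 + 2 * \<Lambda>\<^sup>2)\<^sup>2 * g_energy)"
proof -
  have rad: "d < R - real q * d" "d < S - real q * d" if "Suc q \<le> N" for q
  proof -
    have "(real q + 1) * d \<le> real N * d" using that d(1) by (intro mult_right_mono) auto
    then show "d < R - real q * d" "d < S - real q * d" using d by (auto simp: distrib_right)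
  qed
  have le: "R - real q * d \<le> R" "S - real q * d \<le> S" for q using d(1) by simp_all
  have xs: "adm x \<delta>" if "norm (x - x0) < R - real q * d" for x q
    by (rule x) (use that le(1)[of q] in linarith)
  have les: "R - real q * d \<le> \<tau>" "S - real q * d \<le> \<tau>" for q
    using le[of q] RS by linarith+
  have V: "cyl_energy v (kd \<alpha> k) x0 (R - real p * d) (S - real p * d) \<le> rate d ^ p * (4 * (1 + 2 * \<Lambda>\<^sup>2)\<^sup>2 * g_energy)"
    if "set \<alpha> \<subseteq> Basis" "length \<alpha> = Suc p" "p \<le> N" for p \<alpha>
    using that
  proof (induction p arbitrary: \<alpha>)
    case 0
    then obtain i where "\<alpha> = [i]" "i \<in> Basis" by (auto simp: length_Suc_conv)
    then show ?case using base_energy[OF k _ x RS(2), of i] by simp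
  next
    case (Suc p)
    then obtain i \<alpha>' where \<alpha>: "\<alpha> = i # \<alpha>'" "i \<in> Basis" "set \<alpha>' \<subseteq> Basis" "length \<alpha>' = Suc p"
      by (cases \<alpha>) auto
    have IH: "cyl_energy v (kd \<alpha>' k) x0 (R - real p * d) (S - real p * d) \<le> rate d ^ p * (4 * (1 + 2 * \<Lambda>\<^sup>2)\<^sup>2 * g_energy)"
      using Suc \<alpha> by simp
    have "cyl_energy v (pd i (kd \<alpha>' k)) x0 (R - real p * d - d) (S - real p * d - d)
        \<le> rate d * cyl_energy v (kd \<alpha>' k) x0 (R - real p * d) (S - real p * d)"
      by (rule caccioppoli_rate(2)[OF ker_kd[OF k(1) \<alpha>(3)] xs d(1) rad les(2) les(1) \<alpha>(2)])
         (use Suc.prems in auto)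
    also have "\<dots> \<le> rate d * (rate d ^ p * (4 * (1 + 2 * \<Lambda>\<^sup>2)\<^sup>2 * g_energy))"
      by (intro mult_left_mono IH rate_nonneg)
    moreover have "R - real p * d - d = R - real (Suc p) * d" "S - real p * d - d = S - real (Suc p) * d"
      by (simp_all add: distrib_right)
    ultimately show ?case by (simp only: \<alpha>(1) kd.simps power_Suc mult.assoc)
  qed
  have p: "real p * d \<le> real N * d" "real p * d + d \<le> real N * d"
    using \<alpha>(3) d(1) mult_right_mono[of "real (Suc p)" "real N" d] by (auto simp: distrib_right)
  have pN: "p \<le> N" using \<alpha>(3) by simp
  note V' = V[OF \<alpha>(1,2) pN]
  have kk: "ker \<delta> (kd \<alpha> k)" by (rule ker_kd[OF k(1) \<alpha>(1)])
  show "cyl_energy v (kd \<alpha> k) x0 (R - real N * d) (S - real N * d) \<le> rate d ^ p * (4 * (1 + 2 * \<Lambda>\<^sup>2)\<^sup>2 * g_energy)"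
    by (rule order_trans[OF cyl_energy_mono[OF v_L2 kk] V']) (use p(1) in linarith)+
  have "cyl_energy h (kd \<alpha> k) x0 (R - real p * d - d) (S - real p * d - d)
      \<le> rate d * cyl_energy v (kd \<alpha> k) x0 (R - real p * d) (S - real p * d)"
    by (rule caccioppoli_rate(1)[OF kk xs d(1) rad[OF \<alpha>(3)] les(2) les(1)])
  also have "\<dots> \<le> rate d * (rate d ^ p * (4 * (1 + 2 * \<Lambda>\<^sup>2)\<^sup>2 * g_energy))"
    by (intro mult_left_mono V' rate_nonneg)
  finally have H: "cyl_energy h (kd \<alpha> k) x0 (R - real p * d - d) (S - real p * d - d) \<le> rate d ^ Suc p * (4 * (1 + 2 * \<Lambda>\<^sup>2)\<^sup>2 * g_energy)"
    by (simp only: power_Suc mult.assoc)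
  show "cyl_energy h (kd \<alpha> k) x0 (R - real N * d) (S - real N * d) \<le> rate d ^ Suc p * (4 * (1 + 2 * \<Lambda>\<^sup>2)\<^sup>2 * g_energy)"
    by (rule order_trans[OF cyl_energy_mono[OF h_L2 kk] H]) (use p(2) in linarith)+
qed

text \<open>The Sobolev inequality on a box in the horizontal variable, at a fixed height.\<close>

lemma sobolev_sections:
  assumes \<kappa>: "ker \<delta> \<kappa>" and r: "0 < r"
  shows "ennreal \<bar>pair v \<kappa> x0 y\<bar> \<le> ennreal (2 / r) ^ DIM('a) *
    (\<integral>\<^sup>+ z\<in>{z. \<forall>b\<in>Basis. z \<bullet> b \<in> {0..r}}. (\<Sum>\<alpha>\<in>words DIM('a). ennreal (r ^ length \<alpha> * \<bar>pair v (kd \<alpha> \<kappa>) (x0 + z) y\<bar>)) \<partial>lborel)"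
proof -
  define A where "A \<alpha> x = ennreal (r ^ length \<alpha> * \<bar>pair v (kd \<alpha> \<kappa>) x y\<bar>)" for \<alpha> x
  have kk: "ker \<delta> (kd \<alpha> \<kappa>)" if "\<alpha> \<in> words p" for \<alpha> p
    using ker_kd[OF \<kappa>, of \<alpha>] that by (auto simp: words_def)
  have Am: "A \<alpha> \<in> borel_measurable borel" if "\<alpha> \<in> words p" for \<alpha> p
  proof -
    note [measurable] = pair_section_borel[OF v_L2 kk[OF that]]
    show ?thesis unfolding A_def[abs_def] by measurable
  qed
  define \<Psi> where "\<Psi> p x = (\<Sum>\<alpha>\<in>words p. A \<alpha> x)" for p x
  have \<Psi>m: "\<Psi> p \<in> borel_measurable borel" for p
    unfolding \<Psi>_def[abs_def] by (intro borel_measurable_sum Am)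
  have step: "\<Psi> p x \<le> ennreal (2 / r) * (\<integral>\<^sup>+ t\<in>{0..r}. \<Psi> (Suc p) (x + t *\<^sub>R b) \<partial>lborel)" if b: "b \<in> Basis" for p x b
  proof -
    have W: "\<alpha> \<in> words (Suc p)" "b # \<alpha> \<in> words (Suc p)" if "\<alpha> \<in> words p" for \<alpha>
      using that b by (auto simp: words_def)
    have one: "A \<alpha> x \<le> ennreal (1 / r) * (\<integral>\<^sup>+ t\<in>{0..r}. (A \<alpha> (x + t *\<^sub>R b) + A (b # \<alpha>) (x + t *\<^sub>R b)) \<partial>lborel)"
      if \<alpha>: "\<alpha> \<in> words p" for \<alpha>
    proof -
      let ?g = "\<lambda>t. pair v (kd \<alpha> \<kappa>) (x + t *\<^sub>R b) y" and ?g' = "\<lambda>t. pair v (pd b (kd \<alpha> \<kappa>)) (x + t *\<^sub>R b) y"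
      have g: "(?g has_real_derivative ?g' t) (at t)" for t
        using pair_derivative[OF v_L2 kk[OF \<alpha>] b] by simp
      have g': "continuous_on UNIV ?g'"
        using DERIV_isCont[OF pair_derivative[OF v_L2 kk[OF W(2)[OF \<alpha>]] b]] by (intro continuous_at_imp_continuous_on) simp
      have "ennreal \<bar>?g 0\<bar> \<le> ennreal (1 / r) * (\<integral>\<^sup>+ t\<in>{0..r}. ennreal (\<bar>?g t\<bar> + r * \<bar>?g' t\<bar>) \<partial>lborel)"
        by (rule slice_estimate[OF g g' r])
      then have "ennreal (r ^ length \<alpha>) * ennreal \<bar>?g 0\<bar> \<le> ennreal (r ^ length \<alpha>) * (ennreal (1 / r) * (\<integral>\<^sup>+ t\<in>{0..r}. ennreal (\<bar>?g t\<bar> + r * \<bar>?g' t\<bar>) \<partial>lborel))"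
        by (rule mult_left_mono) simp
      also have "ennreal (r ^ length \<alpha>) * ennreal \<bar>?g 0\<bar> = A \<alpha> x" using r by (simp add: A_def ennreal_mult')
      also have "ennreal (r ^ length \<alpha>) * (ennreal (1 / r) * (\<integral>\<^sup>+ t\<in>{0..r}. ennreal (\<bar>?g t\<bar> + r * \<bar>?g' t\<bar>) \<partial>lborel))
          = ennreal (1 / r) * (\<integral>\<^sup>+ t. ennreal (r ^ length \<alpha>) * (ennreal (\<bar>?g t\<bar> + r * \<bar>?g' t\<bar>) * indicator {0..r} t) \<partial>lborel)"
      proof -
        have [measurable]: "?g \<in> borel_measurable borel" "?g' \<in> borel_measurable borel"
          using g g' by (auto intro!: borel_measurable_continuous_onI continuous_at_imp_continuous_on DERIV_isCont)
        show ?thesis by (subst nn_integral_cmult) (auto simp: mult.left_commute)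
      qed
      also have "(\<lambda>t. ennreal (r ^ length \<alpha>) * (ennreal (\<bar>?g t\<bar> + r * \<bar>?g' t\<bar>) * indicator {0..r} t))
          = (\<lambda>t. (A \<alpha> (x + t *\<^sub>R b) + A (b # \<alpha>) (x + t *\<^sub>R b)) * indicator {0..r} t)"
      proof
        fix t
        have "ennreal (r ^ length \<alpha>) * ennreal (\<bar>?g t\<bar> + r * \<bar>?g' t\<bar>) = ennreal (r ^ length \<alpha> * \<bar>?g t\<bar> + r ^ Suc (length \<alpha>) * \<bar>?g' t\<bar>)"
          using r by (subst ennreal_mult[symmetric]) (auto intro!: arg_cong[where f = ennreal] simp: algebra_simps)
        also have "\<dots> = A \<alpha> (x + t *\<^sub>R b) + A (b # \<alpha>) (x + t *\<^sub>R b)"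
          unfolding A_def using r by (subst ennreal_plus) auto
        finally show "ennreal (r ^ length \<alpha>) * (ennreal (\<bar>?g t\<bar> + r * \<bar>?g' t\<bar>) * indicator {0..r} t)
          = (A \<alpha> (x + t *\<^sub>R b) + A (b # \<alpha>) (x + t *\<^sub>R b)) * indicator {0..r} t"
          by (simp only: mult.assoc[symmetric])
      qed
      finally show ?thesis .
    qed
    have "\<Psi> p x \<le> (\<Sum>\<alpha>\<in>words p. ennreal (1 / r) * (\<integral>\<^sup>+ t\<in>{0..r}. (A \<alpha> (x + t *\<^sub>R b) + A (b # \<alpha>) (x + t *\<^sub>R b)) \<partial>lborel))"
      unfolding \<Psi>_def by (intro sum_mono one)
    also have "\<dots> = ennreal (1 / r) * (\<integral>\<^sup>+ t. (\<Sum>\<alpha>\<in>words p. (A \<alpha> (x + t *\<^sub>R b) + A (b # \<alpha>) (x + t *\<^sub>R b)) * indicator {0..r} t) \<partial>lborel)"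
    proof (subst nn_integral_sum)
      fix \<alpha> :: "'a list" assume \<alpha>: "\<alpha> \<in> words p"
      note [measurable] = Am[OF \<alpha>] Am[OF W(2)[OF \<alpha>]]
      show "(\<lambda>t. (A \<alpha> (x + t *\<^sub>R b) + A (b # \<alpha>) (x + t *\<^sub>R b)) * indicator {0..r} t) \<in> borel_measurable lborel" by measurable
    qed (simp add: sum_distrib_left)
    also have "\<dots> \<le> ennreal (1 / r) * (\<integral>\<^sup>+ t. 2 * (\<Psi> (Suc p) (x + t *\<^sub>R b) * indicator {0..r} t) \<partial>lborel)"
    proof (intro mult_left_mono nn_integral_mono)
      fix t :: real
      have s1: "(\<Sum>\<alpha>\<in>words p. A \<alpha> (x + t *\<^sub>R b)) \<le> \<Psi> (Suc p) (x + t *\<^sub>R b)"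
        unfolding \<Psi>_def using W by (intro sum_mono2 finite_words) auto
      have "(\<Sum>\<alpha>\<in>words p. A (b # \<alpha>) (x + t *\<^sub>R b)) = (\<Sum>\<alpha>\<in>(#) b ` words p. A \<alpha> (x + t *\<^sub>R b))"
        by (subst sum.reindex) (auto simp: comp_def)
      also have "\<dots> \<le> \<Psi> (Suc p) (x + t *\<^sub>R b)"
        unfolding \<Psi>_def using W by (intro sum_mono2 finite_words) auto
      finally have "(\<Sum>\<alpha>\<in>words p. A \<alpha> (x + t *\<^sub>R b) + A (b # \<alpha>) (x + t *\<^sub>R b)) \<le> \<Psi> (Suc p) (x + t *\<^sub>R b) + \<Psi> (Suc p) (x + t *\<^sub>R b)"
        unfolding sum.distrib using s1 by (intro add_mono)
      also have "\<dots> = 2 * \<Psi> (Suc p) (x + t *\<^sub>R b)" by (simp add: mult_2)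
      finally show "(\<Sum>\<alpha>\<in>words p. (A \<alpha> (x + t *\<^sub>R b) + A (b # \<alpha>) (x + t *\<^sub>R b)) * indicator {0..r} t) \<le> 2 * (\<Psi> (Suc p) (x + t *\<^sub>R b) * indicator {0..r} t)"
        by (auto simp: indicator_def)
    qed simp
    also have "\<dots> = (ennreal (1 / r) * 2) * (\<integral>\<^sup>+ t\<in>{0..r}. \<Psi> (Suc p) (x + t *\<^sub>R b) \<partial>lborel)"
    proof -
      note [measurable] = \<Psi>m
      show ?thesis by (subst nn_integral_cmult) (auto simp: mult.assoc)
    qed
    also have "ennreal (1 / r) * 2 = ennreal (2 / r)"
    proof -
      have "ennreal (1 / r) * ennreal 2 = ennreal (1 / r * 2)" using r by (intro ennreal_mult[symmetric]) auto
      then show ?thesis by simp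
    qed
    finally show ?thesis .
  qed
  have \<Psi>0: "\<Psi> 0 x0 = ennreal \<bar>pair v \<kappa> x0 y\<bar>"
  proof -
    have "words 0 = {[] :: 'a list}" by (auto simp: words_def)
    then show ?thesis by (simp add: \<Psi>_def A_def)
  qed
  have "\<Psi> 0 x0 \<le> ennreal (2 / r) ^ DIM('a) * (\<integral>\<^sup>+ z\<in>{z. \<forall>b\<in>Basis. z \<bullet> b \<in> {0..r}}. \<Psi> DIM('a) (x0 + z) \<partial>lborel)"
    by (rule iterated_slice_estimate[of \<Psi> "ennreal (2 / r)" r x0, OF \<Psi>m step])
  then show ?thesis unfolding \<Psi>0 unfolding \<Psi>_def A_def .
qed

end

section \<open>Pointwise bounds for mollified derivatives\<close>

context mixed_solution
begin

text \<open>A bound for the value at one height by integrals over all heights: the vertical derivative of a mollified solution is the mollified vertical gradient, and the cutoff in \<open>y\<close> vanishes at height \<open>S\<close>.\<close>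

lemma pair_slice_bound:
  assumes \<kappa>: "ker \<delta> \<kappa>" and S: "S \<le> \<tau>"
  shows "AE y in lborel. y \<in> {0<..<\<tau>} --> ycut S y * \<bar>pair v \<kappa> x y\<bar>
    \<le> (LBINT s. indicator {0<..<S} s * (2 * \<tau> * \<bar>pair v \<kappa> x s\<bar> + \<tau>\<^sup>2 * \<bar>pair h \<kappa> x s\<bar>))"
proof -
  obtain c0 where c0: "\<And>x z. \<bar>tst \<kappa> x z\<bar> \<le> c0" using tst_bounded[OF \<kappa>] by metis
  note iW = pair_integrable(1)[OF v_L2 \<kappa>, of x] and iY = pair_integrable(1)[OF h_L2 \<kappa>, of x]
  have iT: "integrable lborel (\<lambda>s. 2 * \<tau> * \<bar>pair v \<kappa> x s\<bar> + \<tau>\<^sup>2 * \<bar>pair h \<kappa> x s\<bar>)"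
    using iW iY by simp
  have iB: "integrable lborel (\<lambda>s. indicator {0<..<S} s * (2 * \<tau> * \<bar>pair v \<kappa> x s\<bar> + \<tau>\<^sup>2 * \<bar>pair h \<kappa> x s\<bar>))"
    using integrable_mult_indicator[OF _ iT, of "{0<..<S}"] by simp
  show ?thesis
    using sect_absolutely_continuous[OF S tst_borel[OF \<kappa>] c0, of x]
  proof eventually_elim
    case (elim y)
    show ?case
    proof
      assume y: "y \<in> {0<..<\<tau>}"
      let ?f = "\<lambda>s. indicator {y..} s * (ycut' S s * pair v \<kappa> x s + ycut S s * pair h \<kappa> x s)"
      have e: "ycut S y * pair v \<kappa> x y = - (LBINT s. ?f s)"
        using elim y by (simp add: pair_def)
      have b: "\<bar>?f s\<bar> \<le> indicator {0<..<S} s * (2 * \<tau> * \<bar>pair v \<kappa> x s\<bar> + \<tau>\<^sup>2 * \<bar>pair h \<kappa> x s\<bar>)" for s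
      proof (cases "y \<le> s \<and> s < S")
        case True
        then have "\<bar>ycut' S s\<bar> * \<bar>pair v \<kappa> x s\<bar> \<le> 2 * \<tau> * \<bar>pair v \<kappa> x s\<bar>" "\<bar>ycut S s\<bar> * \<bar>pair h \<kappa> x s\<bar> \<le> \<tau>\<^sup>2 * \<bar>pair h \<kappa> x s\<bar>"
          using ycut_bounds[of s S] S y by (auto intro!: mult_right_mono)
        then show ?thesis using True y abs_triangle_ineq[of "ycut' S s * pair v \<kappa> x s" "ycut S s * pair h \<kappa> x s"]
          by (simp add: abs_mult)
      next
        case False
        then have "?f s = 0" by (auto simp: ycut_def ycut'_def)
        moreover have "0 \<le> indicator {0<..<S} s * (2 * \<tau> * \<bar>pair v \<kappa> x s\<bar> + \<tau>\<^sup>2 * \<bar>pair h \<kappa> x s\<bar>)"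
          using tau_pos by (intro mult_nonneg_nonneg add_nonneg_nonneg) auto
        ultimately show ?thesis by linarith
      qed
      have "ycut S y * \<bar>pair v \<kappa> x y\<bar> = \<bar>\<integral> s. ?f s \<partial>lborel\<bar>"
        using arg_cong[OF e, of abs] by (simp add: abs_mult ycut_def)
      also have "\<dots> \<le> (LBINT s. \<bar>?f s\<bar>)" by (rule integral_abs_bound)
      also have "\<dots> \<le> (LBINT s. indicator {0<..<S} s * (2 * \<tau> * \<bar>pair v \<kappa> x s\<bar> + \<tau>\<^sup>2 * \<bar>pair h \<kappa> x s\<bar>))"
        using b tau_pos by (intro integral_mono_AE' iB AE_I2) auto
      finally show "ycut S y * \<bar>pair v \<kappa> x y\<bar> \<le> (LBINT s. indicator {0<..<S} s * (2 * \<tau> * \<bar>pair v \<kappa> x s\<bar> + \<tau>\<^sup>2 * \<bar>pair h \<kappa> x s\<bar>))" .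
    qed
  qed
qed

lemma AE_Om_m_inverse: "AE X in lborel. snd (X :: 'a \<times> real) \<in> {0<..<\<tau>} --> m (snd X) * inverse (m (snd X)) = 1"
proof (subst AE_lborel_pair(2))
  show "AE y in lborel. AE z in lborel. snd (z :: 'a, y) \<in> {0<..<\<tau>} --> m (snd (z, y)) * inverse (m (snd (z, y))) = 1"
    using AE_m_inverse by eventually_elim auto
qed measurable

text \<open>Cauchy--Schwarz against \<open>1 / m\<close> turns weighted energies into unweighted \<open>L\<^sup>1\<close> norms. The integral of \<open>1 / m\<close> that appears here is what the Muckenhoupt condition compensates.\<close>

lemma box_L1_bound:
  assumes F: "wL2 F" and \<kappa>: "ker \<delta> \<kappa>" and [measurable]: "Q \<in> sets borel" and Q: "Q \<subseteq> ball x0 R"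
  shows "integrable lborel (\<lambda>X. (indicator Q (fst X) * indicator {0<..<S} (snd X)) * \<bar>pair F \<kappa> (fst X) (snd X)\<bar>)"
    and "(LBINT X. (indicator Q (fst X) * indicator {0<..<S} (snd X)) * \<bar>pair F \<kappa> (fst X) (snd X)\<bar>)
      \<le> sqrt (cyl_energy F \<kappa> x0 R S * (measure lborel Q * (LBINT y. inverse (m y))))"
proof -
  note [measurable] = pair_joint_borel[OF F \<kappa>]
  have Qf: "emeasure lborel Q < \<infinity>"
    by (rule le_less_trans[OF emeasure_mono[OF Q] emeasure_lborel_ball_finite]) simp
  let ?I = "\<lambda>X::'a \<times> real. indicator Q (fst X) * indicator {0<..<S} (snd X) :: real"
  let ?P = "\<lambda>X. pair F \<kappa> (fst X) (snd X)"
  define u where "u X = ?P X * m (snd X)" for X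
  define w where "w X = ?I X * inverse (m (snd X))" for X
  have [measurable]: "u \<in> borel_measurable borel" "w \<in> borel_measurable borel"
    unfolding u_def[abs_def] w_def[abs_def] by measurable
  have w0: "0 \<le> w X" for X using m_nonneg by (simp add: w_def)
  have mi: "integrable lborel (\<lambda>y. indicator {0<..<S} y * inverse (m y))"
    using integrable_mult_indicator[OF _ minv_int, of "{0<..<S}"] by simp
  have we: "(LBINT z. w (z, y)) = measure lborel Q * (indicator {0<..<S} y * inverse (m y))" for y
    by (simp add: w_def mult.assoc)
  have iw: "integrable lborel w"
  proof (rule integrable_lborel_pairI)
    show "integrable lborel (\<lambda>z. w (z, y))" for y using Qf by (simp add: w_def mult.assoc)
    have "\<bar>w X\<bar> = w X" for X using w0[of X] by simp
    then show "integrable lborel (\<lambda>y. \<integral> z. \<bar>w (z, y)\<bar> \<partial>lborel)"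
      unfolding we by (simp only: we) (intro integrable_mult_right mi)
  qed simp
  have Iw: "(LBINT X. w X) \<le> measure lborel Q * (LBINT y. inverse (m y))"
  proof -
    have "(LBINT X. w X) = measure lborel Q * (LBINT y. indicator {0<..<S} y * inverse (m y))"
      by (subst integral_lborel_pair(2)[OF iw]) (simp only: we integral_mult_right_zero)
    also have "\<dots> \<le> measure lborel Q * (LBINT y. inverse (m y))"
      using m_nonneg by (intro mult_left_mono integral_mono mi minv_int) (auto simp: indicator_def)
    finally show ?thesis .
  qed
  have uw: "(u X)\<^sup>2 * w X = ?I X * (?P X * ?P X) * m (snd X)" for X
    by (cases "m (snd X) = 0") (auto simp: u_def w_def power2_eq_square field_simps)
  have le: "?I X * (?P X * ?P X) * m (snd X) \<le> (indicator (ball x0 R) (fst X) * indicator {0<..<S} (snd X)) * (?P X * ?P X) * m (snd X)" for X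
  proof -
    have "?I X \<le> indicator (ball x0 R) (fst X) * indicator {0<..<S} (snd X)"
      using Q by (auto simp: indicator_def)
    then have "?I X * (?P X * ?P X * m (snd X)) \<le> (indicator (ball x0 R) (fst X) * indicator {0<..<S} (snd X)) * (?P X * ?P X * m (snd X))"
      by (rule mult_right_mono) (use m_nonneg in auto)
    then show ?thesis by (simp only: mult.assoc)
  qed
  have nn: "0 \<le> ?I X * (?P X * ?P X) * m (snd X)" for X
    by (intro mult_nonneg_nonneg m_nonneg zero_le_square) auto
  have iuw: "integrable lborel (\<lambda>X. (u X)\<^sup>2 * w X)"
    unfolding uw
  proof (rule Bochner_Integration.integrable_bound[OF cyl_energy_integrable[OF F \<kappa>, of x0 R S]])
    show "AE X in lborel. norm (?I X * (?P X * ?P X) * m (snd X)) \<le> norm ((indicator (ball x0 R) (fst X) * indicator {0<..<S} (snd X)) * (?P X * ?P X) * m (snd X))"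
    proof (intro AE_I2)
      fix X :: "'a \<times> real"
      show "norm (?I X * (?P X * ?P X) * m (snd X)) \<le> norm ((indicator (ball x0 R) (fst X) * indicator {0<..<S} (snd X)) * (?P X * ?P X) * m (snd X))"
        using nn[of X] le[of X] unfolding real_norm_def by linarith
    qed
  qed measurable
  have "(LBINT X. (u X)\<^sup>2 * w X) \<le> cyl_energy F \<kappa> x0 R S"
    unfolding cyl_energy_def using iuw le unfolding uw by (intro integral_mono cyl_energy_integrable[OF F \<kappa>])
  moreover have "(LBINT X. \<bar>u X\<bar> * w X)\<^sup>2 \<le> (LBINT X. (u X)\<^sup>2 * w X) * (LBINT X. w X)"
    by (rule Cauchy_Schwarz_integral(2)) (use w0 iw iuw in auto)
  moreover have "0 \<le> (LBINT X. w X)" using w0 by simp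
  ultimately have sq: "(LBINT X. \<bar>u X\<bar> * w X)\<^sup>2 \<le> cyl_energy F \<kappa> x0 R S * (measure lborel Q * (LBINT y. inverse (m y)))"
    using Iw cyl_energy_nonneg[of F \<kappa> x0 R S] by (meson mult_mono order_trans)
  have ae: "AE X in lborel. \<bar>u X\<bar> * w X = ?I X * \<bar>?P X\<bar>"
    using AE_Om_m_inverse
  proof eventually_elim
    case (elim X)
    show ?case
    proof (cases "snd X \<in> {0<..<\<tau>}")
      case True
      then have "m (snd X) * inverse (m (snd X)) = 1" using elim by simp
      moreover have "\<bar>u X\<bar> * w X = ?I X * \<bar>?P X\<bar> * (m (snd X) * inverse (m (snd X)))"
        using m_nonneg[of "snd X"] by (simp add: u_def w_def abs_mult ac_simps)
      ultimately show ?thesis by simp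
    qed (simp add: u_def pair_zero[OF F])
  qed
  have i: "integrable lborel (\<lambda>X. \<bar>u X\<bar> * w X)"
    using Cauchy_Schwarz_integral(1)[of "\<lambda>X. \<bar>u X\<bar>" lborel w] w0 iw iuw by simp
  show "integrable lborel (\<lambda>X. ?I X * \<bar>?P X\<bar>)"
    by (rule integrable_cong_AE_imp[OF i _ ae]) measurable
  have "(LBINT X. ?I X * \<bar>?P X\<bar>) = (LBINT X. \<bar>u X\<bar> * w X)"
    by (rule integral_cong_AE) (use ae in auto)
  also have "\<dots> \<le> sqrt (cyl_energy F \<kappa> x0 R S * (measure lborel Q * (LBINT y. inverse (m y))))"
    using sq by (rule real_le_rsqrt)
  finally show "(LBINT X. ?I X * \<bar>?P X\<bar>) \<le> sqrt (cyl_energy F \<kappa> x0 R S * (measure lborel Q * (LBINT y. inverse (m y))))" .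
qed

text \<open>Sobolev's inequality in the horizontal variable and the slice bound in the vertical one, with \<open>L\<^sup>1\<close> norms controlled by iterated energies.\<close>

lemma section_sup_bound:
  assumes k: "ker \<delta> k" "\<And>z. 0 \<le> k z" "integrable lborel k" "integral\<^sup>L lborel k = 1" "\<And>z. k (Rf z) = k z"
    and x: "\<And>x. norm (x - x0) < R ==> adm x \<delta>"
    and RS: "R \<le> \<tau>" "S \<le> \<tau>" and d: "0 < d" "real N * d < R" "real N * d < S"
    and \<beta>: "set \<beta> \<subseteq> Basis" "\<beta> \<noteq> []" "DIM('a) + length \<beta> \<le> N"
    and r: "0 < r" "real DIM('a) * r < R - real N * d" and s0: "s0 < S - real N * d"
  shows "AE y in lborel. 0 < y \<and> y \<le> s0 --> \<bar>pair v (kd \<beta> k) x0 y\<bar> \<le>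
    (2 / r) ^ DIM('a) * (\<Sum>\<alpha>\<in>(words DIM('a) :: 'a list set). r ^ length \<alpha> / (S - real N * d - s0)\<^sup>2 *
      (\<tau> * sqrt (rate d) ^ (length \<alpha> + length \<beta> - 1) * (2 + \<tau> * sqrt (rate d)) *
        sqrt (4 * (1 + 2 * \<Lambda>\<^sup>2)\<^sup>2 * g_energy * (r ^ DIM('a) * (LBINT y. inverse (m y))))))"
proof -
  define n where "n = DIM('a)"
  define R' where "R' = R - real N * d"
  define S' where "S' = S - real N * d"
  define \<sigma> where "\<sigma> = sqrt (rate d)"
  define G where "G = sqrt (4 * (1 + 2 * \<Lambda>\<^sup>2)\<^sup>2 * g_energy * (r ^ n * (LBINT y. inverse (m y))))"
  define q where "q = (S' - s0)\<^sup>2"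
  have q: "0 < q" using s0 by (simp add: q_def S'_def)
  define Q where "Q = cbox x0 (x0 + r *\<^sub>R One)"
  have [measurable]: "Q \<in> sets borel" by (simp add: Q_def)
  have memQ: "x \<in> Q \<longleftrightarrow> (\<forall>b\<in>Basis. (x - x0) \<bullet> b \<in> {0..r})" for x
    by (auto simp: Q_def mem_box algebra_simps)
  have mQ: "measure lborel Q = r ^ n"
    using r by (simp add: Q_def n_def content_cbox algebra_simps)
  have QR: "Q \<subseteq> ball x0 R'"
  proof
    fix x assume "x \<in> Q"
    then have "norm (x - x0) \<le> (\<Sum>b\<in>Basis. \<bar>(x - x0) \<bullet> b\<bar>)" "\<And>b. b \<in> Basis ==> \<bar>(x - x0) \<bullet> b\<bar> \<le> r"
      using norm_le_l1[of "x - x0"] by (auto simp: memQ)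
    then have "norm (x - x0) \<le> real DIM('a) * r"
      using sum_bounded_above[of Basis "\<lambda>b. \<bar>(x - x0) \<bullet> b\<bar>" r] by force
    then show "x \<in> ball x0 R'" using r by (simp add: R'_def dist_norm norm_minus_commute)
  qed
  define \<gamma> where "\<gamma> \<alpha> = kd (\<alpha> @ \<beta>) k" for \<alpha>
  have w: "set (\<alpha> @ \<beta>) \<subseteq> Basis" "length (\<alpha> @ \<beta>) = Suc (length \<alpha> + length \<beta> - 1)" "Suc (length \<alpha> + length \<beta> - 1) \<le> N"
    if "\<alpha> \<in> words n" for \<alpha>
    using that \<beta> by (auto simp: words_def n_def Suc_le_eq)
  have kg: "ker \<delta> (\<gamma> \<alpha>)" if "\<alpha> \<in> words n" for \<alpha>
    unfolding \<gamma>_def by (rule ker_kd[OF k(1) w(1)[OF that]])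
  define T where "T \<alpha> x = (LBINT s. indicator {0<..<S'} s * (2 * \<tau> * \<bar>pair v (\<gamma> \<alpha>) x s\<bar> + \<tau>\<^sup>2 * \<bar>pair h (\<gamma> \<alpha>) x s\<bar>))" for \<alpha> x
  define K where "K \<alpha> = \<tau> * \<sigma> ^ (length \<alpha> + length \<beta> - 1) * (2 + \<tau> * \<sigma>) * G" for \<alpha> :: "'a list"
  have S': "S' \<le> \<tau>" using RS d(1) mult_nonneg_nonneg[of "real N" d] unfolding S'_def by linarith
  have Tint: "(\<integral>\<^sup>+ x\<in>Q. ennreal (T \<alpha> x) \<partial>lborel) \<le> ennreal (K \<alpha>)" and Tm: "T \<alpha> \<in> borel_measurable borel"
    if \<alpha>: "\<alpha> \<in> words n" for \<alpha>
  proof -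
    let ?p = "length \<alpha> + length \<beta> - 1"
    note pm [measurable] = pair_joint_borel[OF v_L2 kg[OF \<alpha>]] pair_joint_borel[OF h_L2 kg[OF \<alpha>]]
    let ?J = "\<lambda>X::'a \<times> real. indicator Q (fst X) * indicator {0<..<S'} (snd X) :: real"
    let ?Z = "\<lambda>X. 2 * \<tau> * (?J X * \<bar>pair v (\<gamma> \<alpha>) (fst X) (snd X)\<bar>) + \<tau>\<^sup>2 * (?J X * \<bar>pair h (\<gamma> \<alpha>) (fst X) (snd X)\<bar>)"
    show "T \<alpha> \<in> borel_measurable borel"
    proof -
      have "(\<lambda>X. indicator {0<..<S'} (snd X) * (2 * \<tau> * \<bar>pair v (\<gamma> \<alpha>) (fst X) (snd X)\<bar> + \<tau>\<^sup>2 * \<bar>pair h (\<gamma> \<alpha>) (fst X) (snd X)\<bar>)) \<in> borel_measurable borel"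
        by measurable
      then have "(\<lambda>(x, s). indicator {0<..<S'} s * (2 * \<tau> * \<bar>pair v (\<gamma> \<alpha>) x s\<bar> + \<tau>\<^sup>2 * \<bar>pair h (\<gamma> \<alpha>) x s\<bar>)) \<in> borel_measurable (borel \<Otimes>\<^sub>M lborel)"
        by (simp add: case_prod_beta' borel_prod[symmetric] measurable_cong_sets[OF sets_pair_measure_cong[OF refl sets_lborel] refl])
      then show ?thesis unfolding T_def[abs_def] by (rule lborel.borel_measurable_lebesgue_integral)
    qed
    note V = iterated_caccioppoli[OF k x RS d w[OF \<alpha>], folded \<gamma>_def R'_def S'_def]
    note b1 = box_L1_bound[OF v_L2 kg[OF \<alpha>] \<open>Q \<in> sets borel\<close> QR, of S']
    note b2 = box_L1_bound[OF h_L2 kg[OF \<alpha>] \<open>Q \<in> sets borel\<close> QR, of S']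
    have Mi: "0 \<le> r ^ n * (LBINT y. inverse (m y))" using r m_nonneg by simp
    have sq: "sqrt (rate d ^ j * (4 * (1 + 2 * \<Lambda>\<^sup>2)\<^sup>2 * g_energy) * (r ^ n * (LBINT y. inverse (m y)))) = \<sigma> ^ j * G" for j
      unfolding G_def \<sigma>_def by (simp add: real_sqrt_mult real_sqrt_power ac_simps)
    have I1: "(LBINT X. ?J X * \<bar>pair v (\<gamma> \<alpha>) (fst X) (snd X)\<bar>) \<le> \<sigma> ^ ?p * G"
      unfolding sq[symmetric]
      by (rule order_trans[OF b1(2)]) (simp only: mQ, intro real_sqrt_le_mono mult_right_mono V(1) Mi)
    have I2: "(LBINT X. ?J X * \<bar>pair h (\<gamma> \<alpha>) (fst X) (snd X)\<bar>) \<le> \<sigma> ^ Suc ?p * G"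
      unfolding sq[symmetric]
      by (rule order_trans[OF b2(2)]) (simp only: mQ, intro real_sqrt_le_mono mult_right_mono V(2) Mi)
    have iZ: "integrable lborel ?Z" by (intro Bochner_Integration.integrable_add integrable_mult_right b1(1) b2(1))
    have "(LBINT X. ?Z X) = 2 * \<tau> * (LBINT X. ?J X * \<bar>pair v (\<gamma> \<alpha>) (fst X) (snd X)\<bar>) + \<tau>\<^sup>2 * (LBINT X. ?J X * \<bar>pair h (\<gamma> \<alpha>) (fst X) (snd X)\<bar>)"
      using b1(1) b2(1) by (subst Bochner_Integration.integral_add) (auto intro!: integrable_mult_right simp only: integral_mult_right_zero)
    also have "\<dots> \<le> 2 * \<tau> * (\<sigma> ^ ?p * G) + \<tau>\<^sup>2 * (\<sigma> ^ Suc ?p * G)"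
      using tau_pos by (intro add_mono mult_left_mono I1 I2) auto
    also have "\<dots> = K \<alpha>" by (simp add: K_def power2_eq_square algebra_simps)
    finally have IZ: "(LBINT X. ?Z X) \<le> K \<alpha>" .
    have Ze: "?Z (x, s) = indicator Q x * (indicator {0<..<S'} s * (2 * \<tau> * \<bar>pair v (\<gamma> \<alpha>) x s\<bar> + \<tau>\<^sup>2 * \<bar>pair h (\<gamma> \<alpha>) x s\<bar>))" for x s
      by (simp add: algebra_simps)
    have zT: "(LBINT s. ?Z (x, s)) = indicator Q x * T \<alpha> x" for x
      unfolding Ze T_def by (simp only: integral_mult_right_zero)
    have T0: "0 \<le> T \<alpha> x" for x
      unfolding T_def using tau_pos by (intro integral_nonneg_AE AE_I2 mult_nonneg_nonneg add_nonneg_nonneg) auto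
    have "(\<integral>\<^sup>+ x\<in>Q. ennreal (T \<alpha> x) \<partial>lborel) = (\<integral>\<^sup>+ x. ennreal (indicator Q x * T \<alpha> x) \<partial>lborel)"
      by (intro nn_integral_cong) (auto simp: indicator_def)
    also have "\<dots> = ennreal (LBINT x. indicator Q x * T \<alpha> x)"
      using integral_lborel_pair(5)[OF iZ] T0 unfolding zT by (intro nn_integral_eq_integral) auto
    also have "(LBINT x. indicator Q x * T \<alpha> x) = (LBINT X. ?Z X)"
      unfolding integral_lborel_pair(1)[OF iZ] zT ..
    finally show "(\<integral>\<^sup>+ x\<in>Q. ennreal (T \<alpha> x) \<partial>lborel) \<le> ennreal (K \<alpha>)" using IZ by (simp add: ennreal_leI)
  qed
  have AEx: "AE y in lborel. AE x in lborel. y \<in> {0<..<\<tau>} --> ycut S' y * \<bar>pair v (\<gamma> \<alpha>) x y\<bar> \<le> T \<alpha> x"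
    if \<alpha>: "\<alpha> \<in> words n" for \<alpha>
  proof -
    note [measurable] = pair_joint_borel[OF v_L2 kg[OF \<alpha>]] Tm[OF \<alpha>]
    have P: "Measurable.pred borel (\<lambda>X. snd X \<in> {0<..<\<tau>} --> ycut S' (snd X) * \<bar>pair v (\<gamma> \<alpha>) (fst X) (snd X)\<bar> \<le> T \<alpha> (fst X))"
      by measurable
    have "AE x in lborel. AE y in lborel. y \<in> {0<..<\<tau>} --> ycut S' y * \<bar>pair v (\<gamma> \<alpha>) x y\<bar> \<le> T \<alpha> x"
      unfolding T_def by (intro AE_I2 pair_slice_bound[OF kg[OF \<alpha>] S'])
    then show ?thesis using AE_lborel_pair[OF P] by simp
  qed
  have "AE y in lborel. \<forall>\<alpha>\<in>words n. AE x in lborel. y \<in> {0<..<\<tau>} --> ycut S' y * \<bar>pair v (\<gamma> \<alpha>) x y\<bar> \<le> T \<alpha> x"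
    by (rule AE_finite_allI[OF finite_words AEx])
  then show ?thesis
  proof eventually_elim
    case (elim y)
    show ?case
    proof
      assume y: "0 < y \<and> y \<le> s0"
      then have y': "y \<in> {0<..<\<tau>}" using s0 S' by (auto simp: S'_def)
      have qy: "q \<le> ycut S' y" unfolding q_def ycut_def using y s0 by (intro power_mono) (auto simp: S'_def)
      have bd: "AE x in lborel. \<bar>pair v (\<gamma> \<alpha>) x y\<bar> \<le> T \<alpha> x / q" if \<alpha>: "\<alpha> \<in> words n" for \<alpha>
      proof -
        have "AE x in lborel. y \<in> {0<..<\<tau>} --> ycut S' y * \<bar>pair v (\<gamma> \<alpha>) x y\<bar> \<le> T \<alpha> x" using elim \<alpha> by blast
        then show ?thesis
        proof eventually_elim
          case (elim x)
          then have "q * \<bar>pair v (\<gamma> \<alpha>) x y\<bar> \<le> T \<alpha> x"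
            using mult_right_mono[OF qy, of "\<bar>pair v (\<gamma> \<alpha>) x y\<bar>"] y' by auto
          then show ?case using q by (simp add: pos_le_divide_eq mult.commute)
        qed
      qed
      have one: "(\<integral>\<^sup>+ x\<in>Q. ennreal (r ^ length \<alpha> * \<bar>pair v (\<gamma> \<alpha>) x y\<bar>) \<partial>lborel) \<le> ennreal (r ^ length \<alpha> / q * K \<alpha>)"
        if \<alpha>: "\<alpha> \<in> words n" for \<alpha>
      proof -
        note [measurable] = Tm[OF \<alpha>]
        have "(\<integral>\<^sup>+ x\<in>Q. ennreal (r ^ length \<alpha> * \<bar>pair v (\<gamma> \<alpha>) x y\<bar>) \<partial>lborel) \<le> (\<integral>\<^sup>+ x. ennreal (r ^ length \<alpha> / q) * (ennreal (T \<alpha> x) * indicator Q x) \<partial>lborel)"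
        proof (rule nn_integral_mono_AE, use bd[OF \<alpha>] in eventually_elim)
          case (elim x)
          have "r ^ length \<alpha> * \<bar>pair v (\<gamma> \<alpha>) x y\<bar> \<le> r ^ length \<alpha> * (T \<alpha> x / q)"
            using elim r by (intro mult_left_mono) auto
          then have "ennreal (r ^ length \<alpha> * \<bar>pair v (\<gamma> \<alpha>) x y\<bar>) \<le> ennreal (r ^ length \<alpha> / q) * ennreal (T \<alpha> x)"
            using r q by (subst ennreal_mult'[symmetric]) (auto intro!: ennreal_leI)
          then show ?case by (auto simp: indicator_def)
        qed
        also have "\<dots> = ennreal (r ^ length \<alpha> / q) * (\<integral>\<^sup>+ x\<in>Q. ennreal (T \<alpha> x) \<partial>lborel)"
          by (rule nn_integral_cmult) measurable
        also have "\<dots> \<le> ennreal (r ^ length \<alpha> / q) * ennreal (K \<alpha>)"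
          by (intro mult_left_mono Tint[OF \<alpha>]) simp
        also have "\<dots> = ennreal (r ^ length \<alpha> / q * K \<alpha>)" using r q by (intro ennreal_mult'[symmetric]) auto
        finally show ?thesis .
      qed
      have K0: "0 \<le> K \<alpha>" for \<alpha>
        unfolding K_def \<sigma>_def G_def using tau_pos rate_nonneg Lam by (intro mult_nonneg_nonneg add_nonneg_nonneg zero_le_power real_sqrt_ge_zero g_energy_nonneg) (auto simp: r(1) m_nonneg less_imp_le)
      define A where "A x = (\<Sum>\<alpha>\<in>words n. ennreal (r ^ length \<alpha> * \<bar>pair v (\<gamma> \<alpha>) x y\<bar>))" for x
      have [measurable]: "A \<in> borel_measurable borel"
        unfolding A_def[abs_def]
      proof (rule borel_measurable_sum)
        fix \<alpha> :: "'a list" assume \<alpha>: "\<alpha> \<in> words n"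
        note [measurable] = pair_section_borel[OF v_L2 kg[OF \<alpha>]]
        show "(\<lambda>x. ennreal (r ^ length \<alpha> * \<bar>pair v (\<gamma> \<alpha>) x y\<bar>)) \<in> borel_measurable borel" by measurable
      qed
      have kb: "ker \<delta> (kd \<beta> k)" by (rule ker_kd[OF k(1) \<beta>(1)])
      have "ennreal \<bar>pair v (kd \<beta> k) x0 y\<bar> \<le> ennreal (2 / r) ^ n * (\<integral>\<^sup>+ z\<in>{z. \<forall>b\<in>Basis. z \<bullet> b \<in> {0..r}}. A (x0 + z) \<partial>lborel)"
        using sobolev_sections[OF kb r(1), of x0 y] by (simp only: A_def n_def \<gamma>_def kd_append)
      also have "(\<integral>\<^sup>+ z\<in>{z. \<forall>b\<in>Basis. z \<bullet> b \<in> {0..r}}. A (x0 + z) \<partial>lborel) = (\<integral>\<^sup>+ z. A (z + x0) * indicator Q (z + x0) \<partial>lborel)"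
        by (intro nn_integral_cong) (auto simp: indicator_def memQ add.commute)
      also have "\<dots> = (\<integral>\<^sup>+ x\<in>Q. A x \<partial>lborel)"
        by (rule nn_integral_lborel_translate[of "\<lambda>x. A x * indicator Q x"]) measurable
      also have "\<dots> = (\<integral>\<^sup>+ x. (\<Sum>\<alpha>\<in>words n. ennreal (r ^ length \<alpha> * \<bar>pair v (\<gamma> \<alpha>) x y\<bar>) * indicator Q x) \<partial>lborel)"
        by (simp only: A_def sum_distrib_right)
      also have "\<dots> = (\<Sum>\<alpha>\<in>words n. \<integral>\<^sup>+ x\<in>Q. ennreal (r ^ length \<alpha> * \<bar>pair v (\<gamma> \<alpha>) x y\<bar>) \<partial>lborel)"
      proof (rule nn_integral_sum)
        fix \<alpha> :: "'a list" assume \<alpha>: "\<alpha> \<in> words n"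
        note [measurable] = pair_section_borel[OF v_L2 kg[OF \<alpha>]]
        show "(\<lambda>x. ennreal (r ^ length \<alpha> * \<bar>pair v (\<gamma> \<alpha>) x y\<bar>) * indicator Q x) \<in> borel_measurable lborel" by measurable
      qed
      also have "\<dots> \<le> (\<Sum>\<alpha>\<in>words n. ennreal (r ^ length \<alpha> / q * K \<alpha>))" by (intro sum_mono one)
      also have "\<dots> = ennreal (\<Sum>\<alpha>\<in>words n. r ^ length \<alpha> / q * K \<alpha>)"
        using r q K0 by (intro sum_ennreal) auto
      finally have "ennreal \<bar>pair v (kd \<beta> k) x0 y\<bar> \<le> ennreal ((2 / r) ^ n) * ennreal (\<Sum>\<alpha>\<in>words n. r ^ length \<alpha> / q * K \<alpha>)"
        using r by (simp add: ennreal_power mult_left_mono)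
      then have "ennreal \<bar>pair v (kd \<beta> k) x0 y\<bar> \<le> ennreal ((2 / r) ^ n * (\<Sum>\<alpha>\<in>words n. r ^ length \<alpha> / q * K \<alpha>))"
        using r by (simp add: ennreal_mult')
      then have "\<bar>pair v (kd \<beta> k) x0 y\<bar> \<le> (2 / r) ^ n * (\<Sum>\<alpha>\<in>words n. r ^ length \<alpha> / q * K \<alpha>)"
        using r q K0 by (subst (asm) ennreal_le_iff) (auto intro!: mult_nonneg_nonneg sum_nonneg)
      then show "\<bar>pair v (kd \<beta> k) x0 y\<bar> \<le>
        (2 / r) ^ DIM('a) * (\<Sum>\<alpha>\<in>(words DIM('a) :: 'a list set). r ^ length \<alpha> / (S - real N * d - s0)\<^sup>2 *
          (\<tau> * sqrt (rate d) ^ (length \<alpha> + length \<beta> - 1) * (2 + \<tau> * sqrt (rate d)) *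
            sqrt (4 * (1 + 2 * \<Lambda>\<^sup>2)\<^sup>2 * g_energy * (r ^ DIM('a) * (LBINT y. inverse (m y))))))"
        by (simp only: q_def S'_def K_def \<sigma>_def G_def n_def)
    qed
  qed
qed

end

section \<open>Bounds independent of the scale of mollification\<close>

text \<open>The constant of \<open>section_sup_bound\<close> after scaling to \<open>\<tau> = 1\<close>: \<open>n\<close> is the dimension, \<open>W\<close> the number of words of length at most \<open>n\<close>, and \<open>s\<close> is \<open>\<tau>\<close> times the square root of the loss in one Caccioppoli step.\<close>

definition sup_const :: "nat => nat => real => real => real" where
  "sup_const n W \<Lambda> \<theta> = (let c = (1 - \<theta>) / (4 * (1 + 2 * \<Lambda>\<^sup>2)); N = n + 2;
      s = sqrt 20 * \<Lambda>\<^sup>2 * (2 * real N)\<^sup>2 / c\<^sup>2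
    in 2 ^ n / sqrt ((c / (4 * real n)) ^ n) * (real W * (4 * s ^ N * (2 + s) / c\<^sup>2)) * (2 * (1 + 2 * \<Lambda>\<^sup>2)))"

context mixed_solution
begin

text \<open>If a reflected point is close to \<open>x\<close>, then the point itself is close to the flat part, so that the reflection has moved it by at most a multiple of \<open>\<Lambda>\<^sup>2 \<rho>\<close>. The choice of \<open>\<rho>\<close> makes the total distance less than half the gap \<open>(1 - \<theta>) \<tau>\<close>.\<close>

lemma adm_near_interior:
  assumes \<theta>: "0 < \<theta>" "\<theta> < 1" and x0: "norm x0 < \<theta> * \<tau>" "0 < x0 \<bullet> e"
    and \<rho>: "\<rho> = (1 - \<theta>) / (4 * (1 + 2 * \<Lambda>\<^sup>2)) * \<tau>" and \<delta>: "\<delta> \<le> \<rho>" and x: "norm (x - x0) < \<rho>"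
  shows "adm x \<delta>"
proof -
  define L where "L = 1 + 2 * \<Lambda>\<^sup>2"
  have L: "1 \<le> L" by (simp add: L_def)
  have \<rho>0: "0 < \<rho>" using \<theta> tau_pos L by (simp add: \<rho> L_def[symmetric])
  define \<tau>' where "\<tau>' = \<theta> * \<tau> + 2 * \<rho> * L"
  have "2 * \<rho> * L = (1 - \<theta>) * \<tau> / 2" using L by (simp add: \<rho> L_def[symmetric])
  then have "\<tau>' = \<theta> * \<tau> + (1 - \<theta>) * \<tau> / 2" by (simp add: \<tau>'_def)
  moreover have "0 < (1 - \<theta>) * \<tau>" "(1 - \<theta>) * \<tau> = \<tau> - \<theta> * \<tau>" using \<theta> tau_pos by (auto simp: left_diff_distrib)
  ultimately have lt: "\<tau>' < \<tau>" by linarith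
  have rL: "\<rho> \<le> \<rho> * L" using L \<rho>0 by simp
  have nx: "norm x < \<theta> * \<tau> + \<rho>" using norm_triangle_sub[of x x0] x x0 by linarith
  have "\<delta> < norm (x - z) \<and> \<delta> < norm (x - Rf z)" if z: "0 \<le> z \<bullet> e" "\<tau>' \<le> norm z" for z
  proof
    have "norm z \<le> norm x + norm (x - z)" using norm_triangle_sub[of z x] by (simp add: norm_minus_commute)
    then show "\<delta> < norm (x - z)" using z(2) nx \<delta> rL unfolding \<tau>'_def by linarith
    show "\<delta> < norm (x - Rf z)"
    proof (rule ccontr)
      assume "\<not> \<delta> < norm (x - Rf z)"
      then have n: "norm (x - Rf z) \<le> \<delta>" by simp
      have "x \<bullet> e + z \<bullet> e \<le> norm (x - Rf z)"
        using Basis_le_norm[OF e_Basis, of "x - Rf z"] by (simp add: inner_diff_left Rf_e)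
      moreover have "x0 \<bullet> e - x \<bullet> e \<le> norm (x - x0)"
        using Basis_le_norm[OF e_Basis, of "x - x0"] by (simp add: inner_diff_left)
      ultimately have ze: "z \<bullet> e < 2 * \<rho>" using n x x0 \<delta> by linarith
      have "norm (Rf z) \<le> norm x + norm (x - Rf z)" using norm_triangle_sub[of "Rf z" x] by (simp add: norm_minus_commute)
      then have R: "norm (Rf z) < \<theta> * \<tau> + 2 * \<rho>" using nx n \<delta> by linarith
      have "norm z \<le> norm (Rf z) + norm (Rf z - z)" using norm_triangle_sub[of z "Rf z"] by (simp add: norm_minus_commute)
      moreover have "norm (Rf z - z) \<le> 2 * \<Lambda>\<^sup>2 * (z \<bullet> e)" using Rf_distance[of z] z(1) by simp
      moreover have "2 * \<Lambda>\<^sup>2 * (z \<bullet> e) \<le> 2 * \<Lambda>\<^sup>2 * (2 * \<rho>)" using ze by (intro mult_left_mono) auto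
      ultimately have "norm z < \<theta> * \<tau> + 2 * \<rho> + 2 * \<Lambda>\<^sup>2 * (2 * \<rho>)" using R by linarith
      also have "\<dots> = \<tau>'" by (simp add: \<tau>'_def L_def algebra_simps)
      finally show False using z(2) by simp
    qed
  qed
  then show ?thesis using lt by (auto simp: adm_def)
qed

text \<open>Scaling of \<open>section_sup_bound\<close>: the radii are fixed fractions of \<open>\<tau>\<close>, so that each derivative contributes one power of \<open>1 / \<tau>\<close>.\<close>

lemma kernel_sup_bound:
  fixes \<beta> :: "'a list"
  assumes k: "ker \<delta> k" "\<And>z. 0 \<le> k z" "integrable lborel k" "integral\<^sup>L lborel k = 1" "\<And>z. k (Rf z) = k z"
    and \<theta>: "0 < \<theta>" "\<theta> < 1" and x0: "norm x0 < \<theta> * \<tau>" "0 < x0 \<bullet> e"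
    and \<delta>: "\<delta> \<le> (1 - \<theta>) / (4 * (1 + 2 * \<Lambda>\<^sup>2)) * \<tau>"
    and \<beta>: "set \<beta> \<subseteq> Basis" "\<beta> \<noteq> []" "length \<beta> \<le> 2"
  shows "AE y in lborel. 0 < y \<and> y \<le> \<theta> * \<tau> --> \<bar>pair v (kd \<beta> k) x0 y\<bar> \<le>
    sup_const DIM('a) (card (words DIM('a) :: 'a list set)) \<Lambda> \<theta> *
      sqrt (g_energy * (LBINT y. inverse (m y)) / \<tau> ^ DIM('a)) / \<tau> ^ length \<beta>"
proof -
  define n where "n = DIM('a)"
  define N where "N = n + 2"
  define L where "L = 1 + 2 * \<Lambda>\<^sup>2"
  define c where "c = (1 - \<theta>) / (4 * L)"
  define \<rho> where "\<rho> = c * \<tau>"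
  define d where "d = \<rho> / (2 * real N)"
  define r where "r = \<rho> / (4 * real n)"
  define s where "s = sqrt 20 * \<Lambda>\<^sup>2 * (2 * real N)\<^sup>2 / c\<^sup>2"
  define Mi where "Mi = (LBINT y. inverse (m y))"
  have n1: "1 \<le> n" by (simp add: n_def Suc_le_eq)
  have N3: "3 \<le> N" using n1 by (simp add: N_def)
  have L1: "1 \<le> L" by (simp add: L_def)
  have c: "0 < c" "c \<le> 1 / 4"
  proof -
    show "0 < c" using \<theta> L1 by (simp add: c_def)
    have "(1 - \<theta>) / (4 * L) \<le> 1 / (4 * 1)" using \<theta> L1 by (intro frac_le) auto
    then show "c \<le> 1 / 4" by (simp add: c_def)
  qed
  have c_1t: "c \<le> 1 - \<theta>"
  proof -
    have "(1 - \<theta>) / (4 * L) \<le> (1 - \<theta>) / 1" using \<theta> L1 by (intro divide_left_mono) auto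
    then show ?thesis by (simp add: c_def)
  qed
  have \<rho>: "0 < \<rho>" "\<rho> \<le> \<tau> / 4" using c tau_pos mult_right_mono[OF c(2), of \<tau>] by (auto simp: \<rho>_def)
  have d0: "0 < d" and Nd: "real N * d = \<rho> / 2" using \<rho> N3 by (auto simp: d_def)
  have r0: "0 < r" and nr: "real n * r = \<rho> / 4" using \<rho> n1 by (auto simp: r_def)
  have r\<tau>: "r \<le> \<tau>"
  proof -
    have "r \<le> real n * r" using n1 r0 by simp
    then show ?thesis using nr \<rho> by linarith
  qed
  have S\<tau>: "\<theta> * \<tau> + \<rho> \<le> \<tau>"
    using mult_right_mono[OF c_1t, of \<tau>] tau_pos by (simp add: \<rho>_def algebra_simps)
  have \<theta>\<tau>: "0 < \<theta> * \<tau>" using \<theta> tau_pos by simp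
  have Mi0: "0 \<le> Mi" using m_nonneg by (simp add: Mi_def)
  have "sqrt (rate d) = s / \<tau>"
  proof -
    have "rate d = (s / \<tau>)\<^sup>2"
      using c tau_pos N3 by (simp add: rate_def d_def \<rho>_def s_def power_divide power_mult_distrib field_simps power4_eq_xxxx power2_eq_square)
    moreover have "0 \<le> s / \<tau>" using tau_pos by (simp add: s_def)
    ultimately show ?thesis by (simp only: real_sqrt_abs abs_of_nonneg)
  qed
  then have sig: "sqrt (rate d) = s / \<tau>" "\<tau> * sqrt (rate d) = s" using tau_pos by simp_all
  have s1: "1 \<le> s"
  proof -
    have "1 \<le> sqrt 20 * \<Lambda>\<^sup>2 * (2 * real N)\<^sup>2"
    proof -
      have "1 \<le> sqrt 20" by simp
      moreover have "1 \<le> \<Lambda>\<^sup>2" using Lam by (simp add: one_le_power)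
      moreover have "1 \<le> (2 * real N)\<^sup>2" by (rule one_le_power) (use N3 in simp)
      ultimately have "1 * 1 * 1 \<le> sqrt 20 * \<Lambda>\<^sup>2 * (2 * real N)\<^sup>2" by (intro mult_mono) auto
      then show ?thesis by simp
    qed
    moreover have "c\<^sup>2 \<le> 1" using c by (simp add: power_le_one)
    ultimately show ?thesis using c by (simp add: s_def pos_le_divide_eq)
  qed
  define q where "q = (\<theta> * \<tau> + \<rho> - real N * d - \<theta> * \<tau>)\<^sup>2"
  have q: "q = c\<^sup>2 * \<tau>\<^sup>2 / 4" unfolding q_def Nd by (simp add: \<rho>_def power2_eq_square)
  define G where "G = sqrt (4 * (1 + 2 * \<Lambda>\<^sup>2)\<^sup>2 * g_energy * (r ^ n * Mi))"
  have G0: "0 \<le> G" using g_energy_nonneg Mi0 r0 by (simp add: G_def)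
  have sup: "AE y in lborel. 0 < y \<and> y \<le> \<theta> * \<tau> --> \<bar>pair v (kd \<beta> k) x0 y\<bar> \<le>
    (2 / r) ^ n * (\<Sum>\<alpha>\<in>(words n :: 'a list set). r ^ length \<alpha> / q *
      (\<tau> * sqrt (rate d) ^ (length \<alpha> + length \<beta> - 1) * (2 + \<tau> * sqrt (rate d)) * G))"
    unfolding n_def q_def G_def Mi_def
  proof (rule section_sup_bound[OF k, where R = \<rho>])
    show "adm x \<delta>" if "norm (x - x0) < \<rho>" for x
      by (rule adm_near_interior[OF \<theta> x0 refl \<delta>]) (use that in \<open>simp add: \<rho>_def c_def L_def\<close>)
    show "DIM('a) + length \<beta> \<le> N" using \<beta> by (simp add: N_def n_def)
    show "real DIM('a) * r < \<rho> - real N * d" using nr \<rho> unfolding n_def Nd by simp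
    show "real N * d < \<rho>" "real N * d < \<theta> * \<tau> + \<rho>" "\<theta> * \<tau> < \<theta> * \<tau> + \<rho> - real N * d"
      using Nd \<rho> \<theta>\<tau> by linarith+
  qed (use \<rho> tau_pos S\<tau> d0 r0 \<beta> in auto)
  have word_term: "r ^ length \<alpha> / q * (\<tau> * sqrt (rate d) ^ (length \<alpha> + length \<beta> - 1) * (2 + \<tau> * sqrt (rate d)) * G)
      \<le> (4 * s ^ N * (2 + s) / c\<^sup>2) * G / \<tau> ^ length \<beta>" if \<alpha>: "\<alpha> \<in> words n" for \<alpha> :: "'a list"
  proof -
    define a where "a = length \<alpha>"
    define b where "b = length \<beta>"
    have b1: "1 \<le> b" using \<beta> by (simp add: b_def Suc_le_eq)
    have "a \<le> n" "b \<le> 2" using \<alpha> \<beta> by (auto simp: a_def b_def words_def)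
    then have ab: "a + b - 1 \<le> N" unfolding N_def by linarith
    have ra: "r ^ a \<le> \<tau> ^ a" using r\<tau> r0 by (intro power_mono) auto
    have sN: "s ^ (a + b - 1) \<le> s ^ N" using s1 ab by (intro power_increasing)
    have \<tau>ab: "\<tau> ^ a * \<tau> / \<tau> ^ (a + b - 1) = \<tau>\<^sup>2 / \<tau> ^ b"
    proof -
      have "Suc (a + b - 1) = a + b" using b1 by simp
      then have "\<tau> ^ (a + b - 1) * \<tau> = \<tau> ^ a * \<tau> ^ b" by (metis power_Suc2 power_add)
      then show ?thesis using tau_pos by (simp add: field_simps power2_eq_square)
    qed
    have "r ^ a / q * (\<tau> * (s / \<tau>) ^ (a + b - 1) * (2 + s) * G) = (r ^ a * s ^ (a + b - 1)) * (\<tau> / \<tau> ^ (a + b - 1) * (2 + s) * G / q)"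
      by (simp add: power_divide ac_simps)
    also have "\<dots> \<le> (\<tau> ^ a * s ^ N) * (\<tau> / \<tau> ^ (a + b - 1) * (2 + s) * G / q)"
      using s1 tau_pos G0 r0 ra sN by (intro mult_right_mono mult_mono) (auto simp: q)
    also have "\<dots> = (\<tau> ^ a * \<tau> / \<tau> ^ (a + b - 1)) * (s ^ N * (2 + s) * G / q)" by simp
    also have "\<dots> = (4 * s ^ N * (2 + s) / c\<^sup>2) * G / \<tau> ^ b"
      unfolding \<tau>ab q using tau_pos c by (simp add: field_simps)
    finally show ?thesis unfolding sig(2) unfolding sig(1) a_def b_def .
  qed
  have "(2 / r) ^ n * (\<Sum>\<alpha>\<in>(words n :: 'a list set). r ^ length \<alpha> / q *
      (\<tau> * sqrt (rate d) ^ (length \<alpha> + length \<beta> - 1) * (2 + \<tau> * sqrt (rate d)) * G))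
    \<le> (2 / r) ^ n * (real (card (words n :: 'a list set)) * ((4 * s ^ N * (2 + s) / c\<^sup>2) * G / \<tau> ^ length \<beta>))"
    using r0 by (intro mult_left_mono sum_bounded_above word_term) auto
  also have "\<dots> = ((2 / r) ^ n * G) * (real (card (words n :: 'a list set)) * (4 * s ^ N * (2 + s) / c\<^sup>2)) / \<tau> ^ length \<beta>"
    by simp
  also have "(2 / r) ^ n * G = 2 ^ n / sqrt ((c / (4 * real n)) ^ n) * (2 * L) * sqrt (g_energy * Mi / \<tau> ^ n)"
  proof -
    have rn: "r ^ n = (c / (4 * real n)) ^ n * \<tau> ^ n" by (simp add: r_def \<rho>_def power_mult_distrib power_divide)
    have p: "0 < (c / (4 * real n)) ^ n" "0 < \<tau> ^ n" using c n1 tau_pos by auto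
    define w where "w = sqrt (r ^ n)"
    have w: "0 < w" "w * w = r ^ n" using r0 by (simp_all add: w_def)
    have "G = (2 * L) * sqrt (g_energy * Mi) * w"
      unfolding G_def L_def[symmetric] w_def using L1 by (simp add: real_sqrt_mult real_sqrt_abs ac_simps)
    moreover have "(2 / r) ^ n = 2 ^ n / (w * w)" by (simp only: w(2) power_divide)
    ultimately have "(2 / r) ^ n * G = 2 ^ n * (2 * L) * sqrt (g_energy * Mi) / w" using w(1) by simp
    also have "w = sqrt (r ^ n)" by (rule w_def)
    also have "sqrt (r ^ n) = sqrt ((c / (4 * real n)) ^ n) * sqrt (\<tau> ^ n)" by (simp only: rn real_sqrt_mult)
    finally show ?thesis using p by (simp add: real_sqrt_divide real_sqrt_mult)
  qed
  also have "2 ^ n / sqrt ((c / (4 * real n)) ^ n) * (2 * L) * sqrt (g_energy * Mi / \<tau> ^ n) *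
      (real (card (words n :: 'a list set)) * (4 * s ^ N * (2 + s) / c\<^sup>2)) / \<tau> ^ length \<beta>
    = sup_const n (card (words n :: 'a list set)) \<Lambda> \<theta> * sqrt (g_energy * Mi / \<tau> ^ n) / \<tau> ^ length \<beta>"
    unfolding sup_const_def Let_def s_def c_def L_def N_def by (simp only: ac_simps times_divide_eq_right times_divide_eq_left)
  finally show ?thesis using sup unfolding n_def Mi_def
    by (auto elim!: eventually_mono)
qed

lemma B_entry_bound: "i \<in> Basis ==> j \<in> Basis ==> \<bar>B i \<bullet> j\<bar> \<le> \<Lambda>"
  using B_polarized[of 1 i j] by simp

text \<open>Here the growth condition is used. The conormal identity gives \<open>m |h| \<le> sup |L v| \<integral>\<^sub>0\<^sup>y m\<close>, and the growth condition bounds the integral by \<open>C0 \<tau> m y\<close>, which cancels the weight.\<close>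

lemma conormal_sup_bound:
  assumes k: "ker \<delta> k" and x: "adm x \<delta>" and s0: "s0 < \<tau>" and C0: "0 \<le> C0"
    and grow: "AE y in lborel. y \<in> {0<..<\<tau>} --> (LBINT s. indicator {..y} s * m s) \<le> C0 * \<tau> * m y"
    and M: "\<And>i j. i \<in> Basis ==> j \<in> Basis ==> AE y in lborel. 0 < y \<and> y \<le> s0 --> \<bar>pair v (kd [i, j] k) x y\<bar> \<le> M" and M0: "0 \<le> M"
  shows "AE y in lborel. 0 < y \<and> y \<le> s0 --> \<bar>pair h k x y\<bar> \<le> (real DIM('a))\<^sup>2 * \<Lambda> * M * C0 * \<tau>"
proof -
  define T where "T = (real DIM('a))\<^sup>2 * \<Lambda> * M"
  have T0: "0 \<le> T" using Lam M0 by (simp add: T_def)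
  have "AE y in lborel. \<forall>i\<in>Basis. \<forall>j\<in>Basis. 0 < y \<and> y \<le> s0 --> \<bar>pair v (kd [i, j] k) x y\<bar> \<le> M"
    by (intro AE_finite_allI finite_Basis M)
  then have L: "AE y in lborel. 0 < y \<and> y \<le> s0 --> \<bar>pair v (Lop k) x y\<bar> \<le> T"
  proof eventually_elim
    case (elim y)
    show ?case
    proof
      assume y: "0 < y \<and> y \<le> s0"
      have "\<bar>pair v (Lop k) x y\<bar> \<le> (\<Sum>i\<in>Basis. \<Sum>j\<in>Basis. \<bar>(B i \<bullet> j) * pair v (pd i (pd j k)) x y\<bar>)"
        unfolding pair_Lop[OF v_L2 k] by (rule order_trans[OF sum_abs sum_mono[OF sum_abs]])
      also have "\<dots> \<le> (\<Sum>i\<in>(Basis::'a set). \<Sum>j\<in>(Basis::'a set). \<Lambda> * M)"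
        unfolding abs_mult using elim y Lam by (intro sum_mono mult_mono B_entry_bound) auto
      finally show "\<bar>pair v (Lop k) x y\<bar> \<le> T" by (simp add: T_def power2_eq_square)
    qed
  qed
  show ?thesis
    using pair_conormal[OF k x] grow m_pos
  proof eventually_elim
    case (elim y)
    show ?case
    proof
      assume y: "0 < y \<and> y \<le> s0"
      then have y': "y \<in> {0<..<\<tau>}" using s0 by auto
      have "m y * \<bar>pair h k x y\<bar> = \<bar>\<integral> s. indicator {..y} s * (pair v (Lop k) x s * m s) \<partial>lborel\<bar>"
      proof -
        have "m y * pair h k x y = - (LBINT s. indicator {..y} s * (pair v (Lop k) x s * m s))" using elim y' by blast
        from arg_cong[OF this, of abs] show ?thesis using m_nonneg[of y] by (simp add: abs_mult)
      qed
      also have "\<dots> \<le> (LBINT s. \<bar>indicator {..y} s * (pair v (Lop k) x s * m s)\<bar>)" by (rule integral_abs_bound)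
      also have "\<dots> \<le> (LBINT s. T * (indicator {..y} s * m s))"
      proof (rule integral_mono_AE)
        have i: "integrable lborel (\<lambda>s. indicator {..y} s * (pair v (Lop k) x s * m s))"
          using integrable_mult_indicator[OF _ pair_integrable(2)[OF v_L2 ker_Lop[OF k]], of "{..y}"] by simp
        then show "integrable lborel (\<lambda>s. \<bar>indicator {..y} s * (pair v (Lop k) x s * m s)\<bar>)" by (rule integrable_abs)
        show "integrable lborel (\<lambda>s. T * (indicator {..y} s * m s))"
          using integrable_mult_indicator[OF _ m_int, of "{..y}"] by (intro integrable_mult_right) simp
        show "AE s in lborel. \<bar>indicator {..y} s * (pair v (Lop k) x s * m s)\<bar> \<le> T * (indicator {..y} s * m s)"
          using L
        proof eventually_elim
          case (elim s)
          show ?case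
          proof (cases "0 < s \<and> s \<le> y")
            case True
            then have "\<bar>pair v (Lop k) x s\<bar> * m s \<le> T * m s" using elim y m_nonneg[of s] by (intro mult_right_mono) auto
            then show ?thesis using True m_nonneg[of s] by (simp add: abs_mult)
          next
            case False
            then show ?thesis using m_zero[of s] by (cases "s \<le> y") auto
          qed
        qed
      qed
      also have "\<dots> = T * (LBINT s. indicator {..y} s * m s)" by simp
      also have "\<dots> \<le> T * (C0 * \<tau> * m y)" using elim y' T0 by (intro mult_left_mono) auto
      finally have "m y * \<bar>pair h k x y\<bar> \<le> m y * (T * C0 * \<tau>)" by (simp add: ac_simps)
      moreover have "0 < m y" using elim y' by blast
      ultimately show "\<bar>pair h k x y\<bar> \<le> (real DIM('a))\<^sup>2 * \<Lambda> * M * C0 * \<tau>"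
        by (simp add: T_def)
    qed
  qed
qed

text \<open>A bound for mollifications at all small scales holds for the function. The positive part of \<open>|F| - M\<close> is compared with a smooth approximant, whose own mollification converges uniformly; thus only \<open>L\<^sup>1\<close> approximation by smooth functions is used and no differentiation theorem.\<close>

lemma mollified_bound_limit:
  fixes F :: "'a \<times> real => real" and p :: "nat => 'a \<times> real => real"
  assumes F: "wL2 F" and p: "\<And>j. smooth (p j)"
    and conv: "(\<lambda>j. \<integral>\<^sup>+ X\<in>Om. ennreal \<bar>F X - p j X\<bar> \<partial>lborel) \<longlonglongrightarrow> 0"
    and U [measurable]: "U \<in> sets borel" and UD: "U \<subseteq> D" and \<delta>0: "0 < \<delta>0"
    and inside: "\<And>x z. x \<in> U ==> norm (x - z) \<le> \<delta>0 ==> z \<in> D"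
    and bound: "\<And>\<delta>. 0 < \<delta> ==> \<delta> \<le> \<delta>0 ==> \<exists>k. ker \<delta> k \<and> (\<forall>z. 0 \<le> k z) \<and> integrable lborel k \<and> integral\<^sup>L lborel k = 1 \<and>
        (\<forall>x\<in>U. AE y in lborel. 0 < y \<and> y < s0 --> \<bar>\<integral> z. F (z, y) * k (x - z) \<partial>lborel\<bar> \<le> M)"
    and s0: "s0 \<le> \<tau>"
  shows "AE X in lborel. fst X \<in> U \<and> 0 < snd X \<and> snd X < s0 --> \<bar>F X\<bar> \<le> M"
proof -
  note [measurable] = wL2_borel[OF F] smooth_borel[OF p]
  define V where "V = U \<times> {0<..<s0}"
  have [measurable]: "V \<in> sets borel" unfolding V_def borel_prod[symmetric] by measurable
  have VO: "V \<subseteq> Om" using UD s0 by (auto simp: V_def Om_def)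
  have vol: "emeasure lborel V < \<infinity>"
  proof -
    have "V \<subseteq> cball 0 \<tau> \<times> cball 0 \<tau>" using VO by (auto simp: V_def Om_def D_def)
    then have "V \<subseteq> cball 0 (2 * \<tau>)"
    proof (clarsimp simp: subset_iff)
      fix a :: 'a and b :: real
      assume "\<forall>c d. (c, d) \<in> V --> norm c \<le> \<tau> \<and> \<bar>d\<bar> \<le> \<tau>" "(a, b) \<in> V"
      then have "norm a \<le> \<tau>" "\<bar>b\<bar> \<le> \<tau>" by auto
      then show "norm (a, b) \<le> 2 * \<tau>" using norm_Pair_le[of a b] by simp
    qed
    then show ?thesis by (rule le_less_trans[OF emeasure_mono emeasure_lborel_cball_finite]) simp
  qed
  define a where "a j = (\<integral>\<^sup>+ X\<in>Om. ennreal \<bar>F X - p j X\<bar> \<partial>lborel)" for j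
  define E where "E = (\<integral>\<^sup>+ X\<in>V. ennreal (\<bar>F X\<bar> - M) \<partial>lborel)"
  have key: "E \<le> 2 * a j + ennreal \<epsilon> * emeasure lborel V" if \<epsilon>: "0 < \<epsilon>" for \<epsilon> j
  proof -
    have "uniformly_continuous_on (cball 0 (3 * \<tau> + \<delta>0)) (p j)"
      by (intro compact_uniformly_continuous smooth_continuous p compact_cball)
    then have "\<exists>\<delta>1>0. \<forall>X\<in>cball 0 (3 * \<tau> + \<delta>0). \<forall>Y\<in>cball 0 (3 * \<tau> + \<delta>0). dist Y X < \<delta>1 --> dist (p j Y) (p j X) < \<epsilon>"
      using \<epsilon> unfolding uniformly_continuous_on_def by blast
    then obtain \<delta>1 where \<delta>1: "0 < \<delta>1" "\<And>X Y. X \<in> cball 0 (3 * \<tau> + \<delta>0) ==> Y \<in> cball 0 (3 * \<tau> + \<delta>0) ==> dist X Y < \<delta>1 ==> dist (p j X) (p j Y) < \<epsilon>"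
      by (metis dist_commute)
    define \<delta> where "\<delta> = min (\<delta>1 / 2) \<delta>0"
    have \<delta>: "0 < \<delta>" "\<delta> < \<delta>1" "\<delta> \<le> \<delta>0" using \<delta>1 \<delta>0 by (auto simp: \<delta>_def)
    obtain k where k: "ker \<delta> k" "\<And>z. 0 \<le> k z" "integrable lborel k" "integral\<^sup>L lborel k = 1"
      and bd: "\<And>x. x \<in> U ==> AE y in lborel. 0 < y \<and> y < s0 --> \<bar>\<integral> z. F (z, y) * k (x - z) \<partial>lborel\<bar> \<le> M"
      using bound[OF \<delta>(1,3)] by (elim exE conjE) (rule that, auto)
    note [measurable] = ker_borel[OF k(1)]
    obtain ck where ck: "\<And>z. \<bar>k z\<bar> \<le> ck" using ker_bounded[OF k(1)] by metis
    have kn: "(\<integral>\<^sup>+ z. ennreal (k z) \<partial>lborel) = 1"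
      using k by (subst nn_integral_eq_integral) auto
    have kz: "(\<integral>\<^sup>+ z. ennreal (k (x - z)) \<partial>lborel) = 1" for x
      using nn_integral_lborel_reflect[of "\<lambda>z. ennreal (k z)" x] kn by simp
    have kx: "(\<integral>\<^sup>+ x. ennreal (k (x - w)) \<partial>lborel) = 1" for w
      using nn_integral_lborel_translate[of "\<lambda>z. ennreal (k z)" "- w"] kn by simp
    have kint: "integrable lborel (\<lambda>z. k (x - z))" for x
      using kz[of x] k(2) by (intro integrableI_bounded) auto
    have kI: "(LBINT z. k (x - z)) = 1" for x
      using integral_lborel_reflect[of k x] k(4) by simp
    define u where "u X = \<bar>F X - p j X\<bar>" for X
    have [measurable]: "u \<in> borel_measurable borel" unfolding u_def[abs_def] by measurable
    have pt: "AE y in lborel. 0 < y \<and> y < s0 --> ennreal (\<bar>F (x, y)\<bar> - M) \<le>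
        ennreal (u (x, y)) + ennreal \<epsilon> + (\<integral>\<^sup>+ z. ennreal (u (z, y)) * indicator Om (z, y) * ennreal (k (x - z)) \<partial>lborel)"
      if x: "x \<in> U" for x
      using bd[OF x]
    proof eventually_elim
      case (elim y)
      show ?case
      proof
        assume y: "0 < y \<and> y < s0"
        have iF: "integrable lborel (\<lambda>z. F (z, y) * k (x - z))"
          by (rule sect_integrand(1)[OF F, of "\<lambda>z. k (x - z)" ck]) (use ck in auto)
        have "F (x, y) - (LBINT z. F (z, y) * k (x - z)) = (LBINT z. F (x, y) * k (x - z) - F (z, y) * k (x - z))"
          using iF kint[of x] kI[of x] by simp
        then have "ennreal \<bar>F (x, y) - (LBINT z. F (z, y) * k (x - z))\<bar> = ennreal \<bar>\<integral> z. F (x, y) * k (x - z) - F (z, y) * k (x - z) \<partial>lborel\<bar>"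
          by (rule arg_cong)
        also have "\<dots> \<le> (\<integral>\<^sup>+ z. ennreal \<bar>F (x, y) * k (x - z) - F (z, y) * k (x - z)\<bar> \<partial>lborel)"
          using integral_norm_bound_ennreal[of lborel "\<lambda>z. F (x, y) * k (x - z) - F (z, y) * k (x - z)"] iF kint[of x] by (simp only: Bochner_Integration.integrable_diff integrable_mult_right real_norm_def)
        also have "\<dots> \<le> (\<integral>\<^sup>+ z. (ennreal (u (x, y)) + ennreal \<epsilon>) * ennreal (k (x - z)) + ennreal (u (z, y)) * indicator Om (z, y) * ennreal (k (x - z)) \<partial>lborel)"
        proof (rule nn_integral_mono)
          fix z
          show "ennreal \<bar>F (x, y) * k (x - z) - F (z, y) * k (x - z)\<bar> \<le> (ennreal (u (x, y)) + ennreal \<epsilon>) * ennreal (k (x - z)) + ennreal (u (z, y)) * indicator Om (z, y) * ennreal (k (x - z))"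
          proof (cases "norm (x - z) \<le> \<delta>")
            case True
            then have zD: "z \<in> D" using inside[OF x, of z] \<delta> by auto
            then have zO: "(z, y) \<in> Om" using y s0 by (auto simp: Om_def)
            have "norm x < \<tau>" "norm z < \<tau>" using zD x UD by (auto simp: D_def)
            then have "(x, y) \<in> cball 0 (3 * \<tau> + \<delta>0)" "(z, y) \<in> cball 0 (3 * \<tau> + \<delta>0)"
              using norm_Pair_le[of x y] norm_Pair_le[of z y] y s0 tau_pos \<delta>0 by auto
            then have "dist (p j (x, y)) (p j (z, y)) < \<epsilon>"
              using \<delta>1(2)[of "(x, y)" "(z, y)"] True \<delta> by (simp add: dist_Pair_Pair dist_norm)
            then have "\<bar>F (x, y) - F (z, y)\<bar> \<le> u (x, y) + \<epsilon> + u (z, y)" by (simp add: u_def dist_real_def)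
            then have "\<bar>F (x, y) - F (z, y)\<bar> * k (x - z) \<le> (u (x, y) + \<epsilon> + u (z, y)) * k (x - z)"
              using k(2) by (rule mult_right_mono)
            then have "ennreal \<bar>F (x, y) * k (x - z) - F (z, y) * k (x - z)\<bar> \<le> ennreal ((u (x, y) + \<epsilon> + u (z, y)) * k (x - z))"
              using k(2)[of "x - z"] by (intro ennreal_leI) (simp add: left_diff_distrib[symmetric] abs_mult)
            also have "\<dots> = (ennreal (u (x, y)) + ennreal \<epsilon> + ennreal (u (z, y))) * ennreal (k (x - z))"
              using \<epsilon> by (simp add: ennreal_mult'' k(2) u_def ennreal_plus)
            finally show ?thesis using zO by (simp add: distrib_right)
          next
            case False
            then show ?thesis using k(1) by (simp add: ker_def)
          qed
        qed
        also have "\<dots> = ennreal (u (x, y)) + ennreal \<epsilon> + (\<integral>\<^sup>+ z. ennreal (u (z, y)) * indicator Om (z, y) * ennreal (k (x - z)) \<partial>lborel)"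
          by (subst nn_integral_add) (auto simp: nn_integral_cmult kz)
        finally have "ennreal \<bar>F (x, y) - (LBINT z. F (z, y) * k (x - z))\<bar> \<le> \<dots>" .
        moreover have "\<bar>F (x, y)\<bar> - M \<le> \<bar>F (x, y) - (LBINT z. F (z, y) * k (x - z))\<bar>"
          using elim y by linarith
        ultimately show "ennreal (\<bar>F (x, y)\<bar> - M) \<le> ennreal (u (x, y)) + ennreal \<epsilon> + (\<integral>\<^sup>+ z. ennreal (u (z, y)) * indicator Om (z, y) * ennreal (k (x - z)) \<partial>lborel)"
          by (meson ennreal_leI order_trans)
      qed
    qed
    have indV: "indicator V (x, y) = (indicator U x * indicator {0<..<s0} y :: ennreal)" for x y
      by (auto simp: V_def indicator_def)
    have "E = (\<integral>\<^sup>+ x. \<integral>\<^sup>+ y. ennreal (\<bar>F (x, y)\<bar> - M) * indicator V (x, y) \<partial>lborel \<partial>lborel)"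
      unfolding E_def by (rule nn_integral_lborel_pair(1)) measurable
    also have "\<dots> \<le> (\<integral>\<^sup>+ x. \<integral>\<^sup>+ y. (ennreal (u (x, y)) * indicator Om (x, y) + ennreal \<epsilon> * indicator V (x, y)) + (\<integral>\<^sup>+ z. ennreal (u (z, y)) * indicator Om (z, y) * ennreal (k (x - z)) \<partial>lborel) \<partial>lborel \<partial>lborel)"
    proof (rule nn_integral_mono)
      fix x
      show "(\<integral>\<^sup>+ y. ennreal (\<bar>F (x, y)\<bar> - M) * indicator V (x, y) \<partial>lborel) \<le> (\<integral>\<^sup>+ y. (ennreal (u (x, y)) * indicator Om (x, y) + ennreal \<epsilon> * indicator V (x, y)) + (\<integral>\<^sup>+ z. ennreal (u (z, y)) * indicator Om (z, y) * ennreal (k (x - z)) \<partial>lborel) \<partial>lborel)"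
      proof (cases "x \<in> U")
        case True
        show ?thesis
        proof (rule nn_integral_mono_AE, use pt[OF True] in eventually_elim)
          case (elim y)
          show ?case
          proof (cases "0 < y \<and> y < s0")
            case t: True
            then have "(x, y) \<in> V" "(x, y) \<in> Om" using True VO by (auto simp: V_def)
            then show ?thesis using elim t by simp
          qed (simp add: indV)
        qed
      qed (simp add: indV)
    qed
    also have "\<dots> = ((\<integral>\<^sup>+ x. \<integral>\<^sup>+ y. ennreal (u (x, y)) * indicator Om (x, y) \<partial>lborel \<partial>lborel) + (\<integral>\<^sup>+ x. \<integral>\<^sup>+ y. ennreal \<epsilon> * indicator V (x, y) \<partial>lborel \<partial>lborel))
        + (\<integral>\<^sup>+ x. \<integral>\<^sup>+ y. \<integral>\<^sup>+ z. ennreal (u (z, y)) * indicator Om (z, y) * ennreal (k (x - z)) \<partial>lborel \<partial>lborel \<partial>lborel)"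
      by (simp add: nn_integral_add)
    also have "(\<integral>\<^sup>+ x. \<integral>\<^sup>+ y. ennreal (u (x, y)) * indicator Om (x, y) \<partial>lborel \<partial>lborel) = a j"
      unfolding a_def u_def by (subst nn_integral_lborel_pair(1)) auto
    also have "(\<integral>\<^sup>+ x. \<integral>\<^sup>+ y. ennreal \<epsilon> * indicator V (x, y) \<partial>lborel \<partial>lborel) = ennreal \<epsilon> * emeasure lborel V"
      by (subst nn_integral_lborel_pair(1)[of "\<lambda>X. ennreal \<epsilon> * indicator V X", symmetric]) (auto simp: nn_integral_cmult)
    also have "(\<integral>\<^sup>+ x. \<integral>\<^sup>+ y. \<integral>\<^sup>+ z. ennreal (u (z, y)) * indicator Om (z, y) * ennreal (k (x - z)) \<partial>lborel \<partial>lborel \<partial>lborel)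
        = (\<integral>\<^sup>+ x. \<integral>\<^sup>+ X. ennreal (u X) * indicator Om X * ennreal (k (x - fst X)) \<partial>lborel \<partial>lborel)"
      by (intro nn_integral_cong, subst nn_integral_lborel_pair(2)) simp_all
    also have "\<dots> = (\<integral>\<^sup>+ X. \<integral>\<^sup>+ x. ennreal (u X) * indicator Om X * ennreal (k (x - fst X)) \<partial>lborel \<partial>lborel)"
      by (rule lborel_pair.Fubini'[of "\<lambda>X x. ennreal (u X) * indicator Om X * ennreal (k (x - fst X))"]) measurable
    also have "\<dots> = a j"
      unfolding a_def u_def by (simp add: nn_integral_cmult kx)
    finally show ?thesis by (metis mult_2 add.assoc add.commute)
  qed
  have "E \<le> 2 * a j + 0" for j
  proof (rule LIMSEQ_le_const)
    have "(\<lambda>i. ennreal (1 / real (Suc i))) \<longlonglongrightarrow> ennreal 0"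
      using LIMSEQ_Suc[OF lim_1_over_n] by (intro tendsto_ennrealI)
    then have "(\<lambda>i. 2 * a j + ennreal (1 / real (Suc i)) * emeasure lborel V) \<longlonglongrightarrow> 2 * a j + ennreal 0 * emeasure lborel V"
      using vol by (intro tendsto_add tendsto_const tendsto_mult_ennreal) auto
    then show "(\<lambda>i. 2 * a j + ennreal (1 / real (Suc i)) * emeasure lborel V) \<longlonglongrightarrow> 2 * a j + 0" by simp
    show "\<exists>N. \<forall>i\<ge>N. E \<le> 2 * a j + ennreal (1 / real (Suc i)) * emeasure lborel V"
      using key by auto
  qed
  then have "E = 0"
    using conv by (intro zero_if_le_null_sequences[of a a 2 0 E]) (auto simp: a_def[abs_def])
  then have "AE X in lborel. ennreal (\<bar>F X\<bar> - M) * indicator V X = 0"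
    unfolding E_def by (subst (asm) nn_integral_0_iff_AE) auto
  then show ?thesis
    by eventually_elim (auto simp: V_def indicator_def ennreal_eq_0_iff)
qed

end

section \<open>The gradient estimate\<close>

context mixed_solution
begin

text \<open>At distance more than \<open>\<delta>\<close> from the flat part the reflected kernel does not reach the half ball.\<close>

lemma reflected_kernel_vanishes:
  assumes k: "ker \<delta> k" and x: "\<delta> < x \<bullet> e" and z: "z \<in> D"
  shows "k (x - Rf z) = 0"
proof -
  have "\<delta> < (x - Rf z) \<bullet> e" using x z by (simp add: inner_diff_left Rf_e D_def)
  also have "\<dots> \<le> \<bar>(x - Rf z) \<bullet> e\<bar>" by simp
  also have "\<dots> \<le> norm (x - Rf z)" by (rule Basis_le_norm[OF e_Basis])
  finally show ?thesis using k by (simp add: ker_def)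
qed

lemma away_from_flat_part:
  assumes k: "ker \<delta> k" and x: "\<delta> < x \<bullet> e"
  shows "pair h k x y = (LBINT z. h (z, y) * k (x - z))"
    and "(LBINT z. (g (z, y) \<bullet> i) * k (x - z) - (g (z, y) \<bullet> Rf i) * k (x - Rf z)) = (LBINT z. (g (z, y) \<bullet> i) * k (x - z))"
proof -
  have g0: "g (z, y) = 0" if "z \<notin> D" for z
  proof (rule euclidean_eqI)
    fix i :: 'a assume i: "i \<in> Basis"
    have "(z, y) \<notin> Om" using that by (simp add: Om_def)
    from wL2_off[OF g_L2[OF i] this] show "g (z, y) \<bullet> i = 0 \<bullet> i" by simp
  qed
  show "pair h k x y = (LBINT z. h (z, y) * k (x - z))"
    unfolding pair_def sect_def
  proof (rule Bochner_Integration.integral_cong[OF refl])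
    fix z
    show "h (z, y) * tst k x z = h (z, y) * k (x - z)"
      using reflected_kernel_vanishes[OF k x, of z] wL2_off[OF h_L2, of "(z, y)"]
      by (cases "z \<in> D") (auto simp: tst_def Om_def)
  qed
  show "(LBINT z. (g (z, y) \<bullet> i) * k (x - z) - (g (z, y) \<bullet> Rf i) * k (x - Rf z)) = (LBINT z. (g (z, y) \<bullet> i) * k (x - z))"
  proof (rule Bochner_Integration.integral_cong[OF refl])
    fix z
    show "(g (z, y) \<bullet> i) * k (x - z) - (g (z, y) \<bullet> Rf i) * k (x - Rf z) = (g (z, y) \<bullet> i) * k (x - z)"
      using reflected_kernel_vanishes[OF k x, of z] g0[of z] by (cases "z \<in> D") auto
  qed
qed

text \<open>Away from the flat part odd reflection is invisible to small kernels, so the uniform bounds are bounds for honest mollifications of the gradient. They are uniform in the distance to the flat part, which is then sent to \<open>0\<close>.\<close>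

theorem gradient_sup_bound:
  fixes \<theta> C0 :: real
  defines "M1 \<equiv> sup_const DIM('a) (card (words DIM('a) :: 'a list set)) \<Lambda> \<theta> *
      sqrt (g_energy * (LBINT y. inverse (m y)) / \<tau> ^ DIM('a))"
  assumes \<theta>: "0 < \<theta>" "\<theta> < 1" and C0: "0 \<le> C0"
    and grow: "AE y in lborel. y \<in> {0<..<\<tau>} --> (LBINT s. indicator {..y} s * m s) \<le> C0 * \<tau> * m y"
  shows "AE X in lborel. norm (fst X) < \<theta> * \<tau> \<and> 0 < fst X \<bullet> e \<and> 0 < snd X \<and> snd X < \<theta> * \<tau> -->
    (\<forall>i\<in>Basis. \<bar>g X \<bullet> i\<bar> \<le> M1 / \<tau>) \<and> \<bar>h X\<bar> \<le> (real DIM('a))\<^sup>2 * \<Lambda> * (M1 / \<tau>\<^sup>2) * C0 * \<tau>"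
proof -
  define U where "U hh = {x. norm x < \<theta> * \<tau> \<and> hh < x \<bullet> e}" for hh
  define \<rho> where "\<rho> = (1 - \<theta>) / (4 * (1 + 2 * \<Lambda>\<^sup>2)) * \<tau>"
  define M2 where "M2 = (real DIM('a))\<^sup>2 * \<Lambda> * (M1 / \<tau>\<^sup>2) * C0 * \<tau>"
  have \<theta>\<tau>: "\<theta> * \<tau> < \<tau>" using \<theta> tau_pos by simp
  have t2: "0 < (1 - \<theta>) * \<tau> / 2" using \<theta> tau_pos by simp
  have "0 < 1 + 2 * \<Lambda>\<^sup>2" by (simp add: add_pos_nonneg)
  then have \<rho>: "0 < \<rho>" unfolding \<rho>_def using \<theta> tau_pos by (intro mult_pos_pos divide_pos_pos) auto
  have M1: "0 \<le> M1"
    using \<theta> Lam g_energy_nonneg m_nonneg tau_pos unfolding M1_def sup_const_def Let_def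
    by (intro mult_nonneg_nonneg divide_nonneg_nonneg add_nonneg_nonneg real_sqrt_ge_zero integral_nonneg_AE AE_I2 zero_le_power) auto
  have main: "AE X in lborel. fst X \<in> U hh \<and> 0 < snd X \<and> snd X < \<theta> * \<tau> -->
      (\<forall>i\<in>Basis. \<bar>g X \<bullet> i\<bar> \<le> M1 / \<tau>) \<and> \<bar>h X\<bar> \<le> M2" if hh: "0 < hh" for hh
  proof -
    \<comment> \<open>Below \<open>hh\<close> the reflection is not seen, below \<open>\<rho>\<close> the test functions are admissible, and the last
      bound keeps the ball around \<open>x\<close> inside the half ball.\<close>
    define \<delta>0 where "\<delta>0 = min hh (min \<rho> ((1 - \<theta>) * \<tau> / 2))"
    have \<delta>0: "0 < \<delta>0" "\<delta>0 \<le> hh" "\<delta>0 \<le> \<rho>" "\<delta>0 \<le> (1 - \<theta>) * \<tau> / 2" using hh \<rho> t2 by (auto simp: \<delta>0_def)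
    have U: "U hh \<in> sets borel" unfolding U_def by measurable
    have UD: "U hh \<subseteq> D" using \<theta>\<tau> hh by (auto simp: U_def D_def)
    have inside: "z \<in> D" if x: "x \<in> U hh" and z: "norm (x - z) \<le> \<delta>0" for x z
    proof -
      have "x \<bullet> e - z \<bullet> e \<le> norm (x - z)" using Basis_le_norm[OF e_Basis, of "x - z"] by (simp add: inner_diff_left)
      moreover have "norm z \<le> norm x + norm (x - z)" using norm_triangle_sub[of z x] by (simp add: norm_minus_commute)
      moreover have "(1 - \<theta>) * \<tau> = \<tau> - \<theta> * \<tau>" by (simp add: left_diff_distrib)
      ultimately show ?thesis using x z \<delta>0 t2 by (auto simp: U_def D_def)
    qed
    have kern: "\<exists>k. ker \<delta> k \<and> (\<forall>z. 0 \<le> k z) \<and> integrable lborel k \<and> integral\<^sup>L lborel k = 1 \<and>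
        (\<forall>x\<in>U hh. (\<forall>i\<in>Basis. AE y in lborel. 0 < y \<and> y < \<theta> * \<tau> --> \<bar>\<integral> z. (g (z, y) \<bullet> i) * k (x - z) \<partial>lborel\<bar> \<le> M1 / \<tau>)
          \<and> (AE y in lborel. 0 < y \<and> y < \<theta> * \<tau> --> \<bar>\<integral> z. h (z, y) * k (x - z) \<partial>lborel\<bar> \<le> M2))"
      if \<delta>: "0 < \<delta>" "\<delta> \<le> \<delta>0" for \<delta>
    proof -
      obtain k :: "'a => real" where k: "smooth k" "\<And>x. k x \<ge> 0" "\<And>x. norm x > \<delta> ==> k x = 0" "\<And>x. k (Rf x) = k x"
        "integrable lborel k" "integral\<^sup>L lborel k = 1"
        using invariant_kernel_exists[OF \<delta>(1) Rf_linear Rf_Rf] by blast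
      have ker: "ker \<delta> k" using k by (simp add: ker_def)
      have sup: "AE y in lborel. 0 < y \<and> y \<le> \<theta> * \<tau> --> \<bar>pair v (kd \<beta> k) x y\<bar> \<le> M1 / \<tau> ^ length \<beta>"
        if "x \<in> U hh" "set \<beta> \<subseteq> Basis" "\<beta> \<noteq> []" "length \<beta> \<le> 2" for x and \<beta> :: "'a list"
        unfolding M1_def
        by (rule kernel_sup_bound[OF ker k(2,5,6,4) \<theta>]) (use that hh \<delta> \<delta>0 in \<open>auto simp: U_def \<rho>_def\<close>)
      have bds: "(\<forall>i\<in>Basis. AE y in lborel. 0 < y \<and> y < \<theta> * \<tau> --> \<bar>\<integral> z. (g (z, y) \<bullet> i) * k (x - z) \<partial>lborel\<bar> \<le> M1 / \<tau>)
          \<and> (AE y in lborel. 0 < y \<and> y < \<theta> * \<tau> --> \<bar>\<integral> z. h (z, y) * k (x - z) \<partial>lborel\<bar> \<le> M2)" if x: "x \<in> U hh" for x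
      proof
        have nx: "norm x < \<theta> * \<tau>" and xe: "0 < x \<bullet> e" and xd: "\<delta> < x \<bullet> e" using x hh \<delta> \<delta>0 by (auto simp: U_def)
        have "\<delta> \<le> \<rho>" using \<delta> \<delta>0 by simp
        then have adm: "adm x \<delta>"
          by (rule adm_near_interior[OF \<theta> nx xe \<rho>_def]) (use \<rho> in simp)
        show "\<forall>i\<in>Basis. AE y in lborel. 0 < y \<and> y < \<theta> * \<tau> --> \<bar>\<integral> z. (g (z, y) \<bullet> i) * k (x - z) \<partial>lborel\<bar> \<le> M1 / \<tau>"
        proof
          fix i :: 'a assume i: "i \<in> Basis"
          have s1: "AE y in lborel. 0 < y \<and> y \<le> \<theta> * \<tau> --> \<bar>pair v (pd i k) x y\<bar> \<le> M1 / \<tau>"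
            using sup[OF x, of "[i]"] i by simp
          show "AE y in lborel. 0 < y \<and> y < \<theta> * \<tau> --> \<bar>\<integral> z. (g (z, y) \<bullet> i) * k (x - z) \<partial>lborel\<bar> \<le> M1 / \<tau>"
            using s1 pair_gradient[OF ker adm i]
          proof eventually_elim
            case (elim y)
            show ?case using elim \<theta>\<tau> unfolding away_from_flat_part(2)[OF ker xd] by auto
          qed
        qed
        have "AE y in lborel. 0 < y \<and> y \<le> \<theta> * \<tau> --> \<bar>pair h k x y\<bar> \<le> M2"
          unfolding M2_def
        proof (rule conormal_sup_bound[OF ker adm \<theta>\<tau> C0 grow])
          show "AE y in lborel. 0 < y \<and> y \<le> \<theta> * \<tau> --> \<bar>pair v (kd [i, j] k) x y\<bar> \<le> M1 / \<tau>\<^sup>2"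
            if "i \<in> Basis" "j \<in> Basis" for i j
            using sup[OF x, of "[i, j]"] that by (simp add: power2_eq_square)
          show "0 \<le> M1 / \<tau>\<^sup>2" using M1 by simp
        qed
        then show "AE y in lborel. 0 < y \<and> y < \<theta> * \<tau> --> \<bar>\<integral> z. h (z, y) * k (x - z) \<partial>lborel\<bar> \<le> M2"
          unfolding away_from_flat_part(1)[OF ker xd] by eventually_elim auto
      qed
      show ?thesis using ker k bds by (intro exI[of _ k] conjI ballI allI) auto
    qed
    have kg: "\<exists>k. ker \<delta> k \<and> (\<forall>z. 0 \<le> k z) \<and> integrable lborel k \<and> integral\<^sup>L lborel k = 1 \<and>
        (\<forall>x\<in>U hh. AE y in lborel. 0 < y \<and> y < \<theta> * \<tau> --> \<bar>\<integral> z. (g (z, y) \<bullet> i) * k (x - z) \<partial>lborel\<bar> \<le> M1 / \<tau>)"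
      if "0 < \<delta>" "\<delta> \<le> \<delta>0" "i \<in> Basis" for \<delta> i
      using kern[OF that(1,2)] that(3) by blast
    have kh: "\<exists>k. ker \<delta> k \<and> (\<forall>z. 0 \<le> k z) \<and> integrable lborel k \<and> integral\<^sup>L lborel k = 1 \<and>
        (\<forall>x\<in>U hh. AE y in lborel. 0 < y \<and> y < \<theta> * \<tau> --> \<bar>\<integral> z. h (z, y) * k (x - z) \<partial>lborel\<bar> \<le> M2)"
      if "0 < \<delta>" "\<delta> \<le> \<delta>0" for \<delta>
      using kern[OF that] by blast
    have b: "(i, 0) \<in> (Basis :: ('a \<times> real) set)" if "i \<in> Basis" for i :: 'a using that by (simp add: Basis_prod_def)
    have b1: "(0, 1) \<in> (Basis :: ('a \<times> real) set)" by (simp add: Basis_prod_def)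
    have gX: "AE X in lborel. fst X \<in> U hh \<and> 0 < snd X \<and> snd X < \<theta> * \<tau> --> \<bar>g X \<bullet> i\<bar> \<le> M1 / \<tau>" if i: "i \<in> Basis" for i
      by (rule mollified_bound_limit[OF g_L2[OF i] smooth_pd[OF phi_smooth b[OF i]] L1_g[OF i] U UD \<delta>0(1) inside kg[OF _ _ i] less_imp_le[OF \<theta>\<tau>]])
    have hX: "AE X in lborel. fst X \<in> U hh \<and> 0 < snd X \<and> snd X < \<theta> * \<tau> --> \<bar>h X\<bar> \<le> M2"
      by (rule mollified_bound_limit[OF h_L2 smooth_pd[OF phi_smooth b1] L1_h U UD \<delta>0(1) inside kh less_imp_le[OF \<theta>\<tau>]])
    have "AE X in lborel. \<forall>i\<in>Basis. fst X \<in> U hh \<and> 0 < snd X \<and> snd X < \<theta> * \<tau> --> \<bar>g X \<bullet> i\<bar> \<le> M1 / \<tau>"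
      by (intro AE_finite_allI finite_Basis gX)
    with hX show ?thesis by eventually_elim auto
  qed
  have "AE X in lborel. \<forall>j. fst X \<in> U (1 / real (Suc j)) \<and> 0 < snd X \<and> snd X < \<theta> * \<tau> -->
      (\<forall>i\<in>Basis. \<bar>g X \<bullet> i\<bar> \<le> M1 / \<tau>) \<and> \<bar>h X\<bar> \<le> M2"
    unfolding AE_all_countable by (intro allI main) simp
  then show ?thesis
  proof eventually_elim
    case (elim X)
    show ?case
    proof
      assume X: "norm (fst X) < \<theta> * \<tau> \<and> 0 < fst X \<bullet> e \<and> 0 < snd X \<and> snd X < \<theta> * \<tau>"
      then obtain j where "1 / real (Suc j) < fst X \<bullet> e" using nat_approx_posE by blast
      then have "fst X \<in> U (1 / real (Suc j))" using X by (simp add: U_def)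
      then show "(\<forall>i\<in>Basis. \<bar>g X \<bullet> i\<bar> \<le> M1 / \<tau>) \<and> \<bar>h X\<bar> \<le> (real DIM('a))\<^sup>2 * \<Lambda> * (M1 / \<tau>\<^sup>2) * C0 * \<tau>"
        using elim X unfolding M2_def by blast
    qed
  qed
qed

end

section \<open>Muckenhoupt weights and Borel representatives\<close>

text \<open>Completeness of Lebesgue measure: a function that agrees almost everywhere with a Borel function is measurable.\<close>

lemma lebesgue_AE_transfer:
  fixes f F :: "'a::euclidean_space => real"
  assumes f [measurable]: "f \<in> borel_measurable borel" and e: "AE x in lborel. f x = F x"
  shows "F \<in> borel_measurable lebesgue"
    and "integrable lebesgue F \<longleftrightarrow> integrable lborel f" and "integral\<^sup>L lebesgue F = integral\<^sup>L lborel f"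
proof -
  have f': "f \<in> borel_measurable lebesgue" by (rule measurable_completion) simp
  show F: "F \<in> borel_measurable lebesgue"
  proof (rule measurableI)
    fix A :: "real set" assume A: "A \<in> sets borel"
    obtain N where N: "N \<in> null_sets lborel" "{x \<in> space lborel. f x \<noteq> F x} \<subseteq> N"
      using e unfolding eventually_ae_filter by blast
    have "F -` A \<inter> N \<in> sets lebesgue" by (rule sets_completionI_sub[OF N(1)]) auto
    moreover have "f -` A - N \<in> sets lebesgue"
      using N(1) measurable_sets[OF f' A] by (intro sets.Diff) (auto dest: null_setsD2)
    moreover have "F -` A = (f -` A - N) \<union> (F -` A \<inter> N)"
    proof -
      have "f x = F x" if "x \<notin> N" for x using N(2) that by auto
      then show ?thesis by auto
    qed
    ultimately have "F -` A \<in> sets lebesgue" by (metis sets.Un)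
    then show "F -` A \<inter> space lebesgue \<in> sets lebesgue" by simp
  qed simp
  have e': "AE x in lebesgue. f x = F x" using e by (rule AE_completion)
  show "integrable lebesgue F \<longleftrightarrow> integrable lborel f"
    using integrable_cong_AE[OF f' F e'] integrable_completion[of f lborel] by simp
  show "integral\<^sup>L lebesgue F = integral\<^sup>L lborel f"
    using integral_cong_AE[OF f' F e'] integral_completion[of f lborel] by simp
qed

lemma AE_lborel_snd:
  assumes "AE y in lborel. P y"
  shows "AE X in (lborel :: ('a::euclidean_space \<times> real) measure). P (snd X)"
proof -
  obtain N where N: "N \<in> null_sets lborel" "{y \<in> space lborel. \<not> P y} \<subseteq> N"
    using assms unfolding eventually_ae_filter by blast
  have [measurable]: "N \<in> sets borel" using N(1) by (auto dest: null_setsD2)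
  have "AE y in lborel. y \<notin> N" using N(1) by (rule AE_not_in)
  then have "AE X in (lborel :: ('a \<times> real) measure). snd X \<notin> N"
    by (subst AE_lborel_pair(2)) auto
  then show ?thesis by eventually_elim (use N(2) in auto)
qed

lemma AE_lborel_scale:
  fixes P :: "real => bool"
  assumes "AE y in lborel. P y" "c \<noteq> 0"
  shows "AE y in lborel. P (c * y)"
proof -
  obtain N where N: "N \<in> null_sets lborel" "{y \<in> space lborel. \<not> P y} \<subseteq> N"
    using assms unfolding eventually_ae_filter by blast
  have [measurable]: "N \<in> sets borel" using N(1) by (auto dest: null_setsD2)
  have "AE y in lborel. y \<notin> N" using N(1) by (rule AE_not_in)
  then have "AE y in lborel. 0 + c * y \<notin> N" by (intro AE_borel_affine assms) auto
  then show ?thesis by eventually_elim (use N(2) in auto)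
qed

text \<open>On an interval where the mean of the weight is not \<open>0\<close>, finiteness of the product of means forces the mean of the reciprocal to be finite. The weight may vanish near \<open>0\<close> a priori, so the argument is run on a large interval that contains both \<open>[0, \<tau>]\<close> and a set where the weight is positive.\<close>

lemma A2_weight_facts:
  assumes w: "A2_weight \<mu>" and \<tau>: "0 < \<tau>"
  shows "\<mu> \<in> borel_measurable lebesgue" and "AE y in lborel. y \<in> {0..\<tau>} --> 0 < \<mu> y"
    and "\<exists>I J. 0 < I \<and> 0 \<le> J \<and> (\<integral>\<^sup>+ y\<in>{0..\<tau>}. ennreal (\<mu> y) \<partial>lborel) = ennreal I \<and>
      (\<integral>\<^sup>+ y\<in>{0..\<tau>}. inverse (ennreal (\<mu> y)) \<partial>lborel) = ennreal J \<and> I * J \<le> enn2real (A2_const \<mu>) * \<tau>\<^sup>2"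
proof -
  define P where "P a b = (\<integral>\<^sup>+ y\<in>{a..b}. ennreal (\<mu> y) \<partial>lebesgue)" for a b
  define Q where "Q a b = (\<integral>\<^sup>+ y\<in>{a..b}. inverse (ennreal (\<mu> y)) \<partial>lebesgue)" for a b
  have nn: "0 \<le> \<mu> y" and int: "set_integrable lebesgue {a..b} \<mu>" and nz: "\<not> (AE y in lebesgue. \<mu> y = 0)"
    and fin: "A2_const \<mu> < \<infinity>" for y a b
    using w by (auto simp: A2_weight_def)
  show meas [measurable]: "\<mu> \<in> borel_measurable lebesgue"
  proof (rule borel_measurable_LIMSEQ_real)
    show "(\<lambda>y. indicator {- real n..real n} y *\<^sub>R \<mu> y) \<in> borel_measurable lebesgue" for n
      using int[of "- real n" "real n"] unfolding set_integrable_def by auto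
    fix y :: real
    obtain n0 where n0: "\<bar>y\<bar> \<le> real n0" using real_arch_simple by blast
    have "indicator {- real n..real n} y *\<^sub>R \<mu> y = \<mu> y" if "n0 \<le> n" for n
    proof -
      have "\<bar>y\<bar> \<le> real n" using n0 that by linarith
      then show ?thesis by (auto simp: indicator_def)
    qed
    then have "eventually (\<lambda>n. \<mu> y = indicator {- real n..real n} y *\<^sub>R \<mu> y) sequentially"
      unfolding eventually_sequentially by (intro exI[of _ n0]) simp
    then show "(\<lambda>n. indicator {- real n..real n} y *\<^sub>R \<mu> y) \<longlonglongrightarrow> \<mu> y"
      by (rule Lim_transform_eventually[OF tendsto_const])
  qed
  have PQ: "(P a b / ennreal (b - a)) * (Q a b / ennreal (b - a)) \<le> A2_const \<mu>" if "a < b" for a b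
    unfolding A2_const_def P_def Q_def by (rule SUP_upper2[of "(a, b)"]) (use that in auto)
  have mI: "(\<lambda>y. ennreal (\<mu> y) * indicator {a..b} y) \<in> borel_measurable lebesgue" for a b
    by (intro borel_measurable_times_ennreal borel_measurable_indicator measurable_compose[OF meas measurable_ennreal]) simp
  have iM: "(\<lambda>y. inverse (ennreal (\<mu> y)) * indicator {a..b} y) \<in> borel_measurable lebesgue" for a b
    by (intro borel_measurable_times_ennreal borel_measurable_indicator measurable_compose[OF meas, of "\<lambda>x. inverse (ennreal x)"]) simp_all
  have Pfin: "P a b < \<infinity>" for a b
  proof -
    have "P a b = (\<integral>\<^sup>+ y. ennreal (norm (indicator {a..b} y *\<^sub>R \<mu> y)) \<partial>lebesgue)"
      unfolding P_def using nn by (intro nn_integral_cong) (auto simp: indicator_def)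
    then show ?thesis using int[of a b] unfolding set_integrable_def integrable_iff_bounded by simp
  qed
  obtain n where n: "P (- real n) (real n) \<noteq> 0"
  proof -
    have "\<exists>n. P (- real n) (real n) \<noteq> 0"
    proof (rule ccontr)
      assume z: "\<not> ?thesis"
      have "AE y in lebesgue. ennreal (\<mu> y) * indicator {- real n..real n} y = 0" for n
      proof -
        have "P (- real n) (real n) = 0" using z by blast
        then show ?thesis unfolding P_def nn_integral_0_iff_AE[OF mI] .
      qed
      then have "AE y in lebesgue. \<forall>n. ennreal (\<mu> y) * indicator {- real n..real n} y = 0"
        unfolding AE_all_countable by (rule allI)
      then have "AE y in lebesgue. \<mu> y = 0"
      proof eventually_elim
        case (elim y)
        obtain n0 where n0: "\<bar>y\<bar> \<le> real n0" using real_arch_simple by blast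
        then have "y \<in> {- real n0..real n0}" by auto
        then have "ennreal (\<mu> y) = 0" using elim[rule_format, of n0] by (simp only: indicator_simps mult_1_right)
        then show ?case using nn[of y] by (simp add: ennreal_eq_0_iff)
      qed
      then show False using nz by blast
    qed
    then show ?thesis using that by blast
  qed
  \<comment> \<open>One interval that sees both the positive mass of the weight and \<open>[0, \<tau>]\<close>.\<close>
  define N where "N = max (real n) \<tau>"
  have N: "0 < N" "real n \<le> N" "\<tau> \<le> N" using \<tau> by (auto simp: N_def)
  have "P (- real n) (real n) \<le> P (- N) N"
    unfolding P_def using N by (intro nn_integral_mono) (auto simp: indicator_def)
  then have PN: "P (- N) N \<noteq> 0" using n by auto
  have QN: "Q (- N) N < \<infinity>"
  proof (rule ccontr)
    assume "\<not> ?thesis"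
    then have "Q (- N) N = \<infinity>" by (simp add: less_top[symmetric])
    then have "(P (- N) N / ennreal (N - - N)) * (Q (- N) N / ennreal (N - - N)) = \<infinity>"
      using PN N by (simp add: ennreal_mult_eq_top_iff ennreal_divide_eq_top_iff divide_ennreal_def)
    then show False using PQ[of "- N" N] N fin by (simp add: top_unique)
  qed
  have "AE y in lebesgue. inverse (ennreal (\<mu> y)) * indicator {- N..N} y \<noteq> \<infinity>"
    by (rule nn_integral_noteq_infinite[OF iM]) (use QN in \<open>simp add: Q_def\<close>)
  then have pos: "AE y in lborel. y \<in> {- N..N} --> 0 < \<mu> y"
    unfolding AE_completion_iff
  proof eventually_elim
    case (elim y)
    show ?case
    proof
      assume "y \<in> {- N..N}"
      then have "ennreal (\<mu> y) \<noteq> 0" using elim by auto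
      then show "0 < \<mu> y" using nn[of y] by (simp add: ennreal_eq_0_iff not_le)
    qed
  qed
  then show pos': "AE y in lborel. y \<in> {0..\<tau>} --> 0 < \<mu> y"
    by eventually_elim (use N in auto)
  have "Q 0 \<tau> \<le> Q (- N) N"
    unfolding Q_def using N by (intro nn_integral_mono) (auto simp: indicator_def)
  then have Qf: "Q 0 \<tau> < \<infinity>" using QN by simp
  have P0: "P 0 \<tau> \<noteq> 0"
  proof
    assume "P 0 \<tau> = 0"
    then have "AE y in lebesgue. ennreal (\<mu> y) * indicator {0..\<tau>} y = 0"
      unfolding P_def nn_integral_0_iff_AE[OF mI] .
    then have "AE y in lborel. y \<notin> {0..\<tau>}"
      unfolding AE_completion_iff using pos' by eventually_elim (auto simp: indicator_def ennreal_eq_0_iff split: if_splits)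
    then have "{0..\<tau>} \<in> null_sets lborel" using AE_iff_null_sets[of "{0..\<tau>}" lborel] by simp
    then have "emeasure lborel {0..\<tau>} = 0" by (rule null_setsD1)
    then show False using \<tau> by simp
  qed
  define I where "I = enn2real (P 0 \<tau>)"
  define J where "J = enn2real (Q 0 \<tau>)"
  have IJ: "P 0 \<tau> = ennreal I" "Q 0 \<tau> = ennreal J" "0 \<le> J" using Pfin Qf by (auto simp: I_def J_def)
  have I: "0 < I" using P0 Pfin[of 0 \<tau>] by (simp add: I_def enn2real_positive_iff zero_less_iff_neq_zero)
  have "ennreal (I / \<tau> * (J / \<tau>)) \<le> A2_const \<mu>"
  proof -
    have "ennreal (I / \<tau> * (J / \<tau>)) = ennreal (I / \<tau>) * ennreal (J / \<tau>)" using \<tau> I IJ by (intro ennreal_mult) auto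
    also have "\<dots> = (P 0 \<tau> / ennreal (\<tau> - 0)) * (Q 0 \<tau> / ennreal (\<tau> - 0))"
      using \<tau> I IJ by (simp add: divide_ennreal)
    also have "\<dots> \<le> A2_const \<mu>" by (rule PQ[OF \<tau>])
    finally show ?thesis .
  qed
  then have "ennreal (I / \<tau> * (J / \<tau>)) \<le> ennreal (enn2real (A2_const \<mu>))" using fin by simp
  then have "I / \<tau> * (J / \<tau>) \<le> enn2real (A2_const \<mu>)" by (simp only: ennreal_le_iff enn2real_nonneg)
  then have "I * J \<le> enn2real (A2_const \<mu>) * \<tau>\<^sup>2" using \<tau> by (simp add: field_simps power2_eq_square)
  then show "\<exists>I J. 0 < I \<and> 0 \<le> J \<and> (\<integral>\<^sup>+ y\<in>{0..\<tau>}. ennreal (\<mu> y) \<partial>lborel) = ennreal I \<and>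
      (\<integral>\<^sup>+ y\<in>{0..\<tau>}. inverse (ennreal (\<mu> y)) \<partial>lborel) = ennreal J \<and> I * J \<le> enn2real (A2_const \<mu>) * \<tau>\<^sup>2"
    using I IJ unfolding P_def Q_def nn_integral_completion by blast
qed

lemma A2_weight_representative:
  fixes e :: "'a::euclidean_space"
  assumes w: "A2_weight \<mu>" and \<tau>: "0 < \<tau>" and e: "e \<in> Basis"
  obtains m where "half_cylinder_weight e \<tau> m" "AE y in lborel. m y = indicator {0<..<\<tau>} y * \<mu> y"
    "0 < integral\<^sup>L lborel m" "integral\<^sup>L lborel m * (LBINT y. inverse (m y)) \<le> enn2real (A2_const \<mu>) * \<tau>\<^sup>2"
proof -
  have nn: "0 \<le> \<mu> y" for y using w by (simp add: A2_weight_def)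
  obtain m0 where m0 [measurable]: "m0 \<in> borel_measurable borel" and m0e: "AE y in lborel. \<mu> y = m0 y"
    using completion_ex_borel_measurable_real[OF A2_weight_facts(1)[OF w \<tau>]] by auto
  define m where "m y = indicator {0<..<\<tau>} y * \<bar>m0 y\<bar>" for y
  have [measurable]: "m \<in> borel_measurable borel" unfolding m_def[abs_def] by measurable
  have m: "AE y in lborel. m y = indicator {0<..<\<tau>} y * \<mu> y"
    using m0e
  proof eventually_elim
    case (elim y)
    then show ?case using nn[of y] by (simp add: m_def)
  qed
  have mp: "AE y in lborel. y \<in> {0<..<\<tau>} --> 0 < m y"
    using m A2_weight_facts(2)[OF w \<tau>] by eventually_elim auto
  obtain I J where IJ: "0 < I" "0 \<le> J" "(\<integral>\<^sup>+ y\<in>{0..\<tau>}. ennreal (\<mu> y) \<partial>lborel) = ennreal I"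
      "(\<integral>\<^sup>+ y\<in>{0..\<tau>}. inverse (ennreal (\<mu> y)) \<partial>lborel) = ennreal J" "I * J \<le> enn2real (A2_const \<mu>) * \<tau>\<^sup>2"
    using A2_weight_facts(3)[OF w \<tau>] by blast
  have ends: "AE y in lborel. y \<noteq> 0 \<and> y \<noteq> \<tau>"
    using AE_lborel_singleton[of 0] AE_lborel_singleton[of \<tau>] by eventually_elim auto
  have "(\<integral>\<^sup>+ y. ennreal (m y) \<partial>lborel) = (\<integral>\<^sup>+ y\<in>{0..\<tau>}. ennreal (\<mu> y) \<partial>lborel)"
    by (rule nn_integral_cong_AE, use m ends in eventually_elim) (auto simp: indicator_def)
  then have 1: "(\<integral>\<^sup>+ y. ennreal (m y) \<partial>lborel) = ennreal I" using IJ by simp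
  have "(\<integral>\<^sup>+ y. ennreal (inverse (m y)) \<partial>lborel) = (\<integral>\<^sup>+ y\<in>{0..\<tau>}. inverse (ennreal (\<mu> y)) \<partial>lborel)"
    by (rule nn_integral_cong_AE, use m mp ends in eventually_elim) (auto simp: indicator_def inverse_ennreal split: if_splits)
  then have 2: "(\<integral>\<^sup>+ y. ennreal (inverse (m y)) \<partial>lborel) = ennreal J" using IJ by simp
  have m0': "0 \<le> m y" for y by (simp add: m_def)
  have i: "integrable lborel m" "integrable lborel (\<lambda>y. inverse (m y))"
    using 1 2 m0' by (auto intro!: integrableI_nonneg)
  have "integral\<^sup>L lborel m = I" using 1 IJ(1) m0' by (subst integral_eq_nn_integral) auto
  moreover have "(LBINT y. inverse (m y)) = J" using 2 IJ(2) m0' by (subst integral_eq_nn_integral) auto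
  moreover have "half_cylinder_weight e \<tau> m"
    by unfold_locales (use e \<tau> mp i m0' in \<open>auto simp: m_def\<close>)
  ultimately show ?thesis using that[of m] m IJ by simp
qed

lemma locally_integrable_measurable:
  fixes F :: "'a::euclidean_space => 'b::euclidean_space"
  assumes "open S" and F: "locally_integrable S F"
  shows "(\<lambda>X. indicator S X *\<^sub>R F X) \<in> borel_measurable lebesgue"
proof -
  obtain C where C: "\<And>n::nat. compact (C n)" "\<And>n. C n \<subseteq> S" "\<And>n. C n \<subseteq> interior (C (Suc n))" "\<Union> (range C) = S"
    using open_Union_compact_subsets[OF \<open>open S\<close>] by metis
  have mono: "C n \<subseteq> C k" if "n \<le> k" for n k
    by (rule lift_Suc_mono_le[of C, OF _ that]) (use C(3) interior_subset in blast)
  show ?thesis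
  proof (rule borel_measurable_LIMSEQ_metric)
    show "(\<lambda>X. indicator (C n) X *\<^sub>R F X) \<in> borel_measurable lebesgue" for n
    proof (rule borel_measurable_integrable)
      show "integrable lebesgue (\<lambda>X. indicator (C n) X *\<^sub>R F X)"
        using F C(1,2) unfolding locally_integrable_def set_integrable_def by blast
    qed
    fix X
    show "(\<lambda>n. indicator (C n) X *\<^sub>R F X) \<longlonglongrightarrow> indicator S X *\<^sub>R F X"
    proof (cases "X \<in> S")
      case True
      then obtain n0 where n0: "X \<in> C n0" using C(4) by auto
      have "eventually (\<lambda>n. indicator S X *\<^sub>R F X = indicator (C n) X *\<^sub>R F X) sequentially"
        unfolding eventually_sequentially
      proof (intro exI[of _ n0] allI impI)
        fix n assume "n0 \<le> n"
        then have "X \<in> C n" using mono n0 by blast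
        then show "indicator S X *\<^sub>R F X = indicator (C n) X *\<^sub>R F X" using True by simp
      qed
      then show ?thesis by (rule Lim_transform_eventually[OF tendsto_const])
    next
      case False
      then have "indicator (C n) X = (0 :: real)" for n using C(2) by (auto simp: indicator_def)
      then show ?thesis using False by simp
    qed
  qed
qed

section \<open>Weighted Sobolev functions\<close>

text \<open>Integrability without weight follows from \<open>|F| \<le> F\<^sup>2 m + 1 / m\<close>; then almost all sections are integrable, and the others are replaced by \<open>0\<close>.\<close>

lemma (in half_cylinder_weight) wL2_representative:
  fixes F :: "'a \<times> real => real"
  assumes F: "(\<lambda>X. indicator Om X * F X) \<in> borel_measurable lebesgue"
    and fin: "(\<integral>\<^sup>+ X\<in>Om. ennreal ((F X)\<^sup>2 * m (snd X)) \<partial>lborel) < \<infinity>"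
  obtains F' where "wL2 F'" "AE X in lborel. X \<in> Om --> F' X = F X"
proof -
  obtain F0 where F0 [measurable]: "F0 \<in> borel_measurable borel" and F0e: "AE X in lborel. indicator Om X * F X = F0 X"
    using completion_ex_borel_measurable_real[OF F] by auto
  define F1 where "F1 X = indicator Om X * F0 X" for X
  have [measurable]: "F1 \<in> borel_measurable borel" unfolding F1_def[abs_def] by measurable
  have F1e: "AE X in lborel. X \<in> Om --> F1 X = F X" using F0e by eventually_elim (auto simp: F1_def)
  have sq: "(\<integral>\<^sup>+ X. ennreal ((F1 X)\<^sup>2 * m (snd X)) \<partial>lborel) < \<infinity>"
  proof -
    have "(\<integral>\<^sup>+ X. ennreal ((F1 X)\<^sup>2 * m (snd X)) \<partial>lborel) = (\<integral>\<^sup>+ X\<in>Om. ennreal ((F X)\<^sup>2 * m (snd X)) \<partial>lborel)"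
      by (rule nn_integral_cong_AE, use F1e in eventually_elim) (auto simp: F1_def indicator_def)
    then show ?thesis using fin by simp
  qed
  have m_AE: "AE X in (lborel :: ('a \<times> real) measure). snd X \<in> {0<..<\<tau>} --> m (snd X) * inverse (m (snd X)) = 1"
    using AE_lborel_snd[OF AE_m_inverse] .
  have "(\<integral>\<^sup>+ X. ennreal \<bar>F1 X\<bar> \<partial>lborel) \<le> (\<integral>\<^sup>+ X. ennreal ((F1 X)\<^sup>2 * m (snd X)) + ennreal (inverse (m (snd X))) * indicator D (fst X) \<partial>lborel)"
  proof (rule nn_integral_mono_AE, use m_AE in eventually_elim)
    case (elim X)
    show ?case
    proof (cases "X \<in> Om")
      case True
      \<comment> \<open>The inequality \<open>|F1| \<le> F1\<^sup>2 w + 1 / w\<close>, from completing the square.\<close>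
      define w where "w = m (snd X)"
      have w: "w * inverse w = 1" "0 \<le> w" using elim True m_nonneg by (auto simp: w_def Om_def)
      have w0: "0 < w" using w by (cases "w = 0") auto
      have "0 \<le> (\<bar>F1 X\<bar> * w - 1)\<^sup>2 + \<bar>F1 X\<bar> * w" using w0 by simp
      then have "\<bar>F1 X\<bar> * w \<le> (F1 X)\<^sup>2 * w * w + 1"
        by (simp add: power2_diff power_mult_distrib power2_eq_square[of w] algebra_simps)
      then have "\<bar>F1 X\<bar> \<le> ((F1 X)\<^sup>2 * w * w + 1) / w" using w0 by (simp add: pos_le_divide_eq)
      then have "\<bar>F1 X\<bar> \<le> (F1 X)\<^sup>2 * w + inverse w" using w0 by (simp add: add_divide_distrib inverse_eq_divide)
      then have "ennreal \<bar>F1 X\<bar> \<le> ennreal ((F1 X)\<^sup>2 * w) + ennreal (inverse w)"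
        using w0 by (simp add: ennreal_plus[symmetric] ennreal_leI del: ennreal_plus)
      then show ?thesis using True by (auto simp: w_def Om_def)
    qed (simp add: F1_def)
  qed
  also have "\<dots> = (\<integral>\<^sup>+ X. ennreal ((F1 X)\<^sup>2 * m (snd X)) \<partial>lborel) + (\<integral>\<^sup>+ X. ennreal (inverse (m (snd X))) * indicator D (fst X) \<partial>(lborel :: ('a \<times> real) measure))"
    by (rule nn_integral_add) measurable
  also have "(\<integral>\<^sup>+ X. ennreal (inverse (m (snd X))) * indicator D (fst X) \<partial>(lborel :: ('a \<times> real) measure)) = ennreal (LBINT y. inverse (m y)) * emeasure lborel D"
    using minv_int m_nonneg by (subst nn_integral_lborel_pair(2)) (simp_all add: nn_integral_cmult nn_integral_multc nn_integral_eq_integral)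
  also have "(\<integral>\<^sup>+ X. ennreal ((F1 X)\<^sup>2 * m (snd X)) \<partial>lborel) + ennreal (LBINT y. inverse (m y)) * emeasure lborel D < \<infinity>"
    using sq D_finite by (simp add: ennreal_mult_less_top)
  finally have F1fin: "(\<integral>\<^sup>+ X. ennreal \<bar>F1 X\<bar> \<partial>lborel) < \<infinity>" .
  define a where "a y = (\<integral>\<^sup>+ z. ennreal \<bar>F1 (z, y)\<bar> \<partial>lborel)" for y
  have [measurable]: "a \<in> borel_measurable borel" unfolding a_def[abs_def] by measurable
  have "(\<integral>\<^sup>+ y. a y \<partial>lborel) < \<infinity>" using F1fin unfolding a_def by (subst (asm) nn_integral_lborel_pair(2)) auto
  then have a: "AE y in lborel. a y \<noteq> \<infinity>" by (intro nn_integral_noteq_infinite) auto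
  define F' where "F' X = F1 X * indicator {y. a y \<noteq> \<infinity>} (snd X)" for X
  have [measurable]: "{y. a y \<noteq> \<infinity>} \<in> sets borel" by measurable
  have [measurable]: "F' \<in> borel_measurable borel" unfolding F'_def[abs_def] by measurable
  have le: "\<bar>F' X\<bar> \<le> \<bar>F1 X\<bar>" "(F' X)\<^sup>2 \<le> (F1 X)\<^sup>2" for X by (auto simp: F'_def indicator_def)
  have "integrable lborel (\<lambda>z. F' (z, y))" for y
  proof (cases "a y = \<infinity>")
    case False
    then have "(\<integral>\<^sup>+ z. ennreal (norm (F' (z, y))) \<partial>lborel) < \<infinity>" by (simp add: F'_def a_def less_top)
    then show ?thesis by (intro integrableI_bounded) auto
  qed (simp add: F'_def)
  moreover have "integrable lborel (\<lambda>X. (F' X)\<^sup>2 * m (snd X))"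
  proof (rule integrableI_bounded)
    have "(\<integral>\<^sup>+ X. ennreal (norm ((F' X)\<^sup>2 * m (snd X))) \<partial>lborel) \<le> (\<integral>\<^sup>+ X. ennreal ((F1 X)\<^sup>2 * m (snd X)) \<partial>lborel)"
      using le(2) m_nonneg by (intro nn_integral_mono ennreal_leI) (auto simp: abs_mult intro: mult_right_mono)
    then show "(\<integral>\<^sup>+ X. ennreal (norm ((F' X)\<^sup>2 * m (snd X))) \<partial>lborel) < \<infinity>" using sq by simp
  qed measurable
  ultimately have "wL2 F'" by (auto simp: wL2_def) (simp add: F'_def F1_def)
  moreover have "AE X in lborel. X \<in> Om --> F' X = F X"
    using F1e AE_lborel_snd[OF a] by eventually_elim (auto simp: F'_def)
  ultimately show ?thesis using that by blast
qed

lemma grad_inner: "i \<in> Basis ==> grad f x \<bullet> i = pd i f x"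
  by (simp add: grad_def pd_def inner_sum_left inner_Basis if_distrib sum.If_cases cong: if_cong)

lemma grad_pair:
  fixes f :: "'a::euclidean_space \<times> real => real"
  shows "i \<in> Basis ==> fst (grad f X) \<bullet> i = pd (i, 0) f X" and "snd (grad f X) = pd (0, 1) f X"
proof -
  show "fst (grad f X) \<bullet> i = pd (i, 0) f X" if "i \<in> Basis"
    using grad_inner[of "(i, 0)" f X] that by (simp add: Basis_prod_def inner_prod_def)
  show "snd (grad f X) = pd (0, 1) f X"
    using grad_inner[of "(0, 1)" f X] by (simp add: Basis_prod_def inner_prod_def)
qed

lemma grad_continuous:
  assumes "smooth f"
  shows "continuous_on S (grad f)"
  by (subst continuous_on_componentwise) (use assms in \<open>simp add: grad_inner smooth_continuous smooth_pd\<close>)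

lemma continuous_locally_integrable:
  fixes f :: "'a::euclidean_space => 'b::euclidean_space"
  assumes "continuous_on UNIV f"
  shows "locally_integrable S f"
  unfolding locally_integrable_def set_integrable_def
proof (intro allI impI)
  fix K :: "'a set" assume K: "compact K \<and> K \<subseteq> S"
  have "integrable lborel (\<lambda>x. indicator K x *\<^sub>R f x)"
    using borel_integrable_compact[of K f] K assms continuous_on_subset[of UNIV f K]
    by (simp add: indicator_scaleR_eq_if)
  then show "integrable lebesgue (\<lambda>x. indicator K x *\<^sub>R f x)"
    using integrable_completion[of "\<lambda>x. indicator K x *\<^sub>R f x" lborel] borel_measurable_integrable by blast
qed

text \<open>The product with a test function has compact support, so its derivative integrates to \<open>0\<close>.\<close>

lemma weak_gradient_smooth:
  fixes f :: "'a::euclidean_space => real"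
  assumes f: "smooth f"
  shows "weak_gradient S f (grad f)"
  unfolding weak_gradient_def
proof (intro conjI ballI)
  show "locally_integrable S f" "locally_integrable S (grad f)"
    by (intro continuous_locally_integrable smooth_continuous grad_continuous f)+
  fix \<phi> i assume \<phi>: "\<phi> \<in> test_functions S" and i: "(i :: 'a) \<in> Basis"
  have s: "smooth \<phi>" and c: "compact (closure {x. \<phi> x \<noteq> 0})" and S: "closure {x. \<phi> x \<noteq> 0} \<subseteq> S"
    using \<phi> by (auto simp: test_functions_def)
  define T where "T = closure {x. \<phi> x \<noteq> 0}"
  have \<phi>0: "\<phi> x = 0" if "x \<notin> T" for x using that closure_subset[of "{x. \<phi> x \<noteq> 0}"] by (auto simp: T_def)
  have op: "open (- T)" by (simp add: T_def open_Compl)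
  have p0: "pd i \<phi> x = 0" if "x \<notin> T" for x
    by (rule pd_zero_on_open[OF op _ \<phi>0]) (use that in auto)
  obtain r where "\<forall>x\<in>T. norm x \<le> r" using compact_imp_bounded[OF c] unfolding T_def bounded_iff by blast
  then have r: "T \<subseteq> cball 0 r" by auto
  have int: "integrable lborel h" if "smooth h" "\<And>x. x \<notin> T ==> h x = 0" for h :: "'a => real"
  proof -
    have e: "indicator T x *\<^sub>R h x = h x" for x using that(2)[of x] by (cases "x \<in> T") auto
    show ?thesis using borel_integrable_compact[OF c smooth_continuous[OF that(1)]] unfolding T_def[symmetric] e .
  qed
  have sm: "smooth (\<lambda>x. f x * \<phi> x)" "smooth (\<lambda>x. f x * pd i \<phi> x)" "smooth (\<lambda>x. pd i f x * \<phi> x)"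
    by (intro smooth_mult smooth_pd f s i)+
  have I: "integrable lborel (\<lambda>x. f x * pd i \<phi> x)" "integrable lborel (\<lambda>x. pd i f x * \<phi> x)" "integrable lborel (\<lambda>x. f x * \<phi> x)"
    by (rule int; use sm \<phi>0 p0 in simp)+
  obtain C where C: "0 \<le> C" "\<And>x y. x \<in> cball 0 (r + 1) ==> y \<in> cball 0 (r + 1) ==> \<bar>f x * \<phi> x - f y * \<phi> y\<bar> \<le> C * norm (x - y)"
    using smooth_Lipschitz_on_cball[OF sm(1)] by metis
  have "integral\<^sup>L lborel (pd i (\<lambda>x. f x * \<phi> x)) = 0"
  proof (rule integral_directional_derivative_zero[OF I(3), where C = C and r = r and e = i])
    show "pd i (\<lambda>x. f x * \<phi> x) \<in> borel_measurable borel" by (intro smooth_borel smooth_pd sm i)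
    show "f x * \<phi> x = 0" if "r < norm x" for x
    proof -
      have "x \<notin> T" using r that by auto
      then show ?thesis using \<phi>0 by simp
    qed
    show "\<bar>f (x + t *\<^sub>R i) * \<phi> (x + t *\<^sub>R i) - f x * \<phi> x\<bar> \<le> C * t" if t: "0 < t" "t \<le> 1" for x t
    proof (cases "norm x \<le> r + 1 \<and> norm (x + t *\<^sub>R i) \<le> r + 1")
      case True
      then show ?thesis using C(2)[of "x + t *\<^sub>R i" x] t i by simp
    next
      case False
      have "norm (t *\<^sub>R i) \<le> 1" using t i by simp
      moreover have "norm x \<le> norm (x + t *\<^sub>R i) + norm (t *\<^sub>R i)" using norm_triangle_ineq4[of "x + t *\<^sub>R i" "t *\<^sub>R i"] by simp
      moreover have "norm (x + t *\<^sub>R i) \<le> norm x + norm (t *\<^sub>R i)" by (rule norm_triangle_ineq)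
      ultimately have "r < norm x" "r < norm (x + t *\<^sub>R i)" using False by linarith+
      then have "x \<notin> T" "x + t *\<^sub>R i \<notin> T" using r by auto
      then show ?thesis using \<phi>0 C(1) t by simp
    qed
    show "AE x in lborel. ((\<lambda>t. f (x + t *\<^sub>R i) * \<phi> (x + t *\<^sub>R i)) has_real_derivative pd i (\<lambda>x. f x * \<phi> x) x) (at 0)"
      using smooth_has_real_derivative_line[OF sm(1), where i = i and t = 0] by simp
  qed
  then have "(LBINT x. f x * pd i \<phi> x) = - (LBINT x. pd i f x * \<phi> x)"
    using I unfolding pd_mult[OF f s] by simp
  moreover have "(LINT X:S|lebesgue. f X * (grad \<phi> X \<bullet> i)) = (LBINT x. f x * pd i \<phi> x)"
  proof -
    have "indicator S x *\<^sub>R (f x * (grad \<phi> x \<bullet> i)) = f x * pd i \<phi> x" for x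
      using p0[of x] S i by (cases "x \<in> T") (auto simp: grad_inner T_def indicator_def)
    note e = this
    show ?thesis unfolding set_lebesgue_integral_def e
      by (intro integral_completion) (use smooth_borel[OF sm(2)] in simp)
  qed
  moreover have "(LINT X:S|lebesgue. (grad f X \<bullet> i) * \<phi> X) = (LBINT x. pd i f x * \<phi> x)"
  proof -
    have "indicator S x *\<^sub>R ((grad f x \<bullet> i) * \<phi> x) = pd i f x * \<phi> x" for x
      using \<phi>0[of x] S i by (cases "x \<in> T") (auto simp: grad_inner T_def indicator_def)
    note e = this
    show ?thesis unfolding set_lebesgue_integral_def e
      by (intro integral_completion) (use smooth_borel[OF sm(3)] in simp)
  qed
  ultimately show "(LINT X:S|lebesgue. f X * (grad \<phi> X \<bullet> i)) = - (LINT X:S|lebesgue. (grad f X \<bullet> i) * \<phi> X)"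
    by simp
qed

section \<open>The half cylinder and tensor test functions\<close>

lemma half_ball_inner: "half_ball l r = {z. norm z < r \<and> 0 < z \<bullet> axis l 1}"
  by (auto simp: half_ball_def inner_axis dist_norm)

lemma half_ball_open: "open (half_ball l r)"
  unfolding half_ball_inner by (intro open_Collect_conj open_Collect_less continuous_intros)

lemma half_cyl_open: "open (half_cyl l r)"
  unfolding half_cyl_def by (intro open_Times half_ball_open open_greaterThanLessThan)

text \<open>The frontier consists of points on the flat part and of points on the sphere, which is where the horizontal factors of the test functions vanish.\<close>

lemma frontier_half_ball:
  assumes "z \<in> frontier (half_ball l r)"
  shows "z \<bullet> axis l 1 = 0 \<or> (0 \<le> z \<bullet> axis l 1 \<and> r \<le> norm z)"
proof -
  have "closure (half_ball l r) \<subseteq> {z. norm z \<le> r \<and> 0 \<le> z \<bullet> axis l 1}"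
    by (rule closure_minimal) (auto simp: half_ball_inner intro!: closed_Collect_conj closed_Collect_le continuous_intros)
  moreover have "z \<in> closure (half_ball l r)" "z \<notin> half_ball l r"
    using assms by (simp_all add: frontier_def interior_open[OF half_ball_open])
  ultimately show ?thesis by (auto simp: half_ball_inner)
qed

lemma tensor_smooth:
  fixes \<eta> :: "'a::euclidean_space => real"
  assumes \<eta>: "smooth \<eta>" and \<zeta>: "real_polynomial_function \<zeta>"
    and d: "\<And>t. (\<zeta> has_real_derivative \<zeta>' t) (at t)"
  shows "smooth (\<lambda>X. \<eta> (fst X) * \<zeta> (snd X))"
    and "i \<in> Basis ==> pd (i, 0) (\<lambda>X. \<eta> (fst X) * \<zeta> (snd X)) X = pd i \<eta> (fst X) * \<zeta> (snd X)"
    and "pd (0, 1) (\<lambda>X. \<eta> (fst X) * \<zeta> (snd X)) X = \<eta> (fst X) * \<zeta>' (snd X)"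
    and "\<zeta>' = pd 1 \<zeta>"
proof -
  have sz: "smooth \<zeta>" by (rule real_polynomial_function_smooth[OF \<zeta>])
  have l: "linear (fst :: 'a \<times> real => 'a)" "linear (snd :: 'a \<times> real => real)" by (simp_all add: linear_fst linear_snd)
  have s: "smooth (\<lambda>X :: 'a \<times> real. \<eta> (fst X))" "smooth (\<lambda>X :: 'a \<times> real. \<zeta> (snd X))"
    using smooth_affine[OF \<eta> l(1), of 0] smooth_affine[OF sz l(2), of 0] by simp_all
  show "smooth (\<lambda>X. \<eta> (fst X) * \<zeta> (snd X))" by (rule smooth_mult[OF s])
  have z: "pd 1 \<zeta> t = \<zeta>' t" for t
    using pd_eqI[OF d[of t, unfolded has_field_derivative_def], of 1] by simp
  then show "\<zeta>' = pd 1 \<zeta>" by auto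
  have p1: "pd b (\<lambda>X :: 'a \<times> real. \<eta> (fst X)) X = pd (fst b) \<eta> (fst X)" for b X
    using pd_affine(1)[OF smooth_differentiable[OF \<eta>] l(1), where x = X and c = 0 and i = b] pd_sum_Basis[OF \<eta>, of "fst b" "fst X"] by simp
  have p2: "pd b (\<lambda>X :: 'a \<times> real. \<zeta> (snd X)) X = snd b * \<zeta>' (snd X)" for b X
    using pd_affine(1)[OF smooth_differentiable[OF sz] l(2), where x = X and c = 0 and i = b] z[of "snd X"] by simp
  have p0: "pd 0 \<eta> z = 0" for z
    using pd_sum_Basis[OF \<eta>, of 0 z] by simp
  show "pd (i, 0) (\<lambda>X. \<eta> (fst X) * \<zeta> (snd X)) X = pd i \<eta> (fst X) * \<zeta> (snd X)" if "i \<in> Basis"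
    using pd_mult[OF s, of "(i, 0)" X] p1[of "(i, 0)" X] p2[of "(i, 0)" X] by simp
  show "pd (0, 1) (\<lambda>X. \<eta> (fst X) * \<zeta> (snd X)) X = \<eta> (fst X) * \<zeta>' (snd X)"
    using pd_mult[OF s, of "(0, 1)" X] p1[of "(0, 1)" X] p2[of "(0, 1)" X] p0 by simp
qed

context half_cylinder_weight
begin

text \<open>Used both to integrate bounded functions and to evaluate the mass of the full cylinder.\<close>

lemma weight_on_cylinder:
  "integrable lborel (\<lambda>X :: 'a \<times> real. indicator (ball 0 \<tau>) (fst X) * m (snd X))"
  "(\<integral> X. indicator (ball 0 \<tau>) (fst X) * m (snd X) \<partial>(lborel :: ('a \<times> real) measure)) = measure lborel (ball 0 \<tau> :: 'a set) * integral\<^sup>L lborel m"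
proof -
  have b: "integrable lborel (indicator (ball 0 \<tau> :: 'a set) :: 'a => real)"
    using emeasure_bounded_finite[OF bounded_ball, of "0 :: 'a" \<tau>] by (intro integrable_real_indicator) auto
  show i: "integrable lborel (\<lambda>X :: 'a \<times> real. indicator (ball 0 \<tau>) (fst X) * m (snd X))"
  proof (rule integrable_lborel_pairI)
    show "integrable lborel (\<lambda>z :: 'a. indicator (ball 0 \<tau>) (fst (z, y)) * m (snd (z, y)))" for y using b by simp
    have "(\<integral> z. \<bar>indicator (ball 0 \<tau>) (fst (z, y)) * m (snd (z, y))\<bar> \<partial>(lborel :: 'a measure)) = measure lborel (ball 0 \<tau> :: 'a set) * m y" for y
      using m_nonneg[of y] by (simp add: abs_mult)
    then show "integrable lborel (\<lambda>y. \<integral> z. \<bar>indicator (ball 0 \<tau>) (fst (z, y)) * m (snd (z, y))\<bar> \<partial>(lborel :: 'a measure))"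
      using m_int by simp
    show "(\<lambda>X :: 'a \<times> real. indicator (ball 0 \<tau>) (fst X) * m (snd X)) \<in> borel_measurable borel"
    proof (intro borel_measurable_times)
      show "(\<lambda>X :: 'a \<times> real. indicator (ball 0 \<tau>) (fst X) :: real) \<in> borel_measurable borel"
        by (rule measurable_compose[OF _ borel_measurable_indicator, of _ _ borel]) auto
      show "(\<lambda>X :: 'a \<times> real. m (snd X)) \<in> borel_measurable borel"
        by (rule measurable_compose[OF _ m_borel]) auto
    qed
  qed
  show "(\<integral> X. indicator (ball 0 \<tau>) (fst X) * m (snd X) \<partial>(lborel :: ('a \<times> real) measure)) = measure lborel (ball 0 \<tau> :: 'a set) * integral\<^sup>L lborel m"
    unfolding integral_lborel_pair(2)[OF i] by simp
qed

lemma bounded_times_weight_integrable: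
  fixes f :: "'a \<times> real => real"
  assumes f: "continuous_on UNIV f" and \<mu>: "AE y in lborel. m y = indicator {0<..<\<tau>} y * \<mu> y"
  shows "set_integrable lebesgue Om (\<lambda>X. f X * \<mu> (snd X))"
proof -
  have [measurable]: "f \<in> borel_measurable borel" by (rule borel_measurable_continuous_onI[OF f])
  have "bounded (f ` cball 0 (2 * \<tau>))"
    by (intro compact_imp_bounded compact_continuous_image continuous_on_subset[OF f]) auto
  then obtain C where "\<forall>r\<in>f ` cball 0 (2 * \<tau>). norm r \<le> C" unfolding bounded_iff by blast
  then have C: "\<bar>f X\<bar> \<le> C" if "X \<in> cball 0 (2 * \<tau>)" for X using that by simp
  have O: "X \<in> cball 0 (2 * \<tau>)" if "X \<in> Om" for X
    using that norm_Pair_le[of "fst X" "snd X"] by (auto simp: Om_def D_def)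
  have "integrable lborel (\<lambda>X. indicator Om X * (f X * m (snd X)))"
  proof (rule Bochner_Integration.integrable_bound)
    show "integrable lborel (\<lambda>X :: 'a \<times> real. C * (indicator (ball 0 \<tau>) (fst X) * m (snd X)))"
      by (intro integrable_mult_right weight_on_cylinder)
    have "\<bar>indicator Om X * (f X * m (snd X))\<bar> \<le> \<bar>C * (indicator (ball 0 \<tau>) (fst X) * m (snd X))\<bar>" for X
    proof (cases "X \<in> Om")
      case True
      then have "fst X \<in> ball 0 \<tau>" by (auto simp: Om_def D_def)
      moreover have "\<bar>f X\<bar> * m (snd X) \<le> \<bar>C\<bar> * m (snd X)"
        using C[OF O[OF True]] m_nonneg[of "snd X"] by (intro mult_right_mono) auto
      ultimately show ?thesis using True m_nonneg[of "snd X"] by (simp add: abs_mult)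
    qed simp
    then show "AE X in lborel. norm (indicator Om X * (f X * m (snd X))) \<le> norm (C * (indicator (ball 0 \<tau>) (fst X) * m (snd X)))"
      by simp
  qed measurable
  moreover have "AE X in lborel. indicator Om X * (f X * m (snd X)) = indicator Om X *\<^sub>R (f X * \<mu> (snd X))"
    using AE_lborel_snd[OF \<mu>] by eventually_elim (auto simp: indicator_def Om_def)
  ultimately show ?thesis
    unfolding set_integrable_def by (subst lebesgue_AE_transfer(2)) auto
qed

lemma tensor_W12_vanishing:
  fixes f :: "'a \<times> real => real"
  assumes f: "smooth f" and \<mu>: "AE y in lborel. m y = indicator {0<..<\<tau>} y * \<mu> y"
  shows "set_integrable lebesgue Om (\<lambda>X. (f X)\<^sup>2 * \<mu> (snd X))"
    and "set_integrable lebesgue Om (\<lambda>X. (norm (grad f X))\<^sup>2 * \<mu> (snd X))"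
  by (intro bounded_times_weight_integrable \<mu> continuous_intros grad_continuous smooth_continuous f)+

end

lemma AE_lborel_witness:
  assumes "AE y in lborel. P y" "0 < (\<tau>::real)"
  obtains y where "y \<in> {0<..<\<tau>}" "P y"
proof -
  have "\<exists>y\<in>{0<..<\<tau>}. P y"
  proof (rule ccontr)
    assume "\<not> ?thesis"
    with assms(1) have "AE y in lborel. y \<notin> {0<..<\<tau>}" by (auto elim!: eventually_mono)
    then have "{0<..<\<tau>} \<in> null_sets lborel" using AE_iff_null_sets[of "{0<..<\<tau>}" lborel] by simp
    then have "emeasure lborel {0<..<\<tau>} = 0" by (rule null_setsD1)
    then show False using assms(2) by simp
  qed
  then show ?thesis using that by blast
qed

text \<open>The ellipticity hypothesis holds for almost every height and the weight is positive almost everywhere, so for each vector some height allows the weight to be cancelled. The vertical unit vector gives \<open>\<Lambda> \<ge> 1\<close>.\<close>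

lemma ellipticity_of_block:
  fixes B :: "real^'n::finite^'n" and A :: "real => (real^'n) \<times> real => (real^'n) \<times> real"
  assumes \<tau>: "0 < \<tau>" and pos: "AE y in lborel. y \<in> {0<..<\<tau>} --> 0 < \<mu> y"
    and A: "\<And>y \<xi>. y \<in> {0<..<\<tau>} ==> A y \<xi> = \<mu> y *\<^sub>R block_mat B \<xi>"
    and sym: "\<And>y \<xi> \<eta>. y \<in> {0<..<\<tau>} ==> A y \<xi> \<bullet> \<eta> = \<xi> \<bullet> A y \<eta>"
    and ell: "\<And>\<xi>. AE y in lebesgue. 0 < y \<and> y < \<tau> -->
        inverse \<Lambda> * \<mu> y * (norm \<xi>)\<^sup>2 \<le> A y \<xi> \<bullet> \<xi> \<and> A y \<xi> \<bullet> \<xi> \<le> \<Lambda> * \<mu> y * (norm \<xi>)\<^sup>2"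
    and \<Lambda>: "0 < \<Lambda>"
  shows "1 \<le> \<Lambda>" and "inverse \<Lambda> * (norm x)\<^sup>2 \<le> (B *v x) \<bullet> x" and "(B *v x) \<bullet> x \<le> \<Lambda> * (norm x)\<^sup>2"
    and "(B *v x) \<bullet> z = x \<bullet> (B *v z)"
proof -
  have bd: "inverse \<Lambda> * (norm \<xi>)\<^sup>2 \<le> block_mat B \<xi> \<bullet> \<xi> \<and> block_mat B \<xi> \<bullet> \<xi> \<le> \<Lambda> * (norm \<xi>)\<^sup>2" for \<xi>
  proof -
    have "AE y in lborel. y \<in> {0<..<\<tau>} --> 0 < \<mu> y \<and> inverse \<Lambda> * \<mu> y * (norm \<xi>)\<^sup>2 \<le> A y \<xi> \<bullet> \<xi> \<and> A y \<xi> \<bullet> \<xi> \<le> \<Lambda> * \<mu> y * (norm \<xi>)\<^sup>2"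
      using pos ell[of \<xi>, unfolded AE_completion_iff] by eventually_elim auto
    from AE_lborel_witness[OF this \<tau>] obtain y where y: "y \<in> {0<..<\<tau>}" "0 < \<mu> y"
        "inverse \<Lambda> * \<mu> y * (norm \<xi>)\<^sup>2 \<le> A y \<xi> \<bullet> \<xi>" "A y \<xi> \<bullet> \<xi> \<le> \<Lambda> * \<mu> y * (norm \<xi>)\<^sup>2"
      by blast
    have "\<mu> y * (inverse \<Lambda> * (norm \<xi>)\<^sup>2) \<le> \<mu> y * (block_mat B \<xi> \<bullet> \<xi>)" "\<mu> y * (block_mat B \<xi> \<bullet> \<xi>) \<le> \<mu> y * (\<Lambda> * (norm \<xi>)\<^sup>2)"
      using y(3,4) unfolding A[OF y(1)] by (simp_all add: ac_simps)
    then show ?thesis using y(2) by (simp only: mult_le_cancel_left_pos)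
  qed
  show "1 \<le> \<Lambda>" using bd[of "(0, 1)"] \<Lambda> by (simp add: block_mat_def)
  show "inverse \<Lambda> * (norm x)\<^sup>2 \<le> (B *v x) \<bullet> x" "(B *v x) \<bullet> x \<le> \<Lambda> * (norm x)\<^sup>2"
    using bd[of "(x, 0)"] by (simp_all add: block_mat_def)
  obtain y where y: "y \<in> {0<..<\<tau>}" "y \<in> {0<..<\<tau>} --> 0 < \<mu> y" using AE_lborel_witness[OF pos \<tau>] by blast
  have "\<mu> y * ((B *v x) \<bullet> z) = \<mu> y * (x \<bullet> (B *v z))"
    using sym[OF y(1), of "(x, 0)" "(z, 0)"] unfolding A[OF y(1)] by (simp add: block_mat_def)
  then show "(B *v x) \<bullet> z = x \<bullet> (B *v z)" using y by simp
qed

section \<open>Weak solutions\<close>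

text \<open>Smooth products \<open>\<eta>(x) \<zeta>(y)\<close> approximate themselves in the Sobolev space, so they are test functions; Borel representatives of the gradient components then satisfy the requirements of the locale.\<close>

lemma weak_solution_mixed_solution:
  fixes l :: "'n::finite" and B :: "real^'n^'n" and v :: "(real^'n) \<times> real => real"
    and G :: "(real^'n) \<times> real => (real^'n) \<times> real"
  assumes m: "half_cylinder_weight (axis l 1 :: real^'n) \<tau> m" and \<mu>0: "\<And>y. 0 \<le> \<mu> y"
    and \<mu>: "AE y in lborel. m y = indicator {0<..<\<tau>} y * \<mu> y"
    and A: "\<And>y \<xi>. y \<in> {0<..<\<tau>} ==> A y \<xi> = \<mu> y *\<^sub>R block_mat B \<xi>"
    and \<Lambda>: "1 \<le> \<Lambda>" and B_lower: "\<And>x. inverse \<Lambda> * (norm x)\<^sup>2 \<le> (B *v x) \<bullet> x" and B_upper: "\<And>x. (B *v x) \<bullet> x \<le> \<Lambda> * (norm x)\<^sup>2"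
    and B_sym: "\<And>x z. (B *v x) \<bullet> z = x \<bullet> (B *v z)"
    and sol: "weak_solution l \<tau> \<mu> A v G"
  obtains v' h g \<phi> where "mixed_solution (axis l 1 :: real^'n) \<tau> m v' h g \<phi> ((*v) B) \<Lambda>"
    "AE X in lborel. X \<in> half_cyl l \<tau> --> G X = (g X, h X)"
proof -
  interpret half_cylinder_weight "axis l 1 :: real^'n" \<tau> m by (rule m)
  have Om_eq: "half_cyl l \<tau> = Om" by (auto simp: half_cyl_def half_ball_inner Om_def D_def)
  have van: "W12_vanishing Om \<mu> (flat_part l \<tau> \<times> {0<..<\<tau>}) v G"
    and eq: "\<And>\<psi> H. W12_vanishing Om \<mu> (frontier (half_ball l \<tau>) \<times> {0<..<\<tau>} \<union> half_ball l \<tau> \<times> {\<tau>}) \<psi> H ==>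
        (LINT X:Om|lebesgue. A (snd X) (G X) \<bullet> H X) = 0"
    using sol unfolding weak_solution_def Om_eq by blast+
  have wg: "weak_gradient Om v G" and sv: "set_integrable lebesgue Om (\<lambda>X. (v X)\<^sup>2 * \<mu> (snd X))"
    and sG: "set_integrable lebesgue Om (\<lambda>X. (norm (G X))\<^sup>2 * \<mu> (snd X))"
    using van by (simp_all add: W12_vanishing_def W12_def)
  have op: "open Om" using half_cyl_open[of l \<tau>] by (simp add: Om_eq)
  have mv: "(\<lambda>X. indicator Om X *\<^sub>R v X) \<in> borel_measurable lebesgue" and mG: "(\<lambda>X. indicator Om X *\<^sub>R G X) \<in> borel_measurable lebesgue"
    using wg locally_integrable_measurable[OF op] unfolding weak_gradient_def by blast+
  have M: "AE X in lborel. X \<in> Om --> m (snd X) = \<mu> (snd (X :: (real^'n) \<times> real))"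
    using AE_lborel_snd[OF \<mu>] by eventually_elim (auto simp: Om_def)
  have fin: "(\<integral>\<^sup>+ X\<in>Om. ennreal ((F X)\<^sup>2 * m (snd X)) \<partial>lborel) < \<infinity>"
    if q: "set_integrable lebesgue Om (\<lambda>X. q X * \<mu> (snd X))" and le: "\<And>X. (F X)\<^sup>2 \<le> q X" for F q :: "(real^'n) \<times> real => real"
  proof -
    have "(\<integral>\<^sup>+ X\<in>Om. ennreal ((F X)\<^sup>2 * m (snd X)) \<partial>lborel) \<le> (\<integral>\<^sup>+ X. ennreal (norm (indicator Om X *\<^sub>R (q X * \<mu> (snd X)))) \<partial>lborel)"
    proof (rule nn_integral_mono_AE, use M in eventually_elim)
      case (elim X)
      have "(F X)\<^sup>2 * \<mu> (snd X) \<le> q X * \<mu> (snd X)" using le \<mu>0 by (rule mult_right_mono)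
      then have "(F X)\<^sup>2 * \<mu> (snd X) \<le> \<bar>q X * \<mu> (snd X)\<bar>" by linarith
      then show ?case using elim by (cases "X \<in> Om") (simp_all add: ennreal_leI)
    qed
    also have "\<dots> = (\<integral>\<^sup>+ X. ennreal (norm (indicator Om X *\<^sub>R (q X * \<mu> (snd X)))) \<partial>lebesgue)" by (simp only: nn_integral_completion)
    also have "\<dots> < \<infinity>" using q unfolding set_integrable_def integrable_iff_bounded by blast
    finally show ?thesis .
  qed
  have mGi: "(\<lambda>X. indicator Om X * (G X \<bullet> b)) \<in> borel_measurable lebesgue" for b
    using borel_measurable_inner[OF mG borel_measurable_const[of b]] by simp
  have Gsq: "(G X \<bullet> b)\<^sup>2 \<le> (norm (G X))\<^sup>2" if "b \<in> Basis" for b X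
    using Basis_le_norm[OF that, of "G X"] by (metis abs_ge_zero power2_abs power_mono)
  have "\<exists>F'. wL2 F' \<and> (AE X in lborel. X \<in> Om --> F' X = G X \<bullet> b)" if "b \<in> Basis" for b
    using wL2_representative[OF mGi fin[OF sG Gsq[OF that]]] by blast
  note rep = this
  define \<Gamma> where "\<Gamma> b = (SOME F'. wL2 F' \<and> (AE X in lborel. X \<in> Om --> F' X = G X \<bullet> b))" for b
  have \<Gamma>: "wL2 (\<Gamma> b)" "AE X in lborel. X \<in> Om --> \<Gamma> b X = G X \<bullet> b" if "b \<in> Basis" for b
    using someI_ex[OF rep[OF that]] unfolding \<Gamma>_def by blast+
  have b: "(i, 0) \<in> (Basis :: ((real^'n) \<times> real) set)" if "i \<in> Basis" for i :: "real^'n" using that by (simp add: Basis_prod_def)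
  have b1: "(0, 1) \<in> (Basis :: ((real^'n) \<times> real) set)" by (simp add: Basis_prod_def)
  obtain v' where v': "wL2 v'" "AE X in lborel. X \<in> Om --> v' X = v X"
    using wL2_representative[of v] mv fin[OF sv order_refl] by auto
  define h where "h = \<Gamma> (0, 1)"
  define g :: "(real^'n) \<times> real => real^'n" where "g X = (\<Sum>i\<in>Basis. \<Gamma> (i, 0) X *\<^sub>R i)" for X
  have gi: "g X \<bullet> i = \<Gamma> (i, 0) X" if "i \<in> Basis" for i X
    using that by (simp add: g_def inner_sum_left inner_Basis if_distrib sum.If_cases cong: if_cong)
  have gG: "AE X in lborel. X \<in> Om --> G X = (g X, h X)"
  proof -
    have "AE X in lborel. \<forall>b\<in>Basis. X \<in> Om --> \<Gamma> b X = G X \<bullet> b"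
      by (intro AE_finite_allI finite_Basis \<Gamma>(2))
    then show ?thesis
    proof eventually_elim
      case (elim X)
      show ?case
      proof
        assume X: "X \<in> Om"
        have "fst (G X) = g X"
        proof (rule euclidean_eqI)
          fix i :: "real^'n" assume i: "i \<in> Basis"
          show "fst (G X) \<bullet> i = g X \<bullet> i" using elim X b[OF i] gi[OF i] by (simp add: inner_prod_def)
        qed
        moreover have "snd (G X) = h X" using elim X b1 by (simp add: h_def inner_prod_def)
        ultimately show "G X = (g X, h X)" by (simp add: prod_eq_iff)
      qed
    qed
  qed
  define S :: "((real^'n) \<times> real) set" where "S = flat_part l \<tau> \<times> {0<..<\<tau>}"
  define err where "err \<phi> = (\<integral>\<^sup>+ X \<in> Om. ennreal (((v X - \<phi> X)\<^sup>2 + (norm (G X - grad \<phi> X))\<^sup>2) * \<mu> (snd X)) \<partial>lebesgue)" for \<phi>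
  have appr: "\<exists>\<phi>. smooth \<phi> \<and> (\<forall>X\<in>S. \<phi> X = 0) \<and> err \<phi> < ennreal (1 / real (Suc j))" for j
    using van unfolding W12_vanishing_def S_def err_def by simp
  define \<phi> where "\<phi> j = (SOME \<phi>. smooth \<phi> \<and> (\<forall>X\<in>S. \<phi> X = 0) \<and> err \<phi> < ennreal (1 / real (Suc j)))" for j
  have \<phi>: "smooth (\<phi> j)" "\<And>X. X \<in> S ==> \<phi> j X = 0" "err (\<phi> j) < ennreal (1 / real (Suc j))" for j
    using someI_ex[OF appr[of j]] unfolding \<phi>_def by blast+
  have conv: "(\<lambda>j. \<integral>\<^sup>+ X\<in>Om. ennreal ((F X - p j X)\<^sup>2 * m (snd X)) \<partial>lborel) \<longlonglongrightarrow> 0"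
    if le: "\<And>j. AE X in lborel. X \<in> Om --> (F X - p j X)\<^sup>2 \<le> (v X - \<phi> j X)\<^sup>2 + (norm (G X - grad (\<phi> j) X))\<^sup>2" for F p
  proof (rule tendsto_sandwich[of "\<lambda>_. 0" _ _ "\<lambda>j. ennreal (1 / real (Suc j))"])
    have "(\<integral>\<^sup>+ X\<in>Om. ennreal ((F X - p j X)\<^sup>2 * m (snd X)) \<partial>lborel) \<le> ennreal (1 / real (Suc j))" for j
    proof -
      have "(\<integral>\<^sup>+ X\<in>Om. ennreal ((F X - p j X)\<^sup>2 * m (snd X)) \<partial>lborel) \<le> err (\<phi> j)"
        unfolding err_def nn_integral_completion
      proof (rule nn_integral_mono_AE, use M le[of j] in eventually_elim)
        case (elim X)
        show ?case
        proof (cases "X \<in> Om")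
          case True
          then have "(F X - p j X)\<^sup>2 * \<mu> (snd X) \<le> ((v X - \<phi> j X)\<^sup>2 + (norm (G X - grad (\<phi> j) X))\<^sup>2) * \<mu> (snd X)"
            using elim \<mu>0 by (intro mult_right_mono) auto
          then show ?thesis using True elim by (simp add: ennreal_leI)
        qed simp
      qed
      then show ?thesis using \<phi>(3)[of j] by simp
    qed
    then show "\<forall>\<^sub>F j in sequentially. (\<integral>\<^sup>+ X\<in>Om. ennreal ((F X - p j X)\<^sup>2 * m (snd X)) \<partial>lborel) \<le> ennreal (1 / real (Suc j))"
      by (intro always_eventually allI)
    have "(\<lambda>j. ennreal (1 / real (Suc j))) \<longlonglongrightarrow> ennreal 0"
      using LIMSEQ_Suc[OF lim_1_over_n] by (intro tendsto_ennrealI)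
    then show "(\<lambda>j. ennreal (1 / real (Suc j))) \<longlonglongrightarrow> 0" by simp
  qed simp_all
  have comp: "(G X \<bullet> b - grad (\<phi> j) X \<bullet> b)\<^sup>2 \<le> (norm (G X - grad (\<phi> j) X))\<^sup>2" if "b \<in> Basis" for b j X
    using Basis_le_norm[OF that, of "G X - grad (\<phi> j) X"] abs_le_square_iff[of "(G X - grad (\<phi> j) X) \<bullet> b" "norm (G X - grad (\<phi> j) X)"]
    by (simp add: inner_diff_left)
  have convb: "(\<lambda>j. \<integral>\<^sup>+ X\<in>Om. ennreal ((\<Gamma> b X - pd b (\<phi> j) X)\<^sup>2 * m (snd X)) \<partial>lborel) \<longlonglongrightarrow> 0" if b: "b \<in> Basis" for b
  proof (rule conv)
    fix j
    show "AE X in lborel. X \<in> Om --> (\<Gamma> b X - pd b (\<phi> j) X)\<^sup>2 \<le> (v X - \<phi> j X)\<^sup>2 + (norm (G X - grad (\<phi> j) X))\<^sup>2"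
      using \<Gamma>(2)[OF b]
    proof eventually_elim
      case (elim X)
      then show ?case using comp[OF b, of X j] grad_inner[OF b, of "\<phi> j" X] by (auto intro: add_increasing)
    qed
  qed
  have "mixed_solution (axis l 1 :: real^'n) \<tau> m v' h g \<phi> ((*v) B) \<Lambda>"
  proof (rule mixed_solution.intro[OF m mixed_solution_axioms.intro])
    show "linear ((*v) B)" by (rule matrix_vector_mul_linear)
    show "(B *v a) \<bullet> b = a \<bullet> (B *v b)" for a b by (rule B_sym)
    show "1 \<le> \<Lambda>" by (rule \<Lambda>)
    show "inverse \<Lambda> * (norm \<xi>)\<^sup>2 \<le> (B *v \<xi>) \<bullet> \<xi>" "(B *v \<xi>) \<bullet> \<xi> \<le> \<Lambda> * (norm \<xi>)\<^sup>2" for \<xi> by (rule B_lower B_upper)+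
    show "wL2 v'" by (rule v'(1))
    show "wL2 h" unfolding h_def by (rule \<Gamma>(1)[OF b1])
    show "wL2 (\<lambda>X. g X \<bullet> i)" if "i \<in> Basis" for i using \<Gamma>(1)[OF b[OF that]] gi[OF that] by simp
    show "smooth (\<phi> j)" for j by (rule \<phi>(1))
    show "\<phi> j (z, y) = 0" if "norm z < \<tau>" "z \<bullet> axis l 1 = 0" "y \<in> {0<..<\<tau>}" for j z y
      by (rule \<phi>(2)) (use that in \<open>auto simp: S_def flat_part_def inner_axis dist_norm\<close>)
    show "(\<lambda>j. \<integral>\<^sup>+ X\<in>Om. ennreal ((v' X - \<phi> j X)\<^sup>2 * m (snd X)) \<partial>lborel) \<longlonglongrightarrow> 0"
    proof (rule conv)
      show "AE X in lborel. X \<in> Om --> (v' X - \<phi> j X)\<^sup>2 \<le> (v X - \<phi> j X)\<^sup>2 + (norm (G X - grad (\<phi> j) X))\<^sup>2" for j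
        using v'(2) by eventually_elim auto
    qed
    show "(\<lambda>j. \<integral>\<^sup>+ X\<in>Om. ennreal ((g X \<bullet> i - pd (i, 0) (\<phi> j) X)\<^sup>2 * m (snd X)) \<partial>lborel) \<longlonglongrightarrow> 0" if "i \<in> Basis" for i
      using convb[OF b[OF that]] unfolding gi[OF that] .
    show "(\<lambda>j. \<integral>\<^sup>+ X\<in>Om. ennreal ((h X - pd (0, 1) (\<phi> j) X)\<^sup>2 * m (snd X)) \<partial>lborel) \<longlonglongrightarrow> 0"
      using convb[OF b1] unfolding h_def .
    fix \<eta> :: "real^'n => real" and \<zeta> \<zeta>' :: "real => real"
    assume \<eta>: "smooth \<eta>" "\<And>z. z \<bullet> axis l 1 = 0 ==> \<eta> z = 0" "\<And>z. 0 \<le> z \<bullet> axis l 1 ==> \<tau> \<le> norm z ==> \<eta> z = 0"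
      and \<zeta>: "real_polynomial_function \<zeta>" "\<And>t. (\<zeta> has_real_derivative \<zeta>' t) (at t)" "\<zeta> \<tau> = 0"
    define \<psi> where "\<psi> X = \<eta> (fst X) * \<zeta> (snd X)" for X :: "(real^'n) \<times> real"
    have \<psi>: "smooth \<psi>" unfolding \<psi>_def[abs_def] by (rule tensor_smooth[OF \<eta>(1) \<zeta>(1,2)])
    have \<psi>d: "fst (grad \<psi> X) \<bullet> i = pd i \<eta> (fst X) * \<zeta> (snd X)" if "i \<in> Basis" for i X
      using grad_pair(1)[OF that, of \<psi> X] tensor_smooth(2)[OF \<eta>(1) \<zeta>(1,2) that] unfolding \<psi>_def[abs_def] by simp
    have \<psi>s: "snd (grad \<psi> X) = \<eta> (fst X) * \<zeta>' (snd X)" for X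
      using grad_pair(2)[of \<psi> X] tensor_smooth(3)[OF \<eta>(1) \<zeta>(1,2)] unfolding \<psi>_def[abs_def] by simp
    have "W12 Om \<mu> \<psi> (grad \<psi>)"
      unfolding W12_def using weak_gradient_smooth[OF \<psi>] tensor_W12_vanishing[OF \<psi> \<mu>] by blast
    moreover have "\<forall>X\<in>frontier (half_ball l \<tau>) \<times> {0<..<\<tau>} \<union> half_ball l \<tau> \<times> {\<tau>}. \<psi> X = 0"
      using frontier_half_ball[of _ l \<tau>] \<eta>(2,3) \<zeta>(3) by (fastforce simp: \<psi>_def)
    ultimately have "W12_vanishing Om \<mu> (frontier (half_ball l \<tau>) \<times> {0<..<\<tau>} \<union> half_ball l \<tau> \<times> {\<tau>}) \<psi> (grad \<psi>)"
      unfolding W12_vanishing_def using \<psi> by (intro conjI allI impI exI[of _ \<psi>]) auto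
    then have 0: "(LINT X:Om|lebesgue. A (snd X) (G X) \<bullet> grad \<psi> X) = 0" by (rule eq)
    define f where "f X = m (snd X) * ((\<Sum>i\<in>Basis. ((B *v g X) \<bullet> i) * pd i \<eta> (fst X)) * \<zeta> (snd X) + h X * \<eta> (fst X) * \<zeta>' (snd X))" for X
    have f: "f \<in> borel_measurable borel"
    proof -
      note [measurable] = smooth_borel[OF \<eta>(1)] smooth_borel[OF real_polynomial_function_smooth[OF \<zeta>(1)]]
      have [measurable]: "\<zeta>' \<in> borel_measurable borel"
        unfolding tensor_smooth(4)[OF \<eta>(1) \<zeta>(1,2)] by (intro smooth_borel smooth_pd real_polynomial_function_smooth \<zeta>(1)) simp
      have [measurable]: "h \<in> borel_measurable borel" unfolding h_def by (rule wL2_borel[OF \<Gamma>(1)[OF b1]])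
      have g: "g \<in> borel_measurable borel"
        unfolding borel_measurable_euclidean_space[of g] using gi wL2_borel[OF \<Gamma>(1)[OF b]] by simp
      have [measurable]: "(\<lambda>X. (B *v g X) \<bullet> i) \<in> borel_measurable borel" for i
      proof -
        have "continuous_on UNIV (\<lambda>x :: real^'n. (B *v x) \<bullet> i)"
          by (intro continuous_intros matrix_vector_mult_linear_continuous_on)
        then show ?thesis using measurable_compose[OF g borel_measurable_continuous_onI] by blast
      qed
      have [measurable]: "pd i \<eta> \<in> borel_measurable borel" if "i \<in> Basis" for i by (intro smooth_borel smooth_pd \<eta>(1) that)
      have "(\<lambda>X. \<Sum>i\<in>Basis. ((B *v g X) \<bullet> i) * pd i \<eta> (fst X)) \<in> borel_measurable borel"
        by (intro borel_measurable_sum) measurable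
      then show ?thesis unfolding f_def[abs_def] by measurable
    qed
    have "AE X in lborel. f X = indicator Om X *\<^sub>R (A (snd X) (G X) \<bullet> grad \<psi> X)"
      using gG M
    proof eventually_elim
      case (elim X)
      show ?case
      proof (cases "X \<in> Om")
        case True
        then have y: "snd X \<in> {0<..<\<tau>}" by (auto simp: Om_def)
        have "(B *v g X) \<bullet> fst (grad \<psi> X) = (\<Sum>i\<in>Basis. ((B *v g X) \<bullet> i) * (fst (grad \<psi> X) \<bullet> i))" by (rule euclidean_inner)
        also have "\<dots> = (\<Sum>i\<in>Basis. ((B *v g X) \<bullet> i) * pd i \<eta> (fst X)) * \<zeta> (snd X)"
          unfolding sum_distrib_right by (intro sum.cong refl) (simp add: \<psi>d)
        finally show ?thesis
          using True elim unfolding A[OF y] by (simp add: f_def block_mat_def inner_prod_def \<psi>s distrib_left)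
      next
        case False
        have "g X = 0"
        proof (rule euclidean_eqI)
          fix i :: "real^'n" assume i: "i \<in> Basis"
          show "g X \<bullet> i = 0 \<bullet> i" using wL2_off[OF \<Gamma>(1)[OF b[OF i]] False] gi[OF i, of X] by simp
        qed
        moreover have "h X = 0" unfolding h_def by (rule wL2_off[OF \<Gamma>(1)[OF b1] False])
        ultimately show ?thesis using False by (simp add: f_def)
      qed
    qed
    from lebesgue_AE_transfer(3)[OF f this]
    have "integral\<^sup>L lborel f = 0" using 0 unfolding set_lebesgue_integral_def by simp
    then show "(LBINT X. m (snd X) * ((\<Sum>i\<in>Basis. ((B *v g X) \<bullet> i) * pd i \<eta> (fst X)) * \<zeta> (snd X) + h X * \<eta> (fst X) * \<zeta>' (snd X))) = 0"
      unfolding f_def .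
  qed
  then show ?thesis using that gG unfolding Om_eq by blast
qed

section \<open>The interior estimate for weak solutions\<close>

text \<open>The three factors come from the interior estimate, from the comparison of \<open>\<integral> 1 / m\<close> with the mass of the cylinder by the Muckenhoupt condition, and from adding the \<open>n\<close> horizontal components and the vertical one.\<close>

definition grad_const :: "nat => nat => real => real => real => real => real" where
  "grad_const n W \<Lambda> \<theta> C0 \<kappa> = \<bar>sup_const n W \<Lambda> \<theta>\<bar> * sqrt (\<kappa> * unit_ball_vol (real n)) * (real n + (real n)\<^sup>2 * \<Lambda> * C0)"

text \<open>The powers of \<open>\<tau>\<close> cancel: the square of the gradient bound carries the factor \<open>\<integral> (1 / m) / \<tau> ^ (n + 2)\<close>, and the Muckenhoupt condition bounds \<open>\<integral> (1 / m)\<close> by a multiple of \<open>\<tau>\<^sup>2 / \<integral> m\<close>, which leaves the reciprocal of the mass of the cylinder.\<close>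

lemma weak_solution_gradient_bound:
  fixes l :: "'n::finite" and B :: "real^'n^'n" and v :: "(real^'n) \<times> real => real"
    and G :: "(real^'n) \<times> real => (real^'n) \<times> real"
  assumes \<Lambda>: "\<Lambda> > 0" and C0: "C0 > 0" and \<theta>: "0 < \<theta>" "\<theta> < 1" and \<tau>: "0 < \<tau>" and w: "A2_weight \<mu>"
    and grow0: "AE y in lebesgue. 0 < y \<and> y < 1 --> (LINT s:{0..\<tau> * y}|lebesgue. \<mu> s) \<le> C0 * \<tau> * \<mu> (y * \<tau>)"
    and A: "\<And>y \<xi>. y \<in> {0<..<\<tau>} ==> A y \<xi> = \<mu> y *\<^sub>R block_mat B \<xi>"
    and sym: "\<And>y \<xi> \<eta>. y \<in> {0<..<\<tau>} ==> A y \<xi> \<bullet> \<eta> = \<xi> \<bullet> A y \<eta>"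
    and ell: "\<And>\<xi>. AE y in lebesgue. 0 < y \<and> y < \<tau> -->
        inverse \<Lambda> * \<mu> y * (norm \<xi>)\<^sup>2 \<le> A y \<xi> \<bullet> \<xi> \<and> A y \<xi> \<bullet> \<xi> \<le> \<Lambda> * \<mu> y * (norm \<xi>)\<^sup>2"
    and sol: "weak_solution l \<tau> \<mu> A v G"
  defines "E \<equiv> (LINT X:half_cyl l \<tau>|lebesgue. (norm (G X))\<^sup>2 * \<mu> (snd X))"
  shows "Linf_norm (half_cyl l (\<theta> * \<tau>)) G \<le>
    ereal (grad_const CARD('n) (card (words CARD('n) :: (real^'n) list set)) \<Lambda> \<theta> C0 (enn2real (A2_const \<mu>)) *
      sqrt (1 / mu_hat \<mu> (cyl \<tau> :: ((real^'n) \<times> real) set) * E))"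
proof -
  define e where "e = (axis l 1 :: real^'n)"
  have e: "e \<in> Basis" by (simp add: e_def axis_in_Basis_iff)
  have \<mu>0: "0 \<le> \<mu> y" for y using w by (simp add: A2_weight_def)
  obtain m where m: "half_cylinder_weight e \<tau> m" and \<mu>: "AE y in lborel. m y = indicator {0<..<\<tau>} y * \<mu> y"
    and I: "0 < integral\<^sup>L lborel m" and IJ: "integral\<^sup>L lborel m * (LBINT y. inverse (m y)) \<le> enn2real (A2_const \<mu>) * \<tau>\<^sup>2"
    using A2_weight_representative[OF w \<tau> e] by metis
  interpret half_cylinder_weight e \<tau> m by (rule m)
  have pos: "AE y in lborel. y \<in> {0<..<\<tau>} --> 0 < \<mu> y"
    using A2_weight_facts(2)[OF w \<tau>] by eventually_elim auto
  note el = ellipticity_of_block[OF \<tau> pos A sym ell \<Lambda>]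
  obtain v' h g \<phi> where mx: "mixed_solution e \<tau> m v' h g \<phi> ((*v) B) \<Lambda>"
    and G: "AE X in lborel. X \<in> half_cyl l \<tau> --> G X = (g X, h X)"
    using weak_solution_mixed_solution[OF m[unfolded e_def] \<mu>0 \<mu> A el sol] unfolding e_def[symmetric] by blast
  interpret mixed_solution e \<tau> m v' h g \<phi> "(*v) B" \<Lambda> by (rule mx)
  have Om_eq: "half_cyl l \<tau> = Om" 
    unfolding half_cyl_def half_ball_inner Om_def D_def unfolding e_def by auto
  have op: "open Om" using half_cyl_open[of l \<tau>] by (simp add: Om_eq)
  have M: "AE X in lborel. X \<in> Om --> m (snd X) = \<mu> (snd (X :: (real^'n) \<times> real))"
    using AE_lborel_snd[OF \<mu>] by eventually_elim (auto simp: Om_def)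
  have "1 / \<tau> \<noteq> 0" using \<tau> by simp
  from AE_lborel_scale[OF grow0[unfolded AE_completion_iff] this]
  have scaled: "AE y in lborel. 0 < y \<and> y < \<tau> --> (LINT s:{0..y}|lebesgue. \<mu> s) \<le> C0 * \<tau> * \<mu> y"
  proof eventually_elim
    case (elim y)
    have "0 < 1 / \<tau> * y \<and> 1 / \<tau> * y < 1" if "0 < y \<and> y < \<tau>" using that \<tau> by simp
    moreover have "\<tau> * (1 / \<tau> * y) = y" "1 / \<tau> * y * \<tau> = y" using \<tau> by simp_all
    ultimately show ?case using elim by simp
  qed
  have grow: "AE y in lborel. y \<in> {0<..<\<tau>} --> (LBINT s. indicator {..y} s * m s) \<le> C0 * \<tau> * m y"
    using scaled \<mu>
  proof eventually_elim
    case (elim y)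
    show ?case
    proof
      assume "y \<in> {0<..<\<tau>}"
      then have y: "0 < y" "y < \<tau>" by auto
      have "(LBINT s. indicator {..y} s * m s) = (LINT s:{0..y}|lebesgue. \<mu> s)"
        unfolding set_lebesgue_integral_def
      proof (rule lebesgue_AE_transfer(3)[symmetric])
        show "AE s in lborel. indicator {..y} s * m s = indicator {0..y} s *\<^sub>R \<mu> s"
          using \<mu> AE_lborel_singleton[of 0] by eventually_elim (use y in \<open>auto simp: indicator_def\<close>)
      qed measurable
      then show "(LBINT s. indicator {..y} s * m s) \<le> C0 * \<tau> * m y" using elim y by simp
    qed
  qed
  define n where "n = DIM(real^'n)"
  have n: "n = CARD('n)" by (simp add: n_def)
  define sc where "sc = sup_const n (card (words n :: (real^'n) list set)) \<Lambda> \<theta>"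
  define J where "J = (LBINT y. inverse (m y))"
  define M1 where "M1 = sc * sqrt (g_energy * J / \<tau> ^ n)"
  define \<kappa> where "\<kappa> = enn2real (A2_const \<mu>)"
  define mu where "mu = mu_hat \<mu> (cyl \<tau> :: ((real^'n) \<times> real) set)"
  have bound: "AE X in lborel. norm (fst X) < \<theta> * \<tau> \<and> 0 < fst X \<bullet> e \<and> 0 < snd X \<and> snd X < \<theta> * \<tau> -->
    (\<forall>i\<in>Basis. \<bar>g X \<bullet> i\<bar> \<le> M1 / \<tau>) \<and> \<bar>h X\<bar> \<le> (real n)\<^sup>2 * \<Lambda> * (M1 / \<tau>\<^sup>2) * C0 * \<tau>"
    unfolding M1_def sc_def J_def n_def by (rule gradient_sup_bound[OF \<theta> less_imp_le[OF C0] grow])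
  have mu: "mu = unit_ball_vol (real n) * \<tau> ^ n * integral\<^sup>L lborel m"
  proof -
    have "mu = (\<integral> X. indicator (ball 0 \<tau>) (fst X) * m (snd X) \<partial>(lborel :: ((real^'n) \<times> real) measure))"
      unfolding mu_def mu_hat_def set_lebesgue_integral_def
    proof (rule lebesgue_AE_transfer(3))
      show "(\<lambda>X :: (real^'n) \<times> real. indicator (ball 0 \<tau>) (fst X) * m (snd X)) \<in> borel_measurable borel"
        using borel_measurable_integrable[OF weight_on_cylinder(1)] by simp
      show "AE X in lborel. indicator (ball 0 \<tau>) (fst X) * m (snd X) = indicator (cyl \<tau>) X *\<^sub>R \<mu> (snd (X :: (real^'n) \<times> real))"
        using AE_lborel_snd[OF \<mu>] by eventually_elim (auto simp: cyl_def indicator_def)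
    qed
    also have "\<dots> = measure lborel (ball 0 \<tau> :: (real^'n) set) * integral\<^sup>L lborel m" by (rule weight_on_cylinder(2))
    finally show ?thesis using content_ball[of \<tau> "0 :: real^'n"] \<tau> by (simp add: n_def)
  qed
  have mu0: "0 < mu" using I \<tau> by (simp add: mu)
  have E: "g_energy \<le> E"
  proof -
    define f where "f X = (\<Sum>i\<in>Basis. (g X \<bullet> i)\<^sup>2 * m (snd X)) + (h X)\<^sup>2 * m (snd X)" for X
    have i: "integrable lborel (\<lambda>X. \<Sum>i\<in>Basis. (g X \<bullet> i)\<^sup>2 * m (snd X))" "integrable lborel (\<lambda>X. (h X)\<^sup>2 * m (snd X))"
      by (intro Bochner_Integration.integrable_sum wL2_square g_L2 h_L2; assumption)+
    have fi: "integrable lborel f" unfolding f_def[abs_def] by (intro Bochner_Integration.integrable_add i)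
    have "AE X in lborel. f X = indicator Om X *\<^sub>R ((norm (G X))\<^sup>2 * \<mu> (snd X))"
      using G M
    proof eventually_elim
      case (elim X)
      show ?case
      proof (cases "X \<in> Om")
        case True
        have "(norm (g X))\<^sup>2 = g X \<bullet> g X" by (rule power2_norm_eq_inner)
        also have "\<dots> = (\<Sum>i\<in>Basis. (g X \<bullet> i)\<^sup>2)"
          by (simp only: euclidean_inner[of "g X" "g X"] power2_eq_square)
        finally have "(norm (g X))\<^sup>2 = (\<Sum>i\<in>Basis. (g X \<bullet> i)\<^sup>2)" .
        moreover have "(norm (G X))\<^sup>2 = (norm (g X))\<^sup>2 + (h X)\<^sup>2"
          using elim True unfolding Om_eq by (simp add: norm_Pair)
        ultimately show ?thesis using elim True by (simp add: f_def sum_distrib_right distrib_right)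
      next
        case False
        have "g X \<bullet> i = 0" if "i \<in> Basis" for i using wL2_off[OF g_L2[OF that] False] .
        then show ?thesis using wL2_off[OF h_L2 False] False by (simp add: f_def)
      qed
    qed
    then have "E = integral\<^sup>L lborel f"
      unfolding E_def set_lebesgue_integral_def Om_eq using borel_measurable_integrable[OF fi] by (intro lebesgue_AE_transfer(3)) auto
    also have "\<dots> = g_energy + energy h"
      unfolding f_def g_energy_def energy_def using i by (subst Bochner_Integration.integral_add) (auto simp: wL2_square[OF g_L2])
    finally have "E = g_energy + energy h" .
    moreover have "0 \<le> energy h" unfolding energy_def using m_nonneg by simp
    ultimately show ?thesis by simp
  qed
  have J0: "0 \<le> J" using m_nonneg by (simp add: J_def)
  have J: "J \<le> \<kappa> * \<tau>\<^sup>2 / integral\<^sup>L lborel m" using IJ I by (simp add: pos_le_divide_eq mult.commute J_def \<kappa>_def)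
  define R where "R = \<bar>sc\<bar> * sqrt (\<kappa> * unit_ball_vol (real n)) * sqrt (1 / mu * E)"
  have V: "unit_ball_vol (real n) \<noteq> 0" using unit_ball_vol_pos[of "real n"] by linarith
  have MR: "M1 / \<tau> \<le> R"
  proof -
    have "g_energy * J / \<tau> ^ n \<le> E * (\<kappa> * \<tau>\<^sup>2 / integral\<^sup>L lborel m) / \<tau> ^ n"
      using E J J0 g_energy_nonneg \<tau> by (intro divide_right_mono mult_mono) auto
    also have "\<dots> = \<tau>\<^sup>2 * ((\<kappa> * unit_ball_vol (real n)) * (1 / mu * E))"
      unfolding mu using \<tau> I V by (simp add: field_simps)
    finally have "sqrt (g_energy * J / \<tau> ^ n) \<le> sqrt (\<tau>\<^sup>2 * ((\<kappa> * unit_ball_vol (real n)) * (1 / mu * E)))"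
      by (rule real_sqrt_le_mono)
    also have "\<dots> = \<tau> * (sqrt (\<kappa> * unit_ball_vol (real n)) * sqrt (1 / mu * E))"
      using \<tau> by (simp only: real_sqrt_mult real_sqrt_abs abs_of_pos)
    finally have le: "sqrt (g_energy * J / \<tau> ^ n) \<le> \<tau> * (sqrt (\<kappa> * unit_ball_vol (real n)) * sqrt (1 / mu * E))" .
    have "M1 \<le> \<bar>sc\<bar> * sqrt (g_energy * J / \<tau> ^ n)"
      unfolding M1_def using g_energy_nonneg J0 \<tau> by (intro mult_right_mono) auto
    also have "\<dots> \<le> \<bar>sc\<bar> * (\<tau> * (sqrt (\<kappa> * unit_ball_vol (real n)) * sqrt (1 / mu * E)))"
      by (intro mult_left_mono le) simp
    also have "\<dots> = R * \<tau>" by (simp add: R_def)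
    finally show ?thesis using \<tau> by (simp add: pos_divide_le_eq)
  qed
  have final: "AE X in lborel. X \<in> half_cyl l (\<theta> * \<tau>) --> norm (G X) \<le> (real n + (real n)\<^sup>2 * \<Lambda> * C0) * R"
    using bound G
  proof eventually_elim
    case (elim X)
    show ?case
    proof
      assume X: "X \<in> half_cyl l (\<theta> * \<tau>)"
      have "\<theta> * \<tau> < \<tau>" using \<theta> \<tau> by simp
      then have "X \<in> half_cyl l \<tau>" and X': "norm (fst X) < \<theta> * \<tau> \<and> 0 < fst X \<bullet> e \<and> 0 < snd X \<and> snd X < \<theta> * \<tau>"
        using X by (auto simp: half_cyl_def half_ball_inner e_def)
      then have GX: "G X = (g X, h X)" and b: "\<And>i. i \<in> Basis ==> \<bar>g X \<bullet> i\<bar> \<le> M1 / \<tau>"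
        "\<bar>h X\<bar> \<le> (real n)\<^sup>2 * \<Lambda> * (M1 / \<tau>\<^sup>2) * C0 * \<tau>"
        using elim by auto
      have "norm (g X) \<le> (\<Sum>i\<in>Basis. \<bar>g X \<bullet> i\<bar>)" by (rule norm_le_l1)
      also have "\<dots> \<le> real n * (M1 / \<tau>)" unfolding n_def by (rule sum_bounded_above[OF b(1)])
      finally have g: "norm (g X) \<le> real n * (M1 / \<tau>)" .
      have h: "\<bar>h X\<bar> \<le> (real n)\<^sup>2 * \<Lambda> * C0 * (M1 / \<tau>)"
        using b(2) \<tau> by (simp add: power2_eq_square[of \<tau>] field_simps)
      have "norm (G X) \<le> norm (g X) + \<bar>h X\<bar>" unfolding GX using norm_Pair_le[of "g X" "h X"] by simp
      also have "\<dots> \<le> (real n + (real n)\<^sup>2 * \<Lambda> * C0) * (M1 / \<tau>)" using add_mono[OF g h] by (simp only: distrib_right)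
      also have "\<dots> \<le> (real n + (real n)\<^sup>2 * \<Lambda> * C0) * R" using MR \<Lambda> C0 by (intro mult_left_mono) auto
      finally show "norm (G X) \<le> (real n + (real n)\<^sup>2 * \<Lambda> * C0) * R" .
    qed
  qed
  have gc: "grad_const CARD('n) (card (words CARD('n) :: (real^'n) list set)) \<Lambda> \<theta> C0 (enn2real (A2_const \<mu>)) *
      sqrt (1 / mu_hat \<mu> (cyl \<tau> :: ((real^'n) \<times> real) set) * E) = (real n + (real n)\<^sup>2 * \<Lambda> * C0) * R"
    unfolding grad_const_def R_def sc_def mu_def \<kappa>_def n by (simp add: mult_ac)
  have sub: "half_cyl l (\<theta> * \<tau>) \<subseteq> Om"
  proof -
    have "\<theta> * \<tau> < \<tau>" using \<theta> \<tau> by simp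
    then show ?thesis unfolding Om_eq[symmetric] by (auto simp: half_cyl_def half_ball_inner)
  qed
  have mG: "(\<lambda>X. indicator Om X *\<^sub>R G X) \<in> borel_measurable lebesgue"
  proof (rule locally_integrable_measurable[OF op])
    show "locally_integrable Om G"
      using sol unfolding weak_solution_def W12_vanishing_def W12_def weak_gradient_def Om_eq by blast
  qed
  show ?thesis
    unfolding Linf_norm_def gc
  proof (rule esssup_I)
    have "(\<lambda>X. ereal (norm (indicator Om X *\<^sub>R G X))) \<in> borel_measurable (lebesgue_on (half_cyl l (\<theta> * \<tau>)))"
      by (intro measurable_restrict_space1 borel_measurable_ereal measurable_compose[OF mG borel_measurable_norm])
    also have "?this \<longleftrightarrow> (\<lambda>X. ereal (norm (G X))) \<in> borel_measurable (lebesgue_on (half_cyl l (\<theta> * \<tau>)))"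
      using sub by (intro measurable_cong) (auto simp: space_restrict_space)
    finally show "(\<lambda>X. ereal (norm (G X))) \<in> borel_measurable (lebesgue_on (half_cyl l (\<theta> * \<tau>)))" .
    have "half_cyl l (\<theta> * \<tau>) \<inter> space lebesgue \<in> sets lebesgue" using half_cyl_open[of l "\<theta> * \<tau>"] by simp
    from AE_restrict_space_iff[OF this]
    show "AE X in lebesgue_on (half_cyl l (\<theta> * \<tau>)). ereal (norm (G X)) \<le> ereal ((real n + (real n)\<^sup>2 * \<Lambda> * C0) * R)"
      using AE_completion[OF final] by simp
  qed
qed

theorem lemma8p4:
  fixes \<Lambda> C0 \<theta> :: real and K :: ennreal
  assumes "\<Lambda> > 0" and "C0 > 0" and "0 < \<theta>" and "\<theta> < 1"
  shows "\<exists>C>0. \<forall>(l :: 'n::finite) (\<tau> :: real) (\<mu> :: real \<Rightarrow> real) (B :: real^'n^'n)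
      (A :: real \<Rightarrow> (real^'n) \<times> real \<Rightarrow> (real^'n) \<times> real)
      (v :: (real^'n) \<times> real \<Rightarrow> real) (G :: (real^'n) \<times> real \<Rightarrow> (real^'n) \<times> real).
    0 < \<tau> \<longrightarrow> \<tau> < 1 \<longrightarrow>
    A2_weight \<mu> \<longrightarrow> A2_const \<mu> = K \<longrightarrow>
    (AE y in lebesgue. 0 < y \<and> y < 1 \<longrightarrow>
        (LINT s:{0..\<tau> * y}|lebesgue. \<mu> s) \<le> C0 * \<tau> * \<mu> (y * \<tau>)) \<longrightarrow>
    (\<forall>y\<in>{0<..<\<tau>}. \<forall>\<xi>. A y \<xi> = \<mu> y *\<^sub>R block_mat B \<xi>) \<longrightarrow>
    (\<forall>y\<in>{0<..<\<tau>}. \<forall>\<xi> \<eta>. A y \<xi> \<bullet> \<eta> = \<xi> \<bullet> A y \<eta>) \<longrightarrow>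
    (\<exists>c>0. \<forall>\<xi>. c * (norm \<xi>)\<^sup>2 \<le> block_mat B \<xi> \<bullet> \<xi>) \<longrightarrow>
    (\<forall>\<xi>. AE y in lebesgue. 0 < y \<and> y < \<tau> \<longrightarrow>
        inverse \<Lambda> * \<mu> y * (norm \<xi>)\<^sup>2 \<le> A y \<xi> \<bullet> \<xi> \<and>
        A y \<xi> \<bullet> \<xi> \<le> \<Lambda> * \<mu> y * (norm \<xi>)\<^sup>2) \<longrightarrow>
    weak_solution l \<tau> \<mu> A v G \<longrightarrow>
    Linf_norm (half_cyl l (\<theta> * \<tau>)) G \<le>
      ereal (C * sqrt (1 / mu_hat \<mu> (cyl \<tau> :: ((real^'n) \<times> real) set) *
                       (LINT X:half_cyl l \<tau>|lebesgue. (norm (G X))\<^sup>2 * \<mu> (snd X))))"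
proof -
  define \<kappa> where "\<kappa> = enn2real K"
  define c where "c = grad_const CARD('n) (card (words CARD('n) :: (real^'n) list set)) \<Lambda> \<theta> C0 \<kappa>"
  have c: "0 \<le> c"
    unfolding c_def grad_const_def \<kappa>_def using assms by (intro mult_nonneg_nonneg add_nonneg_nonneg real_sqrt_ge_zero) auto
  show ?thesis
  proof (intro exI[of _ "c + 1"] conjI allI impI)
    show "0 < c + 1" using c by simp
    fix l :: 'n and \<tau> :: real and \<mu> :: "real => real" and B :: "real^'n^'n"
      and A :: "real => (real^'n) \<times> real => (real^'n) \<times> real"
      and v :: "(real^'n) \<times> real => real" and G :: "(real^'n) \<times> real => (real^'n) \<times> real"
    assume \<tau>: "0 < \<tau>" and w: "A2_weight \<mu>" and K: "A2_const \<mu> = K"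
      and grow: "AE y in lebesgue. 0 < y \<and> y < 1 --> (LINT s:{0..\<tau> * y}|lebesgue. \<mu> s) \<le> C0 * \<tau> * \<mu> (y * \<tau>)"
      and A: "\<forall>y\<in>{0<..<\<tau>}. \<forall>\<xi>. A y \<xi> = \<mu> y *\<^sub>R block_mat B \<xi>"
      and sym: "\<forall>y\<in>{0<..<\<tau>}. \<forall>\<xi> \<eta>. A y \<xi> \<bullet> \<eta> = \<xi> \<bullet> A y \<eta>"
      and ell: "\<forall>\<xi>. AE y in lebesgue. 0 < y \<and> y < \<tau> -->
        inverse \<Lambda> * \<mu> y * (norm \<xi>)\<^sup>2 \<le> A y \<xi> \<bullet> \<xi> \<and> A y \<xi> \<bullet> \<xi> \<le> \<Lambda> * \<mu> y * (norm \<xi>)\<^sup>2"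
      and sol: "weak_solution l \<tau> \<mu> A v G"
    define E where "E = sqrt (1 / mu_hat \<mu> (cyl \<tau> :: ((real^'n) \<times> real) set) *
                       (LINT X:half_cyl l \<tau>|lebesgue. (norm (G X))\<^sup>2 * \<mu> (snd X)))"
    have \<mu>0: "0 \<le> \<mu> y" for y using w by (simp add: A2_weight_def)
    have E: "0 \<le> E"
      unfolding E_def mu_hat_def set_lebesgue_integral_def using \<mu>0
      by (intro real_sqrt_ge_zero mult_nonneg_nonneg divide_nonneg_nonneg integral_nonneg_AE AE_I2) auto
    have "Linf_norm (half_cyl l (\<theta> * \<tau>)) G \<le> ereal (c * E)"
      unfolding c_def \<kappa>_def E_def K[symmetric]
      by (rule weak_solution_gradient_bound[OF assms \<tau> w grow _ _ _ sol]) (use A sym ell in blast)+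
    also have "ereal (c * E) \<le> ereal ((c + 1) * E)" using E by (simp add: distrib_right)
    finally show "Linf_norm (half_cyl l (\<theta> * \<tau>)) G \<le> ereal ((c + 1) * sqrt (1 / mu_hat \<mu> (cyl \<tau> :: ((real^'n) \<times> real) set) *
                       (LINT X:half_cyl l \<tau>|lebesgue. (norm (G X))\<^sup>2 * \<mu> (snd X))))"
      unfolding E_def .
  qed
qed

end
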